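(* For every $\delta>0$, setting $\delta_k:=\delta/2^k$ for $k\ge 0$, the functions $V^{\delta_k}:\mathbf{R}_+^n\to\mathbf{R}$ (value functions of the grid strategies described in the context) are non-decreasing in $k$, their pointwise limit $\overline V(\mathbf x):=\lim_{k\to\infty}V^{\delta_k}(\mathbf x)$ equals the optimal value function $V(\mathbf x)$ for every $\mathbf x\in\mathbf{R}_+^n$, and $V^{\delta_k}\to V$ locally uniformly in $\mathbf{R}_+^n$ as $k\to\infty$.
   Context: **Notation.** $\mathbf{R}_+^n=[0,\infty)^n$, $\mathbf{N}_0=\{0,1,2,\dots\}$, $\le$ on $\mathbf R^n$ is componentwise, $\mathbf 1=(1,\dots,1)$, $(\mathbf e_i)$ is the standard basis of $\mathbf R^n$. **Model.** Fix $n\ge1$, $\mathbf p=(p_1,\dots,p_n)$ with $p_i>0$, $\mathbf a=(a_1,\dots,a_n)$ with $a_i>0$, $c>0$, $\lambda>0$. Let $(\tau_k)_{k\ge1}$ be the jump times of a Poisson process $N_t$ of intensity $\lambda$, and $(\mathbf U_k)_{k\ge1}$ i.i.d. random vectors in $\mathbf R_+^n$, independent of $N$, with distribution function $F$, $\mathbb E\|\mathbf U_k\|<\infty$, $F(\mathbf 0)=0$. $\Omega$ is the space of sequences $(\tau_k,\mathbf U_k)_{k\ge1}$ and $\mathcal F_t$ is generated by $\{(\tau_k,\mathbf U_k):\tau_k\le t\}$. For initial surplus $\mathbf x\in\mathbf R_+^n$, $\mathbf X_t=\mathbf x+\mathbf p t-\sum_{k=1}^{N_t}\mathbf U_k$.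 An admissible dividend strategy is a process $\mathbf L_t\in\mathbf R_+^n$, componentwise non-decreasing, càdlàg, adapted, with $\mathbf L_0\ge 0$ (and $\mathbf L_{0^-}=\mathbf 0$), $\mathbf L_t\le\mathbf X_t$ for $0\le t<\tau^{\mathbf L}$, where $\tau^{\mathbf L}:=\inf\{\tau_k:\mathbf X_{\tau_k}-\mathbf L_{\tau_k^-}\notin\mathbf R_+^n\}$, and $\mathbf L_t=\mathbf L_{\tau^{\mathbf L -}}$ for $t\ge\tau^{\mathbf L}$. The controlled surplus is $\mathbf X^{\mathbf L}_t=\mathbf X_t-\mathbf L_t$. $\Pi_{\mathbf x}$ is the set of pairs $\pi=(\mathbf L,\overline\tau)$ with $\mathbf L$ admissible and $\overline\tau$ a switch time (a $[0,\infty]$-valued stopping time). Let $B=\{(\mathbf x,\boldsymbol\alpha)\in\mathbf R_+^n\times\mathbf R_+^n:\mathbf x-\boldsymbol\alpha\notin\mathbf R_+^n\}$. The penalty $\upsilon:B\to\mathbf R$ is non-increasing in $\mathbf x$, non-decreasing in $\boldsymbol\alpha$, and $\mathbb E|\upsilon(\mathbf 0,\mathbf U_1)|<\infty$. The switch-value function $f:\mathbf R_+^n\to\mathbf R$ is either right continuous and non-decreasing, or continuous. With $\int_{0^-}^t e^{-cs}\mathbf a\cdot d\mathbf L_s=\mathbf a\cdot\mathbf L_0+\int_0^te^{-cs}\mathbf a\cdot d\mathbf L_s$, define $$V_\pi(\mathbf x)=\mathbb E_{\mathbf x}\Big(\int_{0^-}^{\overline\tau\wedge\tau^{\mathbf L}}e^{-cs}\mathbf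 a\cdot d\mathbf L_s+I_{\{\overline\tau<\tau^{\mathbf L}\}}e^{-c\overline\tau}f(\mathbf X^{\mathbf L}_{\overline\tau})\Big)-\mathbb E_{\mathbf x}\Big(I_{\{\overline\tau\ge\tau^{\mathbf L}\}}e^{-c\tau^{\mathbf L}}\upsilon(\mathbf X^{\mathbf L}_{\tau^{\mathbf L-}},\mathbf X^{\mathbf L}_{\tau^{\mathbf L-}}-\mathbf X^{\mathbf L}_{\tau^{\mathbf L}})\Big),$$ and $V(\mathbf x)=\sup_{\pi\in\Pi_{\mathbf x}}V_\pi(\mathbf x)$ (terms with $e^{-c\cdot\infty}$ are $0$). **Standing assumptions.** A function $h:\mathbf R_+^n\to\mathbf R$ satisfies the growth condition GC if $h/h_0$ is bounded above on $\mathbf R_+^n$, where $h_0(\mathbf x)=e^{\frac{c}{2n}\sum_{i=1}^n x_i/p_i}$. The functions $f$ and $S(\mathbf x):=\sup_{\{\boldsymbol\alpha:(\mathbf x,\boldsymbol\alpha)\in B\}}(-\upsilon(\mathbf x,\boldsymbol\alpha))$ satisfy GC, and $\mathcal R(\mathbf x):=\lambda\int_{\mathbf x-\boldsymbol\alpha\notin\mathbf R_+^n}\upsilon(\mathbf x,\boldsymbol\alpha)\,dF(\boldsymbol\alpha)$ is continuous on $\mathbf R_+^n$. **Grid strategies.** For $\delta>0$ let $g^\delta(\mathbf m)=(p_1\delta m_1,\dots,p_n\delta m_n)$ for $\mathbf m\in\mathbf N_0^n$, $\mathcal G^\delta=g^\delta(\mathbf N_0^n)$, $\rho^\delta(\mathbf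 x)=([x_1/(\delta p_1)],\dots,[x_n/(\delta p_n)])$ (integer parts), and $\langle\mathbf x\rangle^\delta=g^\delta(\rho^\delta(\mathbf x))$. At surplus $g^\delta(\mathbf m)$, with $\tau$ the waiting time until the next jump and $\mathbf U$ its size, the control actions are: - $\mathbf E_0$: pay no dividends up to time $\delta\wedge\tau$. If $\tau>\delta$, the action ends after time $\delta$ at surplus $g^\delta(\mathbf m+\mathbf 1)$. If $\tau\le\delta$ and $\mathbf y:=g^\delta(\mathbf m)+\tau\mathbf p-\mathbf U\in\mathbf R_+^n$, then at time $\tau$ the dividend $\mathbf y-\langle\mathbf y\rangle^\delta$ is paid and the end surplus is $\langle\mathbf y\rangle^\delta$. If $\tau\le\delta$ and $\mathbf y\notin\mathbf R_+^n$, the process stops (ruin). - $\mathbf E_i$ ($1\le i\le n$, allowed only if $m_i>0$): company $i$ immediately pays $p_i\delta$; the end surplus is $g^\delta(\mathbf m-\mathbf e_i)$. - $\mathbf E_s$: switch immediately; the process stops. $\Pi^\delta_{g^\delta(\mathbf m)}\subset\Pi_{g^\delta(\mathbf m)}$ is the set of admissible strategies obtained by applying successively, starting at $g^\delta(\mathbf m)$, a finite or infinite sequence $(s_k)_{k=1,\dots,\tilde k}$ ($1\le\tilde k\le\infty$, depending on $\omega\in\Omega$) of control actions, each applied at the end surplus of the previous one (if $\tilde k<\infty$ the last action is $\mathbf E_s$, or $\mathbf E_0$ ending in ruin), non-anticipatively: if two elements of $\Omega$ have the same jump times and sizes up to time $t$, their sequences agree for all actions chosen at times $\le t$. Define $v^\delta(\mathbf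 m)=\sup_{\pi\in\Pi^\delta_{g^\delta(\mathbf m)}}V_\pi(g^\delta(\mathbf m))$ for $\mathbf m\in\mathbf N_0^n$, and $$V^\delta(\mathbf x)=v^\delta(\rho^\delta(\mathbf x))+\mathbf a\cdot(\mathbf x-\langle\mathbf x\rangle^\delta),\qquad \mathbf x\in\mathbf R_+^n.$$ *)

theory Defs
  imports "HOL-Probability.Probability"
begin

text \<open>
  \<open>\<real>\<^sup>n\<close> is \<^typ>\<open>real^'n\<close> with its componentwise order, so that the orthant is
  \<open>{0..}\<close>. Claims are indexed from 0: \<open>fst (\<omega> k)\<close> and \<open>snd (\<omega> k)\<close> are the arrival
  time \<open>\<tau>\<^bsub>k+1\<^esub>\<close> and the size \<open>U\<^bsub>k+1\<^esub>\<close>. Surplus and dividend processes have time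
  set \<^typ>\<open>real\<close>; stopping times take values in \<^typ>\<open>ennreal\<close>.
\<close>

definition left_limit :: "(real \<Rightarrow> 'a::t2_space) \<Rightarrow> real \<Rightarrow> 'a" where
  "left_limit g t = Lim (at_left t) g"

definition cadlag :: "(real \<Rightarrow> 'a::topological_space) \<Rightarrow> bool" where
  "cadlag g \<longleftrightarrow> (\<forall>t. (g \<longlongrightarrow> g t) (at_right t) \<and> (\<exists>l. (g \<longlongrightarrow> l) (at_left t)))"

text \<open>
  The expectation of a random variable whose positive or negative part is integrable. A Bochner
  integral would return 0 where the true value is \<open>-\<infinity>\<close>; this can occur below, since a
  continuous switch value is only bounded from above by the growth condition.
\<close>

definition ext_expectation :: "'a measure \<Rightarrow> ('a \<Rightarrow> real) \<Rightarrow> ereal" where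
  "ext_expectation M Z =
     enn2ereal (\<integral>\<^sup>+\<omega>. ennreal (Z \<omega>) \<partial>M) - enn2ereal (\<integral>\<^sup>+\<omega>. ennreal (- Z \<omega>) \<partial>M)"

type_synonym 'n claims = "nat \<Rightarrow> real \<times> (real^'n)"

text \<open>
  Only sequences of arrival times without accumulation are admitted, so that the number of
  claims up to any time is finite for every scenario.
\<close>

definition claim_paths :: "'n::finite claims set" where
  "claim_paths = {\<omega>. 0 < fst (\<omega> 0) \<and> strict_mono (\<lambda>k. fst (\<omega> k)) \<and>
      filterlim (\<lambda>k. fst (\<omega> k)) at_top sequentially \<and> (\<forall>k. 0 \<le> snd (\<omega> k))}"

text \<open>
  A Poisson process of intensity \<open>lam\<close> is given by i.i.d. exponential interarrival times
  (\<open>fst (w j)\<close> below); \<open>F\<close> is the law of a claim vector. The resulting law of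
  \<open>(\<tau>\<^sub>k, U\<^sub>k)\<^sub>k\<close> gives \<open>claim_paths\<close> full measure and is restricted to that set.
\<close>

definition claim_measure :: "real \<Rightarrow> (real^'n) measure \<Rightarrow> 'n::finite claims measure" where
  "claim_measure lam F =
     restrict_space
       (distr (Pi\<^sub>M UNIV (\<lambda>_::nat. density lborel (exponential_density lam) \<Otimes>\<^sub>M F))
              (Pi\<^sub>M UNIV (\<lambda>_. borel \<Otimes>\<^sub>M borel))
              (\<lambda>w k. (\<Sum>j\<le>k. fst (w j), snd (w k))))
       claim_paths"

text \<open>
  The sigma-algebra generated by the pairs \<open>(\<tau>\<^sub>k, U\<^sub>k)\<close> with \<open>\<tau>\<^sub>k \<le> t\<close>. It is indexed by
  \<^typ>\<open>ennreal\<close> in order to use the library's \<^const>\<open>stopping_time\<close> for times with values in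
  \<open>[0,\<infinity>]\<close>.
\<close>

definition history :: "ennreal \<Rightarrow> 'n::finite claims measure" where
  "history t = sigma claim_paths
     {{\<omega> \<in> claim_paths. fst (\<omega> k) \<le> s \<and> snd (\<omega> k) \<in> A} | k s A.
        ennreal s \<le> t \<and> A \<in> sets borel}"

definition claim_count :: "'n::finite claims \<Rightarrow> real \<Rightarrow> nat" where
  "claim_count \<omega> t = card {k. fst (\<omega> k) \<le> t}"

definition surplus :: "real^'n \<Rightarrow> real^'n \<Rightarrow> 'n::finite claims \<Rightarrow> real \<Rightarrow> real^'n" where
  "surplus p x \<omega> t = x + t *\<^sub>R p - (\<Sum>k<claim_count \<omega> t. snd (\<omega> k))"

type_synonym 'n dividends = "real \<Rightarrow> 'n claims \<Rightarrow> real^'n"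
type_synonym 'n strategy = "'n dividends \<times> ('n claims \<Rightarrow> ennreal)"

definition controlled_surplus ::
    "real^'n \<Rightarrow> real^'n \<Rightarrow> 'n::finite dividends \<Rightarrow> 'n claims \<Rightarrow> real \<Rightarrow> real^'n" where
  "controlled_surplus p x L \<omega> t = surplus p x \<omega> t - L t \<omega>"

definition ruin_time ::
    "real^'n \<Rightarrow> real^'n \<Rightarrow> 'n::finite dividends \<Rightarrow> 'n claims \<Rightarrow> ennreal" where
  "ruin_time p x L \<omega> =
     (INF k \<in> {k. surplus p x \<omega> (fst (\<omega> k)) - left_limit (\<lambda>t. L t \<omega>) (fst (\<omega> k)) \<notin> {0..}}.
        ennreal (fst (\<omega> k)))"

text \<open>
  A dividend process is extended by 0 to negative times; this encodes \<open>L\<^bsub>0-\<^esub> = 0\<close>.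
\<close>

definition admissible_dividends ::
    "real^'n \<Rightarrow> real^'n \<Rightarrow> 'n::finite dividends \<Rightarrow> bool" where
  "admissible_dividends p x L \<longleftrightarrow>
     (\<forall>t\<ge>0. L t \<in> measurable (history (ennreal t)) borel) \<and>
     (\<forall>\<omega>\<in>claim_paths.
        (\<forall>t<0. L t \<omega> = 0) \<and>
        0 \<le> L 0 \<omega> \<and>
        mono_on {0..} (\<lambda>t. L t \<omega>) \<and>
        cadlag (\<lambda>t. L t \<omega>) \<and>
        (\<forall>t\<ge>0. ennreal t < ruin_time p x L \<omega> \<longrightarrow> L t \<omega> \<le> surplus p x \<omega> t) \<and>
        (\<forall>t\<ge>0. ruin_time p x L \<omega> \<le> ennreal t \<longrightarrow>
            L t \<omega> = left_limit (\<lambda>u. L u \<omega>) (enn2real (ruin_time p x L \<omega>))))"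

definition admissible :: "real^'n \<Rightarrow> real^'n \<Rightarrow> 'n::finite strategy set" where
  "admissible p x = {(L, T). admissible_dividends p x L \<and> stopping_time history T}"

text \<open>
  The integral \<open>\<integral>\<^bsub>0-\<^esub>\<^sup>T e\<^bsup>-cs\<^esup> a \<sqdot> dL\<^sub>s\<close>. As \<open>L\<close> vanishes on the negative half-line, the
  Lebesgue-Stieltjes measure of \<open>a \<bullet> L\<close> has the atom \<open>a \<bullet> L\<^sub>0\<close> at 0.
\<close>

definition discounted_dividends ::
    "real^'n \<Rightarrow> real \<Rightarrow> (real \<Rightarrow> real^'n) \<Rightarrow> ennreal \<Rightarrow> real" where
  "discounted_dividends a c l T =
     (LINT s : {s. 0 \<le> s \<and> ennreal s \<le> T} | interval_measure (\<lambda>s. a \<bullet> l s). exp (- c * s))"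

definition ruin_pairs :: "((real^'n) \<times> (real^'n)) set" where
  "ruin_pairs = {(x, \<alpha>). x \<in> {0..} \<and> \<alpha> \<in> {0..} \<and> x - \<alpha> \<notin> {0..}}"

definition strategy_value ::
    "real^'n \<Rightarrow> real^'n \<Rightarrow> real \<Rightarrow> real \<Rightarrow> (real^'n) measure \<Rightarrow> (real^'n \<Rightarrow> real^'n \<Rightarrow> real) \<Rightarrow>
     (real^'n \<Rightarrow> real) \<Rightarrow> real^'n \<Rightarrow> 'n::finite strategy \<Rightarrow> ereal" where
  "strategy_value p a c lam F \<upsilon> f x = (\<lambda>(L, T).
     let R = ruin_time p x L; Y = controlled_surplus p x L in
       ext_expectation (claim_measure lam F) (\<lambda>\<omega>.
         discounted_dividends a c (\<lambda>s. L s \<omega>) (min (T \<omega>) (R \<omega>)) +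
         (if T \<omega> < R \<omega>
          then exp (- c * enn2real (T \<omega>)) * f (Y \<omega> (enn2real (T \<omega>))) else 0))
       - ext_expectation (claim_measure lam F) (\<lambda>\<omega>.
         (if R \<omega> \<le> T \<omega> \<and> R \<omega> < \<infinity>
          then let r = enn2real (R \<omega>) in
            exp (- c * r) * \<upsilon> (left_limit (Y \<omega>) r) (left_limit (Y \<omega>) r - Y \<omega> r)
          else 0)))"

definition optimal_value ::
    "real^'n \<Rightarrow> real^'n \<Rightarrow> real \<Rightarrow> real \<Rightarrow> (real^'n) measure \<Rightarrow> (real^'n \<Rightarrow> real^'n \<Rightarrow> real) \<Rightarrow>
     (real^'n \<Rightarrow> real) \<Rightarrow> real^'n::finite \<Rightarrow> ereal" where
  "optimal_value p a c lam F \<upsilon> f x = (SUP \<pi> \<in> admissible p x. strategy_value p a c lam F \<upsilon> f x \<pi>)"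

definition growth_weight :: "real \<Rightarrow> real^'n \<Rightarrow> real^'n::finite \<Rightarrow> real" where
  "growth_weight c p x = exp (c / (2 * real CARD('n)) * (\<Sum>i\<in>UNIV. x $ i / p $ i))"

definition growth_condition :: "real \<Rightarrow> real^'n \<Rightarrow> (real^'n::finite \<Rightarrow> real) \<Rightarrow> bool" where
  "growth_condition c p h \<longleftrightarrow> bdd_above ((\<lambda>x. h x / growth_weight c p x) ` {0..})"

definition grid_point :: "real^'n \<Rightarrow> real \<Rightarrow> nat^'n::finite \<Rightarrow> real^'n" where
  "grid_point p \<delta> m = (\<chi> i. p $ i * \<delta> * real (m $ i))"

definition grid_index :: "real^'n \<Rightarrow> real \<Rightarrow> real^'n::finite \<Rightarrow> nat^'n" where
  "grid_index p \<delta> x = (\<chi> i. nat \<lfloor>x $ i / (\<delta> * p $ i)\<rfloor>)"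

definition grid_floor :: "real^'n \<Rightarrow> real \<Rightarrow> real^'n::finite \<Rightarrow> real^'n" where
  "grid_floor p \<delta> x = grid_point p \<delta> (grid_index p \<delta> x)"

text \<open>The control actions \<open>E\<^sub>0\<close>, \<open>E\<^sub>i\<close> and \<open>E\<^sub>s\<close>.\<close>

datatype 'n action = Wait | Pay 'n | Switch

definition next_claim :: "'n::finite claims \<Rightarrow> real \<Rightarrow> nat" where
  "next_claim \<omega> t = (LEAST k. t < fst (\<omega> k))"

definition post_claim ::
    "real^'n \<Rightarrow> real \<Rightarrow> 'n::finite claims \<Rightarrow> real \<Rightarrow> nat^'n \<Rightarrow> real^'n" where
  "post_claim p \<delta> \<omega> t m = grid_point p \<delta> m
     + (fst (\<omega> (next_claim \<omega> t)) - t) *\<^sub>R p - snd (\<omega> (next_claim \<omega> t))"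

text \<open>
  An action applied at time \<open>t\<close> and surplus \<open>grid_point p \<delta> m\<close> returns its end time and the
  index of its end surplus, or \<^const>\<open>None\<close> if the process stops by ruin or by a switch.
\<close>

fun action_end ::
    "real^'n \<Rightarrow> real \<Rightarrow> 'n::finite claims \<Rightarrow> 'n action \<Rightarrow> real \<times> (nat^'n) \<Rightarrow>
     (real \<times> (nat^'n)) option" where
  "action_end p \<delta> \<omega> Wait (t, m) =
     (if \<delta> < fst (\<omega> (next_claim \<omega> t)) - t then Some (t + \<delta>, m + 1)
      else if post_claim p \<delta> \<omega> t m \<in> {0..}
      then Some (fst (\<omega> (next_claim \<omega> t)), grid_index p \<delta> (post_claim p \<delta> \<omega> t m))
      else None)"
| "action_end p \<delta> \<omega> (Pay i) (t, m) = Some (t, m - axis i 1)"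
| "action_end p \<delta> \<omega> Switch (t, m) = None"

text \<open>Dividends are credited at the end time of the action (see \<open>grid_dividends\<close>).\<close>

fun action_dividend ::
    "real^'n \<Rightarrow> real \<Rightarrow> 'n::finite claims \<Rightarrow> 'n action \<Rightarrow> real \<times> (nat^'n) \<Rightarrow> real^'n" where
  "action_dividend p \<delta> \<omega> Wait (t, m) =
     (if fst (\<omega> (next_claim \<omega> t)) - t \<le> \<delta> \<and> post_claim p \<delta> \<omega> t m \<in> {0..}
      then post_claim p \<delta> \<omega> t m - grid_floor p \<delta> (post_claim p \<delta> \<omega> t m) else 0)"
| "action_dividend p \<delta> \<omega> (Pay i) (t, m) = axis i (p $ i * \<delta>)"
| "action_dividend p \<delta> \<omega> Switch (t, m) = 0"

text \<open>
  Time and grid index at which the action \<open>s k\<close> is applied in the scenario \<open>\<omega>\<close>, or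
  \<^const>\<open>None\<close> if the process has stopped before. Action sequences are total functions; the
  entries after the process has stopped are not part of the sequence and have no effect, so its
  length is the first \<open>k\<close> with \<open>grid_state p \<delta> m \<omega> s k = None\<close>, if there is one.
\<close>

primrec grid_state ::
    "real^'n \<Rightarrow> real \<Rightarrow> nat^'n \<Rightarrow> 'n::finite claims \<Rightarrow> (nat \<Rightarrow> 'n action) \<Rightarrow> nat \<Rightarrow>
     (real \<times> (nat^'n)) option" where
  "grid_state p \<delta> m \<omega> s 0 = Some (0, m)"
| "grid_state p \<delta> m \<omega> s (Suc k) = Option.bind (grid_state p \<delta> m \<omega> s k) (action_end p \<delta> \<omega> (s k))"

definition allowed_actions ::
    "real^'n \<Rightarrow> real \<Rightarrow> nat^'n \<Rightarrow> ('n::finite claims \<Rightarrow> nat \<Rightarrow> 'n action) \<Rightarrow> bool" where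
  "allowed_actions p \<delta> m s \<longleftrightarrow>
     (\<forall>\<omega>\<in>claim_paths. \<forall>k t m' i.
        grid_state p \<delta> m \<omega> (s \<omega>) k = Some (t, m') \<and> s \<omega> k = Pay i \<longrightarrow> 0 < m' $ i)"

definition same_claims_until :: "real \<Rightarrow> 'n::finite claims \<Rightarrow> 'n claims \<Rightarrow> bool" where
  "same_claims_until t \<omega> \<omega>' \<longleftrightarrow> (\<forall>k. fst (\<omega> k) \<le> t \<or> fst (\<omega>' k) \<le> t \<longrightarrow> \<omega> k = \<omega>' k)"

definition non_anticipative ::
    "real^'n \<Rightarrow> real \<Rightarrow> nat^'n \<Rightarrow> ('n::finite claims \<Rightarrow> nat \<Rightarrow> 'n action) \<Rightarrow> bool" where
  "non_anticipative p \<delta> m s \<longleftrightarrow>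
     (\<forall>\<omega>\<in>claim_paths. \<forall>\<omega>'\<in>claim_paths. \<forall>t. same_claims_until t \<omega> \<omega>' \<longrightarrow>
        (\<forall>k t' m'. grid_state p \<delta> m \<omega> (s \<omega>) k = Some (t', m') \<and> t' \<le> t \<longrightarrow> s \<omega> k = s \<omega>' k))"

text \<open>
  The sum ranges over the actions that have ended by time \<open>t\<close> without stopping the process; for
  allowed actions there are finitely many of them, because each scenario has finitely many claims
  up to time \<open>t\<close> and consecutive \<^const>\<open>Pay\<close> actions decrease the grid index.
\<close>

definition grid_dividends ::
    "real^'n \<Rightarrow> real \<Rightarrow> nat^'n \<Rightarrow> ('n::finite claims \<Rightarrow> nat \<Rightarrow> 'n action) \<Rightarrow> 'n dividends" where
  "grid_dividends p \<delta> m s t \<omega> =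
     (\<Sum>k | \<exists>t' m'. grid_state p \<delta> m \<omega> (s \<omega>) (Suc k) = Some (t', m') \<and> t' \<le> t.
        action_dividend p \<delta> \<omega> (s \<omega> k) (the (grid_state p \<delta> m \<omega> (s \<omega>) k)))"

definition grid_switch_time ::
    "real^'n \<Rightarrow> real \<Rightarrow> nat^'n \<Rightarrow> ('n::finite claims \<Rightarrow> nat \<Rightarrow> 'n action) \<Rightarrow> 'n claims \<Rightarrow> ennreal" where
  "grid_switch_time p \<delta> m s \<omega> =
     Inf {ennreal t | t k m'. grid_state p \<delta> m \<omega> (s \<omega>) k = Some (t, m') \<and> s \<omega> k = Switch}"

definition grid_strategies :: "real^'n \<Rightarrow> real \<Rightarrow> nat^'n \<Rightarrow> 'n::finite strategy set" where
  "grid_strategies p \<delta> m =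
     {(L, T) \<in> admissible p (grid_point p \<delta> m).
        \<exists>s. allowed_actions p \<delta> m s \<and> non_anticipative p \<delta> m s \<and>
            (\<forall>\<omega>\<in>claim_paths. (\<forall>t. L t \<omega> = grid_dividends p \<delta> m s t \<omega>) \<and>
                               T \<omega> = grid_switch_time p \<delta> m s \<omega>)}"

definition grid_optimal ::
    "real^'n \<Rightarrow> real^'n \<Rightarrow> real \<Rightarrow> real \<Rightarrow> (real^'n) measure \<Rightarrow> (real^'n \<Rightarrow> real^'n \<Rightarrow> real) \<Rightarrow>
     (real^'n \<Rightarrow> real) \<Rightarrow> real \<Rightarrow> nat^'n::finite \<Rightarrow> ereal" where
  "grid_optimal p a c lam F \<upsilon> f \<delta> m =
     (SUP \<pi> \<in> grid_strategies p \<delta> m. strategy_value p a c lam F \<upsilon> f (grid_point p \<delta> m) \<pi>)"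

definition grid_value ::
    "real^'n \<Rightarrow> real^'n \<Rightarrow> real \<Rightarrow> real \<Rightarrow> (real^'n) measure \<Rightarrow> (real^'n \<Rightarrow> real^'n \<Rightarrow> real) \<Rightarrow>
     (real^'n \<Rightarrow> real) \<Rightarrow> real \<Rightarrow> real^'n::finite \<Rightarrow> ereal" where
  "grid_value p a c lam F \<upsilon> f \<delta> x =
     grid_optimal p a c lam F \<upsilon> f \<delta> (grid_index p \<delta> x) + ereal (a \<bullet> (x - grid_floor p \<delta> x))"

end

theory Submission
  imports Defs
begin

text \<open>
  A function that dominates the switch value and does not decrease under paying dividends or under
  waiting for the next claim (a supersolution) dominates the value of every strategy: this holds up
  to the first claim path by path, and iterating over the claims is a contraction in the weight
  \<open>h\<^sub>0\<close>. Likewise the grid value function is the least supersolution of the discretised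
  inequalities; it satisfies them because a first action can be followed by near-optimal
  continuations. Two waits of length \<open>\<delta>/2\<close> make a wait of length \<open>\<delta>\<close>, so the value function of the
  finer grid is a supersolution for the coarser grid, whence the monotonicity in \<open>k\<close>.

  Waiting for a short time costs little, so the grid value functions grow slowly in the direction
  \<open>p\<close>, uniformly in \<open>k\<close>. Hence their limit is continuous from above, and the waiting inequality
  passes from the grid points to all points: the limit is a supersolution and dominates the
  optimal value, which in turn dominates all grid values. The same growth estimate reduces local
  uniform convergence to convergence at finitely many grid points.
\<close>

subsection \<open>Paths of the claim process\<close>

text \<open>Discounting is read as killing: integrating by parts, the discounted dividends of a path
  are the mean of the dividends paid up to an exponential time of rate \<open>c\<close> (or up to
  the horizon, if that is earlier). Jumps of the dividend process then need no separate treatment,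
  and before the first claim the killing clock and the claim clock merge into one exponential clock
  of rate \<open>beta = lam + c\<close>. The obstacle is regularity. Grid value functions jump
  across cell boundaries, and a continuous \<open>f\<close> may be unbounded below, so that a
  strategy may have the value \<open>-\<infinity>\<close>. Hence continuity is only demanded along
  points above \<open>x\<close> (\<open>tame\<close>). This survives averaging over claims, and it
  suffices because every approximation lies above its target: dividends are paid late, corners are
  taken upwards, times are rounded upwards. Values are compared through the nonnegative gap to an
  upper bound \<open>C\<close> instead of through integrability of the payoff. Along
  \<open>p\<close> the weight grows at rate \<open>c / 2\<close>, half of the discount rate; this
  margin gives the contraction factor \<open>theta = lam / (lam + c / 2)\<close>.\<close>

definition path_space :: "'n::finite claims measure" where
 "path_space = restrict_space (\<Pi>\<^sub>M _\<in>UNIV. borel \<Otimes>\<^sub>M borel) claim_paths"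

definition delay :: "real \<Rightarrow> 'n::finite claims \<Rightarrow> 'n claims" where
 "delay r w = (\<lambda>k. (r + fst (w k), snd (w k)))"

text \<open>The arrival times of \<open>w\<close> are counted from the first claim. For fixed
  \<open>(s, u)\<close> the map \<open>cons_claim s u\<close> thus parametrises the scenarios with
  first claim \<open>(s, u)\<close>, and conditioning on the first claim becomes
  substitution.\<close>

definition cons_claim :: "real \<Rightarrow> real^'n \<Rightarrow> 'n::finite claims \<Rightarrow> 'n claims" where
 "cons_claim s u w = case_nat (s, u) (delay s w)"

lemma delay_simps [simp]: "fst (delay r w k) = r + fst (w k)" "snd (delay r w k) = snd (w k)"
 by (auto simp: delay_def)

lemma cons_claim_simps [simp]:
 "cons_claim s u w 0 = (s, u)" "cons_claim s u w (Suc k) = (s + fst (w k), snd (w k))"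
 by (auto simp: cons_claim_def delay_def)

lemma cons_claim_add: "cons_claim (r + s) u w = delay r (cons_claim s u w)"
 by (rule ext) (auto simp: cons_claim_def delay_def split: nat.splits)

lemma closed_orthant: "closed {0::real^'n::finite..}"
 by (rule closed_eucl_atLeast)

lemma orthant_borel [measurable]: "Measurable.pred borel (\<lambda>x::real^'n::finite. 0 \<le> x)"
 using borel_closed[OF closed_orthant] by (simp add: pred_def atLeast_def)

text \<open>Divergence is tested at integers only, so that all conditions are countable ones. This
  gives measurability of the set and makes its stability under shifts elementary.\<close>

lemma claim_paths_iff:
 "w \<in> claim_paths \<longleftrightarrow> 0 < fst (w 0) \<and> (\<forall>k. fst (w k) < fst (w (Suc k))) \<and>
  (\<forall>N::nat. \<exists>k. real N \<le> fst (w k)) \<and> (\<forall>k. 0 \<le> snd (w k))"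
proof -
 have "filterlim (\<lambda>k. fst (w k)) at_top sequentially \<longleftrightarrow> (\<forall>N::nat. \<exists>k. real N \<le> fst (w k))"
  if "strict_mono (\<lambda>k. fst (w k))"
 proof
  assume "filterlim (\<lambda>k. fst (w k)) at_top sequentially"
  then show "\<forall>N::nat. \<exists>k. real N \<le> fst (w k)"
   unfolding filterlim_at_top eventually_at_top_linorder by blast
 next
  assume A: "\<forall>N::nat. \<exists>k. real N \<le> fst (w k)"
  show "filterlim (\<lambda>k. fst (w k)) at_top sequentially"
   unfolding filterlim_at_top eventually_at_top_linorder
  proof
   fix Z :: real
   obtain N :: nat where "Z \<le> real N" using real_arch_simple by blast
   then obtain k where "Z \<le> fst (w k)" using A order_trans by blast
   then show "\<exists>k. \<forall>n\<ge>k. Z \<le> fst (w n)"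
    using strict_mono_less_eq[OF that] order_trans by blast
  qed
 qed
 then show ?thesis
  unfolding claim_paths_def mem_Collect_eq strict_mono_Suc_iff[of "\<lambda>k. fst (w k)"] by blast
qed

lemma claim_paths_sets: "claim_paths \<in> sets (\<Pi>\<^sub>M _\<in>UNIV. borel \<Otimes>\<^sub>M borel)"
proof -
 have "Measurable.pred (\<Pi>\<^sub>M _\<in>UNIV::nat set. borel \<Otimes>\<^sub>M borel)
  (\<lambda>w::'n::finite claims. 0 < fst (w 0) \<and> (\<forall>k. fst (w k) < fst (w (Suc k))) \<and>
  (\<forall>N::nat. \<exists>k. real N \<le> fst (w k)) \<and> (\<forall>k. 0 \<le> snd (w k)))"
  by measurable
 then have "claim_paths \<inter> space (\<Pi>\<^sub>M _\<in>UNIV::nat set. borel \<Otimes>\<^sub>M borel) \<in> sets (\<Pi>\<^sub>M _\<in>UNIV::nat set. (borel::real measure) \<Otimes>\<^sub>M (borel :: (real^'n) measure))"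
  unfolding pred_def claim_paths_iff[symmetric] by (simp add: Int_def conj_commute)
 then show ?thesis by (simp add: space_PiM space_pair_measure)
qed

lemma space_path_space [simp]: "space path_space = claim_paths"
 unfolding path_space_def by (rule space_restrict_space2[OF claim_paths_sets])

lemma measurable_path_spaceI:
 assumes "\<And>x. x \<in> space N ==> f x \<in> claim_paths"
  and "\<And>k. (\<lambda>x. fst (f x k)) \<in> borel_measurable N" "\<And>k. (\<lambda>x. snd (f x k)) \<in> borel_measurable N"
 shows "f \<in> measurable N path_space"
 unfolding path_space_def
proof (rule measurable_restrict_space2)
 show "f \<in> measurable N (\<Pi>\<^sub>M _\<in>UNIV. borel \<Otimes>\<^sub>M borel)"
  by (rule measurable_PiM_single') (auto simp: measurable_pair_iff assms comp_def space_pair_measure)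
qed (use assms(1) in auto)

lemma measurable_claim_comp:
 assumes "f \<in> measurable N path_space"
 shows "(\<lambda>x. fst (f x k)) \<in> borel_measurable N" "(\<lambda>x. snd (f x k)) \<in> borel_measurable N"
proof -
 have "f \<in> measurable N (\<Pi>\<^sub>M _\<in>UNIV. borel \<Otimes>\<^sub>M borel)"
  using assms claim_paths_sets unfolding path_space_def by (subst (asm) measurable_restrict_space2_iff) auto
 then have [measurable]: "(\<lambda>x. f x k) \<in> measurable N (borel \<Otimes>\<^sub>M borel)"
  by (rule measurable_compose) (rule measurable_component_singleton, simp)
 show "(\<lambda>x. fst (f x k)) \<in> borel_measurable N" "(\<lambda>x. snd (f x k)) \<in> borel_measurable N"
  by measurable
qed

lemma measurable_claim:
 "(\<lambda>w. fst (w k)) \<in> borel_measurable path_space" "(\<lambda>w. snd (w k)) \<in> borel_measurable path_space"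
 by (rule measurable_claim_comp[OF measurable_ident, unfolded id_def])+

lemma claim_pathsD:
 assumes "w \<in> claim_paths"
 shows "0 < fst (w k)" "j < k \<longleftrightarrow> fst (w j) < fst (w k)" "j \<le> k \<longleftrightarrow> fst (w j) \<le> fst (w k)" "0 \<le> snd (w k)"
  "strict_mono (\<lambda>k. fst (w k))"
proof -
 show sm: "strict_mono (\<lambda>k. fst (w k))" using assms by (auto simp: claim_paths_def)
 have "fst (w 0) \<le> fst (w k)" using strict_mono_less_eq[OF sm, of 0 k] by simp
 moreover have "0 < fst (w 0)" using assms by (auto simp: claim_paths_def)
 ultimately show "0 < fst (w k)" by simp
 show "j < k \<longleftrightarrow> fst (w j) < fst (w k)" "j \<le> k \<longleftrightarrow> fst (w j) \<le> fst (w k)"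
  using strict_mono_less[OF sm, of j k] strict_mono_less_eq[OF sm, of j k] by simp_all
 show "0 \<le> snd (w k)" using assms by (auto simp: claim_paths_def)
qed

lemma delay_paths: "w \<in> claim_paths ==> 0 \<le> r ==> delay r w \<in> claim_paths"
 unfolding claim_paths_iff by (force simp: add_nonneg_pos intro: add_increasing)

lemma cons_paths: "w \<in> claim_paths ==> 0 < s ==> 0 \<le> u ==> cons_claim s u w \<in> claim_paths"
 unfolding claim_paths_iff
proof (intro conjI allI)
 assume A: "0 < fst (w 0) \<and> (\<forall>k. fst (w k) < fst (w (Suc k))) \<and>
  (\<forall>N::nat. \<exists>k. real N \<le> fst (w k)) \<and> (\<forall>k. 0 \<le> snd (w k))" "0 < s" "0 \<le> u"
 fix k show "fst (cons_claim s u w k) < fst (cons_claim s u w (Suc k))"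
  using A by (cases k) auto
 show "0 \<le> snd (cons_claim s u w k)"
  using A by (cases k) auto
 show "\<exists>j. real k \<le> fst (cons_claim s u w j)"
  using A by (metis add_increasing cons_claim_simps(2) fst_conv less_eq_real_def)
qed auto

lemma cons_paths_iff: "cons_claim s u w \<in> claim_paths ==> 0 < s \<and> 0 \<le> u \<and> w \<in> claim_paths"
proof -
 assume A: "cons_claim s u w \<in> claim_paths"
 have B: "fst (cons_claim s u w k) < fst (cons_claim s u w (Suc k))" for k
  using A by (auto simp: claim_paths_iff)
 have "\<exists>k. real N \<le> fst (w k)" for N
 proof -
  obtain m :: nat where m: "real N + s < real m" using reals_Archimedean2 by blast
  obtain k where "real m \<le> fst (cons_claim s u w k)" using A unfolding claim_paths_iff[of "cons_claim s u w"] by blast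
  with m have k: "real N + s < fst (cons_claim s u w k)" by simp
  then obtain j where "k = Suc j" by (cases k) auto
  with k show ?thesis by (intro exI[of _ j]) simp
 qed
 moreover have "fst (w k) < fst (w (Suc k))" for k using B[of "Suc k"] by simp
 moreover have "0 < fst (w 0)" using B[of 0] by simp
 moreover have "0 \<le> snd (w k)" for k using claim_pathsD(4)[OF A, of "Suc k"] by simp
 moreover have "0 < s" "0 \<le> u" using A claim_pathsD(4)[OF A, of 0] by (auto simp: claim_paths_iff)
 ultimately show ?thesis by (auto simp: claim_paths_iff)
qed

lemma measurable_delay [measurable]: "0 \<le> r ==> delay r \<in> measurable path_space path_space"
 by (rule measurable_path_spaceI) (auto simp: delay_paths[simplified] intro!: borel_measurable_add measurable_claim)

lemma measurable_cons:
 assumes "0 < s" "0 \<le> u" shows "cons_claim s u \<in> measurable path_space path_space"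
proof (rule measurable_path_spaceI)
 fix k show "(\<lambda>x. fst (cons_claim s u x k)) \<in> borel_measurable path_space" "(\<lambda>x. snd (cons_claim s u x k)) \<in> borel_measurable path_space"
  by (cases k; auto intro!: borel_measurable_add measurable_claim)+
qed (use assms in \<open>auto intro: cons_paths\<close>)

section \<open>The law of the claim sequence: renewal at the first claim and memorylessness\<close>

locale claim_model =
 fixes lam :: real and F :: "(real^'n::finite) measure"
 assumes lam_pos: "0 < lam" and F_prob: "prob_space F" and F_sets [measurable_cong]: "sets F = sets borel"
  and F_nonneg: "AE u in F. 0 \<le> u"
begin

abbreviation "M \<equiv> claim_measure lam F"
abbreviation "wait_law \<equiv> density lborel (exponential_density lam)"

sublocale F: prob_space F by (rule F_prob)
sublocale E: prob_space wait_law by (rule prob_space_exponential_density[OF lam_pos])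
sublocale EF: pair_prob_space wait_law F ..
sublocale S: sequence_space "wait_law \<Otimes>\<^sub>M F" ..

lemma F_space [simp]: "space F = UNIV"
 using sets_eq_imp_space_eq[OF F_sets] by simp

definition arrivals :: "'n claims \<Rightarrow> 'n claims" where
 "arrivals ys k = (\<Sum>j\<le>k. fst (ys j), snd (ys k))"

lemma arrivals_case_nat: "arrivals (case_nat (s, u) ys) = cons_claim s u (arrivals ys)"
proof
 fix k show "arrivals (case_nat (s, u) ys) k = cons_claim s u (arrivals ys) k"
  by (cases k) (auto simp: arrivals_def sum.atMost_Suc_shift simp del: sum.atMost_Suc)
qed

lemma measurable_arrivals [measurable]: "arrivals \<in> measurable S.S (\<Pi>\<^sub>M _\<in>UNIV. borel \<Otimes>\<^sub>M borel)"
proof (rule measurable_PiM_single')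
 fix i have "(\<lambda>w. fst (arrivals w i)) \<in> borel_measurable S.S"  "(\<lambda>w. snd (arrivals w i)) \<in> borel_measurable S.S"
  by (simp_all add: arrivals_def)
 then show "(\<lambda>w. arrivals w i) \<in> S.S \<rightarrow>\<^sub>M borel \<Otimes>\<^sub>M borel"
  by (auto simp: measurable_pair_iff comp_def)
qed (simp add: space_pair_measure)

lemma sets_M [measurable_cong]: "sets M = sets path_space"
 unfolding claim_measure_def path_space_def by (intro sets_restrict_space_cong) simp

lemma space_M [simp]: "space M = claim_paths"
 using sets_eq_imp_space_eq[OF sets_M] by simp

lemma measurable_M: "measurable M N = measurable path_space N"
 by (rule measurable_cong_sets) (auto simp: sets_M)

text \<open>Integrals are computed over the full product of interarrival times and claims. Extension
  by zero replaces the restriction to \<open>claim_paths\<close>, a set that will turn out to have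
  full measure.\<close>

definition ext0 :: "('n claims \<Rightarrow> ennreal) \<Rightarrow> 'n claims \<Rightarrow> ennreal" where
 "ext0 g w = g w * indicator claim_paths w"

lemma nn_integral_M:
 assumes g: "g \<in> borel_measurable path_space"
 shows "(\<integral>\<^sup>+w. g w \<partial>M) = (\<integral>\<^sup>+ys. ext0 g (arrivals ys) \<partial>S.S)"
  and "ext0 g \<in> borel_measurable (\<Pi>\<^sub>M _\<in>UNIV. borel \<Otimes>\<^sub>M borel)"
proof -
 show m: "ext0 g \<in> borel_measurable (\<Pi>\<^sub>M _\<in>UNIV. borel \<Otimes>\<^sub>M borel)"
  using g claim_paths_sets unfolding path_space_def ext0_def
  by (subst borel_measurable_restrict_space_iff_ennreal[symmetric]) auto
 have "(\<integral>\<^sup>+w. g w \<partial>M) = (\<integral>\<^sup>+w. g w * indicator claim_paths w \<partial>distr S.S (\<Pi>\<^sub>M _\<in>UNIV. borel \<Otimes>\<^sub>M borel) arrivals)"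
  unfolding claim_measure_def arrivals_def[abs_def, symmetric]
  by (rule nn_integral_restrict_space) (simp add: claim_paths_sets)
 also have "\<dots> = (\<integral>\<^sup>+ys. ext0 g (arrivals ys) \<partial>S.S)"
  using m unfolding ext0_def[symmetric] by (subst nn_integral_distr) auto
 finally show "(\<integral>\<^sup>+w. g w \<partial>M) = (\<integral>\<^sup>+ys. ext0 g (arrivals ys) \<partial>S.S)" .
qed

lemma wait_pos: "AE s in wait_law. 0 < s"
proof -
 have "AE s in lborel. s \<noteq> (0::real)" by (rule AE_lborel_singleton)
 then show ?thesis
  by (subst AE_density) (auto simp: exponential_density_def elim!: AE_mp)
qed

lemma nn_integral_S_iter:
 assumes [measurable]: "g \<in> borel_measurable S.S"
 shows "(\<integral>\<^sup>+ys. g ys \<partial>S.S) = (\<integral>\<^sup>+s. \<integral>\<^sup>+u. \<integral>\<^sup>+ys. g (case_nat (s, u) ys) \<partial>S.S \<partial>F \<partial>wait_law)"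
proof -
 have "(\<integral>\<^sup>+ys. g ys \<partial>S.S) = (\<integral>\<^sup>+ys. g ys \<partial>distr ((wait_law \<Otimes>\<^sub>M F) \<Otimes>\<^sub>M S.S) S.S (\<lambda>(s, w). case_nat s w))"
  by (simp add: S.PiM_iter)
 also have "\<dots> = (\<integral>\<^sup>+x. g (case_nat (fst x) (snd x)) \<partial>((wait_law \<Otimes>\<^sub>M F) \<Otimes>\<^sub>M S.S))"
  by (subst nn_integral_distr) (auto simp: split_beta')
 also have "\<dots> = (\<integral>\<^sup>+y. \<integral>\<^sup>+ys. g (case_nat y ys) \<partial>S.S \<partial>(wait_law \<Otimes>\<^sub>M F))"
  by (subst S.nn_integral_fst[symmetric]) auto
 also have "\<dots> = (\<integral>\<^sup>+s. \<integral>\<^sup>+u. \<integral>\<^sup>+ys. g (case_nat (s, u) ys) \<partial>S.S \<partial>F \<partial>wait_law)"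
  by (subst F.nn_integral_fst[symmetric]) auto
 finally show ?thesis .
qed

text \<open>Exponential tilting: the density of rate \<open>lam\<close> times
  \<open>exp (- b * s)\<close> is \<open>lam / (lam + b)\<close> times the density of rate
  \<open>lam + b\<close>, which has mass one.\<close>

lemma nn_integral_wait_exp:
 assumes "- lam < b"
 shows "(\<integral>\<^sup>+s. ennreal (exp (- b * s)) \<partial>wait_law) = ennreal (lam / (lam + b))"
proof -
 interpret E': prob_space "density lborel (exponential_density (lam + b))"
  using assms by (intro prob_space_exponential_density) simp
 have "(\<integral>\<^sup>+s. ennreal (exp (- b * s)) \<partial>wait_law) =
   (\<integral>\<^sup>+s. ennreal (lam / (lam + b)) * ennreal (exponential_density (lam + b) s) \<partial>lborel)"
  using lam_pos assms
  by (subst nn_integral_density)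
   (auto intro!: nn_integral_cong simp: exponential_density_def ennreal_mult[symmetric] mult_exp_exp distrib_left)
 also have "\<dots> = ennreal (lam / (lam + b)) * emeasure (density lborel (exponential_density (lam + b))) UNIV"
  by (subst nn_integral_cmult) (auto simp: emeasure_density)
 also have "\<dots> = ennreal (lam / (lam + b))"
  using E'.emeasure_space_1 by simp
 finally show ?thesis .
qed

lemma AE_S_component:
 assumes "AE s in wait_law. P s" "AE u in F. Q u" "Measurable.pred borel P" "Measurable.pred borel Q"
 shows "AE ys in S.S. \<forall>k. P (fst (ys k)) \<and> Q (snd (ys k))"
proof -
 note [measurable] = assms(3,4)
 have "AE x in wait_law \<Otimes>\<^sub>M F. P (fst x) \<and> Q (snd x)"
 proof (rule EF.AE_pair_measure)
  show "{x \<in> space (wait_law \<Otimes>\<^sub>M F). P (fst x) \<and> Q (snd x)} \<in> sets (wait_law \<Otimes>\<^sub>M F)"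
   by measurable
  show "AE x in wait_law. AE y in F. P (fst (x, y)) \<and> Q (snd (x, y))"
   using assms(1) by eventually_elim (use assms(2) in auto)
 qed
 then have "AE ys in S.S. P (fst (ys k)) \<and> Q (snd (ys k))" for k
  using S.AE_component[of k "\<lambda>x. P (fst x) \<and> Q (snd x)"] by auto
 then show ?thesis
  unfolding AE_all_countable by blast
qed

text \<open>\<open>exp (- fst (arrivals ys k))\<close> is a product of \<open>k + 1\<close>
  independent factors of mean \<open>q < 1\<close>, so its mean decays geometrically. The infimum
  over \<open>k\<close> has mean zero and vanishes almost surely, which forces the arrival times to
  be unbounded.\<close>

lemma AE_arrivals_unbounded:
 "AE ys in S.S. \<forall>N::nat. \<exists>k. real N \<le> fst (arrivals ys k)"
proof -
 define q where "q = lam / (lam + 1)"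
 have q: "0 < q" "q < 1" using lam_pos by (auto simp: q_def)
 define X where "X k ys = ennreal (exp (- fst (arrivals ys k)))" for k ys
 have [measurable]: "X k \<in> borel_measurable S.S" for k
  unfolding X_def arrivals_def by measurable
 have I: "(\<integral>\<^sup>+ys. X k ys \<partial>S.S) = ennreal (q ^ Suc k)" for k
 proof (induction k)
  case 0
  have "(\<integral>\<^sup>+ys. X 0 ys \<partial>S.S) = (\<integral>\<^sup>+s. \<integral>\<^sup>+u. \<integral>\<^sup>+ys. ennreal (exp (- s)) \<partial>S.S \<partial>F \<partial>wait_law)"
   by (subst nn_integral_S_iter) (auto simp: X_def arrivals_def)
  also have "\<dots> = ennreal q"
   using nn_integral_wait_exp[of 1] lam_pos by (simp add: S.emeasure_space_1 F.emeasure_space_1[simplified] q_def)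
  finally show ?case by simp
 next
  case (Suc k)
  have "(\<integral>\<^sup>+ys. X (Suc k) ys \<partial>S.S) = (\<integral>\<^sup>+s. \<integral>\<^sup>+u. \<integral>\<^sup>+ys. ennreal (exp (- s)) * X k ys \<partial>S.S \<partial>F \<partial>wait_law)"
   by (subst nn_integral_S_iter)
    (auto simp: X_def arrivals_case_nat ennreal_mult[symmetric] mult_exp_exp add.commute)
  also have "\<dots> = ennreal q * ennreal (q ^ Suc k)"
   using nn_integral_wait_exp[of 1] lam_pos
   by (subst nn_integral_cmult) (auto simp: Suc F.emeasure_space_1[simplified] nn_integral_multc q_def)
  also have "\<dots> = ennreal (q ^ Suc (Suc k))" using q by (subst ennreal_mult[symmetric]) auto
  finally show ?case .
 qed
 have "(\<integral>\<^sup>+ys. (INF k. X k ys) \<partial>S.S) \<le> ennreal (q ^ Suc k)" for k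
  unfolding I[symmetric] by (intro nn_integral_mono INF_lower) simp
 moreover have "(\<lambda>k. ennreal (q ^ Suc k)) \<longlonglongrightarrow> ennreal 0"
  using q by (intro tendsto_ennrealI LIMSEQ_Suc LIMSEQ_realpow_zero) auto
 ultimately have "(\<integral>\<^sup>+ys. (INF k. X k ys) \<partial>S.S) \<le> ennreal 0"
  by (intro LIMSEQ_le_const[of _ "ennreal 0"]) auto
 then have "(\<integral>\<^sup>+ys. (INF k. X k ys) \<partial>S.S) = 0" by simp
 then have "AE ys in S.S. (INF k. X k ys) = 0"
  by (subst (asm) nn_integral_0_iff_AE) auto
 then show ?thesis
 proof eventually_elim
  case (elim ys)
  show ?case
  proof
   fix N :: nat
   have "(INF k. X k ys) < ennreal (exp (- real N))" using elim by simp
   then obtain k where "X k ys < ennreal (exp (- real N))" by (auto simp: INF_less_iff)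
   then show "\<exists>k. real N \<le> fst (arrivals ys k)"
    by (intro exI[of _ k]) (simp add: X_def ennreal_less_iff)
  qed
 qed
qed

lemma AE_arrivals_paths: "AE ys in S.S. arrivals ys \<in> claim_paths"
 using AE_arrivals_unbounded AE_S_component[OF wait_pos F_nonneg, simplified]
proof eventually_elim
 case (elim ys)
 have "0 < fst (ys 0)" using elim by blast
 with elim show ?case
  unfolding claim_paths_iff by (auto simp: arrivals_def)
qed

lemma prob_space_M: "prob_space M"
proof
 have "emeasure M (space M) = (\<integral>\<^sup>+w. 1 \<partial>M)" by simp
 also have "\<dots> = (\<integral>\<^sup>+ys. indicator claim_paths (arrivals ys) \<partial>S.S)"
  by (subst nn_integral_M) (auto simp: ext0_def)
 also have "\<dots> = (\<integral>\<^sup>+ys. 1 \<partial>S.S)"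
  using AE_arrivals_paths by (intro nn_integral_cong_AE) auto
 also have "\<dots> = 1" by (simp add: S.emeasure_space_1)
 finally show "emeasure M (space M) = 1" .
qed

lemma ext0_cons:
 "0 < s ==> 0 \<le> u ==> ext0 g (cons_claim s u w) = ext0 (\<lambda>w. g (cons_claim s u w)) w"
 using cons_paths[of w s u] cons_paths_iff[of s u w] by (auto simp: ext0_def indicator_def)

lemma measurable_comp_cons:
 "g \<in> measurable path_space N ==> 0 < s ==> 0 \<le> u ==> (\<lambda>w. g (cons_claim s u w)) \<in> measurable path_space N"
 using measurable_compose[OF measurable_cons] .

text \<open>Renewal: the first claim is independent of the scenario that follows it, and that
  scenario has the law \<open>M\<close> again. The detour through \<open>ext0\<close> is due to
  \<open>cons_claim s u\<close> mapping into \<open>claim_paths\<close> only for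
  \<open>0 < s\<close> and \<open>0 \<le> u\<close>, that is, for almost all
  \<open>(s, u)\<close>.\<close>

lemma nn_integral_M_cons:
 assumes g: "g \<in> borel_measurable path_space"
 shows "(\<integral>\<^sup>+w. g w \<partial>M) = (\<integral>\<^sup>+s. \<integral>\<^sup>+u. \<integral>\<^sup>+w. g (cons_claim s u w) \<partial>M \<partial>F \<partial>wait_law)"
proof -
 note [measurable] = nn_integral_M(2)[OF g]
 have "(\<integral>\<^sup>+w. g w \<partial>M) = (\<integral>\<^sup>+s. \<integral>\<^sup>+u. \<integral>\<^sup>+ys. ext0 g (arrivals (case_nat (s, u) ys)) \<partial>S.S \<partial>F \<partial>wait_law)"
  unfolding nn_integral_M(1)[OF g] by (rule nn_integral_S_iter) simp
 also have "\<dots> = (\<integral>\<^sup>+s. \<integral>\<^sup>+u. \<integral>\<^sup>+w. g (cons_claim s u w) \<partial>M \<partial>F \<partial>wait_law)"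
 proof (rule nn_integral_cong_AE, use wait_pos in eventually_elim)
  fix s :: real assume s: "0 < s"
  show "(\<integral>\<^sup>+u. \<integral>\<^sup>+ys. ext0 g (arrivals (case_nat (s, u) ys)) \<partial>S.S \<partial>F) = (\<integral>\<^sup>+u. \<integral>\<^sup>+w. g (cons_claim s u w) \<partial>M \<partial>F)"
  proof (rule nn_integral_cong_AE, use F_nonneg in eventually_elim)
   fix u :: "real^'n" assume u: "0 \<le> u"
   show "(\<integral>\<^sup>+ys. ext0 g (arrivals (case_nat (s, u) ys)) \<partial>S.S) = (\<integral>\<^sup>+w. g (cons_claim s u w) \<partial>M)"
    by (simp add: arrivals_case_nat ext0_cons[OF s u] nn_integral_M(1)[OF measurable_comp_cons[OF g s u]])
  qed
 qed
 finally show ?thesis .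
qed

text \<open>Memorylessness of the exponential law: given that no claim occurs up to time
  \<open>r\<close>, the scenario as seen from \<open>r\<close> has the law \<open>M\<close>.\<close>

lemma nn_integral_M_delay:
 assumes g: "g \<in> borel_measurable path_space" and r: "0 \<le> r"
 shows "(\<integral>\<^sup>+w. g w * indicator {r<..} (fst (w 0)) \<partial>M) = ennreal (exp (- lam * r)) * (\<integral>\<^sup>+w. g (delay r w) \<partial>M)"
proof -
 note [measurable] = nn_integral_M(2)[OF g]
 define H where "H s = (\<integral>\<^sup>+u. \<integral>\<^sup>+ys. ext0 g (arrivals (case_nat (s, u) ys)) \<partial>S.S \<partial>F)" for s
 have [measurable]: "H \<in> borel_measurable borel"
  unfolding H_def by measurable
 have H: "H s = (\<integral>\<^sup>+u. \<integral>\<^sup>+w. g (cons_claim s u w) \<partial>M \<partial>F)" if s: "0 < s" for s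
  unfolding H_def
 proof (rule nn_integral_cong_AE, use F_nonneg in eventually_elim)
  fix u :: "real^'n" assume u: "0 \<le> u"
  show "(\<integral>\<^sup>+ys. ext0 g (arrivals (case_nat (s, u) ys)) \<partial>S.S) = (\<integral>\<^sup>+w. g (cons_claim s u w) \<partial>M)"
   by (simp add: arrivals_case_nat ext0_cons[OF s u] nn_integral_M(1)[OF measurable_comp_cons[OF g s u]])
 qed
 have g': "(\<lambda>w. g w * indicator {r<..} (fst (w 0))) \<in> borel_measurable path_space"
  by (intro borel_measurable_times_ennreal g measurable_compose[OF measurable_claim(1)]; measurable)+
 have gd: "(\<lambda>w. g (delay r w)) \<in> borel_measurable path_space"
  using measurable_compose[OF measurable_delay[OF r] g] .
 have "(\<integral>\<^sup>+w. g w * indicator {r<..} (fst (w 0)) \<partial>M) = (\<integral>\<^sup>+s. H s * indicator {r<..} s \<partial>wait_law)"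
  unfolding nn_integral_M_cons[OF g']
 proof (rule nn_integral_cong_AE, use wait_pos in eventually_elim)
  fix s :: real assume s: "0 < s"
  show "(\<integral>\<^sup>+u. \<integral>\<^sup>+w. g (cons_claim s u w) * indicator {r<..} (fst (cons_claim s u w 0)) \<partial>M \<partial>F) = H s * indicator {r<..} s"
   unfolding H[OF s] by (auto simp: indicator_def)
 qed
 also have "\<dots> = (\<integral>\<^sup>+s. ennreal (exponential_density lam s) * (H s * indicator {r<..} s) \<partial>lborel)"
  by (rule nn_integral_density) auto
 also have "\<dots> = (\<integral>\<^sup>+s. ennreal (exponential_density lam (r + s)) * (H (r + s) * indicator {r<..} (r + s)) \<partial>lborel)"
  using nn_integral_real_affine[of "\<lambda>s. ennreal (exponential_density lam s) * (H s * indicator {r<..} s)" 1 r] by simp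
 also have "\<dots> = (\<integral>\<^sup>+s. ennreal (exponential_density lam s) * (ennreal (exp (- lam * r)) * H (r + s)) \<partial>lborel)"
 \<comment> \<open>At \<open>s = 0\<close> the indicator of \<open>{r<..}\<close> vanishes whereas
   the exponential density does not; this single point has to be left out.\<close>
 proof (rule nn_integral_cong_AE, use AE_lborel_singleton[of 0] in eventually_elim)
  fix s :: real assume "s \<noteq> 0"
  then show "ennreal (exponential_density lam (r + s)) * (H (r + s) * indicator {r<..} (r + s)) =
   ennreal (exponential_density lam s) * (ennreal (exp (- lam * r)) * H (r + s))"
  proof (cases "0 < s")
   case True
   then have "exponential_density lam (r + s) = exponential_density lam s * exp (- lam * r)"
    using r by (simp add: exponential_density_def mult_exp_exp algebra_simps)
   then show ?thesis
    using True r lam_pos by (simp add: ennreal_mult exponential_density_nonneg mult.assoc)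
  next
   case False
   with \<open>s \<noteq> 0\<close> show ?thesis by (simp add: exponential_density_def)
  qed
 qed
 also have "\<dots> = ennreal (exp (- lam * r)) * (\<integral>\<^sup>+s. H (r + s) \<partial>wait_law)"
  by (subst nn_integral_density[symmetric]) (simp_all add: nn_integral_cmult)
 also have "(\<integral>\<^sup>+s. H (r + s) \<partial>wait_law) = (\<integral>\<^sup>+w. g (delay r w) \<partial>M)"
  unfolding nn_integral_M_cons[OF gd]
 proof (rule nn_integral_cong_AE, use wait_pos in eventually_elim)
  fix s :: real assume s: "0 < s"
  then show "H (r + s) = (\<integral>\<^sup>+u. \<integral>\<^sup>+w. g (delay r (cons_claim s u w)) \<partial>M \<partial>F)"
   using r by (simp add: H cons_claim_add)
 qed
 finally show ?thesis .
qed

lemma nn_integral_M_split: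
 assumes g: "g \<in> borel_measurable path_space" and r: "0 \<le> r"
 shows "(\<integral>\<^sup>+w. g w \<partial>M) =
  (\<integral>\<^sup>+s. (\<integral>\<^sup>+u. \<integral>\<^sup>+w. g (cons_claim s u w) \<partial>M \<partial>F) * indicator {..r} s \<partial>wait_law) +
  ennreal (exp (- lam * r)) * (\<integral>\<^sup>+w. g (delay r w) \<partial>M)"
proof -
 have m1: "(\<lambda>w. g w * indicator {r<..} (fst (w 0))) \<in> borel_measurable path_space"
 and m2: "(\<lambda>w. g w * indicator {..r} (fst (w 0))) \<in> borel_measurable path_space"
  by (intro borel_measurable_times_ennreal g measurable_compose[OF measurable_claim(1)]; measurable)+
 have "(\<integral>\<^sup>+w. g w \<partial>M) = (\<integral>\<^sup>+w. g w * indicator {..r} (fst (w 0)) + g w * indicator {r<..} (fst (w 0)) \<partial>M)"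
  by (intro nn_integral_cong) (auto simp: indicator_def)
 also have "\<dots> = (\<integral>\<^sup>+w. g w * indicator {..r} (fst (w 0)) \<partial>M) + (\<integral>\<^sup>+w. g w * indicator {r<..} (fst (w 0)) \<partial>M)"
  using m1 m2 by (intro nn_integral_add) (auto simp: measurable_M)
 also have "(\<integral>\<^sup>+w. g w * indicator {..r} (fst (w 0)) \<partial>M) =
  (\<integral>\<^sup>+s. (\<integral>\<^sup>+u. \<integral>\<^sup>+w. g (cons_claim s u w) \<partial>M \<partial>F) * indicator {..r} s \<partial>wait_law)"
  unfolding nn_integral_M_cons[OF m2] by (intro nn_integral_cong) (auto simp: indicator_def)
 finally show ?thesis
  unfolding nn_integral_M_delay[OF g r] .
qed

end

subsection \<open>Information up to a fixed time\<close>

text \<open>Dependence on the claims up to \<open>t\<close>, free of measurability. Together with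
  measurability on \<open>path_space\<close> it amounts to measurability for the history
  (\<open>measurable_history_iff\<close>), so that adaptedness can be checked by comparing two
  scenarios.\<close>

definition adapted_at :: "real \<Rightarrow> ('n::finite claims \<Rightarrow> 'b) \<Rightarrow> bool" where
 "adapted_at t H \<longleftrightarrow> (\<forall>w\<in>claim_paths. \<forall>w'\<in>claim_paths. same_claims_until t w w' \<longrightarrow> H w = H w')"

lemma adapted_atD:
 "adapted_at t H ==> w \<in> claim_paths ==> w' \<in> claim_paths ==> same_claims_until t w w' ==> H w = H w'"
 by (auto simp: adapted_at_def)

lemma same_claims_until_mono: "same_claims_until t w w' ==> s \<le> t ==> same_claims_until s w w'"
 unfolding same_claims_until_def by (meson order_trans)

lemma same_claims_until_sym: "same_claims_until t w w' ==> same_claims_until t w' w"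
 unfolding same_claims_until_def by metis

text \<open>Erases all information after \<open>t\<close>: later claims are replaced by a fixed
  sequence. The arrival times \<open>max t 0 + 1 + real k\<close> are positive, later than
  \<open>t\<close>, strictly increasing and unbounded, so that the result is again a claim
  path.\<close>

definition freeze :: "real \<Rightarrow> 'n::finite claims \<Rightarrow> 'n claims" where
 "freeze t w k = (if fst (w k) \<le> t then w k else (max t 0 + 1 + real k, 0))"

lemma freeze_paths: "w \<in> claim_paths ==> freeze t w \<in> claim_paths"
 unfolding claim_paths_iff
proof (intro conjI allI)
 assume A: "0 < fst (w 0) \<and> (\<forall>k. fst (w k) < fst (w (Suc k))) \<and>
  (\<forall>N::nat. \<exists>k. real N \<le> fst (w k)) \<and> (\<forall>k. 0 \<le> snd (w k))"
 then have A': "w \<in> claim_paths" by (simp add: claim_paths_iff)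
 show "0 < fst (freeze t w 0)" using A by (auto simp: freeze_def)
 fix k
 have "fst (w k) < fst (w (Suc k))" using A by blast
 then show "fst (freeze t w k) < fst (freeze t w (Suc k))" by (auto simp: freeze_def)
 show "0 \<le> snd (freeze t w k)" using A by (auto simp: freeze_def)
 obtain m :: nat where "t < real m" using reals_Archimedean2 by blast
 then obtain j where j: "t < fst (w j)" using A order_less_le_trans by blast
 have "fst (w j) \<le> fst (w (max j k))" using claim_pathsD(3)[OF A', of j "max j k"] by simp
 with j have "real k \<le> fst (freeze t w (max j k))" by (auto simp: freeze_def)
 then show "\<exists>j. real k \<le> fst (freeze t w j)" by blast
qed

lemma same_claims_freeze: "w \<in> claim_paths ==> same_claims_until t w (freeze t w)"
 by (auto simp: same_claims_until_def freeze_def split: if_splits)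

lemma space_history [simp]: "space (history t) = claim_paths"
 by (simp add: history_def space_measure_of_conv)

lemma sets_history:
 "sets (history t) = sigma_sets claim_paths
  {{w \<in> claim_paths. fst (w k) \<le> s \<and> snd (w k) \<in> A} | k s A. ennreal s \<le> t \<and> A \<in> sets borel}"
 unfolding history_def by (rule sets_measure_of) auto

lemma sets_history_subset: "sets (history t) \<subseteq> sets path_space"
proof -
 have "{w \<in> claim_paths. fst (w k) \<le> s \<and> snd (w k) \<in> A} \<in> sets path_space" if A: "A \<in> sets borel" for k s A
 proof -
  have "{w \<in> space path_space. fst (w k) \<le> s} \<in> sets path_space"
   by (rule borel_measurable_le[OF measurable_claim(1)]) simp
  moreover have "(\<lambda>w. snd (w k)) -` A \<inter> space path_space \<in> sets path_space"
   by (rule measurable_sets[OF measurable_claim(2) A])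
  ultimately have "{w \<in> space path_space. fst (w k) \<le> s} \<inter> ((\<lambda>w. snd (w k)) -` A \<inter> space path_space) \<in> sets path_space"
   by (rule sets.Int)
  also have "{w \<in> space path_space. fst (w k) \<le> s} \<inter> ((\<lambda>w. snd (w k)) -` A \<inter> space path_space) = {w \<in> claim_paths. fst (w k) \<le> s \<and> snd (w k) \<in> A}"
   by auto
  finally show ?thesis .
 qed
 then show ?thesis
  unfolding sets_history space_path_space[symmetric] by (intro sets.sigma_sets_subset) auto
qed

lemma history_generator:
 "ennreal s \<le> t ==> A \<in> sets borel ==> {w \<in> claim_paths. fst (w k) \<le> s \<and> snd (w k) \<in> A} \<in> sets (history t)"
 unfolding sets_history by (rule sigma_sets.Basic) auto

lemma history_generator': "ennreal s \<le> t ==> {w \<in> claim_paths. fst (w k) \<le> s} \<in> sets (history t)"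
 using history_generator[of s t UNIV k] by simp

lemma measurable_freeze:
 assumes "0 \<le> t" shows "freeze t \<in> measurable (history (ennreal t) :: 'n::finite claims measure) path_space"
proof (rule measurable_path_spaceI)
 fix k
 show "(\<lambda>w::'n claims. fst (freeze t w k)) \<in> borel_measurable (history (ennreal t))"
 proof (rule borel_measurableI_le)
  fix y
  show "{w \<in> space (history (ennreal t) :: 'n claims measure). fst (freeze t w k) \<le> y} \<in> sets (history (ennreal t) :: 'n claims measure)"
  \<comment> \<open>Below the artificial arrival time the event concerns only claims that really
    arrive by \<open>t\<close>; from that time on it is certain.\<close>
  proof (cases "y < max t 0 + 1 + real k")
   case True
   then have eq: "{w \<in> space (history (ennreal t) :: 'n claims measure). fst (freeze t w k) \<le> y} = {w \<in> (claim_paths :: 'n claims set). fst (w k) \<le> min y t}"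
    by (auto simp: freeze_def)
   show ?thesis unfolding eq by (rule history_generator') (simp add: ennreal_leI)
  next
   case False
   then have eq: "{w \<in> space (history (ennreal t) :: 'n claims measure). fst (freeze t w k) \<le> y} = space (history (ennreal t))"
    by (auto simp: freeze_def)
   show ?thesis unfolding eq by (rule sets.top)
  qed
 qed
 show "(\<lambda>w::'n claims. snd (freeze t w k)) \<in> borel_measurable (history (ennreal t))"
 proof (rule measurableI)
  fix A :: "(real^'n) set" assume A: "A \<in> sets borel"
  have "(\<lambda>w::'n claims. snd (freeze t w k)) -` A \<inter> space (history (ennreal t)) =
   {w \<in> (claim_paths :: 'n claims set). fst (w k) \<le> t \<and> snd (w k) \<in> A} \<union>
   (if 0 \<in> A then space (history (ennreal t)) - {w \<in> (claim_paths :: 'n claims set). fst (w k) \<le> t} else {})"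
   by (auto simp: freeze_def split: if_splits)
  also have "\<dots> \<in> sets (history (ennreal t) :: 'n claims measure)"
   using sets.Un[OF history_generator[OF order_refl A, of k t] sets.Diff[OF sets.top history_generator'[OF order_refl, of k t]]]
    history_generator[OF order_refl A, of k t]
   by (cases "0 \<in> A") (simp_all only: if_True if_False Un_empty_right simp_thms)
  finally show "(\<lambda>w::'n claims. snd (freeze t w k)) -` A \<inter> space (history (ennreal t)) \<in> sets (history (ennreal t) :: 'n claims measure)" .
 qed simp
qed (simp add: freeze_paths)

lemma history_invariant:
 assumes "A \<in> sets (history (ennreal t))" "0 \<le> t" "w \<in> claim_paths" "w' \<in> claim_paths" "same_claims_until t w w'"
 shows "w \<in> A \<longleftrightarrow> w' \<in> A"
 using assms(1) unfolding sets_history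
proof (induction rule: sigma_sets.induct)
 case (Basic B)
 then obtain k s A where B: "B = {w \<in> claim_paths. fst (w k) \<le> s \<and> snd (w k) \<in> A}" and s: "ennreal s \<le> ennreal t"
  by auto
 have "s \<le> t" using s assms(2) by (simp add: ennreal_le_iff)
 then have "w k = w' k" if "fst (w k) \<le> s \<or> fst (w' k) \<le> s"
  using that assms(5) unfolding same_claims_until_def by (meson order_trans)
 then show ?case unfolding B using assms(3,4) by auto
qed (use assms(3,4) in auto)

text \<open>A Doob-Dynkin lemma. Forwards, fibres over points are Borel sets (whence
  \<open>t1_space\<close>), and events of the history do not separate scenarios with the same claims
  up to \<open>t\<close>. Backwards, an adapted \<open>H\<close> coincides with \<open>H\<close>
  composed with \<open>freeze t\<close>.\<close>

lemma measurable_history_iff: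
 fixes H :: "'n::finite claims \<Rightarrow> 'b::t1_space"
 assumes t: "0 \<le> t"
 shows "H \<in> borel_measurable (history (ennreal t)) \<longleftrightarrow> H \<in> borel_measurable path_space \<and> adapted_at t H"
proof safe
 assume H: "H \<in> borel_measurable (history (ennreal t))"
 show "H \<in> borel_measurable path_space"
  using H sets_history_subset by (auto simp: measurable_def)
 show "adapted_at t H"
  unfolding adapted_at_def
 proof (intro ballI impI)
  fix w w' :: "'n claims" assume *: "w \<in> claim_paths" "w' \<in> claim_paths" "same_claims_until t w w'"
  have "H -` {H w} \<inter> space (history (ennreal t)) \<in> sets (history (ennreal t))"
   by (rule measurable_sets[OF H]) simp
  from history_invariant[OF this t *] * show "H w = H w'" by auto
 qed
next
 assume H: "H \<in> borel_measurable path_space" and ad: "adapted_at t H"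
 have "(\<lambda>w. H (freeze t w)) \<in> borel_measurable (history (ennreal t))"
  by (rule measurable_compose[OF measurable_freeze[OF t] H])
 moreover have "H w = H (freeze t w)" if "w \<in> claim_paths" for w
  using adapted_atD[OF ad that freeze_paths[OF that] same_claims_freeze[OF that]] .
 ultimately show "H \<in> borel_measurable (history (ennreal t))"
  by (subst measurable_cong[of _ _ "\<lambda>w. H (freeze t w)"]) auto
qed

lemma pred_history_iff:
 fixes H :: "'n::finite claims \<Rightarrow> bool"
 assumes t: "0 \<le> t"
 shows "Measurable.pred (history (ennreal t)) H \<longleftrightarrow> Measurable.pred path_space H \<and> adapted_at t H"
proof safe
 assume H: "Measurable.pred (history (ennreal t)) H"
 show "Measurable.pred path_space H"
  using H sets_history_subset by (auto simp: pred_def)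
 show "adapted_at t H"
  unfolding adapted_at_def
 proof (intro ballI impI)
  fix w w' :: "'n claims" assume *: "w \<in> claim_paths" "w' \<in> claim_paths" "same_claims_until t w w'"
  from history_invariant[OF H[unfolded pred_def] t *] * show "H w = H w'" by auto
 qed
next
 assume H: "Measurable.pred path_space H" and ad: "adapted_at t H"
 have "Measurable.pred (history (ennreal t)) (\<lambda>w. H (freeze t w))"
  by (rule measurable_compose[OF measurable_freeze[OF t] H])
 moreover have "H w = H (freeze t w)" if "w \<in> claim_paths" for w
  using adapted_atD[OF ad that freeze_paths[OF that] same_claims_freeze[OF that]] .
 ultimately show "Measurable.pred (history (ennreal t)) H"
  by (subst measurable_cong[of _ _ "\<lambda>w. H (freeze t w)"]) auto
qed

lemma stopping_time_history_iff:
 fixes T :: "'n::finite claims \<Rightarrow> ennreal"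
 shows "stopping_time history T \<longleftrightarrow>
  T \<in> borel_measurable path_space \<and> (\<forall>t\<ge>0. adapted_at t (\<lambda>w. T w \<le> ennreal t))"
proof safe
 assume T: "stopping_time history T"
 show m: "T \<in> borel_measurable path_space"
  by (rule measurable_stopping_time[OF T]) (auto simp: sets_history_subset)
 fix t :: real assume "0 \<le> t"
 then show "adapted_at t (\<lambda>w. T w \<le> ennreal t)"
  using stopping_timeD[OF T, of "ennreal t"] by (simp add: pred_history_iff)
next
 assume T: "T \<in> borel_measurable path_space" and ad: "\<forall>t\<ge>0. adapted_at t (\<lambda>w. T w \<le> ennreal t)"
 show "stopping_time history T"
 proof
  fix t :: ennreal
  show "Measurable.pred (history t) (\<lambda>w. T w \<le> t)"
  proof (cases t)
   case (real r)
   then show ?thesis using ad T by (simp add: pred_history_iff)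
  next
   case top
   then show ?thesis by simp
  qed
 qed
qed

text \<open>Galmarino's test. The two scenarios agree on every event of the form "stopped by
  \<open>r\<close>" with \<open>r \<le> t\<close>; comparing at the levels \<open>T w\<close> and
  \<open>T w'\<close> gives both inequalities.\<close>

lemma stopping_time_eq:
 assumes T: "stopping_time history T" and "w \<in> claim_paths" "w' \<in> claim_paths" "same_claims_until t w w'"
  and "0 \<le> t" "T w \<le> ennreal t"
 shows "T w' = T w"
proof -
 have ad: "T w \<le> ennreal r \<longleftrightarrow> T w' \<le> ennreal r" if "0 \<le> r" "r \<le> t" for r
  using T that assms(2-4) same_claims_until_mono[OF assms(4) that(2)]
  unfolding stopping_time_history_iff adapted_at_def by blast
 obtain r where r: "T w = ennreal r" "0 \<le> r" "r \<le> t"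
  using assms(5,6) by (cases "T w") (auto simp: top_unique)
 have "T w' \<le> ennreal r" using ad[of r] r by simp
 then obtain r' where r': "T w' = ennreal r'" "0 \<le> r'" "r' \<le> r"
  using r by (cases "T w'") (auto simp: top_unique)
 have "T w \<le> ennreal r'" using ad[of r'] r r' by simp
 then show ?thesis using r r' by (simp add: order_antisym)
qed

section \<open>Discounting as an exponential killing time\<close>

definition stop :: "ennreal \<Rightarrow> real \<Rightarrow> real" where
 "stop T q = enn2real (min (ennreal q) T)"

lemma stop_simps: "0 \<le> q ==> stop \<infinity> q = q" "0 \<le> q ==> 0 \<le> t ==> stop (ennreal t) q = min q t"
 by (auto simp: stop_def min_def ennreal_le_iff)

lemma stop_nonneg [simp]: "0 \<le> stop T q" by (simp add: stop_def)

lemma stop_le: "0 \<le> q ==> stop T q \<le> q"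
 by (cases T) (auto simp: stop_simps min_def stop_def ennreal_le_iff)

lemma ennreal_stop: "ennreal (stop T q) = min (ennreal q) T"
 unfolding stop_def by (cases T) (auto simp: min_def top_unique)

text \<open>As \<open>G\<close> vanishes on negative times, the open negative half-line is a null
  set. Hence \<open>{0..t}\<close> has the mass of \<open>{-1<..t}\<close>, and the atom of size
  \<open>G 0\<close> at 0 is counted.\<close>

lemma emeasure_interval_measure_atMost:
 fixes G :: "real \<Rightarrow> real"
 assumes G: "mono G" "\<And>x. continuous (at_right x) G" "\<And>t. t < 0 ==> G t = 0" and t: "0 \<le> t"
 shows "emeasure (interval_measure G) {0..t} = ennreal (G t)"
proof -
 have m: "\<And>x y. x \<le> y ==> G x \<le> G y" using G(1) by (simp add: monoD)
 have z: "emeasure (interval_measure G) {- real (Suc n)<..- 1 / real (Suc n)} = 0" for n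
  by (subst emeasure_interval_measure_Ioc_eq[OF m G(2)]) (auto simp: G(3))
 have "{..<0::real} \<subseteq> (\<Union>n. {- real (Suc n)<..- 1 / real (Suc n)})"
 proof
  fix x :: real assume "x \<in> {..<0}"
  then have x: "0 < -x" by simp
  obtain n1 :: nat where n1: "1 / real (Suc n1) < -x" using x reals_Archimedean[of "-x"] by (auto simp: inverse_eq_divide)
  obtain n2 :: nat where n2: "-x < real n2" using reals_Archimedean2 by blast
  have "1 / real (Suc (max n1 n2)) \<le> 1 / real (Suc n1)" by (intro divide_left_mono) auto
  with n1 n2 have "x \<in> {- real (Suc (max n1 n2))<..- 1 / real (Suc (max n1 n2))}" by auto
  then show "x \<in> (\<Union>n. {- real (Suc n)<..- 1 / real (Suc n)})" by blast
 qed
 then have sub: "{..<0::real} \<subseteq> (\<Union>n. {- real (Suc n)<..- 1 / real (Suc n)})" .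
 have nul: "(\<Union>n. {- real (Suc n)<..- 1 / real (Suc n)}) \<in> null_sets (interval_measure G)"
  by (rule null_sets_UN, rule null_setsI, rule z) simp
 have "{..<0::real} \<in> null_sets (interval_measure G)"
  by (rule null_sets_subset[OF nul _ sub]) simp
 then have n: "{-1<..<0::real} \<in> null_sets (interval_measure G)"
  by (rule null_sets_subset) auto
 have "ennreal (G t) = emeasure (interval_measure G) {-1<..t}"
  using t by (subst emeasure_interval_measure_Ioc[OF _ m G(2)]) (auto simp: G(3))
 also have "{-1<..t} = {0..t} \<union> {-1<..<0}" using t by auto
 also have "emeasure (interval_measure G) \<dots> = emeasure (interval_measure G) {0..t}"
  by (rule emeasure_Un_null_set[OF _ n]) simp
 finally show ?thesis by simp
qed

lemma nn_integral_exp_atLeast: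
 assumes "0 < (b::real)"
 shows "(\<integral>\<^sup>+q. ennreal (b * exp (- b * q)) * indicator {s..} q \<partial>lborel) = ennreal (exp (- b * s))"
proof -
 have "(\<integral>\<^sup>+q. ennreal (b * exp (- b * q)) * indicator {s..} q \<partial>lborel) = ennreal (0 - (- exp (- b * s)))"
 proof (rule nn_integral_FTC_atLeast)
  show "((\<lambda>q. - exp (- b * q)) \<longlongrightarrow> 0) at_top"
   using assms by real_asymp
 qed (use assms in \<open>auto intro!: derivative_eq_intros\<close>)
 then show ?thesis by simp
qed

text \<open>\<open>exp (- c * s)\<close> is the probability that an exponential variable
  \<open>q\<close> of rate \<open>c\<close> exceeds \<open>s\<close>. After exchanging the two
  integrals, the inner one is the mass of \<open>{0..stop T q}\<close>, which is
  \<open>G (stop T q)\<close>.\<close>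

lemma interval_measure_by_parts:
 fixes G :: "real \<Rightarrow> real"
 assumes G: "mono G" "\<And>x. continuous (at_right x) G" "\<And>t. t < 0 ==> G t = 0" and c: "0 < c"
 shows "(LINT s : {s. 0 \<le> s \<and> ennreal s \<le> T} | interval_measure G. exp (- c * s)) =
  (LINT q:{0..}|lborel. c * exp (- c * q) * G (stop T q))"
proof -
 let ?\<mu> = "interval_measure G"
 let ?S = "{s. 0 \<le> s \<and> ennreal s \<le> T}"
 have m: "\<And>x y. x \<le> y ==> G x \<le> G y" using G(1) by (simp add: monoD)
 have [measurable]: "G \<in> borel_measurable borel" by (rule borel_measurable_mono[OF G(1)])
 have G0: "0 \<le> G t" for t using m[of "min t (-1)" t] G(3)[of "min t (-1)"] by simp
 have [measurable]: "(\<lambda>q. stop T q) \<in> borel_measurable borel" unfolding stop_def by measurable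
 interpret \<mu>: sigma_finite_measure ?\<mu> by (rule sigma_finite_interval_measure[OF m G(2)])
 interpret P: pair_sigma_finite ?\<mu> lborel ..
 have S: "?S \<in> sets borel" by measurable
 have "(\<integral>\<^sup>+s. ennreal (exp (- c * s)) * indicator ?S s \<partial>?\<mu>) =
    (\<integral>\<^sup>+s. \<integral>\<^sup>+q. ennreal (c * exp (- c * q)) * indicator {s..} q * indicator ?S s \<partial>lborel \<partial>?\<mu>)"
  by (intro nn_integral_cong) (simp add: nn_integral_multc nn_integral_exp_atLeast[OF c, simplified])
 also have "\<dots> = (\<integral>\<^sup>+q. \<integral>\<^sup>+s. ennreal (c * exp (- c * q)) * indicator {s..} q * indicator ?S s \<partial>?\<mu> \<partial>lborel)"
 proof (rule P.Fubini'[symmetric])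
  have [measurable]: "Measurable.pred (?\<mu> \<Otimes>\<^sub>M lborel) (\<lambda>x. snd x \<in> {fst x..})" by simp
  show "(\<lambda>(s, q). ennreal (c * exp (- c * q)) * indicator {s..} q * indicator ?S s) \<in> borel_measurable (?\<mu> \<Otimes>\<^sub>M lborel)"
   by (simp add: split_beta' indicator_def)
 qed
 also have "\<dots> = (\<integral>\<^sup>+q. ennreal (c * exp (- c * q) * G (stop T q)) * indicator {0..} q \<partial>lborel)"
 proof (rule nn_integral_cong)
  fix q :: real
  have "(\<integral>\<^sup>+s. ennreal (c * exp (- c * q)) * indicator {s..} q * indicator ?S s \<partial>?\<mu>) =
   (\<integral>\<^sup>+s. ennreal (c * exp (- c * q)) * indicator (if 0 \<le> q then {0..stop T q} else {}) s \<partial>?\<mu>)"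
  proof (intro nn_integral_cong)
   fix s
   have "s \<le> q \<and> 0 \<le> s \<and> ennreal s \<le> T \<longleftrightarrow> 0 \<le> q \<and> 0 \<le> s \<and> s \<le> stop T q"
   proof (cases "0 \<le> q \<and> 0 \<le> s")
    case True
    then have "s \<le> stop T q \<longleftrightarrow> ennreal s \<le> min (ennreal q) T"
     unfolding ennreal_stop[symmetric] by (simp add: ennreal_le_iff)
    then show ?thesis using True by (simp add: ennreal_le_iff)
   qed auto
   then show "ennreal (c * exp (- c * q)) * indicator {s..} q * indicator ?S s =
    ennreal (c * exp (- c * q)) * indicator (if 0 \<le> q then {0..stop T q} else {}) s"
    by (auto simp: indicator_def)
  qed
  also have "\<dots> = ennreal (c * exp (- c * q) * G (stop T q)) * indicator {0..} q"
   using emeasure_interval_measure_atMost[OF G, of "stop T q"] c G0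
   by (auto simp: nn_integral_cmult_indicator ennreal_mult)
  finally show "(\<integral>\<^sup>+s. ennreal (c * exp (- c * q)) * indicator {s..} q * indicator ?S s \<partial>?\<mu>) =
   ennreal (c * exp (- c * q) * G (stop T q)) * indicator {0..} q" .
 qed
 finally have eq: "(\<integral>\<^sup>+s. ennreal (exp (- c * s)) * indicator ?S s \<partial>?\<mu>) =
  (\<integral>\<^sup>+q. ennreal (c * exp (- c * q) * G (stop T q)) * indicator {0..} q \<partial>lborel)" .
 have "(LINT s : ?S | ?\<mu>. exp (- c * s)) = enn2real (\<integral>\<^sup>+s. ennreal (exp (- c * s)) * indicator ?S s \<partial>?\<mu>)"
  unfolding set_lebesgue_integral_def
  by (subst integral_eq_nn_integral) (use S in \<open>auto simp: indicator_def intro!: arg_cong[where f=enn2real] nn_integral_cong\<close>)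
 also have "\<dots> = (LINT q:{0..}|lborel. c * exp (- c * q) * G (stop T q))"
  unfolding eq set_lebesgue_integral_def using c G0
  by (subst integral_eq_nn_integral) (auto simp: indicator_def intro!: arg_cong[where f=enn2real] nn_integral_cong)
 finally show ?thesis .
qed

subsection \<open>Controlled surplus along a path\<close>

lemma claim_count_iff:
 assumes "w \<in> claim_paths" shows "fst (w k) \<le> t \<longleftrightarrow> k < claim_count w t"
proof -
 obtain m :: nat where "t < real m" using reals_Archimedean2 by blast
 then have ex: "\<exists>j. t < fst (w j)" using assms unfolding claim_paths_iff by (meson order_less_le_trans)
 define N where "N = (LEAST j. t < fst (w j))"
 have N: "t < fst (w N)" unfolding N_def using ex by (rule LeastI_ex)
 have *: "fst (w k) \<le> t \<longleftrightarrow> k < N" for k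
 proof
  assume "fst (w k) \<le> t"
  then have "fst (w k) < fst (w N)" using N by simp
  then show "k < N" using claim_pathsD(2)[OF assms] by simp
 next
  assume "k < N"
  then show "fst (w k) \<le> t" unfolding N_def using not_less_Least[of k "\<lambda>j. t < fst (w j)"] by simp
 qed
 then have "{k. fst (w k) \<le> t} = {..<N}" by auto
 then have "claim_count w t = N" by (simp add: claim_count_def)
 with * show ?thesis by simp
qed

lemma claim_count_eqI:
 assumes "w \<in> claim_paths" "\<And>k. fst (w k) \<le> t \<longleftrightarrow> k < n" shows "claim_count w t = n"
proof -
 have "k < claim_count w t \<longleftrightarrow> k < n" for k using claim_count_iff[OF assms(1)] assms(2) by simp
 then show ?thesis by (metis linorder_neqE_nat less_irrefl)
qed

text \<open>Common frame for the restarts that occur: after a claim-free period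
  (\<open>d = 0\<close>), at the first claim (\<open>d = 1\<close>), and at time 0
  (\<open>d = 0\<close>, \<open>r = 0\<close>). Seen from time \<open>r\<close>, with
  \<open>d\<close> claims gone, \<open>w\<close> continues as \<open>w'\<close>.\<close>

definition shift_rel :: "nat \<Rightarrow> real \<Rightarrow> 'n::finite claims \<Rightarrow> 'n claims \<Rightarrow> bool" where
 "shift_rel d r w w' \<longleftrightarrow> w \<in> claim_paths \<and> w' \<in> claim_paths \<and> 0 \<le> r \<and>
  (\<forall>j. fst (w (j + d)) = r + fst (w' j) \<and> snd (w (j + d)) = snd (w' j)) \<and> (\<forall>j<d. fst (w j) \<le> r)"

lemma shift_relD:
 assumes "shift_rel d r w w'"
 shows "w \<in> claim_paths" "w' \<in> claim_paths" "0 \<le> r" "fst (w (j + d)) = r + fst (w' j)" "snd (w (j + d)) = snd (w' j)"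
  "j < d ==> fst (w j) \<le> r"
 using assms by (auto simp: shift_rel_def)

lemma shift_rel_delay: "w \<in> claim_paths ==> 0 \<le> r ==> shift_rel 0 r (delay r w) w"
 by (auto simp: shift_rel_def delay_paths)

lemma shift_rel_cons: "w \<in> claim_paths ==> 0 < s ==> 0 \<le> u ==> shift_rel 1 s (cons_claim s u w) w"
 by (auto simp: shift_rel_def cons_paths)

lemma shift_rel_refl: "w \<in> claim_paths ==> shift_rel 0 0 w w"
 by (auto simp: shift_rel_def)

lemma claim_count_shift:
 assumes "shift_rel d r w w'" "0 \<le> t"
 shows "claim_count w (r + t) = d + claim_count w' t"
proof (rule claim_count_eqI[OF shift_relD(1)[OF assms(1)]])
 fix k
 note S = shift_relD[OF assms(1)]
 show "fst (w k) \<le> r + t \<longleftrightarrow> k < d + claim_count w' t"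
 proof (cases "k < d")
  case True
  then show ?thesis using S(6)[OF True] assms(2) by auto
 next
  case False
  then obtain j where k: "k = j + d" by (metis add.commute le_Suc_ex not_less)
  show ?thesis using claim_count_iff[OF S(2), of j t] S(4)[of j] by (auto simp: k)
 qed
qed

text \<open>\<open>b\<close> stands for the dividends already paid by time \<open>r\<close>. They
  are moved into the initial surplus of the restarted process, whose own dividends are again counted
  from zero.\<close>

lemma surplus_shift:
 assumes "shift_rel d r w w'" "0 \<le> t"
 shows "surplus p x w (r + t) = surplus p (x + r *\<^sub>R p - (\<Sum>k<d. snd (w k)) - b) w' t + b"
proof -
 note S = shift_relD[OF assms(1)]
 have "(\<Sum>k<d + n. snd (w k)) = (\<Sum>k<d. snd (w k)) + (\<Sum>k<n. snd (w' k))" for n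
  by (induction n) (use S(5) in \<open>auto simp: add.commute[of d]\<close>)
 from this[of "claim_count w' t"] show ?thesis
  by (simp add: surplus_def claim_count_shift[OF assms] algebra_simps)
qed

section \<open>Left limits, ruin and admissible paths\<close>

lemma left_limit_tendsto: "cadlag g ==> (g \<longlongrightarrow> left_limit g t) (at_left t)"
 unfolding cadlag_def left_limit_def by (metis tendsto_Lim trivial_limit_at_left_real)

lemma left_limitI: "(g \<longlongrightarrow> l) (at_left (t::real)) ==> left_limit g t = l"
 unfolding left_limit_def by (rule tendsto_Lim) simp

lemma filterlim_shift_left: "filterlim (\<lambda>t. r + t) (at_left (r + s)) (at_left (s::real))"
 unfolding filterlim_at by (auto intro!: tendsto_intros simp: eventually_at_filter)

lemma filterlim_shift_right: "filterlim (\<lambda>t. r + t) (at_right (r + s)) (at_right (s::real))"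
 unfolding filterlim_at by (auto intro!: tendsto_intros simp: eventually_at_filter)

lemma tendsto_shift_left:
 "(l \<longlongrightarrow> m) (at_left (r + s)) \<longleftrightarrow> ((\<lambda>t. l (r + t)) \<longlongrightarrow> m) (at_left (s::real))"
proof
 assume "((\<lambda>t. l (r + t)) \<longlongrightarrow> m) (at_left s)"
 moreover have "filterlim (\<lambda>t. - r + t) (at_left s) (at_left (r + s))"
  using filterlim_shift_left[of "-r" "r + s"] by simp
 ultimately have "((\<lambda>t. l (r + (- r + t))) \<longlongrightarrow> m) (at_left (r + s))" by (rule filterlim_compose)
 then show "(l \<longlongrightarrow> m) (at_left (r + s))" by simp
qed (rule filterlim_compose[OF _ filterlim_shift_left])

lemma tendsto_shift_right:
 "(l \<longlongrightarrow> m) (at_right (r + s)) \<longleftrightarrow> ((\<lambda>t. l (r + t)) \<longlongrightarrow> m) (at_right (s::real))"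
proof
 assume "((\<lambda>t. l (r + t)) \<longlongrightarrow> m) (at_right s)"
 moreover have "filterlim (\<lambda>t. - r + t) (at_right s) (at_right (r + s))"
  using filterlim_shift_right[of "-r" "r + s"] by simp
 ultimately have "((\<lambda>t. l (r + (- r + t))) \<longlongrightarrow> m) (at_right (r + s))" by (rule filterlim_compose)
 then show "(l \<longlongrightarrow> m) (at_right (r + s))" by simp
qed (rule filterlim_compose[OF _ filterlim_shift_right])

lemma eventually_left_pos: "0 < (s::real) ==> eventually (\<lambda>t. 0 < t) (at_left s)"
 by (rule eventually_at_leftI[of 0]) auto

lemma left_limit_shift:
 fixes l l' :: "real \<Rightarrow> 'a::{t2_space, topological_monoid_add}"
 assumes l: "\<And>t. 0 \<le> t ==> l (r + t) = b + l' t" and s: "0 < s" and c: "cadlag l'"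
 shows "left_limit l (r + s) = b + left_limit l' s" "(l \<longlongrightarrow> b + left_limit l' s) (at_left (r + s))"
proof -
 have "((\<lambda>t. b + l' t) \<longlongrightarrow> b + left_limit l' s) (at_left s)"
  by (intro tendsto_intros left_limit_tendsto c)
 moreover have "eventually (\<lambda>t. b + l' t = l (r + t)) (at_left s)"
  using eventually_left_pos[OF s] by eventually_elim (simp add: l)
 ultimately have "((\<lambda>t. l (r + t)) \<longlongrightarrow> b + left_limit l' s) (at_left s)"
  by (rule Lim_transform_eventually)
 then show "(l \<longlongrightarrow> b + left_limit l' s) (at_left (r + s))" by (simp add: tendsto_shift_left)
 then show "left_limit l (r + s) = b + left_limit l' s" by (rule left_limitI)
qed

text \<open>The surplus immediately before claim \<open>k\<close>: at its arrival time
  \<open>surplus\<close> has already deducted the claim, which is therefore added back.\<close>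

definition pre_claim :: "real^'n \<Rightarrow> real^'n \<Rightarrow> (real \<Rightarrow> real^'n) \<Rightarrow> 'n::finite claims \<Rightarrow> nat \<Rightarrow> real^'n" where
 "pre_claim p x l w k = surplus p x w (fst (w k)) + snd (w k) - left_limit l (fst (w k))"

definition ruin_at :: "real^'n \<Rightarrow> real^'n \<Rightarrow> (real \<Rightarrow> real^'n) \<Rightarrow> 'n::finite claims \<Rightarrow> nat \<Rightarrow> bool" where
 "ruin_at p x l w k \<longleftrightarrow> \<not> snd (w k) \<le> pre_claim p x l w k"

definition path_ruin :: "real^'n \<Rightarrow> real^'n \<Rightarrow> (real \<Rightarrow> real^'n) \<Rightarrow> 'n::finite claims \<Rightarrow> ennreal" where
 "path_ruin p x l w = ruin_time p x (\<lambda>t _. l t) w"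

lemma ruin_time_path: "ruin_time p x L w = path_ruin p x (\<lambda>t. L t w) w"
 by (simp add: ruin_time_def path_ruin_def)

lemma path_ruin_INF: "path_ruin p x l w = (INF k\<in>{k. ruin_at p x l w k}. ennreal (fst (w k)))"
proof -
 have "(0 \<le> s - m) \<longleftrightarrow> u \<le> s + u - m" for s m u :: "real^'n"
  by (auto simp: less_eq_vec_def algebra_simps)
 then have "{k. ruin_at p x l w k} = {k. surplus p x w (fst (w k)) - left_limit l (fst (w k)) \<notin> {0..}}"
  by (simp add: ruin_at_def pre_claim_def)
 then show ?thesis unfolding path_ruin_def ruin_time_def by simp
qed

lemma path_ruin_eq:
 assumes "w \<in> claim_paths" "ruin_at p x l w k" "\<And>j. j < k ==> \<not> ruin_at p x l w j"
 shows "path_ruin p x l w = ennreal (fst (w k))"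
 unfolding path_ruin_INF
proof (rule antisym)
 show "(INF k\<in>{k. ruin_at p x l w k}. ennreal (fst (w k))) \<le> ennreal (fst (w k))"
  using assms(2) by (intro INF_lower) simp
 show "ennreal (fst (w k)) \<le> (INF k\<in>{k. ruin_at p x l w k}. ennreal (fst (w k)))"
 proof (rule INF_greatest)
  fix j assume "j \<in> {k. ruin_at p x l w k}"
  then have "k \<le> j" using assms(3) not_less by blast
  then show "ennreal (fst (w k)) \<le> ennreal (fst (w j))"
   using claim_pathsD(3)[OF assms(1)] by (simp add: ennreal_leI)
 qed
qed

lemma path_ruin_none: "(\<And>k. \<not> ruin_at p x l w k) ==> path_ruin p x l w = \<infinity>"
 unfolding path_ruin_INF by simp

lemma path_ruin_cases:
 assumes "w \<in> claim_paths"
 obtains (ruin) k where "ruin_at p x l w k" "\<And>j. j < k ==> \<not> ruin_at p x l w j"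
   "path_ruin p x l w = ennreal (fst (w k))" "(LEAST k. ruin_at p x l w k) = k"
 | (none) "\<And>k. \<not> ruin_at p x l w k" "path_ruin p x l w = \<infinity>"
proof (cases "\<exists>k. ruin_at p x l w k")
 case True
 then have "ruin_at p x l w (LEAST k. ruin_at p x l w k)" by (rule LeastI_ex)
 moreover have "\<And>j. j < (LEAST k. ruin_at p x l w k) ==> \<not> ruin_at p x l w j" by (rule not_less_Least)
 ultimately show ?thesis using path_ruin_eq[OF assms] ruin by blast
next
 case False
 then show ?thesis using none path_ruin_none by blast
qed

lemma path_ruin_pos: "w \<in> claim_paths ==> ennreal (fst (w 0)) \<le> path_ruin p x l w"
 using claim_pathsD(3) by (auto simp: path_ruin_INF intro!: INF_greatest ennreal_leI)

text \<open>The part of admissibility that concerns a single scenario, separated from adaptedness.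
  Tails and concatenations of strategies can then be examined path by path.\<close>

definition good_path :: "real^'n \<Rightarrow> real^'n \<Rightarrow> 'n::finite claims \<Rightarrow> (real \<Rightarrow> real^'n) \<Rightarrow> bool" where
 "good_path p x w l \<longleftrightarrow> (\<forall>t<0. l t = 0) \<and> 0 \<le> l 0 \<and> mono_on {0..} l \<and> cadlag l \<and>
  (\<forall>t\<ge>0. ennreal t < path_ruin p x l w \<longrightarrow> l t \<le> surplus p x w t) \<and>
  (\<forall>t\<ge>0. path_ruin p x l w \<le> ennreal t \<longrightarrow> l t = left_limit l (enn2real (path_ruin p x l w)))"

lemma admissible_iff:
 "(L, T) \<in> admissible p x \<longleftrightarrow>
  (\<forall>t\<ge>0. L t \<in> borel_measurable path_space \<and> adapted_at t (L t)) \<and>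
  (\<forall>w\<in>claim_paths. good_path p x w (\<lambda>t. L t w)) \<and> stopping_time history T"
 unfolding admissible_def admissible_dividends_def good_path_def ruin_time_path
 by (auto simp: measurable_history_iff)

lemma good_pathD:
 assumes "good_path p x w l"
 shows "t < 0 ==> l t = 0" "0 \<le> l 0" "cadlag l" "mono l" "0 \<le> l t"
  "0 \<le> t ==> ennreal t < path_ruin p x l w ==> l t \<le> surplus p x w t"
  "0 \<le> t ==> path_ruin p x l w \<le> ennreal t ==> l t = left_limit l (enn2real (path_ruin p x l w))"
proof -
 have 1: "t < 0 ==> l t = 0" for t using assms by (auto simp: good_path_def)
 then show "t < 0 ==> l t = 0" .
 show l0: "0 \<le> l 0" and "cadlag l" and
  "0 \<le> t ==> ennreal t < path_ruin p x l w ==> l t \<le> surplus p x w t"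
  "0 \<le> t ==> path_ruin p x l w \<le> ennreal t ==> l t = left_limit l (enn2real (path_ruin p x l w))"
  using assms by (auto simp: good_path_def)
 have mo: "mono_on {0..} l" using assms by (auto simp: good_path_def)
 show "mono l"
 proof
  fix s t :: real assume "s \<le> t"
  consider "0 \<le> s" | "s < 0" "0 \<le> t" | "s < 0" "t < 0" by linarith
  then show "l s \<le> l t"
  proof cases
   case 1 then show ?thesis using mo \<open>s \<le> t\<close> by (auto simp: mono_on_def)
  next
   case 2
   have "l 0 \<le> l t" using mo 2 by (auto simp: mono_on_def)
   then show ?thesis using 1[of s] 2 l0 by (metis order_trans)
  next
   case 3 then show ?thesis using 1 by simp
  qed
 qed
 then have "l (min t (-1)) \<le> l t" by (simp add: monoD)
 then show "0 \<le> l t" using 1[of "min t (-1)"] by simp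
qed

lemma surplus_le:
 assumes "w \<in> claim_paths" shows "surplus p x w t \<le> x + t *\<^sub>R p"
proof -
 have "0 \<le> (\<Sum>k<claim_count w t. snd (w k))" by (intro sum_nonneg claim_pathsD(4)[OF assms])
 then show ?thesis by (simp add: surplus_def)
qed

lemma vec_scale_mono: "(s::real) \<le> t ==> 0 \<le> (p::real^'n::finite) ==> s *\<^sub>R p \<le> t *\<^sub>R p"
 by (auto simp: less_eq_vec_def intro!: mult_right_mono)

lemma tendsto_upperbound_vec:
 fixes g :: "'a \<Rightarrow> real^'n::finite"
 assumes "(g \<longlongrightarrow> m) F" "eventually (\<lambda>t. g t \<le> b) F" "F \<noteq> bot" shows "m \<le> b"
 using Lim_in_closed_set[OF closed_eucl_atMost[of b] _ assms(3,1)] assms(2) by simp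

lemma tendsto_lowerbound_vec:
 fixes g :: "'a \<Rightarrow> real^'n::finite"
 assumes "(g \<longlongrightarrow> m) F" "eventually (\<lambda>t. b \<le> g t) F" "F \<noteq> bot" shows "b \<le> m"
 using Lim_in_closed_set[OF closed_eucl_atLeast[of b] _ assms(3,1)] assms(2) by simp

text \<open>Before ruin the dividends are bounded by the surplus, which claims only reduce. From
  ruin on they are frozen at their left limit, to which the bound passes.\<close>

lemma good_path_le:
 assumes w: "w \<in> claim_paths" and g: "good_path p x w l" and p: "0 \<le> p" and t: "0 \<le> t"
 shows "l t \<le> x + t *\<^sub>R p"
proof (cases "ennreal t < path_ruin p x l w")
 case True
 then show ?thesis using good_pathD(6)[OF g t] surplus_le[OF w] order_trans by blast
next
 case False
 have *: "l s \<le> x + s *\<^sub>R p" if "0 \<le> s" "ennreal s < path_ruin p x l w" for s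
  using good_pathD(6)[OF g that] surplus_le[OF w] order_trans by blast
 from False have le: "path_ruin p x l w \<le> ennreal t" by simp
 obtain k where k: "path_ruin p x l w = ennreal (fst (w k))"
  by (rule path_ruin_cases[OF w, of p x l]) (use le in \<open>auto simp: top_unique\<close>)
 let ?r = "fst (w k)"
 have r: "0 < ?r" by (rule claim_pathsD(1)[OF w])
 have rt: "?r \<le> t" using le r t by (simp add: k ennreal_le_iff)
 have "eventually (\<lambda>s. l s \<le> x + t *\<^sub>R p) (at_left ?r)"
  unfolding eventually_at_left_real
 proof (rule eventually_at_leftI[OF _ r])
  fix s assume s: "s \<in> {0<..<?r}"
  have "l s \<le> x + s *\<^sub>R p" using s by (intro *) (auto simp: k ennreal_less_iff)
  also have "\<dots> \<le> x + t *\<^sub>R p" using s rt by (intro add_left_mono vec_scale_mono p) auto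
  finally show "l s \<le> x + t *\<^sub>R p" .
 qed
 then have "left_limit l ?r \<le> x + t *\<^sub>R p"
  by (rule tendsto_upperbound_vec[OF left_limit_tendsto[OF good_pathD(3)[OF g]]]) simp
 then show ?thesis using good_pathD(7)[OF g t le] r by (simp add: k)
qed

lemma surplus_tendsto_left:
 assumes w: "w \<in> claim_paths"
 shows "(surplus p x w \<longlongrightarrow> surplus p x w (fst (w k)) + snd (w k)) (at_left (fst (w k)))"
proof -
 let ?r = "fst (w k)"
 define s where "s = (if k = 0 then 0 else fst (w (k - 1)))"
 have s: "s < ?r" using claim_pathsD(1)[OF w, of k] claim_pathsD(2)[OF w, of "k - 1" k] by (auto simp: s_def)
 have cc: "claim_count w t = k" if "s < t" "t < ?r" for t
 proof (rule claim_count_eqI[OF w])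
  fix i
  show "fst (w i) \<le> t \<longleftrightarrow> i < k"
  proof
   assume "fst (w i) \<le> t"
   then show "i < k" using that claim_pathsD(2)[OF w, of i k] by simp
  next
   assume "i < k"
   then have "i \<le> k - 1" by simp
   then have "fst (w i) \<le> fst (w (k - 1))" using claim_pathsD(3)[OF w] by blast
   then show "fst (w i) \<le> t" using that \<open>i < k\<close> by (auto simp: s_def)
  qed
 qed
 have "((\<lambda>t. x + t *\<^sub>R p - (\<Sum>j<k. snd (w j))) \<longlongrightarrow> x + ?r *\<^sub>R p - (\<Sum>j<k. snd (w j))) (at_left ?r)"
  by (intro tendsto_intros)
 moreover have "eventually (\<lambda>t. x + t *\<^sub>R p - (\<Sum>j<k. snd (w j)) = surplus p x w t) (at_left ?r)"
  by (rule eventually_at_leftI[OF _ s]) (auto simp: surplus_def cc)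
 ultimately have "(surplus p x w \<longlongrightarrow> x + ?r *\<^sub>R p - (\<Sum>j<k. snd (w j))) (at_left ?r)"
  by (rule Lim_transform_eventually)
 moreover have "claim_count w ?r = Suc k"
  by (rule claim_count_eqI[OF w]) (use claim_pathsD(3)[OF w] in \<open>auto simp: less_Suc_eq_le\<close>)
 then have "surplus p x w ?r + snd (w k) = x + ?r *\<^sub>R p - (\<Sum>j<k. snd (w j))"
  by (simp add: surplus_def)
 ultimately show ?thesis by simp
qed

lemma pre_claim_tendsto:
 assumes "w \<in> claim_paths" "cadlag l"
 shows "((\<lambda>t. surplus p x w t - l t) \<longlongrightarrow> pre_claim p x l w k) (at_left (fst (w k)))"
 unfolding pre_claim_def by (intro tendsto_diff surplus_tendsto_left left_limit_tendsto assms)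

lemma pre_claim_bounds:
 assumes w: "w \<in> claim_paths" and g: "good_path p x w l" and p: "0 \<le> p" and k: "ennreal (fst (w k)) \<le> path_ruin p x l w"
 shows "0 \<le> pre_claim p x l w k" "pre_claim p x l w k \<le> x + fst (w k) *\<^sub>R p"
proof -
 note lim = pre_claim_tendsto[OF w good_pathD(3)[OF g], of p x k]
 have r: "0 < fst (w k)" by (rule claim_pathsD(1)[OF w])
 have "eventually (\<lambda>t. 0 \<le> surplus p x w t - l t) (at_left (fst (w k)))"
 proof (rule eventually_at_leftI[OF _ r])
  fix t assume t: "t \<in> {0<..<fst (w k)}"
  then have "ennreal t < path_ruin p x l w" using k by (metis ennreal_less_iff greaterThanLessThan_iff less_imp_le order_less_le_trans)
  then show "0 \<le> surplus p x w t - l t" using good_pathD(6)[OF g, of t] t by simp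
 qed
 then show "0 \<le> pre_claim p x l w k" by (rule tendsto_lowerbound_vec[OF lim]) simp
 have "eventually (\<lambda>t. surplus p x w t - l t \<le> x + fst (w k) *\<^sub>R p) (at_left (fst (w k)))"
 proof (rule eventually_at_leftI[OF _ r])
  fix t assume t: "t \<in> {0<..<fst (w k)}"
  have "surplus p x w t - l t \<le> surplus p x w t" using good_pathD(5)[OF g] by simp
  also have "\<dots> \<le> x + t *\<^sub>R p" by (rule surplus_le[OF w])
  also have "\<dots> \<le> x + fst (w k) *\<^sub>R p" using t by (intro add_left_mono vec_scale_mono p) auto
  finally show "surplus p x w t - l t \<le> x + fst (w k) *\<^sub>R p" .
 qed
 then show "pre_claim p x l w k \<le> x + fst (w k) *\<^sub>R p" by (rule tendsto_upperbound_vec[OF lim]) simp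
qed

lemma pre_claim_shift:
 assumes S: "shift_rel d r w w'" and l: "\<And>t. 0 \<le> t ==> l (r + t) = b + l' t" and c: "cadlag l'"
 shows "pre_claim p x l w (j + d) = pre_claim p (x + r *\<^sub>R p - (\<Sum>k<d. snd (w k)) - b) l' w' j"
proof -
 note D = shift_relD[OF S]
 have pos: "0 < fst (w' j)" by (rule claim_pathsD(1)[OF D(2)])
 show ?thesis
  using left_limit_shift(1)[where b=b, OF l pos c] surplus_shift[OF S, of "fst (w' j)" p x b] pos
  by (simp add: pre_claim_def D(4,5))
qed

lemma ruin_at_shift:
 assumes S: "shift_rel d r w w'" and l: "\<And>t. 0 \<le> t ==> l (r + t) = b + l' t" and c: "cadlag l'"
 shows "ruin_at p x l w (j + d) \<longleftrightarrow> ruin_at p (x + r *\<^sub>R p - (\<Sum>k<d. snd (w k)) - b) l' w' j"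
 by (simp add: ruin_at_def pre_claim_shift[where b=b, OF S l c] shift_relD(5)[OF S])

lemma path_ruin_shift:
 assumes S: "shift_rel d r w w'" and l: "\<And>t. 0 \<le> t ==> l (r + t) = b + l' t" and c: "cadlag l'"
  and n: "\<And>j. j < d ==> \<not> ruin_at p x l w j"
 shows "path_ruin p x l w = ennreal r + path_ruin p (x + r *\<^sub>R p - (\<Sum>k<d. snd (w k)) - b) l' w'"
proof -
 let ?y = "x + r *\<^sub>R p - (\<Sum>k<d. snd (w k)) - b"
 note D = shift_relD[OF S]
 show ?thesis
 proof (rule path_ruin_cases[OF D(2), of p ?y l'])
  fix k assume ruin: "ruin_at p ?y l' w' k" "\<And>j. j < k ==> \<not> ruin_at p ?y l' w' j"
   "path_ruin p ?y l' w' = ennreal (fst (w' k))"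
  have "path_ruin p x l w = ennreal (fst (w (k + d)))"
  proof (rule path_ruin_eq[OF D(1)])
   show "ruin_at p x l w (k + d)" using ruin(1) ruin_at_shift[where b=b, OF S l c] by simp
   fix j assume j: "j < k + d"
   show "\<not> ruin_at p x l w j"
   proof (cases "j < d")
    case True then show ?thesis by (rule n)
   next
    case False
    then obtain i where i: "j = i + d" by (metis add.commute le_Suc_ex not_less)
    then show ?thesis using ruin(2)[of i] j ruin_at_shift[where b=b, OF S l c] by simp
   qed
  qed
  then show ?thesis using D(3) claim_pathsD(1)[OF D(2), of k] by (simp add: D(4) ruin(3) ennreal_plus[symmetric] less_imp_le del: ennreal_plus)
 next
  assume none: "\<And>k. \<not> ruin_at p ?y l' w' k" "path_ruin p ?y l' w' = \<infinity>"
  have "path_ruin p x l w = \<infinity>"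
  proof (rule path_ruin_none)
   fix j
   show "\<not> ruin_at p x l w j"
   proof (cases "j < d")
    case True then show ?thesis by (rule n)
   next
    case False
    then obtain i where i: "j = i + d" by (metis add.commute le_Suc_ex not_less)
    then show ?thesis using none(1)[of i] ruin_at_shift[where b=b, OF S l c] by simp
   qed
  qed
  then show ?thesis using none(2) by simp
 qed
qed

lemma left_limit_ruin_shift:
 assumes S: "shift_rel d r w w'" and l: "\<And>t. 0 \<le> t ==> l (r + t) = b + l' t" and c: "cadlag l'"
  and R: "R = ennreal r + R'" and R': "R' = path_ruin p y l' w'" "R' < \<infinity>"
 shows "left_limit l (enn2real R) = b + left_limit l' (enn2real R')"
proof -
 note D = shift_relD[OF S]
 obtain k where k: "R' = ennreal (fst (w' k))"
  by (rule path_ruin_cases[OF D(2), of p y l']) (use R' in auto)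
 have pos: "0 < fst (w' k)" by (rule claim_pathsD(1)[OF D(2)])
 have "enn2real R = r + fst (w' k)" using D(3) pos
  by (simp add: R k ennreal_plus[symmetric] less_imp_le del: ennreal_plus)
 then show ?thesis using left_limit_shift(1)[where b=b, OF l pos c] pos by (simp add: k)
qed

text \<open>\<open>b\<close> may be smaller than \<open>l r\<close>. At a claim time, for instance,
  \<open>b\<close> will be the left limit, and whatever is paid in reaction to the claim becomes the
  initial payment of the tail.\<close>

lemma good_path_tail:
 assumes g: "good_path p x w l" and S: "shift_rel d r w w'"
  and n: "\<And>j. j < d ==> \<not> ruin_at p x l w j" and b: "b \<le> l r"
  and l': "\<And>t. l' t = (if t < 0 then 0 else l (r + t) - b)"
 shows "good_path p (x + r *\<^sub>R p - (\<Sum>k<d. snd (w k)) - b) w' l'"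
proof -
 let ?y = "x + r *\<^sub>R p - (\<Sum>k<d. snd (w k)) - b"
 note D = shift_relD[OF S] and G = good_pathD[OF g]
 have l: "l (r + t) = b + l' t" if "0 \<le> t" for t using that by (simp add: l')
 have c: "cadlag l'"
  unfolding cadlag_def
 proof (intro allI conjI)
  fix t :: real
  have *: "(l \<longlongrightarrow> l (r + t)) (at_right (r + t))" "\<exists>m. (l \<longlongrightarrow> m) (at_left (r + t))"
   using G(3) by (auto simp: cadlag_def)
  show "(l' \<longlongrightarrow> l' t) (at_right t)"
  proof (cases "t < 0")
   case True
   have "eventually (\<lambda>s. 0 = l' s) (at_right t)" by (rule eventually_at_rightI[OF _ True]) (auto simp: l')
   then have "(l' \<longlongrightarrow> 0) (at_right t)" by (rule Lim_transform_eventually[rotated]) simp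
   then show ?thesis using True by (simp add: l')
  next
   case False
   have "((\<lambda>s. l (r + s) - b) \<longlongrightarrow> l (r + t) - b) (at_right t)"
    using *(1) unfolding tendsto_shift_right by (intro tendsto_intros)
   moreover have "eventually (\<lambda>s. l (r + s) - b = l' s) (at_right t)"
    by (rule eventually_at_rightI[of t "t + 1"]) (use False in \<open>auto simp: l'\<close>)
   ultimately have "(l' \<longlongrightarrow> l (r + t) - b) (at_right t)" by (rule Lim_transform_eventually)
   then show ?thesis using False by (simp add: l')
  qed
  show "\<exists>m. (l' \<longlongrightarrow> m) (at_left t)"
  proof (cases "t \<le> 0")
   case True
   have "eventually (\<lambda>s. 0 = l' s) (at_left t)" by (rule eventually_at_leftI[of "t - 1"]) (use True in \<open>auto simp: l'\<close>)
   then have "(l' \<longlongrightarrow> 0) (at_left t)" by (rule Lim_transform_eventually[rotated]) simp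
   then show ?thesis by blast
  next
   case False
   obtain m where "(l \<longlongrightarrow> m) (at_left (r + t))" using *(2) by blast
   then have "((\<lambda>s. l (r + s) - b) \<longlongrightarrow> m - b) (at_left t)"
    unfolding tendsto_shift_left by (intro tendsto_intros)
   moreover have "eventually (\<lambda>s. l (r + s) - b = l' s) (at_left t)"
    using eventually_left_pos[of t] False by (auto elim!: eventually_mono simp: l')
   ultimately have "(l' \<longlongrightarrow> m - b) (at_left t)" by (rule Lim_transform_eventually)
   then show ?thesis by blast
  qed
 qed
 have R: "path_ruin p x l w = ennreal r + path_ruin p ?y l' w'" by (rule path_ruin_shift[where b=b, OF S l c n])
 show ?thesis
  unfolding good_path_def
 proof (intro conjI allI impI c)
  show "0 \<le> l' 0" using b by (simp add: l')
  show "mono_on {0..} l'" using G(4) by (auto simp: l' mono_on_def monoD)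
  fix t :: real
  show "l' t = 0" if "t < 0" using that by (simp add: l')
  assume t: "0 \<le> t"
  have e: "ennreal (r + t) = ennreal r + ennreal t" using t D(3) by simp
  { assume "ennreal t < path_ruin p ?y l' w'"
   then have "ennreal (r + t) < path_ruin p x l w" unfolding R e by (simp add: ennreal_add_left_cancel_less)
   then have "l (r + t) \<le> surplus p x w (r + t)" using t D(3) by (intro G(6)) auto
   then show "l' t \<le> surplus p ?y w' t" using t surplus_shift[OF S t, of p x b] by (simp add: l' diff_le_eq) }
  { assume le: "path_ruin p ?y l' w' \<le> ennreal t"
   then have "path_ruin p x l w \<le> ennreal (r + t)" unfolding R e by (simp add: add_left_mono)
   then have "l (r + t) = left_limit l (enn2real (path_ruin p x l w))" using t D(3) by (intro G(7)) auto
   also have "\<dots> = b + left_limit l' (enn2real (path_ruin p ?y l' w'))"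
    using le_less_trans[OF le, of \<infinity>] by (intro left_limit_ruin_shift[where b=b, OF S l c R refl]) auto
   finally show "l' t = left_limit l' (enn2real (path_ruin p ?y l' w'))" using l[OF t] by simp }
 qed
qed

text \<open>Counterpart of \<open>good_path_tail\<close> for a path that pays nothing before
  \<open>r\<close>, then \<open>b\<close> on top of \<open>l'\<close>. Before \<open>r\<close> the
  zero dividend is admissible as long as the uncontrolled surplus is nonnegative.\<close>

lemma good_path_glue:
 assumes g: "good_path p (x + r *\<^sub>R p - (\<Sum>k<d. snd (w k)) - b) w' l'" and S: "shift_rel d r w w'"
  and n: "\<And>j. j < d ==> \<not> ruin_at p x l w j" and b: "0 \<le> b"
  and l: "\<And>t. l t = (if t < r then 0 else b + l' (t - r))"
  and s: "\<And>t. 0 \<le> t ==> t < r ==> 0 \<le> surplus p x w t"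
 shows "good_path p x w l"
proof -
 let ?y = "x + r *\<^sub>R p - (\<Sum>k<d. snd (w k)) - b"
 note D = shift_relD[OF S] and G = good_pathD[OF g]
 have l1: "l (r + t) = b + l' t" if "0 \<le> t" for t using that by (simp add: l)
 have R: "path_ruin p x l w = ennreal r + path_ruin p ?y l' w'" by (rule path_ruin_shift[where b=b, OF S l1 G(3) n])
 have c: "cadlag l"
  unfolding cadlag_def
 proof (intro allI conjI)
  fix t :: real
  show "(l \<longlongrightarrow> l t) (at_right t)"
  proof (cases "t < r")
   case True
   have "eventually (\<lambda>s. 0 = l s) (at_right t)" by (rule eventually_at_rightI[OF _ True]) (auto simp: l)
   then have "(l \<longlongrightarrow> 0) (at_right t)" by (rule Lim_transform_eventually[rotated]) simp
   then show ?thesis using True by (simp add: l)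
  next
   case False
   have "(l' \<longlongrightarrow> l' (t - r)) (at_right (- r + t))" using G(3) unfolding cadlag_def by simp
   then have "((\<lambda>s. b + l' (- r + s)) \<longlongrightarrow> b + l' (t - r)) (at_right t)"
    unfolding tendsto_shift_right by (intro tendsto_intros)
   moreover have "eventually (\<lambda>s. b + l' (- r + s) = l s) (at_right t)"
    by (rule eventually_at_rightI[of t "t + 1"]) (use False in \<open>auto simp: l\<close>)
   ultimately have "(l \<longlongrightarrow> b + l' (t - r)) (at_right t)" by (rule Lim_transform_eventually)
   then show ?thesis using False by (simp add: l)
  qed
  show "\<exists>m. (l \<longlongrightarrow> m) (at_left t)"
  proof (cases "t \<le> r")
   case True
   have "eventually (\<lambda>s. 0 = l s) (at_left t)" by (rule eventually_at_leftI[of "t - 1"]) (use True in \<open>auto simp: l\<close>)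
   then have "(l \<longlongrightarrow> 0) (at_left t)" by (rule Lim_transform_eventually[rotated]) simp
   then show ?thesis by blast
  next
   case False
   then have "(l \<longlongrightarrow> b + left_limit l' (t - r)) (at_left (r + (t - r)))"
    by (intro left_limit_shift(2)[where b=b] l1 G(3)) auto
   then show ?thesis by auto
  qed
 qed
 show ?thesis
  unfolding good_path_def
 proof (intro conjI allI impI c)
  have l0: "0 \<le> l t" for t using b G(5)[of "t - r"] by (simp add: l add_nonneg_nonneg)
  then show "0 \<le> l 0" .
  show "mono_on {0..} l"
  proof (rule mono_onI)
   fix u v :: real assume "u \<in> {0..}" "v \<in> {0..}" "u \<le> v"
   then show "l u \<le> l v"
    using l0[of v] monoD[OF G(4), of "u - r" "v - r"] by (auto simp: l split: if_splits)
  qed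
  fix t :: real
  show "l t = 0" if "t < 0" using that D(3) by (simp add: l)
  assume t: "0 \<le> t"
  have e: "ennreal t = ennreal r + ennreal (t - r)" if "r \<le> t" using that D(3) by (simp add: ennreal_plus[symmetric] del: ennreal_plus)
  { assume lt: "ennreal t < path_ruin p x l w"
   show "l t \<le> surplus p x w t"
   proof (cases "t < r")
    case True then show ?thesis using s[OF t] by (simp add: l)
   next
    case False
    then have "ennreal (t - r) < path_ruin p ?y l' w'" using lt unfolding R by (simp add: e ennreal_add_left_cancel_less)
    then have "l' (t - r) \<le> surplus p ?y w' (t - r)" using False by (intro G(6)) auto
    then show ?thesis using surplus_shift[OF S, of "t - r" p x b] False by (simp add: l add.commute)
   qed }
  { assume le: "path_ruin p x l w \<le> ennreal t"
   have "ennreal r \<le> path_ruin p x l w" unfolding R by simp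
   then have "ennreal r \<le> ennreal t" using le by (rule order_trans)
   then have rt: "r \<le> t" using t by (simp add: ennreal_le_iff)
   then have le': "path_ruin p ?y l' w' \<le> ennreal (t - r)" using le unfolding R by (simp add: e ennreal_add_left_cancel_le)
   then have "l' (t - r) = left_limit l' (enn2real (path_ruin p ?y l' w'))" using rt by (intro G(7)) auto
   moreover have "left_limit l (enn2real (path_ruin p x l w)) = b + left_limit l' (enn2real (path_ruin p ?y l' w'))"
    using le_less_trans[OF le', of \<infinity>] by (intro left_limit_ruin_shift[where b=b, OF S l1 G(3) R refl]) auto
   ultimately show "l t = left_limit l (enn2real (path_ruin p x l w))" using rt by (simp add: l) }
 qed
qed

subsection \<open>Exponential laws and extended expectations\<close>

abbreviation "elaw b \<equiv> density lborel (exponential_density b)"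

lemma measurable_elaw: "measurable (elaw b) N = measurable borel N"
 by (rule measurable_cong_sets) auto

lemma AE_elaw_pos: "AE s in elaw b. 0 < s"
proof -
 have "AE s in lborel. s \<noteq> (0::real)" by (rule AE_lborel_singleton)
 then show ?thesis
  by (subst AE_density) (auto simp: exponential_density_def elim!: AE_mp)
qed

text \<open>An exponential factor is traded for a change of rate, by comparing densities. With
  \<open>b = lam\<close> and \<open>b' = beta\<close> the factor is the discount factor, so a
  discounted mean over the claim time becomes a mean at rate \<open>beta\<close>.\<close>

lemma elaw_tilt:
 assumes "0 < b" "0 < b'" and g: "g \<in> borel_measurable borel"
 shows "integrable (elaw b) (\<lambda>s. exp (- (b' - b) * s) * g s) \<longleftrightarrow> integrable (elaw b') (g :: real \<Rightarrow> real)"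
  and "(LINT s|elaw b. exp (- (b' - b) * s) * g s) = b / b' * (LINT s|elaw b'. g s)"
proof -
 have e: "exponential_density b s * (exp (- (b' - b) * s) * g s) = b / b' * (exponential_density b' s * g s)" for s
 proof -
  have "exp (- s * b) * exp (- (b' - b) * s) = exp (- s * b')"
   by (simp add: mult_exp_exp algebra_simps)
  then show ?thesis using assms(1,2) by (simp add: exponential_density_def mult.assoc[symmetric])
 qed
 have m: "(\<lambda>s. exp (- (b' - b) * s) * g s) \<in> borel_measurable lborel" "g \<in> borel_measurable lborel" using g by measurable
 have nn: "AE s in lborel. 0 \<le> exponential_density b s" "AE s in lborel. 0 \<le> exponential_density b' s"
  using assms by (auto simp: exponential_density_nonneg)
 show "integrable (elaw b) (\<lambda>s. exp (- (b' - b) * s) * g s) \<longleftrightarrow> integrable (elaw b') g"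
 proof -
  have "integrable (elaw b) (\<lambda>s. exp (- (b' - b) * s) * g s) \<longleftrightarrow>
    integrable lborel (\<lambda>s. exponential_density b s *\<^sub>R (exp (- (b' - b) * s) * g s))"
   by (rule integrable_density[OF m(1) _ nn(1)]) simp
  also have "\<dots> \<longleftrightarrow> integrable lborel (\<lambda>s. exponential_density b' s *\<^sub>R g s)"
   unfolding real_scaleR_def e using assms(1,2) by (simp add: integrable_mult_right_iff del: times_divide_eq_left)
  also have "\<dots> \<longleftrightarrow> integrable (elaw b') g"
   by (rule integrable_density[OF m(2) _ nn(2), symmetric]) simp
  finally show ?thesis .
 qed
 show "(LINT s|elaw b. exp (- (b' - b) * s) * g s) = b / b' * (LINT s|elaw b'. g s)"
 proof -
  have "(LINT s|elaw b. exp (- (b' - b) * s) * g s) =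
    (LINT s|lborel. exponential_density b s *\<^sub>R (exp (- (b' - b) * s) * g s))"
   by (rule integral_density[OF m(1) _ nn(1)]) simp
  also have "\<dots> = b / b' * (LINT s|lborel. exponential_density b' s *\<^sub>R g s)"
   unfolding real_scaleR_def e by simp
  also have "(LINT s|lborel. exponential_density b' s *\<^sub>R g s) = (LINT s|elaw b'. g s)"
   by (rule integral_density[OF m(2) _ nn(2), symmetric]) simp
  finally show ?thesis .
 qed
qed

lemma elaw_exp:
 assumes b: "0 < b" "k < b"
 shows "integrable (elaw b) (\<lambda>s. exp (k * s))" "(LINT s|elaw b. exp (k * s)) = b / (b - k)"
proof -
 interpret E: prob_space "elaw (b - k)" using b by (intro prob_space_exponential_density) simp
 have "integrable (elaw b) (\<lambda>s. exp (- ((b - k) - b) * s) * 1)" 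
  using b by (subst elaw_tilt(1)) auto
 then show "integrable (elaw b) (\<lambda>s. exp (k * s))" by simp
 have "(LINT s|elaw b. exp (- ((b - k) - b) * s) * 1) = b / (b - k) * (LINT s|elaw (b - k). 1)"
  using b by (intro elaw_tilt(2)) auto
 then show "(LINT s|elaw b. exp (k * s)) = b / (b - k)" using E.prob_space by simp
qed

text \<open>Memorylessness for integrands of any sign: the part beyond \<open>r\<close> is the law
  itself, moved by \<open>r\<close>, with mass \<open>exp (- b * r)\<close>. All semigroup
  identities for waiting come from this splitting.\<close>

lemma elaw_shift:
 fixes g :: "real \<Rightarrow> real"
 assumes b: "0 < b" and r: "0 \<le> r" and g: "integrable (elaw b) g"
 shows "integrable (elaw b) (\<lambda>q. g (r + q))"
  "(LINT q|elaw b. g q) = (LINT q|elaw b. indicator {..<r} q * g q) + exp (- b * r) * (LINT q|elaw b. g (r + q))"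
proof -
 have gm [measurable]: "g \<in> borel_measurable borel" using borel_measurable_integrable[OF g] by (simp add: measurable_elaw)
 have nn: "AE s in lborel. 0 \<le> exponential_density b s"
  using b by (auto simp: exponential_density_nonneg)
 let ?e = "exponential_density b"
 have i: "integrable lborel (\<lambda>q. ?e q * g q)"
  using g by (simp add: integrable_density[OF _ _ nn])
 have i2: "integrable lborel (\<lambda>q. indicator {r..} q * (?e q * g q))"
  by (rule Bochner_Integration.integrable_bound[OF i]) (auto simp: indicator_def)
 have s: "indicator {r..} (r + q) * (?e (r + q) * g (r + q)) = exp (- b * r) * (?e q * g (r + q))" for q
 proof (cases "q < 0")
  case False
  have "exp (- (r + q) * b) = exp (- b * r) * exp (- q * b)" by (simp add: mult_exp_exp algebra_simps)
  then show ?thesis using False r by (simp add: exponential_density_def)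
 qed (simp add: exponential_density_def)
 have "integrable lborel (\<lambda>q. indicator {r..} (r + 1 * q) * (?e (r + 1 * q) * g (r + 1 * q)))"
  by (rule lborel_integrable_real_affine[OF i2]) simp
 then have i3: "integrable lborel (\<lambda>q. ?e q * g (r + q))" by (simp add: s)
 then show "integrable (elaw b) (\<lambda>q. g (r + q))"
  by (subst integrable_density[OF _ _ nn]) auto
 have "(LINT q|elaw b. g q) = (LINT q|lborel. ?e q * g q)"
  by (subst integral_density[OF _ _ nn]) auto
 also have "\<dots> = (LINT q|lborel. ?e q * (indicator {..<r} q * g q) + indicator {r..} q * (?e q * g q))"
  by (intro Bochner_Integration.integral_cong) (auto simp: indicator_def)
 also have "\<dots> = (LINT q|lborel. ?e q * (indicator {..<r} q * g q)) + (LINT q|lborel. indicator {r..} q * (?e q * g q))"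
  by (intro Bochner_Integration.integral_add i2 Bochner_Integration.integrable_bound[OF i]) (auto simp: indicator_def)
 also have "(LINT q|lborel. ?e q * (indicator {..<r} q * g q)) = (LINT q|elaw b. indicator {..<r} q * g q)"
  by (subst integral_density[OF _ _ nn]) auto
 also have "(LINT q|lborel. indicator {r..} q * (?e q * g q)) = (LINT q|lborel. indicator {r..} (r + q) * (?e (r + q) * g (r + q)))"
  using lborel_integral_real_affine[of 1 "\<lambda>q. indicator {r..} q * (?e q * g q)" r] by simp
 also have "\<dots> = exp (- b * r) * (LINT q|lborel. ?e q * g (r + q))" by (simp only: s) simp
 also have "(LINT q|lborel. ?e q * g (r + q)) = (LINT q|elaw b. g (r + q))"
  by (subst integral_density[OF _ _ nn]) auto
 finally show "(LINT q|elaw b. g q) = (LINT q|elaw b. indicator {..<r} q * g q) + exp (- b * r) * (LINT q|elaw b. g (r + q))" .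
qed

text \<open>The two coordinates on the product space are independent exponential variables, and the
  rate of their minimum is the sum of the rates. This merges the killing clock with the claim
  clock.\<close>

lemma elaw_min:
 fixes g :: "real \<Rightarrow> ennreal"
 assumes b: "0 < b" "0 < b'" and [measurable]: "g \<in> borel_measurable borel"
 shows "(\<integral>\<^sup>+s. \<integral>\<^sup>+q. g (min q s) \<partial>elaw b \<partial>elaw b') = (\<integral>\<^sup>+q. g q \<partial>elaw (b + b'))"
proof -
 let ?P = "elaw b \<Otimes>\<^sub>M elaw b'"
 interpret E: prob_space "elaw b" using b by (intro prob_space_exponential_density)
 interpret E': prob_space "elaw b'" using b by (intro prob_space_exponential_density)
 interpret P: pair_prob_space "elaw b" "elaw b'" ..
 have d: "distr ?P borel fst = elaw b" "distr ?P borel snd = elaw b'"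
 proof -
  show "distr ?P borel fst = elaw b" using E'.distr_pair_fst[of "elaw b"] by (simp cong: distr_cong)
  show "distr ?P borel snd = elaw b'"
  proof (rule measure_eqI)
   fix A assume "A \<in> sets (distr ?P borel snd)"
   then have A: "A \<in> sets borel" by simp
   have "snd -` A \<inter> space ?P = UNIV \<times> A" by (auto simp: space_pair_measure)
   then show "emeasure (distr ?P borel snd) A = emeasure (elaw b') A"
    using A E.emeasure_space_1 by (simp add: emeasure_distr E'.emeasure_pair_measure_Times)
  qed simp
 qed
 have D: "distributed ?P lborel fst (exponential_density b)" "distributed ?P lborel snd (exponential_density b')"
  using d by (auto simp: distributed_def cong: distr_cong)
 have "distr ?P (borel \<Otimes>\<^sub>M borel) (\<lambda>x. (fst x, snd x)) = distr ?P ?P (\<lambda>x. x)"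
  by (rule distr_cong) (auto intro!: sets_pair_measure_cong)
 then have "P.indep_var borel fst borel snd"
  unfolding P.indep_var_distribution_eq d by simp
 from P.exponential_distributed_min[OF b D this]
 have "distr ?P lborel (\<lambda>x. min (fst x) (snd x)) = elaw (b + b')" by (simp add: distributed_def)
 then have "(\<integral>\<^sup>+q. g q \<partial>elaw (b + b')) = (\<integral>\<^sup>+x. g (min (fst x) (snd x)) \<partial>?P)"
  by (simp add: nn_integral_distr flip: \<open>distr ?P lborel (\<lambda>x. min (fst x) (snd x)) = elaw (b + b')\<close>)
 also have "\<dots> = (\<integral>\<^sup>+s. \<integral>\<^sup>+q. g (min q s) \<partial>elaw b \<partial>elaw b')"
  using P.nn_integral_snd[of "\<lambda>x. g (min (fst x) (snd x))"] by simp
 finally show ?thesis by simp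
qed

text \<open>An upper bound makes the positive part integrable, so no difference of infinities
  arises. The expectation is then encoded by the integral of the nonnegative gap
  \<open>C - Z\<close>, which is infinite exactly if the expectation is \<open>-\<infinity>\<close>;
  all later comparisons of values are made on this integral.\<close>

lemma (in prob_space) ext_expectation_upper:
 assumes Z: "Z \<in> borel_measurable M" and le: "\<And>w. w \<in> space M ==> Z w \<le> C"
 shows "ext_expectation M Z = ereal C - enn2ereal (\<integral>\<^sup>+w. ennreal (C - Z w) \<partial>M)"
proof -
 \<comment> \<open>\<open>C\<close> may be negative, while the gap between the bound and the
   positive part of \<open>Z\<close> has to be nonnegative.\<close>
 define D where "D = max C 0"
 define P Q X where "P = (\<integral>\<^sup>+w. ennreal (Z w) \<partial>M)" and "Q = (\<integral>\<^sup>+w. ennreal (- Z w) \<partial>M)"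
  and "X = (\<integral>\<^sup>+w. ennreal (D - max (Z w) 0) \<partial>M)"
 define Y where "Y = (\<integral>\<^sup>+w. ennreal (C - Z w) \<partial>M)"
 note [measurable] = Z
 have "X + P = (\<integral>\<^sup>+w. ennreal (D - max (Z w) 0) + ennreal (Z w) \<partial>M)"
  unfolding X_def P_def by (rule nn_integral_add[symmetric]) auto
 also have "\<dots> = (\<integral>\<^sup>+w. ennreal D \<partial>M)"
 proof (rule nn_integral_cong)
  fix w assume "w \<in> space M"
  then show "ennreal (D - max (Z w) 0) + ennreal (Z w) = ennreal D"
   using le[of w] by (cases "0 \<le> Z w") (auto simp: D_def max_def ennreal_plus[symmetric] ennreal_neg simp del: ennreal_plus)
 qed
 also have "\<dots> = ennreal D" by (simp add: emeasure_space_1)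
 finally have XP: "X + P = ennreal D" .
 have "Y + ennreal (D - C) = (\<integral>\<^sup>+w. ennreal (C - Z w) + ennreal (D - C) \<partial>M)"
  unfolding Y_def by (subst nn_integral_add) (auto simp: emeasure_space_1)
 also have "\<dots> = (\<integral>\<^sup>+w. ennreal (D - max (Z w) 0) + ennreal (- Z w) \<partial>M)"
 proof (rule nn_integral_cong)
  fix w assume "w \<in> space M"
  then show "ennreal (C - Z w) + ennreal (D - C) = ennreal (D - max (Z w) 0) + ennreal (- Z w)"
   using le[of w] by (cases "0 \<le> Z w") (auto simp: D_def max_def ennreal_plus[symmetric] ennreal_neg simp del: ennreal_plus)
 qed
 also have "\<dots> = X + Q" unfolding X_def Q_def by (rule nn_integral_add) auto
 finally have YQ: "Y + ennreal (D - C) = X + Q" .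
 have D: "0 \<le> D" "C \<le> D" by (auto simp: D_def)
 have fin: "X \<noteq> \<infinity>" "P \<noteq> \<infinity>" using XP by (auto simp: ennreal_add_eq_top)
 obtain x where x: "X = ennreal x" "0 \<le> x" using fin by (cases X) auto
 obtain u where u: "P = ennreal u" "0 \<le> u" using fin by (cases P) auto
 have xu: "x + u = D" using XP x u D by (simp add: ennreal_plus[symmetric] del: ennreal_plus)
 show ?thesis
 proof (cases Q)
  case (real v)
  then have "Y \<noteq> \<infinity>" using YQ x by (auto simp: ennreal_plus[symmetric] simp del: ennreal_plus)
  then obtain y where y: "Y = ennreal y" "0 \<le> y" by (cases Y) auto
  have "y + (D - C) = x + v" using YQ x y real D by (simp add: ennreal_plus[symmetric] del: ennreal_plus)
  then show ?thesis
   unfolding ext_expectation_def P_def[symmetric] Q_def[symmetric] Y_def[symmetric]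
   using xu u y real by (simp add: enn2ereal_ennreal)
 next
  case top
  then have "Y = \<infinity>" using YQ by (cases Y) (auto simp: ennreal_plus[symmetric] simp del: ennreal_plus)
  then show ?thesis
   unfolding ext_expectation_def P_def[symmetric] Q_def[symmetric] Y_def[symmetric]
   using u top by (simp add: enn2ereal_ennreal)
 qed
qed

lemma ereal_minus_enn_le_iff:
 "ereal C - enn2ereal I \<le> ereal vf \<longleftrightarrow> ennreal (C - vf) \<le> I"
proof (cases I)
 case (real i)
 then show ?thesis by (cases "vf \<le> C") (auto simp: enn2ereal_ennreal ennreal_le_iff ennreal_neg)
qed (simp add: top_unique)

lemma ereal_le_minus_enn_iff:
 "ereal vf \<le> ereal C - enn2ereal I \<longleftrightarrow> vf \<le> C \<and> I \<le> ennreal (C - vf)"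
proof (cases I)
 case (real i)
 then show ?thesis by (cases "vf \<le> C") (auto simp: enn2ereal_ennreal ennreal_le_iff ennreal_neg)
qed (simp add: top_unique)

lemma (in prob_space) ext_expectation_le_iff:
 assumes "Z \<in> borel_measurable M" "\<And>w. w \<in> space M ==> Z w \<le> C"
 shows "ext_expectation M Z \<le> ereal vf \<longleftrightarrow> ennreal (C - vf) \<le> (\<integral>\<^sup>+w. ennreal (C - Z w) \<partial>M)"
 using ereal_minus_enn_le_iff ext_expectation_upper[where Z=Z and C=C] assms by simp

text \<open>The conjunct \<open>vf \<le> C\<close> cannot be read off the integral: for
  \<open>vf > C\<close> the truncated gap \<open>ennreal (C - vf)\<close> is 0, as it is for
  \<open>vf = C\<close>.\<close>

lemma (in prob_space) ext_expectation_ge_iff: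
 assumes "Z \<in> borel_measurable M" "\<And>w. w \<in> space M ==> Z w \<le> C"
 shows "ereal vf \<le> ext_expectation M Z \<longleftrightarrow> vf \<le> C \<and> (\<integral>\<^sup>+w. ennreal (C - Z w) \<partial>M) \<le> ennreal (C - vf)"
 using ereal_le_minus_enn_iff ext_expectation_upper[where Z=Z and C=C] assms by simp

lemma ext_expectation_uminus:
 assumes "(\<integral>\<^sup>+w. ennreal (- Z w) \<partial>M) \<noteq> \<infinity>"
 shows "ext_expectation M (\<lambda>w. - Z w) = - ext_expectation M Z"
 using assms unfolding ext_expectation_def
 by (cases "\<integral>\<^sup>+w. ennreal (- Z w) \<partial>M"; cases "\<integral>\<^sup>+w. ennreal (Z w) \<partial>M") (auto simp: enn2ereal_ennreal)

lemma (in prob_space) nn_integral_upper_finite: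
 assumes "\<And>w. w \<in> space M ==> Z w \<le> C"
 shows "(\<integral>\<^sup>+w. ennreal (Z w) \<partial>M) \<noteq> \<infinity>"
proof -
 have "(\<integral>\<^sup>+w. ennreal (Z w) \<partial>M) \<le> (\<integral>\<^sup>+w. ennreal C \<partial>M)"
  using assms by (intro nn_integral_mono ennreal_leI)
 also have "\<dots> = ennreal C" by (simp add: emeasure_space_1)
 also have "\<dots> < \<infinity>" by simp
 finally show ?thesis by simp
qed

text \<open>Both \<open>A\<close> and \<open>- B\<close> are bounded above, so the two terms can
  only be infinite in the same direction, and their gaps add up.\<close>

lemma (in prob_space) ext_expectation_diff:
 assumes A: "A \<in> borel_measurable M" "\<And>w. w \<in> space M ==> A w \<le> C"
  and B: "B \<in> borel_measurable M" "\<And>w. w \<in> space M ==> - B w \<le> C'"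
 shows "ext_expectation M A - ext_expectation M B = ext_expectation M (\<lambda>w. A w - B w)"
proof -
 have B': "ext_expectation M (\<lambda>w. - B w) = - ext_expectation M B"
  by (rule ext_expectation_uminus[OF nn_integral_upper_finite[OF B(2)]])
 note [measurable] = A(1) B(1)
 have mB: "(\<lambda>w. - B w) \<in> borel_measurable M" by measurable
 define I J where "I = (\<integral>\<^sup>+w. ennreal (C - A w) \<partial>M)" and "J = (\<integral>\<^sup>+w. ennreal (C' - (- B w)) \<partial>M)"
 have "(\<integral>\<^sup>+w. ennreal ((C + C') - (A w - B w)) \<partial>M) = (\<integral>\<^sup>+w. ennreal (C - A w) + ennreal (C' - (- B w)) \<partial>M)"
 proof (rule nn_integral_cong)
  fix w assume "w \<in> space M"
  from A(2)[OF this] B(2)[OF this]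
  show "ennreal ((C + C') - (A w - B w)) = ennreal (C - A w) + ennreal (C' - (- B w))"
   by (simp add: ennreal_plus[symmetric] algebra_simps del: ennreal_plus)
 qed
 also have "\<dots> = I + J" unfolding I_def J_def by (rule nn_integral_add) auto
 finally have IJ: "(\<integral>\<^sup>+w. ennreal ((C + C') - (A w - B w)) \<partial>M) = I + J" .
 have "ext_expectation M (\<lambda>w. A w - B w) = ereal (C + C') - enn2ereal (I + J)"
 proof -
  have "A w - B w \<le> C + C'" if "w \<in> space M" for w using A(2)[OF that] B(2)[OF that] by simp
  then show ?thesis by (subst ext_expectation_upper[of _ "C + C'"]) (simp_all only: IJ, measurable)
 qed
 also have "\<dots> = (ereal C - enn2ereal I) + (ereal C' - enn2ereal J)"
  by (cases I; cases J) (auto simp: enn2ereal_ennreal ennreal_plus[symmetric] simp del: ennreal_plus)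
 also have "ereal C - enn2ereal I = ext_expectation M A"
  unfolding I_def by (rule ext_expectation_upper[OF A, symmetric])
 also have "ereal C' - enn2ereal J = - ext_expectation M B"
  unfolding J_def B'[symmetric] by (rule ext_expectation_upper[OF mB B(2), symmetric])
 finally show ?thesis by (simp add: minus_ereal_def)
qed

lemma (in prob_space) ext_expectation_affine:
 assumes Z: "Z \<in> borel_measurable M" "\<And>w. w \<in> space M ==> Z w \<le> C" and q: "0 < q"
 shows "ext_expectation M (\<lambda>w. b + q * Z w) = ereal b + ereal q * ext_expectation M Z"
proof -
 note [measurable] = Z(1)
 define I where "I = (\<integral>\<^sup>+w. ennreal (C - Z w) \<partial>M)"
 have "(\<integral>\<^sup>+w. ennreal ((b + q * C) - (b + q * Z w)) \<partial>M) = (\<integral>\<^sup>+w. ennreal q * ennreal (C - Z w) \<partial>M)"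
 proof (rule nn_integral_cong)
  fix w assume "w \<in> space M"
  from Z(2)[OF this] q show "ennreal ((b + q * C) - (b + q * Z w)) = ennreal q * ennreal (C - Z w)"
   by (simp add: ennreal_mult[symmetric] algebra_simps)
 qed
 also have "\<dots> = ennreal q * I" unfolding I_def by (rule nn_integral_cmult) simp
 finally have "ext_expectation M (\<lambda>w. b + q * Z w) = ereal (b + q * C) - enn2ereal (ennreal q * I)"
  using Z(2) q by (subst ext_expectation_upper[of _ "b + q * C"]) auto
 also have "\<dots> = ereal b + ereal q * (ereal C - enn2ereal I)"
  using q by (cases I) (auto simp: enn2ereal_ennreal ennreal_mult[symmetric] ennreal_mult_top algebra_simps)
 also have "ereal C - enn2ereal I = ext_expectation M Z"
  unfolding I_def by (rule ext_expectation_upper[OF Z, symmetric])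
 finally show ?thesis .
qed

section \<open>Measurability of upper continuous functions and right continuous processes\<close>

lemma measurable_vec_count_space:
 fixes h :: "'a \<Rightarrow> 'n::finite \<Rightarrow> 'b::countable"
 assumes "\<And>i. (\<lambda>x. h x i) \<in> measurable N (count_space UNIV)"
 shows "(\<lambda>x. \<chi> i. h x i) \<in> measurable N (count_space UNIV)"
 unfolding measurable_count_space_eq2_countable
proof (intro conjI ballI)
 fix v :: "'b^'n"
 have "(\<lambda>x. \<chi> i. h x i) -` {v} \<inter> space N = (\<Inter>i\<in>UNIV. (\<lambda>x. h x i) -` {v $ i} \<inter> space N)"
  by (auto simp: vec_eq_iff)
 also have "\<dots> \<in> sets N"
  by (rule sets.finite_INT) (auto intro: measurable_sets[OF assms])
 finally show "(\<lambda>x. \<chi> i. h x i) -` {v} \<inter> space N \<in> sets N" .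
qed simp

lemma borel_measurable_vec_nth': "(\<lambda>x::real^'n::finite. x $ i) \<in> borel_measurable borel"
 by (intro borel_measurable_continuous_onI continuous_intros)

text \<open>A function that is continuous from above is the limit of its values at the upper dyadic corners.\<close>

lemma borel_measurable_upper_continuous:
 fixes g :: "real^'n::finite \<Rightarrow> real"
 assumes "\<And>x. 0 \<le> x ==> continuous (at x within {x..}) g"
 shows "(\<lambda>x. if 0 \<le> x then g x else 0) \<in> borel_measurable borel"
proof (rule borel_measurable_LIMSEQ_metric)
 define up :: "nat \<Rightarrow> real^'n \<Rightarrow> real^'n" where
  "up n x = (\<chi> i. (real_of_int ((\<chi> i. \<lfloor>x $ i * 2 ^ n\<rfloor>) $ i) + 1) / 2 ^ n)" for n x
 fix n
 have "(\<lambda>x::real^'n. \<chi> i. \<lfloor>x $ i * 2 ^ n\<rfloor>) \<in> measurable borel (count_space UNIV)"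
  using borel_measurable_vec_nth' by (intro measurable_vec_count_space) measurable
 then have "(\<lambda>x. g (up n x)) \<in> borel_measurable borel"
  unfolding up_def by (rule measurable_compose[where N="count_space UNIV" and g="\<lambda>v. g (\<chi> i. (real_of_int (v $ i) + 1) / 2 ^ n)"]) simp
 then show "(\<lambda>x. if 0 \<le> x then g (up n x) else 0) \<in> borel_measurable borel" by measurable
next
 fix x :: "real^'n"
 define up :: "nat \<Rightarrow> real^'n \<Rightarrow> real^'n" where
  "up n x = (\<chi> i. (real_of_int ((\<chi> i. \<lfloor>x $ i * 2 ^ n\<rfloor>) $ i) + 1) / 2 ^ n)" for n x
 have le: "x $ i \<le> up n x $ i" "up n x $ i \<le> x $ i + (1/2) ^ n" for n i
 proof -
  have "x $ i * 2 ^ n \<le> real_of_int \<lfloor>x $ i * 2 ^ n\<rfloor> + 1" by linarith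
  then show "x $ i \<le> up n x $ i" by (simp add: up_def pos_le_divide_eq)
  have "(real_of_int \<lfloor>x $ i * 2 ^ n\<rfloor> + 1) / 2 ^ n \<le> (x $ i * 2 ^ n + 1) / 2 ^ n"
   by (intro divide_right_mono) auto
  also have "\<dots> = x $ i + (1/2) ^ n" by (simp add: add_divide_distrib power_one_over)
  finally show "up n x $ i \<le> x $ i + (1/2) ^ n" by (simp add: up_def)
 qed
 have "(\<lambda>n. up n x) \<longlonglongrightarrow> x"
 proof (rule vec_tendstoI)
  fix i
  have "(\<lambda>n. x $ i + (1/2) ^ n) \<longlonglongrightarrow> x $ i + 0" by (intro tendsto_add tendsto_const LIMSEQ_realpow_zero) auto
  then have "(\<lambda>n. x $ i + (1/2) ^ n) \<longlonglongrightarrow> x $ i" by simp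
  from tendsto_sandwich[OF _ _ tendsto_const this, of "\<lambda>n. up n x $ i"]
  show "(\<lambda>n. up n x $ i) \<longlonglongrightarrow> x $ i" using le by simp
 qed
 moreover have "\<forall>n. up n x \<in> {x..}" by (auto simp: less_eq_vec_def le)
 ultimately have "(\<lambda>n. g (up n x)) \<longlonglongrightarrow> g x" if "0 \<le> x"
  using assms[OF that, unfolded continuous_within_sequentially comp_def, THEN spec[of _ "\<lambda>n. up n x"]] by simp
 then show "(\<lambda>n. if 0 \<le> x then g (up n x) else 0) \<longlonglongrightarrow> (if 0 \<le> x then g x else 0)" by simp
qed

text \<open>The random time is rounded to a dyadic number strictly above it. Each rounding takes
  countably many values, so only fixed-time measurability enters; right continuity gives the
  limit.\<close>

lemma measurable_right_continuous_process:
 fixes L :: "real \<Rightarrow> 's \<Rightarrow> 'b::metric_space"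
 assumes m: "\<And>t. L t \<in> borel_measurable N" and r: "\<And>w t. w \<in> space N ==> ((\<lambda>s. L s w) \<longlongrightarrow> L t w) (at_right t)"
  and g: "g \<in> borel_measurable N'" and h: "h \<in> measurable N' N"
 shows "(\<lambda>x. L (g x) (h x)) \<in> borel_measurable N'"
proof (rule borel_measurable_LIMSEQ_metric)
 fix n
 have "(\<lambda>x. \<lfloor>g x * 2 ^ n\<rfloor>) \<in> measurable N' (count_space UNIV)" using g by measurable
 moreover have "(\<lambda>x. L ((real_of_int k + 1) / 2 ^ n) (h x)) \<in> borel_measurable N'" for k
  by (rule measurable_compose[OF h m])
 ultimately show "(\<lambda>x. L ((real_of_int \<lfloor>g x * 2 ^ n\<rfloor> + 1) / 2 ^ n) (h x)) \<in> borel_measurable N'"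
  by (rule measurable_compose_countable[rotated])
next
 fix x assume x: "x \<in> space N'"
 define t where "t n = (real_of_int \<lfloor>g x * 2 ^ n\<rfloor> + 1) / 2 ^ n" for n :: nat
 have t: "g x < t n" "t n \<le> g x + (1/2) ^ n" for n
 proof -
  have "g x * 2 ^ n < real_of_int \<lfloor>g x * 2 ^ n\<rfloor> + 1" by linarith
  then show "g x < t n" by (simp add: t_def pos_less_divide_eq)
  have "(real_of_int \<lfloor>g x * 2 ^ n\<rfloor> + 1) / 2 ^ n \<le> (g x * 2 ^ n + 1) / 2 ^ n"
   by (intro divide_right_mono) auto
  also have "\<dots> = g x + (1/2) ^ n" by (simp add: add_divide_distrib power_one_over)
  finally show "t n \<le> g x + (1/2) ^ n" by (simp add: t_def)
 qed
 have "(\<lambda>n. g x + (1/2) ^ n) \<longlonglongrightarrow> g x + 0" by (intro tendsto_add tendsto_const LIMSEQ_realpow_zero) auto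
 then have "(\<lambda>n. g x + (1/2) ^ n) \<longlonglongrightarrow> g x" by simp
 from tendsto_sandwich[OF _ _ tendsto_const this, of t]
 have "t \<longlonglongrightarrow> g x" using t by (simp add: less_imp_le)
 moreover have "t n \<in> {g x<..} \<and> t n \<noteq> g x" for n using t(1)[of n] by auto
 ultimately have "filterlim t (at_right (g x)) sequentially"
  unfolding filterlim_at by simp
 from filterlim_compose[OF r[OF measurable_space[OF h x]] this]
 show "(\<lambda>n. L ((real_of_int \<lfloor>g x * 2 ^ n\<rfloor> + 1) / 2 ^ n) (h x)) \<longlonglongrightarrow> L (g x) (h x)"
  by (simp add: t_def)
qed

lemma pred_le_vec:
 fixes g h :: "'a \<Rightarrow> real^'n::finite"
 assumes "g \<in> borel_measurable N" "h \<in> borel_measurable N"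
 shows "Measurable.pred N (\<lambda>x. g x \<le> h x)"
proof -
 have "Measurable.pred N (\<lambda>x. 0 \<le> h x - g x)" using assms by (intro measurable_compose[OF _ orthant_borel]) auto
 then show ?thesis by (simp add: less_eq_vec_def)
qed

lemma ruin_pairs_sets: "ruin_pairs \<in> sets (borel :: ((real^'n::finite) \<times> (real^'n)) measure)"
proof -
 have "Measurable.pred (borel :: ((real^'n) \<times> (real^'n)) measure) (\<lambda>x. 0 \<le> fst x \<and> 0 \<le> snd x \<and> \<not> snd x \<le> fst x)"
  by (intro pred_intros_logic pred_le_vec) (auto intro!: borel_measurable_continuous_onI continuous_intros)
 moreover have "ruin_pairs = {x::(real^'n) \<times> (real^'n). 0 \<le> fst x \<and> 0 \<le> snd x \<and> \<not> snd x \<le> fst x}"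
  by (auto simp: ruin_pairs_def less_eq_vec_def)
 ultimately show ?thesis by (simp add: pred_def)
qed

lemma ruin_pairs_iff: "(x, u) \<in> ruin_pairs \<longleftrightarrow> 0 \<le> x \<and> 0 \<le> u \<and> \<not> u \<le> (x :: real^'n::finite)"
 by (auto simp: ruin_pairs_def less_eq_vec_def)

section \<open>The dividend model: growth weight, switch value and penalty\<close>

locale dividend_model = claim_model lam F for lam and F :: "(real^'n::finite) measure" +
 fixes p a :: "real^'n" and c :: real and \<upsilon> :: "real^'n \<Rightarrow> real^'n \<Rightarrow> real" and f :: "real^'n \<Rightarrow> real"
 assumes p_pos: "0 < p $ i" and a_pos: "0 < a $ i" and c_pos: "0 < c"
  and pen_measurable: "(\<lambda>(x, \<alpha>). \<upsilon> x \<alpha>) \<in> borel_measurable (restrict_space borel ruin_pairs)"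
  and pen_antimono: "(x, \<alpha>) \<in> ruin_pairs ==> (y, \<alpha>) \<in> ruin_pairs ==> x \<le> y ==> \<upsilon> y \<alpha> \<le> \<upsilon> x \<alpha>"
  and pen_integrable: "set_integrable F {u. (0, u) \<in> ruin_pairs} (\<upsilon> 0)"
  and f_upper_continuous: "0 \<le> x ==> continuous (at x within {x..}) f"
  and f_growth: "growth_condition c p f"
  and pen_bdd: "0 \<le> x ==> bdd_above ((\<lambda>\<alpha>. - \<upsilon> x \<alpha>) ` {\<alpha>. (x, \<alpha>) \<in> ruin_pairs})"
  and pen_growth: "growth_condition c p (\<lambda>x. SUP \<alpha>\<in>{\<alpha>. (x, \<alpha>) \<in> ruin_pairs}. - \<upsilon> x \<alpha>)"
  and pen_continuous: "continuous_on {0..} (\<lambda>x. lam * (LINT \<alpha> : {\<alpha>. (x, \<alpha>) \<in> ruin_pairs} | F. \<upsilon> x \<alpha>))"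
begin

sublocale M: prob_space M by (rule prob_space_M)
sublocale C: prob_space "elaw c" by (rule prob_space_exponential_density[OF c_pos])

lemma measurable_F: "measurable F N = measurable borel N"
 by (rule measurable_cong_sets[OF F_sets refl])

abbreviation "h0 \<equiv> growth_weight c p"

lemma p_nonneg: "0 \<le> p" and a_nonneg: "0 \<le> a"
 using p_pos a_pos by (auto simp: less_eq_vec_def less_imp_le)

lemma a_inner_mono: "x \<le> y ==> a \<bullet> x \<le> a \<bullet> y"
 using a_nonneg by (auto simp: inner_vec_def less_eq_vec_def intro!: sum_mono mult_left_mono)

lemma a_inner_nonneg: "0 \<le> x ==> 0 \<le> a \<bullet> x"
 using a_inner_mono[of 0 x] by simp

lemma h0_pos: "0 < h0 x" by (simp add: growth_weight_def)

lemma h0_mono: "x \<le> y ==> h0 x \<le> h0 y"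
 using p_pos c_pos
 by (auto simp: growth_weight_def less_eq_vec_def less_imp_le intro!: mult_left_mono sum_mono divide_right_mono)

lemma h0_ge_1: "0 \<le> x ==> 1 \<le> h0 x"
 using h0_mono[of 0 x] by (simp add: growth_weight_def)

text \<open>Each coordinate adds \<open>t\<close> to the sum in the exponent, and the normalisation
  by the number of companies leaves the rate \<open>c / 2\<close> in every dimension, strictly below
  the discount rate.\<close>

lemma h0_shift: "h0 (x + t *\<^sub>R p) = h0 x * exp (c / 2 * t)"
proof -
 have "(\<Sum>i\<in>UNIV. (x + t *\<^sub>R p) $ i / p $ i) = (\<Sum>i\<in>UNIV. x $ i / p $ i) + real CARD('n) * t"
 proof -
  have "(x + t *\<^sub>R p) $ i / p $ i = x $ i / p $ i + t" for i
   using p_pos[of i] by (simp add: add_divide_distrib)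
  then show ?thesis by (simp add: sum.distrib)
 qed
 then show ?thesis by (simp add: growth_weight_def distrib_left exp_add)
qed

lemma h0_continuous: "continuous_on S h0"
 unfolding growth_weight_def by (intro continuous_intros) (use p_pos in \<open>auto simp: less_imp_neq[symmetric]\<close>)

lemma growth_bound: "\<exists>K\<ge>0. \<forall>x\<ge>0. f x \<le> K * h0 x \<and> a \<bullet> x \<le> K * h0 x \<and> (\<forall>\<alpha>. (x, \<alpha>) \<in> ruin_pairs \<longrightarrow> - \<upsilon> x \<alpha> \<le> K * h0 x)"
proof -
 obtain K1 where K1: "\<And>x. 0 \<le> x ==> f x / h0 x \<le> K1"
  using f_growth unfolding growth_condition_def bdd_above_def by auto
 obtain K2 where K2: "\<And>x. 0 \<le> x ==> (SUP \<alpha>\<in>{\<alpha>. (x, \<alpha>) \<in> ruin_pairs}. - \<upsilon> x \<alpha>) / h0 x \<le> K2"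
  using pen_growth unfolding growth_condition_def bdd_above_def by auto
 \<comment> \<open>Each coordinate of \<open>x\<close> is at most \<open>p $ i\<close> times the sum
   in the exponent of \<open>h0\<close>. By \<open>y \<le> exp y\<close> that sum is at most
   \<open>2 * CARD('n) / c\<close> times the weight, so linear functions satisfy the growth
   condition too.\<close>
 define K3 where "K3 = (\<Sum>i\<in>UNIV. a $ i * p $ i) * (2 * real CARD('n) / c)"
 have K3: "a \<bullet> x \<le> K3 * h0 x" if x: "0 \<le> x" for x
 proof -
  define s where "s = (\<Sum>i\<in>UNIV. x $ i / p $ i)"
  have xs: "x $ i / p $ i \<le> s" for i
   unfolding s_def using x p_pos by (intro member_le_sum) (auto simp: less_eq_vec_def less_imp_le)
  then have "x $ i \<le> p $ i * s" for i
   using p_pos[of i] by (simp add: divide_le_eq mult.commute)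
  then have "a \<bullet> x \<le> (\<Sum>i\<in>UNIV. a $ i * (p $ i * s))"
   unfolding inner_vec_def using a_pos by (auto intro!: sum_mono mult_left_mono simp: less_imp_le)
  also have "\<dots> = (\<Sum>i\<in>UNIV. a $ i * p $ i) * s" by (simp add: sum_distrib_right mult.assoc)
  also have "\<dots> \<le> (\<Sum>i\<in>UNIV. a $ i * p $ i) * ((2 * real CARD('n) / c) * h0 x)"
  proof (rule mult_left_mono)
   have "c / (2 * real CARD('n)) * s \<le> h0 x"
    unfolding growth_weight_def s_def[symmetric] using exp_ge_add_one_self[of "c / (2 * real CARD('n)) * s"] by linarith
   then show "s \<le> (2 * real CARD('n) / c) * h0 x" using c_pos by (simp add: field_simps)
   show "0 \<le> (\<Sum>i\<in>UNIV. a $ i * p $ i)" using a_pos p_pos by (auto intro!: sum_nonneg simp: less_imp_le)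
  qed
  finally show ?thesis by (simp add: K3_def mult.assoc)
 qed
 define K where "K = Max {K1, K2, K3, 0}"
 have K: "K1 \<le> K" "K2 \<le> K" "K3 \<le> K" "0 \<le> K" by (auto simp: K_def)
 have up: "z \<le> K * h0 x" if "z / h0 x \<le> k" "k \<le> K" for z x k
 proof -
  have "z \<le> k * h0 x" using that(1) h0_pos[of x] by (simp add: divide_le_eq)
  also have "\<dots> \<le> K * h0 x" using that(2) h0_pos[of x] by (simp add: mult_right_mono)
  finally show ?thesis .
 qed
 show ?thesis
 proof (intro exI[of _ K] conjI allI impI K)
  fix x :: "real^'n" assume x: "0 \<le> x"
  show "f x \<le> K * h0 x" by (rule up[OF K1[OF x] K(1)])
  show "a \<bullet> x \<le> K * h0 x" using K3[OF x] h0_pos[of x] by (intro up[OF _ K(3)]) (simp add: divide_le_eq)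
  fix \<alpha> assume \<alpha>: "(x, \<alpha>) \<in> ruin_pairs"
  have "- \<upsilon> x \<alpha> \<le> (SUP \<alpha>\<in>{\<alpha>. (x, \<alpha>) \<in> ruin_pairs}. - \<upsilon> x \<alpha>)"
   using \<alpha> by (intro cSUP_upper pen_bdd[OF x]) auto
  also have "\<dots> \<le> K * h0 x" by (rule up[OF K2[OF x] K(2)])
  finally show "- \<upsilon> x \<alpha> \<le> K * h0 x" .
 qed
qed

definition K where
 "K = (SOME K. 0 \<le> K \<and> (\<forall>x\<ge>0. f x \<le> K * h0 x \<and> a \<bullet> x \<le> K * h0 x \<and> (\<forall>\<alpha>. (x, \<alpha>) \<in> ruin_pairs \<longrightarrow> - \<upsilon> x \<alpha> \<le> K * h0 x)))"

lemma K: "0 \<le> K" "0 \<le> x ==> f x \<le> K * h0 x" "0 \<le> x ==> a \<bullet> x \<le> K * h0 x" "(x, \<alpha>) \<in> ruin_pairs ==> - \<upsilon> x \<alpha> \<le> K * h0 x"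
proof -
 have "\<exists>K. 0 \<le> K \<and> (\<forall>x\<ge>0. f x \<le> K * h0 x \<and> a \<bullet> x \<le> K * h0 x \<and> (\<forall>\<alpha>. (x, \<alpha>) \<in> ruin_pairs \<longrightarrow> - \<upsilon> x \<alpha> \<le> K * h0 x))"
  using growth_bound by blast
 from someI_ex[OF this] 
 have *: "0 \<le> K \<and> (\<forall>x\<ge>0. f x \<le> K * h0 x \<and> a \<bullet> x \<le> K * h0 x \<and> (\<forall>\<alpha>. (x, \<alpha>) \<in> ruin_pairs \<longrightarrow> - \<upsilon> x \<alpha> \<le> K * h0 x))"
  unfolding K_def[symmetric] .
 then show "0 \<le> K" "0 \<le> x ==> f x \<le> K * h0 x" "0 \<le> x ==> a \<bullet> x \<le> K * h0 x" by auto
 assume "(x, \<alpha>) \<in> ruin_pairs"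
 moreover from this have "0 \<le> x" by (simp add: ruin_pairs_iff)
 ultimately show "- \<upsilon> x \<alpha> \<le> K * h0 x" using * by blast
qed

text \<open>Extension by zero, here off the orthant and next off \<open>ruin_pairs\<close>, turns
  both data into Borel functions on the whole space without changing any payoff.\<close>

definition f0 where "f0 x = (if 0 \<le> x then f x else 0)"
definition pen0 where "pen0 x u = (if (x, u) \<in> ruin_pairs then \<upsilon> x u else 0)"

lemma f0_measurable [measurable]: "f0 \<in> borel_measurable borel"
 unfolding f0_def[abs_def] by (rule borel_measurable_upper_continuous[OF f_upper_continuous])

lemma pen0_measurable_pair: "(\<lambda>x. pen0 (fst x) (snd x)) \<in> borel_measurable borel"
proof -
 have "(\<lambda>x. indicator ruin_pairs x *\<^sub>R (case x of (x, \<alpha>) \<Rightarrow> \<upsilon> x \<alpha>)) \<in> borel_measurable borel"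
  using pen_measurable by (subst (asm) borel_measurable_restrict_space_iff) (auto simp: ruin_pairs_sets)
 moreover have "(\<lambda>x. indicator ruin_pairs x *\<^sub>R (case x of (x, \<alpha>) \<Rightarrow> \<upsilon> x \<alpha>)) = (\<lambda>x. pen0 (fst x) (snd x))"
  by (auto simp: pen0_def indicator_def split: prod.splits)
 ultimately show ?thesis by simp
qed

lemma pen0_measurable:
 assumes "g \<in> borel_measurable N" "h \<in> borel_measurable N"
 shows "(\<lambda>x. pen0 (g x) (h x)) \<in> borel_measurable N"
 using measurable_compose[OF borel_measurable_Pair[OF assms] pen0_measurable_pair] by simp

lemma pen0_lower: "0 \<le> x ==> - pen0 x u \<le> K * h0 x"
 using K(4)[of x u] K(1) h0_pos[of x] by (auto simp: pen0_def)

text \<open>By monotonicity in the surplus the penalty at \<open>x\<close> is at most that at 0,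
  where it is integrable in \<open>u\<close>. The absolute value covers those \<open>u\<close> that
  do not ruin at \<open>x\<close>, where \<open>pen0\<close> is 0.\<close>

lemma pen0_upper: "0 \<le> x ==> pen0 x u \<le> \<bar>pen0 0 u\<bar>"
proof (cases "(x, u) \<in> ruin_pairs")
 case True
 assume "0 \<le> x"
 then have "(0, u) \<in> ruin_pairs" using True by (auto simp: ruin_pairs_iff intro: order_trans)
 then have "\<upsilon> x u \<le> \<upsilon> 0 u" using pen_antimono[of 0 u x] True \<open>0 \<le> x\<close> by simp
 then show ?thesis using True \<open>(0, u) \<in> ruin_pairs\<close> by (simp add: pen0_def)
qed (simp add: pen0_def)

lemma pen0_abs: "0 \<le> x ==> \<bar>pen0 x u\<bar> \<le> K * h0 x + \<bar>pen0 0 u\<bar>"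
proof -
 assume x: "0 \<le> x"
 have "0 \<le> K * h0 x" using K(1) h0_pos[of x] by simp
 then show ?thesis using pen0_lower[OF x, of u] pen0_upper[OF x, of u] by linarith
qed

lemma pen0_integrable_0: "integrable F (pen0 0)"
proof -
 have "pen0 0 = (\<lambda>u. indicator {u. (0, u) \<in> ruin_pairs} u *\<^sub>R \<upsilon> 0 u)"
  by (auto simp: pen0_def indicator_def)
 then show ?thesis using pen_integrable by (simp add: set_integrable_def)
qed

lemma pen0_integrable: assumes "0 \<le> x" shows "integrable F (pen0 x)"
proof (rule Bochner_Integration.integrable_bound)
 show "integrable F (\<lambda>u. K * h0 x + \<bar>pen0 0 u\<bar>)" using pen0_integrable_0 by auto
 show "pen0 x \<in> borel_measurable F" unfolding measurable_F by (rule pen0_measurable) auto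
 show "AE u in F. norm (pen0 x u) \<le> norm (K * h0 x + \<bar>pen0 0 u\<bar>)"
 proof (rule AE_I2)
  fix u show "norm (pen0 x u) \<le> norm (K * h0 x + \<bar>pen0 0 u\<bar>)"
   using pen0_abs[OF assms, of u] by simp
 qed
qed

definition pen_mean where "pen_mean x = (LINT u|F. pen0 x u)"

lemma pen_mean_continuous: "continuous_on {0..} pen_mean"
proof -
 have "pen_mean = (\<lambda>x. lam * (LINT \<alpha> : {\<alpha>. (x, \<alpha>) \<in> ruin_pairs} | F. \<upsilon> x \<alpha>) / lam)"
 proof
  fix x
  have "pen0 x = (\<lambda>u. indicator {\<alpha>. (x, \<alpha>) \<in> ruin_pairs} u *\<^sub>R \<upsilon> x u)"
   by (auto simp: pen0_def indicator_def)
  then show "pen_mean x = lam * (LINT \<alpha> : {\<alpha>. (x, \<alpha>) \<in> ruin_pairs} | F. \<upsilon> x \<alpha>) / lam"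
   using lam_pos by (simp add: pen_mean_def set_lebesgue_integral_def)
 qed
 then show ?thesis using lam_pos by (simp only:) (intro continuous_intros pen_continuous, auto)
qed

end

subsection \<open>Strategy values\<close>

lemma stop_add:
 assumes "0 \<le> r" "0 \<le> q" shows "stop (ennreal r + T) (r + q) = r + stop T q"
proof (cases T)
 case (real t)
 have "stop (ennreal r + T) (r + q) = stop (ennreal (r + t)) (r + q)" using real assms by simp
 also have "\<dots> = min (r + q) (r + t)" by (rule stop_simps(2)) (use assms real in auto)
 also have "\<dots> = r + stop T q" using stop_simps(2)[OF assms(2) real(1)] real by (auto simp: min_def)
 finally show ?thesis .
next
 case top
 have "stop \<infinity> (r + q) = r + q" by (rule stop_simps(1)) (use assms in auto)
 then show ?thesis using stop_simps(1)[OF assms(2)] top by simp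
qed

lemma stop_before: "0 \<le> q ==> ennreal q \<le> T ==> stop T q = q"
 by (simp add: stop_def min_def)

text \<open>From ruin on the dividends stay at their left limit, so cutting the horizon at ruin does
  not change the amount paid. The ruin time thereby disappears from the dividend part of the
  payoff.\<close>

lemma stop_ruin:
 assumes "good_path p x w l" "w \<in> claim_paths"
 shows "l (stop (min T (path_ruin p x l w)) q) = l (stop T q)"
proof -
 let ?R = "path_ruin p x l w"
 note G = good_pathD[OF assms(1)]
 show ?thesis
 proof (cases "T \<le> ?R \<or> ennreal q \<le> ?R")
  case True
  then have "min (ennreal q) (min T ?R) = min (ennreal q) T"
   by (auto simp: min_def)
  then show ?thesis by (simp add: stop_def)
 next
  case False
  then have f: "?R < T" "?R < ennreal q" by auto
  then have m: "min (ennreal q) (min T ?R) = ?R" by (auto simp: min_def)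
  have s: "ennreal (stop T q) = min (ennreal q) T" by (rule ennreal_stop)
  have R: "ennreal (enn2real ?R) = ?R" by (rule ennreal_enn2real[OF order_less_le_trans[OF f(1) top_greatest]])
  have "l (stop (min T ?R) q) = left_limit l (enn2real ?R)"
   unfolding stop_def m by (rule G(7)) (simp_all add: R)
  moreover have "l (stop T q) = left_limit l (enn2real ?R)"
   by (rule G(7)) (use f s in auto)
  ultimately show ?thesis by simp
 qed
qed

lemma surplus_before: "w \<in> claim_paths ==> t < fst (w 0) ==> surplus p x w t = x + t *\<^sub>R p"
 using claim_count_iff[of w 0 t] by (simp add: surplus_def)

lemma claim_count_Least: "w \<in> claim_paths ==> claim_count w t = (LEAST j. t < fst (w j))"
proof -
 assume w: "w \<in> claim_paths"
 have "(LEAST j. t < fst (w j)) = claim_count w t"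
 proof (rule Least_equality)
  show "t < fst (w (claim_count w t))" using claim_count_iff[OF w, of "claim_count w t" t] by simp
  fix j assume "t < fst (w j)" then show "claim_count w t \<le> j" using claim_count_iff[OF w, of j t] by simp
 qed
 then show ?thesis by simp
qed

lemma surplus_measurable:
 assumes g: "g \<in> borel_measurable path_space"
 shows "(\<lambda>w::'n::finite claims. surplus p x w (g w)) \<in> borel_measurable path_space"
proof -
 have "(\<lambda>w::'n claims. LEAST j. g w < fst (w j)) \<in> measurable path_space (count_space UNIV)"
  by (rule measurable_Least) (unfold pred_def, rule borel_measurable_less[OF g measurable_claim(1)])
 moreover have "(\<lambda>w::'n claims. x + g w *\<^sub>R p - (\<Sum>k<n. snd (w k))) \<in> borel_measurable path_space" for n :: nat
  by (intro borel_measurable_diff borel_measurable_add borel_measurable_const borel_measurable_scaleR g borel_measurable_sum measurable_claim)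
 ultimately have "(\<lambda>w::'n claims. x + g w *\<^sub>R p - (\<Sum>k<(LEAST j. g w < fst (w j)). snd (w k))) \<in> borel_measurable path_space"
  by (rule measurable_compose_countable[rotated])
 then show ?thesis
  by (subst measurable_cong[where g="\<lambda>w. x + g w *\<^sub>R p - (\<Sum>k<(LEAST j. g w < fst (w j)). snd (w k))"])
   (simp_all add: surplus_def claim_count_Least)
qed

context dividend_model
begin

text \<open>The killed form of the discounted dividends; \<open>discounted_dividends_eq\<close>
  identifies it with the Stieltjes integral.\<close>

definition div_value :: "(real \<Rightarrow> real^'n) \<Rightarrow> ennreal \<Rightarrow> real" where
 "div_value l T = (LINT q|elaw c. a \<bullet> l (stop T q))"

definition ruin_index where "ruin_index x l w = (LEAST k. ruin_at p x l w k)"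

definition gain where
 "gain x l T w = div_value l T + (if T < path_ruin p x l w
  then exp (- c * enn2real T) * f0 (surplus p x w (enn2real T) - l (enn2real T)) else 0)"

definition loss where
 "loss x l T w = (if path_ruin p x l w \<le> T \<and> path_ruin p x l w < \<infinity>
  then exp (- c * enn2real (path_ruin p x l w)) *
   pen0 (pre_claim p x l w (ruin_index x l w)) (snd (w (ruin_index x l w))) else 0)"

definition payoff where "payoff x l T w = gain x l T w - loss x l T w"

lemma measurable_good_path: "good_path p x w l ==> (\<lambda>q. a \<bullet> l (g q)) \<in> borel_measurable N" if "g \<in> borel_measurable N"
proof -
 assume "good_path p x w l"
 then have "mono (\<lambda>t. a \<bullet> l t)" by (intro monoI a_inner_mono monoD[OF good_pathD(4)])
 then have "(\<lambda>t. a \<bullet> l t) \<in> borel_measurable borel" by (rule borel_measurable_mono)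
 from measurable_compose[OF that this] show ?thesis .
qed

lemma stop_measurable: "stop T \<in> borel_measurable borel"
 unfolding stop_def[abs_def] by measurable

lemma discounted_dividends_eq:
 assumes g: "good_path p x w l"
 shows "discounted_dividends a c l T = div_value l T"
proof -
 note G = good_pathD[OF g]
 have "discounted_dividends a c l T = (LINT q:{0..}|lborel. c * exp (- c * q) * (a \<bullet> l (stop T q)))"
  unfolding discounted_dividends_def
 proof (rule interval_measure_by_parts[OF _ _ _ c_pos])
  show "mono (\<lambda>s. a \<bullet> l s)" by (intro monoI a_inner_mono monoD[OF G(4)])
  show "continuous (at_right x) (\<lambda>s. a \<bullet> l s)" for x
   using G(3) unfolding cadlag_def continuous_within by (auto intro!: tendsto_intros)
  show "t < 0 ==> a \<bullet> l t = 0" for t using G(1) by simp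
 qed
 also have "\<dots> = (LINT q|lborel. exponential_density c q *\<^sub>R (a \<bullet> l (stop T q)))"
  unfolding set_lebesgue_integral_def
  by (intro Bochner_Integration.integral_cong) (auto simp: exponential_density_def indicator_def mult.commute)
 also have "\<dots> = div_value l T"
  unfolding div_value_def
  by (rule integral_density[symmetric])
   (auto intro!: measurable_good_path[OF _ g] stop_measurable simp: exponential_density_nonneg c_pos)
 finally show ?thesis .
qed

lemma dividend_bound:
 assumes w: "w \<in> claim_paths" and g: "good_path p x w l" and x: "0 \<le> x" and q: "0 \<le> q" and s: "0 \<le> s" "s \<le> q"
 shows "0 \<le> a \<bullet> l s" "a \<bullet> l s \<le> K * h0 x * exp (c / 2 * q)"
proof -
 show "0 \<le> a \<bullet> l s" by (rule a_inner_nonneg[OF good_pathD(5)[OF g]])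
 have l: "l s \<le> x + s *\<^sub>R p" by (rule good_path_le[OF w g p_nonneg s(1)])
 have "l s \<le> x + q *\<^sub>R p" using l vec_scale_mono[OF s(2) p_nonneg] by (meson add_left_mono order_trans)
 then have "a \<bullet> l s \<le> a \<bullet> (x + q *\<^sub>R p)" by (rule a_inner_mono)
 also have "\<dots> \<le> K * h0 (x + q *\<^sub>R p)"
  using x q p_nonneg vec_scale_mono[of 0 q p] by (intro K(3)) (simp add: add_nonneg_nonneg)
 finally show "a \<bullet> l s \<le> K * h0 x * exp (c / 2 * q)" by (simp add: h0_shift mult.assoc)
qed

lemma dividend_integrable:
 assumes w: "w \<in> claim_paths" and g: "good_path p x w l" and x: "0 \<le> x"
 shows "integrable (elaw c) (\<lambda>q. a \<bullet> l (stop T q))"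
proof (rule Bochner_Integration.integrable_bound)
 show "integrable (elaw c) (\<lambda>q. K * h0 x * exp (c / 2 * q))"
  using elaw_exp(1)[of c "c/2"] c_pos by simp
 show "(\<lambda>q. a \<bullet> l (stop T q)) \<in> borel_measurable (elaw c)"
  unfolding measurable_elaw by (intro measurable_good_path[OF _ g] stop_measurable)
 show "AE q in elaw c. norm (a \<bullet> l (stop T q)) \<le> norm (K * h0 x * exp (c / 2 * q))"
  using AE_elaw_pos
 proof eventually_elim
  case (elim q)
  then show ?case using dividend_bound[OF w g x, of q "stop T q"] stop_le[of q T] by simp
 qed
qed

text \<open>The dividends up to time \<open>q\<close> are at most
  \<open>K * h0 x * exp (c / 2 * q)\<close>, and the factor 2 is the mean of
  \<open>exp (c / 2 * q)\<close> under the exponential law of rate \<open>c\<close>.\<close>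

lemma div_value_bounds:
 assumes w: "w \<in> claim_paths" and g: "good_path p x w l" and x: "0 \<le> x"
 shows "0 \<le> div_value l T" "div_value l T \<le> 2 * K * h0 x"
proof -
 show "0 \<le> div_value l T" unfolding div_value_def
  by (intro integral_nonneg_AE AE_I2 a_inner_nonneg good_pathD(5)[OF g])
 have "div_value l T \<le> (LINT q|elaw c. K * h0 x * exp (c / 2 * q))"
  unfolding div_value_def
 proof (rule integral_mono_AE[OF dividend_integrable[OF assms]])
  show "integrable (elaw c) (\<lambda>q. K * h0 x * exp (c / 2 * q))"
   using elaw_exp(1)[of c "c/2"] c_pos by simp
  show "AE q in elaw c. a \<bullet> l (stop T q) \<le> K * h0 x * exp (c / 2 * q)"
   using AE_elaw_pos
  proof eventually_elim
   case (elim q)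
   then show ?case using dividend_bound[OF w g x, of q "stop T q"] stop_le[of q T] by simp
  qed
 qed
 also have "\<dots> = 2 * K * h0 x" using elaw_exp(2)[of c "c/2"] c_pos by simp
 finally show "div_value l T \<le> 2 * K * h0 x" .
qed

text \<open>Uncontrolled growth multiplies the weight by \<open>exp (c / 2 * t)\<close>, and
  discounting at rate \<open>c\<close> more than compensates for it.\<close>

lemma discounted_growth:
 assumes "0 \<le> y" "y \<le> x + t *\<^sub>R p" "0 \<le> t"
 shows "exp (- c * t) * (K * h0 y) \<le> K * h0 x"
proof -
 have "exp (- c * t) * (K * h0 y) \<le> exp (- c * t) * (K * h0 (x + t *\<^sub>R p))"
  using h0_mono[OF assms(2)] K(1) by (intro mult_left_mono) auto
 also have "\<dots> = K * h0 x * (exp (- c * t) * exp (c / 2 * t))" by (simp add: h0_shift)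
 also have "exp (- c * t) * exp (c / 2 * t) = exp (- (c / 2 * t))" by (simp add: mult_exp_exp)
 also have "K * h0 x * exp (- (c / 2 * t)) \<le> K * h0 x * 1"
  using K(1) h0_pos[of x] c_pos assms(3) by (intro mult_left_mono) (auto simp: less_imp_le)
 finally show ?thesis by simp
qed

lemma gain_le:
 assumes w: "w \<in> claim_paths" and g: "good_path p x w l" and x: "0 \<le> x"
 shows "gain x l T w \<le> 3 * K * h0 x"
proof -
 note G = good_pathD[OF g]
 have Kh: "0 \<le> K * h0 x" using K(1) h0_pos[of x] by simp
 have "exp (- c * enn2real T) * f0 (surplus p x w (enn2real T) - l (enn2real T)) \<le> K * h0 x" if T: "T < path_ruin p x l w"
 proof -
  define t where "t = enn2real T"
  have t: "T = ennreal t" "0 \<le> t"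
   using ennreal_enn2real[OF order_less_le_trans[OF T top_greatest]] by (simp_all add: t_def)
  define y where "y = surplus p x w t - l t"
  have y0: "0 \<le> y" using G(6)[OF t(2)] T t by (simp add: y_def)
  have "y \<le> surplus p x w t" using G(5)[of t] by (simp add: y_def)
  also have "\<dots> \<le> x + t *\<^sub>R p" by (rule surplus_le[OF w])
  finally have y: "y \<le> x + t *\<^sub>R p" .
  have "exp (- c * t) * f0 y \<le> exp (- c * t) * (K * h0 y)"
   using K(2)[OF y0] y0 by (simp add: f0_def)
  also have "\<dots> \<le> K * h0 x" by (rule discounted_growth[OF y0 y t(2)])
  finally show ?thesis by (simp add: t_def y_def)
 qed
 then show ?thesis
  using div_value_bounds[OF assms, of T] Kh by (auto simp: gain_def)
qed

lemma loss_ge: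
 assumes w: "w \<in> claim_paths" and g: "good_path p x w l" and x: "0 \<le> x"
 shows "- loss x l T w \<le> K * h0 x"
proof -
 have Kh: "0 \<le> K * h0 x" using K(1) h0_pos[of x] by simp
 have "- (exp (- c * enn2real (path_ruin p x l w)) * pen0 (pre_claim p x l w (ruin_index x l w)) (snd (w (ruin_index x l w)))) \<le> K * h0 x"
  if R: "path_ruin p x l w < \<infinity>"
 proof (rule path_ruin_cases[OF w, of p x l])
  fix k assume k: "path_ruin p x l w = ennreal (fst (w k))" "(LEAST k. ruin_at p x l w k) = k"
  have t: "0 < fst (w k)" by (rule claim_pathsD(1)[OF w])
  note b = pre_claim_bounds[OF w g p_nonneg, of k, simplified k(1), OF order_refl]
  have "exp (- c * fst (w k)) * (- pen0 (pre_claim p x l w k) (snd (w k))) \<le> exp (- c * fst (w k)) * (K * h0 (pre_claim p x l w k))"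
   using pen0_lower[OF b(1)] by (intro mult_left_mono) auto
  also have "\<dots> \<le> K * h0 x" using t by (intro discounted_growth b) auto
  finally show ?thesis using t by (simp add: ruin_index_def k)
 next
  assume "path_ruin p x l w = \<infinity>" then show ?thesis using R by simp
 qed
 then show ?thesis using Kh by (auto simp: loss_def)
qed

text \<open>Of the four units, two bound the dividends, one the switch value and one the
  penalty.\<close>

lemma payoff_le:
 assumes "w \<in> claim_paths" "good_path p x w l" "0 \<le> x"
 shows "payoff x l T w \<le> 4 * K * h0 x"
 using gain_le[OF assms, of T] loss_ge[OF assms, of T] by (simp add: payoff_def)

text \<open>At ruin the dividends keep their left limit, so the jump of the controlled surplus is
  exactly the claim. The pair of surplus before ruin and claim lies in \<open>ruin_pairs\<close>,
  where \<open>pen0\<close> is the penalty itself.\<close>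

lemma loss_eq:
 assumes w: "w \<in> claim_paths" and g: "good_path p x w l" and R: "path_ruin p x l w < \<infinity>"
  and Y: "Y = (\<lambda>t. surplus p x w t - l t)"
 shows "(let r = enn2real (path_ruin p x l w) in exp (- c * r) * \<upsilon> (left_limit Y r) (left_limit Y r - Y r)) =
  exp (- c * enn2real (path_ruin p x l w)) * pen0 (pre_claim p x l w (ruin_index x l w)) (snd (w (ruin_index x l w)))"
proof (rule path_ruin_cases[OF w, of p x l])
 fix k assume k: "ruin_at p x l w k" "path_ruin p x l w = ennreal (fst (w k))" "(LEAST k. ruin_at p x l w k) = k"
 have t: "0 < fst (w k)" by (rule claim_pathsD(1)[OF w])
 have YL: "left_limit Y (fst (w k)) = pre_claim p x l w k"
  unfolding Y by (rule left_limitI[OF pre_claim_tendsto[OF w good_pathD(3)[OF g]]])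
 have "l (fst (w k)) = left_limit l (fst (w k))"
  using good_pathD(7)[OF g, of "fst (w k)"] t k(2) by simp
 then have "left_limit Y (fst (w k)) - Y (fst (w k)) = snd (w k)"
  unfolding YL by (simp add: Y pre_claim_def)
 moreover have "(pre_claim p x l w k, snd (w k)) \<in> ruin_pairs"
  using k(1) pre_claim_bounds(1)[OF w g p_nonneg, of k] claim_pathsD(4)[OF w, of k] by (simp add: ruin_pairs_iff ruin_at_def k(2))
 ultimately show ?thesis using t YL by (simp add: k ruin_index_def pen0_def Let_def)
next
 assume "path_ruin p x l w = \<infinity>" then show ?thesis using R by simp
qed

lemma gain_eq:
 assumes w: "w \<in> claim_paths" and g: "good_path p x w l"
 shows "discounted_dividends a c l (min T (path_ruin p x l w)) +
  (if T < path_ruin p x l w then exp (- c * enn2real T) * f (surplus p x w (enn2real T) - l (enn2real T)) else 0) = gain x l T w"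
proof -
 have "f (surplus p x w (enn2real T) - l (enn2real T)) = f0 (surplus p x w (enn2real T) - l (enn2real T))" if T: "T < path_ruin p x l w"
 proof -
  have "ennreal (enn2real T) = T" using order_less_le_trans[OF T top_greatest] by (rule ennreal_enn2real)
  then have "l (enn2real T) \<le> surplus p x w (enn2real T)"
   using good_pathD(6)[OF g, of "enn2real T"] T by (simp only: enn2real_nonneg simp_thms)
  then show ?thesis by (simp add: f0_def)
 qed
 note f = this
 have "div_value l (min T (path_ruin p x l w)) = div_value l T"
  unfolding div_value_def by (rule Bochner_Integration.integral_cong[OF refl]) (rule arg_cong[OF stop_ruin[OF g w]])
 then have "discounted_dividends a c l (min T (path_ruin p x l w)) = div_value l T"
  using discounted_dividends_eq[OF g] by simp
 then show ?thesis using f by (cases "T < path_ruin p x l w") (simp_all only: gain_def if_True if_False)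
qed

lemma admissible_good_path: "(L, T) \<in> admissible p x ==> w \<in> claim_paths ==> good_path p x w (\<lambda>t. L t w)"
 unfolding admissible_iff by blast

lemma process_measurable:
 assumes A: "(L, T) \<in> admissible p x" and g: "g \<in> borel_measurable N" and h: "h \<in> measurable N path_space"
 shows "(\<lambda>y. L (g y) (h y)) \<in> borel_measurable N"
proof (rule measurable_right_continuous_process[OF _ _ g h])
 note A' = A[unfolded admissible_iff]
 show "L t \<in> borel_measurable path_space" for t
 proof (cases "0 \<le> t")
  case False
  then have "L t w = 0" if "w \<in> space path_space" for w
   using good_pathD(1)[OF admissible_good_path[OF A], of w t] that by simp
  then show ?thesis by (subst measurable_cong[where g="\<lambda>_. 0"]) auto
 qed (use A' in blast)
 show "((\<lambda>s. L s w) \<longlongrightarrow> L t w) (at_right t)" if "w \<in> space path_space" for w t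
  using good_pathD(3)[OF admissible_good_path[OF A], of w] that by (simp add: cadlag_def)
qed

lemma pre_claim_measurable:
 assumes A: "(L, T) \<in> admissible p x"
 shows "(\<lambda>w. pre_claim p x (\<lambda>t. L t w) w k) \<in> borel_measurable path_space"
proof -
 have "(\<lambda>w. left_limit (\<lambda>t. L t w) (fst (w k))) \<in> borel_measurable path_space"
 proof (rule borel_measurable_LIMSEQ_metric)
  fix n
  show "(\<lambda>w. L (fst (w k) - 1 / real (Suc n)) w) \<in> borel_measurable path_space"
   by (rule process_measurable[OF A]) (auto intro!: borel_measurable_diff measurable_claim)
 next
  fix w :: "'n claims" assume "w \<in> space path_space"
  then have "cadlag (\<lambda>t. L t w)" using good_pathD(3)[OF admissible_good_path[OF A], of w] by simp
  moreover have "filterlim (\<lambda>n. fst (w k) - 1 / real (Suc n)) (at_left (fst (w k))) sequentially"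
   unfolding filterlim_at
  proof
   show "\<forall>\<^sub>F n in sequentially. fst (w k) - 1 / real (Suc n) \<in> {..<fst (w k)} \<and> fst (w k) - 1 / real (Suc n) \<noteq> fst (w k)"
    by simp
   have "(\<lambda>n. fst (w k) - 1 / real (Suc n)) \<longlonglongrightarrow> fst (w k) - 0"
    by (intro tendsto_diff tendsto_const LIMSEQ_Suc lim_1_over_n)
   then show "(\<lambda>n. fst (w k) - 1 / real (Suc n)) \<longlonglongrightarrow> fst (w k)" by simp
  qed
  ultimately show "(\<lambda>n. L (fst (w k) - 1 / real (Suc n)) w) \<longlonglongrightarrow> left_limit (\<lambda>t. L t w) (fst (w k))"
   by (rule filterlim_compose[OF left_limit_tendsto])
 qed
 then show ?thesis
  unfolding pre_claim_def by (intro borel_measurable_diff borel_measurable_add surplus_measurable measurable_claim)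
qed

lemma ruin_at_measurable:
 assumes A: "(L, T) \<in> admissible p x"
 shows "Measurable.pred path_space (\<lambda>w. ruin_at p x (\<lambda>t. L t w) w k)"
 unfolding ruin_at_def by (intro pred_intros_logic pred_le_vec pre_claim_measurable[OF A] measurable_claim)

lemma path_ruin_measurable:
 assumes A: "(L, T) \<in> admissible p x"
 shows "(\<lambda>w. path_ruin p x (\<lambda>t. L t w) w) \<in> borel_measurable path_space"
proof -
 have "path_ruin p x l w = (INF k. if ruin_at p x l w k then ennreal (fst (w k)) else \<infinity>)" for l and w :: "'n claims"
  unfolding path_ruin_INF
 proof (rule antisym; rule INF_greatest)
  fix k :: nat
  show "(INF k\<in>{k. ruin_at p x l w k}. ennreal (fst (w k))) \<le> (if ruin_at p x l w k then ennreal (fst (w k)) else \<infinity>)"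
   using INF_lower[of k "{k. ruin_at p x l w k}" "\<lambda>k. ennreal (fst (w k))"] by simp
  assume "k \<in> {k. ruin_at p x l w k}"
  then show "(INF k. if ruin_at p x l w k then ennreal (fst (w k)) else \<infinity>) \<le> ennreal (fst (w k))"
   by (intro INF_lower2[of k]) auto
 qed
 then show ?thesis
  by (simp only:) (intro borel_measurable_INF measurable_If ruin_at_measurable[OF A, unfolded pred_def]
    measurable_compose[OF measurable_claim(1)] measurable_const; simp)
qed

lemma admissible_T_measurable: "(L, T) \<in> admissible p x ==> T \<in> borel_measurable path_space"
 unfolding admissible_iff stopping_time_history_iff by blast

lemma gain_measurable:
 assumes A: "(L, T) \<in> admissible p x"
 shows "(\<lambda>w. gain x (\<lambda>t. L t w) (T w) w) \<in> borel_measurable path_space"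
proof -
 note T [measurable] = admissible_T_measurable[OF A]
 note R [measurable] = path_ruin_measurable[OF A]
 have "(\<lambda>x. L (stop (T (fst x)) (snd x)) (fst x)) \<in> borel_measurable (path_space \<Otimes>\<^sub>M elaw c)"
  unfolding stop_def by (rule process_measurable[OF A]) measurable
 then have 1: "(\<lambda>w. div_value (\<lambda>t. L t w) (T w)) \<in> borel_measurable path_space"
  unfolding div_value_def
  by (intro C.borel_measurable_lebesgue_integral) (auto simp: split_beta' intro!: borel_measurable_inner)
 have t: "(\<lambda>w. enn2real (T w)) \<in> borel_measurable path_space" by measurable
 have "(\<lambda>w. surplus p x w (enn2real (T w)) - L (enn2real (T w)) w) \<in> borel_measurable path_space"
  by (intro borel_measurable_diff surplus_measurable[OF t] process_measurable[OF A t]) simp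
 then have 2: "(\<lambda>w. f0 (surplus p x w (enn2real (T w)) - L (enn2real (T w)) w)) \<in> borel_measurable path_space"
  by (rule measurable_compose[OF _ f0_measurable])
 have 3: "Measurable.pred path_space (\<lambda>w. T w < path_ruin p x (\<lambda>t. L t w) w)"
  unfolding pred_def by (rule borel_measurable_less[OF T R])
 have 4: "(\<lambda>w. exp (- c * enn2real (T w))) \<in> borel_measurable path_space" using t by measurable
 show ?thesis
  unfolding gain_def
  by (rule borel_measurable_add[OF 1 measurable_If[OF borel_measurable_times[OF 4 2] _ 3[unfolded pred_def]]]) simp
qed

lemma loss_measurable:
 assumes A: "(L, T) \<in> admissible p x"
 shows "(\<lambda>w. loss x (\<lambda>t. L t w) (T w) w) \<in> borel_measurable path_space"
proof -
 note T [measurable] = admissible_T_measurable[OF A]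
 note R [measurable] = path_ruin_measurable[OF A]
 have 1: "(\<lambda>w. ruin_index x (\<lambda>t. L t w) w) \<in> measurable path_space (count_space UNIV)"
  unfolding ruin_index_def by (rule measurable_Least[OF ruin_at_measurable[OF A]])
 have "(\<lambda>w. pen0 (pre_claim p x (\<lambda>t. L t w) w k) (snd (w k))) \<in> borel_measurable path_space" for k
  by (intro pen0_measurable pre_claim_measurable[OF A] measurable_claim)
 from measurable_compose_countable[OF this 1]
 have 2: "(\<lambda>w. pen0 (pre_claim p x (\<lambda>t. L t w) w (ruin_index x (\<lambda>t. L t w) w)) (snd (w (ruin_index x (\<lambda>t. L t w) w)))) \<in> borel_measurable path_space" .
 have 3: "Measurable.pred path_space (\<lambda>w. path_ruin p x (\<lambda>t. L t w) w \<le> T w \<and> path_ruin p x (\<lambda>t. L t w) w < \<infinity>)"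
  by (rule pred_intros_logic, unfold pred_def) (rule borel_measurable_le[OF R T], rule borel_measurable_less[OF R borel_measurable_const])
 have 4: "(\<lambda>w. exp (- c * enn2real (path_ruin p x (\<lambda>t. L t w) w))) \<in> borel_measurable path_space" by measurable
 show ?thesis
  unfolding loss_def
  by (rule measurable_If[OF borel_measurable_times[OF 4 2] _ 3[unfolded pred_def]]) simp
qed

lemma payoff_measurable:
 "(L, T) \<in> admissible p x ==> (\<lambda>w. payoff x (\<lambda>t. L t w) (T w) w) \<in> borel_measurable path_space"
 unfolding payoff_def by (intro borel_measurable_diff gain_measurable loss_measurable)

abbreviation "val x \<pi> \<equiv> strategy_value p a c lam F \<upsilon> f x \<pi>"

lemma ext_expectation_cong:
 "(\<And>w. w \<in> space N ==> X w = Y w) ==> ext_expectation N X = ext_expectation N Y"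
 unfolding ext_expectation_def by (simp cong: nn_integral_cong)

text \<open>The gain is bounded above and the loss below, hence the two extended expectations may be
  merged into one, of a payoff that is bounded above.\<close>

lemma strategy_value_eq:
 assumes A: "(L, T) \<in> admissible p x" and x: "0 \<le> x"
 shows "val x (L, T) = ext_expectation M (\<lambda>w. payoff x (\<lambda>t. L t w) (T w) w)"
proof -
 note g = admissible_good_path[OF A]
 have "val x (L, T) = ext_expectation M (\<lambda>w. gain x (\<lambda>t. L t w) (T w) w) - ext_expectation M (\<lambda>w. loss x (\<lambda>t. L t w) (T w) w)"
  unfolding strategy_value_def Let_def prod.case
 proof (intro arg_cong2[where f="(-)"] ext_expectation_cong)
  fix w assume "w \<in> space M"
  then have w: "w \<in> claim_paths" by simp
  show "discounted_dividends a c (\<lambda>s. L s w) (min (T w) (ruin_time p x L w)) +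
    (if T w < ruin_time p x L w then exp (- c * enn2real (T w)) * f (controlled_surplus p x L w (enn2real (T w))) else 0) =
    gain x (\<lambda>t. L t w) (T w) w"
   unfolding gain_eq[OF w g[OF w], symmetric] controlled_surplus_def ruin_time_path ..
  show "(if ruin_time p x L w \<le> T w \<and> ruin_time p x L w < \<infinity>
     then exp (- c * enn2real (ruin_time p x L w)) *
       \<upsilon> (left_limit (controlled_surplus p x L w) (enn2real (ruin_time p x L w)))
        (left_limit (controlled_surplus p x L w) (enn2real (ruin_time p x L w)) -
        controlled_surplus p x L w (enn2real (ruin_time p x L w)))
     else 0) = loss x (\<lambda>t. L t w) (T w) w"
   unfolding loss_def ruin_time_path
   using loss_eq[OF w g[OF w], of "controlled_surplus p x L w"]
   by (auto simp: Let_def controlled_surplus_def fun_eq_iff)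
 qed
 also have "\<dots> = ext_expectation M (\<lambda>w. gain x (\<lambda>t. L t w) (T w) w - loss x (\<lambda>t. L t w) (T w) w)"
  by (rule M.ext_expectation_diff)
   (auto simp: measurable_M intro: gain_measurable[OF A] loss_measurable[OF A] gain_le[OF _ g x] loss_ge[OF _ g x])
 finally show ?thesis by (simp add: payoff_def)
qed

lemma payoff_bound: 
 "(L, T) \<in> admissible p x ==> 0 \<le> x ==> w \<in> claim_paths ==> payoff x (\<lambda>t. L t w) (T w) w \<le> 4 * K * h0 x"
 by (rule payoff_le[OF _ admissible_good_path])

text \<open>The killing time is split at \<open>r\<close>. Beyond \<open>r\<close> it starts afresh,
  and the dividends paid by then are \<open>b\<close> plus those of the tail; this is why the path
  in the first integral is frozen at \<open>b\<close> from \<open>r\<close> on. Switch, ruin and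
  penalty are merely shifted by \<open>r\<close>.\<close>

lemma payoff_tail:
 assumes S: "shift_rel d r w w'" and g: "good_path p x w l" and x: "0 \<le> x"
  and y: "y = x + r *\<^sub>R p - (\<Sum>k<d. snd (w k)) - b" "0 \<le> y" and g': "good_path p y w' l'"
  and l: "\<And>t. 0 \<le> t ==> l (r + t) = b + l' t" and n: "\<And>j. j < d ==> \<not> ruin_at p x l w j"
  and T: "T = ennreal r + T'"
 shows "payoff x l T w = (LINT q|elaw c. a \<bullet> (if q < r then l q else b)) + exp (- c * r) * payoff y l' T' w'"
proof -
 note D = shift_relD[OF S]
 have cad: "cadlag l'" by (rule good_pathD(3)[OF g'])
 let ?R = "path_ruin p x l w" and ?R' = "path_ruin p y l' w'"
 have R: "?R = ennreal r + ?R'" unfolding y by (rule path_ruin_shift[where b=b, OF S l cad n])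
 have m: "(\<lambda>q. a \<bullet> (if q < r then l q else b)) \<in> borel_measurable borel"
 proof -
  have "(\<lambda>q. if q < r then a \<bullet> l q else a \<bullet> b) \<in> borel_measurable borel"
   by (intro measurable_If measurable_good_path[OF _ g]) auto
  then show ?thesis by (simp add: if_distrib[of "\<lambda>v. a \<bullet> v"])
 qed
 let ?g = "\<lambda>q. a \<bullet> l (stop T q)"
 have i: "integrable (elaw c) ?g" by (rule dividend_integrable[OF D(1) g x])
 have i': "integrable (elaw c) (\<lambda>q. a \<bullet> (if q < r then l q else b))"
 proof (rule Bochner_Integration.integrable_bound)
  show "integrable (elaw c) (\<lambda>q. ?g q + \<bar>a \<bullet> b\<bar>)" using i by simp
  show "AE q in elaw c. norm (a \<bullet> (if q < r then l q else b)) \<le> norm (?g q + \<bar>a \<bullet> b\<bar>)"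
   using AE_elaw_pos
  proof eventually_elim
   case (elim q)
   have "0 \<le> ?g q" by (rule a_inner_nonneg[OF good_pathD(5)[OF g]])
   moreover have "stop T q = q" if "q < r"
    using that elim order_trans[OF ennreal_leI[of q r], of T] unfolding T by (intro stop_before) auto
   ultimately show ?case by auto
  qed
 qed (simp add: measurable_elaw m)
 have dv: "div_value l T = (LINT q|elaw c. a \<bullet> (if q < r then l q else b)) + exp (- c * r) * div_value l' T'"
 proof -
  have 1: "(LINT q|elaw c. indicator {..<r} q * ?g q) = (LINT q|elaw c. indicator {..<r} q * (a \<bullet> (if q < r then l q else b)))"
  proof (rule integral_cong_AE)
   show "AE q in elaw c. indicator {..<r} q * ?g q = indicator {..<r} q * (a \<bullet> (if q < r then l q else b))"
    using AE_elaw_pos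
   proof eventually_elim
    case (elim q)
    moreover have "stop T q = q" if "q < r"
     using that elim order_trans[OF ennreal_leI[of q r], of T] unfolding T by (intro stop_before) auto
    ultimately show ?case by (auto simp: indicator_def)
   qed
  qed (use borel_measurable_integrable[OF i] borel_measurable_integrable[OF i'] in auto)
  have "(LINT q|elaw c. ?g (r + q)) = (LINT q|elaw c. a \<bullet> b + a \<bullet> l' (stop T' q))"
  proof (rule integral_cong_AE)
   show "AE q in elaw c. ?g (r + q) = a \<bullet> b + a \<bullet> l' (stop T' q)"
    using AE_elaw_pos
   proof eventually_elim
    case (elim q)
    then have "stop T (r + q) = r + stop T' q" unfolding T using D(3) by (intro stop_add) auto
    then show ?case by (simp add: l inner_add_right)
   qed
  qed (use borel_measurable_integrable[OF elaw_shift(1)[OF c_pos D(3) i]]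
     borel_measurable_integrable[OF dividend_integrable[OF D(2) g' y(2), of T']] in auto)
  also have "\<dots> = a \<bullet> b + div_value l' T'"
   using C.prob_space dividend_integrable[OF D(2) g' y(2), of T'] by (simp add: div_value_def)
  finally have 2: "(LINT q|elaw c. ?g (r + q)) = a \<bullet> b + div_value l' T'" .
  have "(LINT q|elaw c. a \<bullet> (if r + q < r then l (r + q) else b)) = (LINT q|elaw c. a \<bullet> b)"
   by (rule integral_cong_AE) (use AE_elaw_pos[of c] borel_measurable_integrable[OF elaw_shift(1)[OF c_pos D(3) i']] in auto)
  then have 3: "(LINT q|elaw c. a \<bullet> (if r + q < r then l (r + q) else b)) = a \<bullet> b"
   using C.prob_space by simp
  show ?thesis
   unfolding div_value_def[of l] elaw_shift(2)[OF c_pos D(3) i] elaw_shift(2)[OF c_pos D(3) i'] 1 2 3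
   by (simp add: distrib_left)
 qed
 have ga: "(if T < ?R then exp (- c * enn2real T) * f0 (surplus p x w (enn2real T) - l (enn2real T)) else 0) =
  exp (- c * r) * (if T' < ?R' then exp (- c * enn2real T') * f0 (surplus p y w' (enn2real T') - l' (enn2real T')) else 0)"
 proof (cases "T' < ?R'")
  case True
  then have fin: "T' < \<infinity>" using order_less_le_trans[OF _ top_greatest] by simp
  then have eT: "enn2real T = r + enn2real T'" unfolding T using D(3) by (simp add: enn2real_plus)
  have "surplus p x w (r + enn2real T') - l (r + enn2real T') = surplus p y w' (enn2real T') - l' (enn2real T')"
   using surplus_shift[OF S, of "enn2real T'" p x b] l[of "enn2real T'"] by (simp add: y)
  moreover have "T < ?R" using True unfolding R T by (simp add: ennreal_add_left_cancel_less)
  moreover have "exp (- c * (r + enn2real T')) = exp (- c * r) * exp (- c * enn2real T')"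
   by (simp add: mult_exp_exp algebra_simps)
  ultimately show ?thesis using True by (simp add: eT)
 next
  case False
  then have "\<not> T < ?R" unfolding R T by (simp add: ennreal_add_left_cancel_less)
  then show ?thesis using False by simp
 qed
 have lo: "loss x l T w = exp (- c * r) * loss y l' T' w'"
 proof (rule path_ruin_cases[OF D(2), of p y l'])
  fix k assume k: "ruin_at p y l' w' k" "\<And>j. j < k ==> \<not> ruin_at p y l' w' j"
   "?R' = ennreal (fst (w' k))" "(LEAST k. ruin_at p y l' w' k) = k"
  have t: "0 < fst (w' k)" by (rule claim_pathsD(1)[OF D(2)])
  have "(LEAST k. ruin_at p x l w k) = k + d"
  proof (rule Least_equality)
   show "ruin_at p x l w (k + d)" using k(1) ruin_at_shift[where b=b, OF S l cad] by (simp add: y)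
   fix j assume j: "ruin_at p x l w j"
   then have "\<not> j < d" using n by blast
   then obtain i where i: "j = i + d" by (metis add.commute le_Suc_ex not_less)
   then have "ruin_at p y l' w' i" using j ruin_at_shift[where b=b, OF S l cad] by (simp add: y)
   then show "k + d \<le> j" using k(2)[of i] i by (meson add_le_mono1 not_less)
  qed
  moreover have "pre_claim p x l w (k + d) = pre_claim p y l' w' k"
   unfolding y by (rule pre_claim_shift[where b=b, OF S l cad])
  moreover have "?R \<le> T \<longleftrightarrow> ?R' \<le> T'" unfolding R T by (simp add: ennreal_add_left_cancel_le)
  moreover have "enn2real ?R = r + fst (w' k)" "?R < \<infinity>" unfolding R k using D(3) t
   by (simp_all add: ennreal_plus[symmetric] less_imp_le del: ennreal_plus)
  moreover have "exp (- c * (r + fst (w' k))) = exp (- c * r) * exp (- c * fst (w' k))"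
   by (simp add: mult_exp_exp algebra_simps)
  ultimately show ?thesis using k t D(5) by (auto simp: loss_def ruin_index_def)
 next
  assume "?R' = \<infinity>"
  then have "?R = \<infinity>" unfolding R by simp
  then show ?thesis using \<open>?R' = \<infinity>\<close> by (simp add: loss_def)
 qed
 show ?thesis
  unfolding payoff_def gain_def dv ga lo by (simp add: algebra_simps)
qed

end

subsection \<open>Supersolutions\<close>

lemma continuous_within_seqD:
 fixes g :: "'a::{first_countable_topology, t2_space} \<Rightarrow> 'b::topological_space"
 assumes "continuous (at x within S) g" "\<And>n. z n \<in> S" "z \<longlonglongrightarrow> x"
 shows "(\<lambda>n. g (z n)) \<longlonglongrightarrow> g x"
 using assms(1)[unfolded continuous_within_sequentially comp_def, THEN spec[of _ z]] assms(2,3) by simp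

context dividend_model
begin

definition beta where "beta = lam + c"

lemma beta_pos: "0 < beta" "c < beta" "lam < beta" using lam_pos c_pos by (auto simp: beta_def)

sublocale B: prob_space "elaw beta" by (rule prob_space_exponential_density[OF beta_pos(1)])

text \<open>The class of all candidate value functions. Continuity is asked for along points above
  \<open>y\<close> only, because functions lifted from a grid may jump when a cell boundary is
  reached from below.\<close>

definition tame :: "(real^'n \<Rightarrow> real) \<Rightarrow> bool" where
 "tame vf \<longleftrightarrow> vf \<in> borel_measurable borel \<and> (\<exists>C. \<forall>y\<ge>0. \<bar>vf y\<bar> \<le> C * h0 y) \<and> (\<forall>y\<ge>0. continuous (at y within {y..}) vf)"

definition psi :: "(real^'n \<Rightarrow> real) \<Rightarrow> real^'n \<Rightarrow> real^'n \<Rightarrow> real" where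
 "psi vf y u = (if u \<le> y then vf (y - u) else - pen0 y u)"

definition Q :: "(real^'n \<Rightarrow> real) \<Rightarrow> real^'n \<Rightarrow> real" where
 "Q vf y = (LINT u|F. psi vf y u)"

lemma tameD:
 assumes "tame vf"
 obtains C where "0 \<le> C" "\<And>y. 0 \<le> y ==> \<bar>vf y\<bar> \<le> C * h0 y"
proof -
 obtain C where C: "\<And>y. 0 \<le> y ==> \<bar>vf y\<bar> \<le> C * h0 y" using assms by (auto simp: tame_def)
 have "0 \<le> C * h0 0" using C[of 0] by simp
 then have "0 \<le> C" using h0_pos[of 0] by (simp add: zero_le_mult_iff)
 then show ?thesis using that C by blast
qed

lemma tame_measurable: "tame vf ==> vf \<in> borel_measurable borel"
 by (simp add: tame_def)

lemma tame_growth: "tame vf ==> \<exists>C\<ge>0. \<forall>y\<ge>0. \<bar>vf y\<bar> \<le> C * h0 y"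
 using tameD by metis

lemma psi_measurable_pair:
 assumes w: "tame vf" and [measurable]: "g \<in> borel_measurable N" "h \<in> borel_measurable N"
 shows "(\<lambda>x. if h x \<le> g x then vf (g x - h x) else 0) \<in> borel_measurable N" "(\<lambda>x. psi vf (g x) (h x)) \<in> borel_measurable N"
proof -
 have 1: "(\<lambda>x. vf (g x - h x)) \<in> borel_measurable N"
  by (rule measurable_compose[OF _ tame_measurable[OF w]]) measurable
 have 2: "{x \<in> space N. h x \<le> g x} \<in> sets N" using pred_le_vec[OF assms(3,2)] by (simp only: pred_def)
 show "(\<lambda>x. if h x \<le> g x then vf (g x - h x) else 0) \<in> borel_measurable N"
  by (rule measurable_If[OF 1 measurable_const 2]) simp
 show "(\<lambda>x. psi vf (g x) (h x)) \<in> borel_measurable N"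
  unfolding psi_def by (rule measurable_If[OF 1 borel_measurable_uminus[OF pen0_measurable[OF assms(2,3)]] 2])
qed

lemma psi_measurable:
 assumes w: "tame vf" shows "psi vf y \<in> borel_measurable F" "(\<lambda>u. if u \<le> y then vf (y - u) else 0) \<in> borel_measurable F"
 unfolding measurable_F by (intro psi_measurable_pair[OF w] measurable_const measurable_ident; simp)+

lemma psi_split: "psi vf y u = (if u \<le> y then vf (y - u) else 0) - pen0 y u"
 by (auto simp: psi_def pen0_def ruin_pairs_iff)

lemma shifted_bound:
 assumes C: "0 \<le> C" "\<And>y. 0 \<le> y ==> \<bar>vf y\<bar> \<le> C * h0 y" and u: "0 \<le> u"
 shows "\<bar>if u \<le> y then vf (y - u) else 0\<bar> \<le> C * h0 y"
proof (cases "u \<le> y")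
 case True
 then have "\<bar>vf (y - u)\<bar> \<le> C * h0 (y - u)" by (intro C) simp
 also have "\<dots> \<le> C * h0 y" using C(1) h0_mono[of "y - u" y] u by (intro mult_left_mono) auto
 finally show ?thesis using True by simp
qed (use C h0_pos[of y] in simp)

lemma shifted_integrable:
 assumes w: "tame vf"
 shows "integrable F (\<lambda>u. if u \<le> y then vf (y - u) else 0)"
proof -
 obtain C where C: "0 \<le> C" "\<And>y. 0 \<le> y ==> \<bar>vf y\<bar> \<le> C * h0 y" using tame_growth[OF w] by blast
 show ?thesis
 proof (rule F.integrable_const_bound[of _ "C * h0 y"])
  show "AE u in F. norm (if u \<le> y then vf (y - u) else 0) \<le> C * h0 y"
   using F_nonneg
  proof eventually_elim
   case (elim u)
   show ?case using shifted_bound[OF C elim] by simp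
  qed
 qed (rule psi_measurable[OF w])
qed

lemma psi_integrable:
 assumes w: "tame vf" and y: "0 \<le> y"
 shows "integrable F (psi vf y)"
 unfolding psi_split[abs_def] by (intro Bochner_Integration.integrable_diff shifted_integrable[OF w] pen0_integrable[OF y])

lemma Q_split:
 assumes w: "tame vf" and y: "0 \<le> y"
 shows "Q vf y = (LINT u|F. (if u \<le> y then vf (y - u) else 0)) - pen_mean y"
 unfolding Q_def psi_split pen_mean_def
 by (intro Bochner_Integration.integral_diff shifted_integrable[OF w] pen0_integrable[OF y])

lemma Q_bound:
 assumes w: "tame vf" shows "\<exists>C\<ge>0. \<forall>y\<ge>0. \<bar>Q vf y\<bar> \<le> C * h0 y"
proof -
 obtain C where C: "0 \<le> C" "\<And>y. 0 \<le> y ==> \<bar>vf y\<bar> \<le> C * h0 y" using tame_growth[OF w] by blast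
 define P where "P = (LINT u|F. \<bar>pen0 0 u\<bar>)"
 have P0: "0 \<le> P" by (simp add: P_def)
 show ?thesis
 proof (intro exI[of _ "C + K + P"] conjI allI impI)
  fix y :: "real^'n" assume y: "0 \<le> y"
  have "\<bar>LINT u|F. (if u \<le> y then vf (y - u) else 0)\<bar> \<le> (LINT u|F. \<bar>if u \<le> y then vf (y - u) else 0\<bar>)"
   by (rule integral_abs_bound)
  also have "\<dots> \<le> (LINT u|F. C * h0 y)"
  proof (rule integral_mono_AE)
   show "AE u in F. \<bar>if u \<le> y then vf (y - u) else 0\<bar> \<le> C * h0 y"
    using F_nonneg by eventually_elim (rule shifted_bound[OF C])
  qed (use shifted_integrable[OF w] in auto)
  also have "\<dots> = C * h0 y" using F.prob_space by simp
  finally have 1: "\<bar>LINT u|F. (if u \<le> y then vf (y - u) else 0)\<bar> \<le> C * h0 y" .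
  have "\<bar>pen_mean y\<bar> \<le> (LINT u|F. \<bar>pen0 y u\<bar>)" unfolding pen_mean_def by (rule integral_abs_bound)
  also have "\<dots> \<le> (LINT u|F. K * h0 y + \<bar>pen0 0 u\<bar>)"
   using pen0_integrable_0 pen0_integrable[OF y] pen0_abs[OF y] by (intro integral_mono) auto
  also have "\<dots> = K * h0 y + P" using pen0_integrable_0 F.prob_space by (simp add: P_def)
  also have "\<dots> \<le> K * h0 y + P * h0 y" using P0 h0_ge_1[OF y] by (simp add: mult_le_cancel_left1)
  finally show "\<bar>Q vf y\<bar> \<le> (C + K + P) * h0 y" using 1 by (simp add: Q_split[OF w y] distrib_right)
 qed (use C K(1) P0 in simp)
qed

lemma vec_tendsto_nth: "(g \<longlongrightarrow> (y::real^'n)) G ==> ((\<lambda>n. g n $ i) \<longlongrightarrow> y $ i) G"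
 by (rule tendsto_vec_nth)

text \<open>Along points above \<open>y\<close>, survival of a claim \<open>u\<close> is eventually
  decided as at \<open>y\<close>: it persists if \<open>u \<le> y\<close>, and it fails if some
  coordinate of \<open>u\<close> is strictly larger. The averaged penalty is continuous by
  assumption and needs no such argument.\<close>

lemma Q_upper_continuous:
 assumes w: "tame vf" and y: "0 \<le> y"
 shows "continuous (at y within {y..}) (Q vf)"
 unfolding continuous_within_sequentially comp_def
proof (intro allI impI, elim conjE)
 fix z :: "nat \<Rightarrow> real^'n" assume z: "\<forall>n. z n \<in> {y..}" "z \<longlonglongrightarrow> y"
 obtain C where C: "0 \<le> C" "\<And>y. 0 \<le> y ==> \<bar>vf y\<bar> \<le> C * h0 y" using tame_growth[OF w] by blast
 have zy: "y \<le> z n" for n using z by auto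
 then have z0: "0 \<le> z n" for n using y order_trans by blast
 have "isCont h0 y" using h0_continuous[of UNIV] continuous_on_eq_continuous_at open_UNIV by blast
 then have "(\<lambda>n. h0 (z n)) \<longlonglongrightarrow> h0 y" using z(2) by (rule isCont_tendsto_compose)
 then have "Bseq (\<lambda>n. h0 (z n))" by (intro convergent_imp_Bseq) (auto simp: convergent_def)
 then obtain B where B: "\<And>n. norm (h0 (z n)) \<le> B" by (auto simp: Bseq_def)
 have wconv: "(\<lambda>n. if u \<le> z n then vf (z n - u) else 0) \<longlonglongrightarrow> (if u \<le> y then vf (y - u) else 0)" if u: "0 \<le> u" for u
 proof (cases "u \<le> y")
  case True
  have "continuous (at (y - u) within {y - u..}) vf" using w True by (auto simp: tame_def)
  moreover have "z n - u \<in> {y - u..}" for n using zy[of n] by simp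
  moreover have "(\<lambda>n. z n - u) \<longlonglongrightarrow> y - u" using z(2) by (intro tendsto_diff tendsto_const)
  ultimately have "(\<lambda>n. vf (z n - u)) \<longlonglongrightarrow> vf (y - u)" by (rule continuous_within_seqD)
  moreover have "u \<le> z n" for n using True zy order_trans by blast
  ultimately show ?thesis using True by simp
 next
  case False
  then obtain i where i: "y $ i < u $ i" by (auto simp: less_eq_vec_def not_le)
  have "eventually (\<lambda>n. z n $ i < u $ i) sequentially"
   using order_tendstoD(2)[OF vec_tendsto_nth[OF z(2), of i] i] .
  then have "eventually (\<lambda>n. 0 = (if u \<le> z n then vf (z n - u) else 0)) sequentially"
  proof eventually_elim
   case (elim n)
   then have "\<not> u \<le> z n" unfolding less_eq_vec_def not_all not_le by blast
   then show ?case by simp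
  qed
  then have "(\<lambda>n. if u \<le> z n then vf (z n - u) else 0) \<longlonglongrightarrow> 0"
   by (rule Lim_transform_eventually[OF tendsto_const])
  then show ?thesis using False by simp
 qed
 have "(\<lambda>n. LINT u|F. (if u \<le> z n then vf (z n - u) else 0)) \<longlonglongrightarrow> (LINT u|F. (if u \<le> y then vf (y - u) else 0))"
 proof (rule integral_dominated_convergence[where w="\<lambda>_. C * B"])
  show "AE u in F. (\<lambda>n. if u \<le> z n then vf (z n - u) else 0) \<longlonglongrightarrow> (if u \<le> y then vf (y - u) else 0)"
   using F_nonneg by eventually_elim (rule wconv)
  show "AE u in F. norm (if u \<le> z n then vf (z n - u) else 0) \<le> C * B" for n
   using F_nonneg
  proof eventually_elim
   case (elim u)
   have "\<bar>if u \<le> z n then vf (z n - u) else 0\<bar> \<le> C * h0 (z n)" by (rule shifted_bound[OF C elim])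
   also have "\<dots> \<le> C * B" using B[of n] C(1) by (intro mult_left_mono) auto
   finally show ?case by simp
  qed
 qed (use psi_measurable[OF w] in auto)
 moreover have "(\<lambda>n. pen_mean (z n)) \<longlonglongrightarrow> pen_mean y"
  using pen_mean_continuous z(2) y z0 unfolding continuous_on_sequentially comp_def by auto
 ultimately show "(\<lambda>n. Q vf (z n)) \<longlonglongrightarrow> Q vf y"
  unfolding Q_split[OF w y] Q_split[OF w z0] by (rule tendsto_diff)
qed

lemma Q_measurable: assumes w: "tame vf" shows "Q vf \<in> borel_measurable borel"
proof -
 have "(\<lambda>x. psi vf (fst x) (snd x)) \<in> borel_measurable (borel \<Otimes>\<^sub>M F)"
  by (intro psi_measurable_pair[OF w]) auto
 then show ?thesis
  unfolding Q_def[abs_def] by (intro F.borel_measurable_lebesgue_integral) (simp add: split_beta')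
qed

lemma Q_tame: "tame vf ==> tame (Q vf)"
 unfolding tame_def[of "Q vf"] using Q_bound Q_upper_continuous Q_measurable by blast

lemma tame_h0: "tame h0"
 unfolding tame_def
proof (intro conjI allI impI)
 show "h0 \<in> borel_measurable borel" by (rule borel_measurable_continuous_onI[OF h0_continuous])
 show "\<exists>C. \<forall>y\<ge>0. \<bar>h0 y\<bar> \<le> C * h0 y" using h0_pos less_imp_le by (intro exI[of _ 1]) (auto simp: abs_of_pos)
 show "continuous (at y within {y..}) h0" for y using h0_continuous[of UNIV]
  by (meson UNIV_I continuous_at_imp_continuous_within continuous_on_eq_continuous_at open_UNIV)
qed

lemma tame_add:
 assumes "tame vf" "tame v" shows "tame (\<lambda>x. vf x + k * v x)"
 unfolding tame_def
proof (intro conjI allI impI)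
 obtain C where C: "0 \<le> C" "\<And>y. 0 \<le> y ==> \<bar>vf y\<bar> \<le> C * h0 y" using tame_growth[OF assms(1)] by blast
 obtain D where D: "0 \<le> D" "\<And>y. 0 \<le> y ==> \<bar>v y\<bar> \<le> D * h0 y" using tame_growth[OF assms(2)] by blast
 show "\<exists>C. \<forall>y\<ge>0. \<bar>vf y + k * v y\<bar> \<le> C * h0 y"
 proof (intro exI[of _ "C + \<bar>k\<bar> * D"] allI impI)
  fix y :: "real^'n" assume y: "0 \<le> y"
  have "\<bar>k * v y\<bar> \<le> \<bar>k\<bar> * (D * h0 y)" unfolding abs_mult using D(2)[OF y] by (intro mult_left_mono) auto
  then show "\<bar>vf y + k * v y\<bar> \<le> (C + \<bar>k\<bar> * D) * h0 y" using C(2)[OF y] by (simp add: algebra_simps)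
 qed
 show "(\<lambda>x. vf x + k * v x) \<in> borel_measurable borel"
  using tame_measurable[OF assms(1)] tame_measurable[OF assms(2)] by (intro borel_measurable_add borel_measurable_times borel_measurable_const)
 show "continuous (at y within {y..}) (\<lambda>x. vf x + k * v x)" if "0 \<le> y" for y
  using assms that unfolding tame_def by (intro continuous_intros) auto
qed

text \<open>The rate \<open>beta\<close> combines discounting with the probability that no claim occurs; \<open>q y\<close> is the
 expected value when a claim occurs at surplus \<open>y\<close>.\<close>

definition wait_value where
 "wait_value vf q h x = exp (- beta * h) * vf (x + h *\<^sub>R p) + lam / beta * (LINT s|elaw beta. indicator {..<h} s * q (x + s *\<^sub>R p))"

lemma elaw_beta_growth:
 "integrable (elaw beta) (\<lambda>s. exp (c / 2 * s))" "(LINT s|elaw beta. exp (c / 2 * s)) = beta / (beta - c / 2)"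
 using elaw_exp[OF beta_pos(1), of "c / 2"] c_pos lam_pos by (simp_all add: beta_def)

lemma tame_path_integrable:
 assumes w: "tame vf" and y: "y \<in> borel_measurable borel" and b: "\<And>s. 0 \<le> s ==> 0 \<le> y s" "\<And>s. 0 \<le> s ==> y s \<le> x + s *\<^sub>R p"
 shows "integrable (elaw beta) (\<lambda>s. vf (y s))"
proof -
 obtain C where C: "0 \<le> C" "\<And>y. 0 \<le> y ==> \<bar>vf y\<bar> \<le> C * h0 y" using tame_growth[OF w] by blast
 show "integrable (elaw beta) (\<lambda>s. vf (y s))"
 proof (rule Bochner_Integration.integrable_bound)
  show "integrable (elaw beta) (\<lambda>s. C * (h0 x * exp (c / 2 * s)))" using elaw_beta_growth(1) by simp
  show "AE s in elaw beta. norm (vf (y s)) \<le> norm (C * (h0 x * exp (c / 2 * s)))"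
   using AE_elaw_pos
  proof eventually_elim
   case (elim s)
   have "\<bar>vf (y s)\<bar> \<le> C * h0 (y s)" using b(1)[of s] elim by (intro C) auto
   also have "\<dots> \<le> C * h0 (x + s *\<^sub>R p)" using b(2)[of s] elim C(1) h0_mono by (intro mult_left_mono) auto
   finally show ?case using C(1) h0_pos[of x] by (simp add: h0_shift)
  qed
 qed (use measurable_compose[OF y tame_measurable[OF w]] in \<open>simp add: measurable_elaw\<close>)
qed

lemma indicator_integrable:
 fixes g :: "real \<Rightarrow> real"
 assumes "integrable N g" "A \<in> sets N" shows "integrable N (\<lambda>s. indicator A s * g s)"
 using integrable_mult_indicator[OF assms(2,1)] by simp

lemma orthant_path: "0 \<le> x ==> 0 \<le> s ==> 0 \<le> x + s *\<^sub>R p"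
 using vec_scale_mono[of 0 s p] p_nonneg by (simp add: add_nonneg_nonneg)

end

section \<open>Supersolutions along a deterministic dividend path before the first claim\<close>

lemma mono_vec_measurable:
 fixes l :: "real \<Rightarrow> real^'n::finite"
 assumes "mono l" shows "l \<in> borel_measurable borel"
proof (subst borel_measurable_euclidean_space, intro ballI)
 fix b :: "real^'n" assume "b \<in> Basis"
 then obtain j where b: "b = axis j 1" by (auto simp: Basis_vec_def)
 have "mono (\<lambda>t. l t $ j)" using assms by (auto simp: mono_def less_eq_vec_def)
 then show "(\<lambda>t. l t \<bullet> b) \<in> borel_measurable borel"
  unfolding b by (simp add: inner_axis borel_measurable_mono)
qed

lemma mono_vec_isCont_AE:
 fixes l :: "real \<Rightarrow> real^'n::finite"
 assumes "mono l" shows "AE s in lborel. isCont l s"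
proof -
 have "AE s in lborel. isCont (\<lambda>t. l t $ j) s" for j
 proof -
  have "mono (\<lambda>t. l t $ j)" using assms by (auto simp: mono_def less_eq_vec_def)
  then have "countable {s. \<not> isCont (\<lambda>t. l t $ j) s}" by (rule mono_ctble_discont)
  then have "{s. \<not> isCont (\<lambda>t. l t $ j) s} \<in> null_sets lborel" by (rule countable_imp_null_set_lborel)
  then show ?thesis by (rule AE_I') auto
 qed
 then have "AE s in lborel. \<forall>j\<in>UNIV. isCont (\<lambda>t. l t $ j) s" by (intro AE_finite_allI) auto
 then show ?thesis
 proof eventually_elim
  case (elim s)
  then show ?case unfolding isCont_def by (intro vec_tendstoI) auto
 qed
qed

lemma AE_elaw: "AE s in lborel. P s ==> AE s in elaw b. P s"
 by (subst AE_density) auto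

context dividend_model
begin

text \<open>The claim term \<open>q\<close> is independent of \<open>W\<close>, because in the
  iteration over claims the value after a claim is bounded by the previous bound and not by
  \<open>W\<close>. The lower bound on \<open>W\<close> controls the remainder of a strategy that
  never switches.\<close>

definition supersol where
 "supersol W q \<longleftrightarrow> tame W \<and> tame q \<and> (\<forall>x\<ge>0. \<forall>z\<ge>0. a \<bullet> z + W x \<le> W (x + z)) \<and> (\<forall>x\<ge>0. f x \<le> W x) \<and>
  (\<forall>x\<ge>0. \<forall>h\<ge>0. wait_value W q h x \<le> W x) \<and> (\<exists>C. \<forall>x\<ge>0. - C \<le> W x)"

definition pay_path :: "real^'n \<Rightarrow> (real \<Rightarrow> real^'n) \<Rightarrow> bool" where
 "pay_path x l \<longleftrightarrow> l \<in> borel_measurable borel \<and> (\<forall>s\<ge>0. 0 \<le> l s \<and> l s \<le> x + s *\<^sub>R p)"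

text \<open>The accumulated dividends \<open>a \<bullet> l s\<close> appear in place of their
  increments since the killed form has integrated by parts. The factor \<open>lam / beta\<close> is
  the probability that a claim precedes the killing.\<close>

definition flow where
 "flow q x l s = a \<bullet> l s + lam / beta * q (x + s *\<^sub>R p - l s)"

lemma pay_pathD:
 assumes "pay_path x l"
 shows "l \<in> borel_measurable borel" "0 \<le> s ==> 0 \<le> l s" "0 \<le> s ==> l s \<le> x + s *\<^sub>R p"
 using assms by (auto simp: pay_path_def)

lemma inner_growth:
 assumes "0 \<le> l" "l \<le> x + s *\<^sub>R p" "0 \<le> x" "0 \<le> s"
 shows "0 \<le> a \<bullet> l" "a \<bullet> l \<le> K * h0 x * exp (c / 2 * s)"
proof -
 show "0 \<le> a \<bullet> l" by (rule a_inner_nonneg[OF assms(1)])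
 have "a \<bullet> l \<le> a \<bullet> (x + s *\<^sub>R p)" by (rule a_inner_mono[OF assms(2)])
 also have "\<dots> \<le> K * h0 (x + s *\<^sub>R p)" by (intro K(3) orthant_path assms)
 finally show "a \<bullet> l \<le> K * h0 x * exp (c / 2 * s)" by (simp add: h0_shift mult.assoc)
qed

lemma pay_path_inner_integrable:
 assumes l: "pay_path x l" and x: "0 \<le> x"
 shows "integrable (elaw beta) (\<lambda>s. a \<bullet> l s)"
proof (rule Bochner_Integration.integrable_bound)
 show "integrable (elaw beta) (\<lambda>s. K * h0 x * exp (c / 2 * s))" using elaw_beta_growth(1) by simp
 show "(\<lambda>s. a \<bullet> l s) \<in> borel_measurable (elaw beta)"
  unfolding measurable_elaw using pay_pathD(1)[OF l] by (rule borel_measurable_inner[OF borel_measurable_const])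
 show "AE s in elaw beta. norm (a \<bullet> l s) \<le> norm (K * h0 x * exp (c / 2 * s))"
  using AE_elaw_pos
 proof eventually_elim
  case (elim s)
  then show ?case using inner_growth[of "l s" x s] pay_pathD(2,3)[OF l, of s] x by simp
 qed
qed

lemma pay_path_surplus:
 assumes l: "pay_path x l"
 shows "(\<lambda>s. x + s *\<^sub>R p - l s) \<in> borel_measurable borel" "0 \<le> s ==> 0 \<le> x + s *\<^sub>R p - l s" "0 \<le> s ==> x + s *\<^sub>R p - l s \<le> x + s *\<^sub>R p"
proof -
 show "(\<lambda>s. x + s *\<^sub>R p - l s) \<in> borel_measurable borel"
  using pay_pathD(1)[OF l] by (intro borel_measurable_diff borel_measurable_add borel_measurable_scaleR measurable_const) auto
 assume "0 \<le> s"
 then show "0 \<le> x + s *\<^sub>R p - l s" "x + s *\<^sub>R p - l s \<le> x + s *\<^sub>R p"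
  using pay_pathD(2,3)[OF l, of s] by auto
qed

lemma pay_path_q_integrable:
 assumes l: "pay_path x l" and q: "tame q"
 shows "integrable (elaw beta) (\<lambda>s. q (x + s *\<^sub>R p - l s))"
 by (rule tame_path_integrable[OF q pay_path_surplus(1)[OF l] pay_path_surplus(2)[OF l] pay_path_surplus(3)[OF l]])

lemma flow_integrable:
 assumes l: "pay_path x l" and x: "0 \<le> x" and q: "tame q"
 shows "integrable (elaw beta) (flow q x l)"
 unfolding flow_def[abs_def]
 by (intro Bochner_Integration.integrable_add pay_path_inner_integrable[OF l x] Bochner_Integration.integrable_mult_right pay_path_q_integrable[OF l q])

lemma flow_bound:
 assumes q: "tame q" and x: "0 \<le> x"
 obtains D where "0 \<le> D" "\<And>l s. pay_path x l ==> 0 \<le> s ==> \<bar>flow q x l s\<bar> \<le> D * exp (c / 2 * s)"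
proof -
 obtain C where C: "0 \<le> C" "\<And>y. 0 \<le> y ==> \<bar>q y\<bar> \<le> C * h0 y" using tame_growth[OF q] by blast
 define D where "D = K * h0 x + lam / beta * (C * h0 x)"
 show ?thesis
 proof
  show "0 \<le> D" using K(1) C(1) h0_pos[of x] lam_pos beta_pos by (simp add: D_def)
  fix l and s :: real assume l: "pay_path x l" and s: "0 \<le> s"
  have "\<bar>q (x + s *\<^sub>R p - l s)\<bar> \<le> C * h0 (x + s *\<^sub>R p - l s)" by (rule C(2)[OF pay_path_surplus(2)[OF l s]])
  also have "\<dots> \<le> C * h0 (x + s *\<^sub>R p)" using C(1) h0_mono[OF pay_path_surplus(3)[OF l s]] by (intro mult_left_mono) auto
  finally have "\<bar>lam / beta * q (x + s *\<^sub>R p - l s)\<bar> \<le> lam / beta * (C * h0 (x + s *\<^sub>R p))"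
   unfolding abs_mult using lam_pos beta_pos by (simp add: mult_left_mono divide_right_mono)
  moreover have "0 \<le> a \<bullet> l s" "a \<bullet> l s \<le> K * h0 x * exp (c / 2 * s)"
   using inner_growth[of "l s" x s] pay_pathD(2,3)[OF l s] x s by auto
  ultimately have "\<bar>flow q x l s\<bar> \<le> K * h0 x * exp (c / 2 * s) + lam / beta * (C * h0 (x + s *\<^sub>R p))"
   unfolding flow_def by linarith
  then show "\<bar>flow q x l s\<bar> \<le> D * exp (c / 2 * s)"
   by (simp add: D_def h0_shift distrib_right mult.assoc)
 qed
qed

lemma elaw_beta_indicator: "0 \<le> h ==> (LINT s|elaw beta. indicator {..<h} s * k) = (1 - exp (- beta * h)) * k"
 using elaw_shift(2)[OF beta_pos(1), of h "\<lambda>_. k"] B.prob_space by (simp add: algebra_simps)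

text \<open>Dividends are paid only at the times \<open>i h\<close>; the supersolution property is applied on each interval.\<close>

lemma step_path_inequality:
 assumes S: "supersol W q" and x: "0 \<le> x" and l: "pay_path x l" and m: "mono l" and h: "0 < h"
 defines "lN \<equiv> \<lambda>s. l (h * real_of_int \<lfloor>s / h\<rfloor>)"
 shows "exp (- beta * (real i * h)) * (a \<bullet> l (real i * h) + W (x + (real i * h) *\<^sub>R p - l (real i * h))) +
  (LINT s|elaw beta. indicator {..<real i * h} s * flow q x lN s) \<le> W x"
proof -
 note S' = S[unfolded supersol_def]
 have lN: "pay_path x lN"
  unfolding pay_path_def
 proof (intro conjI allI impI)
  show "lN \<in> borel_measurable borel"
   unfolding lN_def by (rule measurable_compose[OF _ pay_pathD(1)[OF l]]) measurable
  fix s :: real assume s: "0 \<le> s"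
  have f: "0 \<le> h * real_of_int \<lfloor>s / h\<rfloor>" "h * real_of_int \<lfloor>s / h\<rfloor> \<le> s"
   using s h floor_divide_lower[OF h, of s] by (auto simp: mult.commute)
  show "0 \<le> lN s" unfolding lN_def by (rule pay_pathD(2)[OF l f(1)])
  show "lN s \<le> x + s *\<^sub>R p"
   unfolding lN_def using pay_pathD(3)[OF l f(1)] vec_scale_mono[OF f(2) p_nonneg]
   by (meson add_left_mono order_trans)
 qed
 have int: "integrable (elaw beta) (\<lambda>s. indicator {..<t} s * flow q x lN s)" for t
  by (rule indicator_integrable[OF flow_integrable[OF lN x]]) (use S' in auto)
 show ?thesis
 proof (induction i)
  case 0
  have l0: "0 \<le> l 0" "l 0 \<le> x" using pay_pathD(2,3)[OF l, of 0] by auto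
  then have "a \<bullet> l 0 + W (x - l 0) \<le> W (x - l 0 + l 0)" using S' by (metis diff_ge_0_iff_ge)
  moreover have "(LINT s|elaw beta. indicator {..<0} s * flow q x lN s) = (LINT s|elaw beta. 0)"
   by (rule integral_cong_AE) (use AE_elaw_pos[of beta] borel_measurable_integrable[OF int[of 0]] in \<open>auto elim!: eventually_mono\<close>)
  ultimately show ?case by simp
 next
  case (Suc i)
  define t where "t = real i * h"
  define t' where "t' = real (Suc i) * h"
  define y where "y = x + t *\<^sub>R p - l t"
  define y' where "y' = x + t' *\<^sub>R p - l t'"
  have t: "0 \<le> t" "t' = t + h" using h by (auto simp: t_def t'_def algebra_simps)
  have t'0: "0 \<le> t'" using t h by simp
  have y0: "0 \<le> y" "0 \<le> y'" using pay_path_surplus(2)[OF l t(1)] pay_path_surplus(2)[OF l t'0] by (auto simp: y_def y'_def)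
  have d: "0 \<le> l t' - l t" using monoD[OF m, of t t'] t h by simp
  have wait: "wait_value W q h y \<le> W y" using S' y0(1) h by auto
  \<comment> \<open>The interval is first waited through, from \<open>y\<close> to
    \<open>y + h *\<^sub>R p\<close>; only at its end is the increment \<open>l t' - l t\<close>
    paid, which the payment inequality covers.\<close>
  have "a \<bullet> (l t' - l t) + W y' \<le> W (y' + (l t' - l t))" using S' y0(2) d by blast
  also have "y' + (l t' - l t) = y + h *\<^sub>R p" by (simp add: y_def y'_def t algebra_simps)
  finally have pay: "a \<bullet> l t' + W y' \<le> a \<bullet> l t + W (y + h *\<^sub>R p)" by (simp add: inner_diff_right)
  let ?e = "exp (- beta * h)"
  have q: "tame q" using S' by blast
  have iq: "integrable (elaw beta) (\<lambda>s. indicator {..<h} s * q (y + s *\<^sub>R p))"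
   using indicator_integrable[OF pay_path_q_integrable[of y "\<lambda>_. 0", OF _ q], of "{..<h}"] y0(1)
   by (auto simp: pay_path_def orthant_path)
  have shift: "(LINT s|elaw beta. indicator {..<t'} (t + s) * flow q x lN (t + s)) =
   (LINT s|elaw beta. indicator {..<h} s * (a \<bullet> l t) + lam / beta * (indicator {..<h} s * q (y + s *\<^sub>R p)))"
  proof (rule integral_cong_AE)
   show "AE s in elaw beta. indicator {..<t'} (t + s) * flow q x lN (t + s) =
    indicator {..<h} s * (a \<bullet> l t) + lam / beta * (indicator {..<h} s * q (y + s *\<^sub>R p))"
    using AE_elaw_pos
   proof eventually_elim
    case (elim s)
    show ?case
    proof (cases "s < h")
     case True
     have "\<lfloor>(t + s) / h\<rfloor> = int i"
     proof (rule floor_unique)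
      have e: "(t + s) / h = real i + s / h" using h by (simp add: t_def add_divide_distrib)
      show "real_of_int (int i) \<le> (t + s) / h" "(t + s) / h < real_of_int (int i) + 1"
       using True elim h unfolding e by auto
     qed
     then have "lN (t + s) = l t" by (simp add: lN_def t_def mult.commute)
     moreover have "x + (t + s) *\<^sub>R p - l t = y + s *\<^sub>R p" by (simp add: y_def algebra_simps)
     ultimately show ?thesis using True t by (simp add: flow_def)
    qed (use t in simp)
   qed
  qed (use borel_measurable_integrable[OF elaw_shift(1)[OF beta_pos(1) t(1) int[of t']]] borel_measurable_integrable[OF iq] in auto)
  have "(LINT s|elaw beta. indicator {..<t'} s * flow q x lN s) =
   (LINT s|elaw beta. indicator {..<t} s * (indicator {..<t'} s * flow q x lN s)) + exp (- beta * t) *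
   (LINT s|elaw beta. indicator {..<t'} (t + s) * flow q x lN (t + s))"
   by (rule elaw_shift(2)[OF beta_pos(1) t(1) int])
  also have "(\<lambda>s. indicator {..<t} s * (indicator {..<t'} s * flow q x lN s)) = (\<lambda>s. indicator {..<t} s * flow q x lN s)"
   using t h by (auto simp: indicator_def)
  also have "(LINT s|elaw beta. indicator {..<t'} (t + s) * flow q x lN (t + s)) =
   (1 - ?e) * (a \<bullet> l t) + lam / beta * (LINT s|elaw beta. indicator {..<h} s * q (y + s *\<^sub>R p))"
  proof -
   have "(LINT s|elaw beta. indicator {..<h} s * (a \<bullet> l t) + lam / beta * (indicator {..<h} s * q (y + s *\<^sub>R p))) =
    (LINT s|elaw beta. indicator {..<h} s * (a \<bullet> l t)) + (LINT s|elaw beta. lam / beta * (indicator {..<h} s * q (y + s *\<^sub>R p)))"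
    by (intro Bochner_Integration.integral_add indicator_integrable Bochner_Integration.integrable_mult_right iq B.integrable_const) simp
   then show ?thesis unfolding shift using elaw_beta_indicator[of h "a \<bullet> l t"] h by simp
  qed
  finally have I: "(LINT s|elaw beta. indicator {..<t'} s * flow q x lN s) =
   (LINT s|elaw beta. indicator {..<t} s * flow q x lN s) + exp (- beta * t) *
   ((1 - ?e) * (a \<bullet> l t) + lam / beta * (LINT s|elaw beta. indicator {..<h} s * q (y + s *\<^sub>R p)))" .
  have e: "exp (- beta * t') = exp (- beta * t) * ?e" by (simp add: t mult_exp_exp algebra_simps)
  have "?e * (a \<bullet> l t' + W y') \<le> ?e * (a \<bullet> l t + W (y + h *\<^sub>R p))" using pay by (intro mult_left_mono) auto
  also have "\<dots> \<le> ?e * (a \<bullet> l t) + W y - lam / beta * (LINT s|elaw beta. indicator {..<h} s * q (y + s *\<^sub>R p))"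
   using wait by (simp add: wait_value_def distrib_left)
  finally have "?e * (a \<bullet> l t' + W y') + ((1 - ?e) * (a \<bullet> l t) + lam / beta * (LINT s|elaw beta. indicator {..<h} s * q (y + s *\<^sub>R p)))
   \<le> a \<bullet> l t + W y" by (simp add: algebra_simps)
  then have "exp (- beta * t) * (?e * (a \<bullet> l t' + W y') + ((1 - ?e) * (a \<bullet> l t) + lam / beta * (LINT s|elaw beta. indicator {..<h} s * q (y + s *\<^sub>R p))))
   \<le> exp (- beta * t) * (a \<bullet> l t + W y)" by (intro mult_left_mono) auto
  then show ?case
   using Suc unfolding t_def[symmetric] t'_def[symmetric] y_def[symmetric] y'_def[symmetric] I e by (simp add: distrib_left mult.assoc)
 qed
qed

text \<open>The limit of vanishing step length. A step path lags behind \<open>l\<close>, so its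
  surplus lies above that of \<open>l\<close>, and continuity of \<open>q\<close> from above
  suffices. Convergence holds where the monotone path \<open>l\<close> is continuous, hence almost
  everywhere.\<close>

lemma path_inequality:
 assumes S: "supersol W q" and x: "0 \<le> x" and l: "pay_path x l" and m: "mono l" and t: "0 \<le> t"
 shows "exp (- beta * t) * (a \<bullet> l t + W (x + t *\<^sub>R p - l t)) + (LINT s|elaw beta. indicator {..<t} s * flow q x l s) \<le> W x"
proof (cases "t = 0")
 case True
 have "(LINT s|elaw beta. indicator {..<0} s * g s) = 0" for g :: "real \<Rightarrow> real"
  by (rule integral_eq_zero_AE) (use AE_elaw_pos[of beta] in \<open>auto elim!: eventually_mono\<close>)
 then show ?thesis using step_path_inequality[OF S x l m, of 1 0] by (simp add: True)
next
 case False
 with t have t: "0 < t" by simp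
 note S' = S[unfolded supersol_def]
 \<comment> \<open>The step length divides \<open>t\<close>, so that \<open>t\<close> itself is one
   of the payment times.\<close>
 define h where "h n = t / real (Suc n)" for n
 define lN where "lN n s = l (h n * real_of_int \<lfloor>s / h n\<rfloor>)" for n s
 have h: "0 < h n" for n using t by (simp add: h_def)
 have hn: "real (Suc n) * h n = t" for n by (simp add: h_def)
 have step: "exp (- beta * t) * (a \<bullet> l t + W (x + t *\<^sub>R p - l t)) + (LINT s|elaw beta. indicator {..<t} s * flow q x (lN n) s) \<le> W x" for n
  using step_path_inequality[OF S x l m h[of n], of "Suc n"] unfolding hn lN_def[abs_def] .
 obtain D where D: "0 \<le> D" "\<And>l s. pay_path x l ==> 0 \<le> s ==> \<bar>flow q x l s\<bar> \<le> D * exp (c / 2 * s)"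
  using flow_bound[of q x] S' x by blast
 have fl: "0 \<le> h n * real_of_int \<lfloor>s / h n\<rfloor>" "h n * real_of_int \<lfloor>s / h n\<rfloor> \<le> s" "s - h n < h n * real_of_int \<lfloor>s / h n\<rfloor>" if "0 \<le> s" for s n
  using that h[of n] floor_divide_lower[OF h[of n], of s] floor_divide_upper[OF h[of n], of s] by (auto simp: algebra_simps)
 have lN: "pay_path x (lN n)" for n
  unfolding pay_path_def
 proof (intro conjI allI impI)
  show "lN n \<in> borel_measurable borel"
   unfolding lN_def[abs_def] by (rule measurable_compose[OF _ pay_pathD(1)[OF l]]) measurable
  fix s :: real assume s: "0 \<le> s"
  show "0 \<le> lN n s" unfolding lN_def by (rule pay_pathD(2)[OF l fl(1)[OF s]])
  show "lN n s \<le> x + s *\<^sub>R p"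
   unfolding lN_def using pay_pathD(3)[OF l fl(1)[OF s]] vec_scale_mono[OF fl(2)[OF s] p_nonneg]
   by (meson add_left_mono order_trans)
 qed
 have q: "tame q" using S' by blast
 have "(\<lambda>n. LINT s|elaw beta. indicator {..<t} s * flow q x (lN n) s) \<longlonglongrightarrow> (LINT s|elaw beta. indicator {..<t} s * flow q x l s)"
 proof (rule integral_dominated_convergence[where w="\<lambda>s. D * exp (c / 2 * s)"])
  show "integrable (elaw beta) (\<lambda>s. D * exp (c / 2 * s))" using elaw_beta_growth(1) by simp
  show "(\<lambda>s. indicator {..<t} s * flow q x l s) \<in> borel_measurable (elaw beta)"
   by (rule borel_measurable_integrable[OF indicator_integrable[OF flow_integrable[OF l x q]]]) simp
  show "(\<lambda>s. indicator {..<t} s * flow q x (lN n) s) \<in> borel_measurable (elaw beta)" for n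
   by (rule borel_measurable_integrable[OF indicator_integrable[OF flow_integrable[OF lN x q]]]) simp
  show "AE s in elaw beta. norm (indicator {..<t} s * flow q x (lN n) s) \<le> D * exp (c / 2 * s)" for n
   using AE_elaw_pos
  proof eventually_elim
   case (elim s)
   then show ?case using D(2)[OF lN[of n], of s] D(1) by (auto simp: indicator_def)
  qed
  show "AE s in elaw beta. (\<lambda>n. indicator {..<t} s * flow q x (lN n) s) \<longlonglongrightarrow> indicator {..<t} s * flow q x l s"
   using AE_elaw_pos AE_elaw[OF mono_vec_isCont_AE[OF m]]
  proof eventually_elim
   case (elim s)
   then have s: "0 \<le> s" by simp
   have "h \<longlonglongrightarrow> 0" unfolding h_def[abs_def] by (intro LIMSEQ_Suc lim_const_over_n)
   then have "(\<lambda>n. s - h n) \<longlonglongrightarrow> s - 0" by (intro tendsto_intros)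
   then have 1: "(\<lambda>n. s - h n) \<longlonglongrightarrow> s" by simp
   have "(\<lambda>n. h n * real_of_int \<lfloor>s / h n\<rfloor>) \<longlonglongrightarrow> s"
    by (rule tendsto_sandwich[OF _ _ 1 tendsto_const]) (use fl[OF s] in \<open>auto simp: less_imp_le\<close>)
   then have ll: "(\<lambda>n. lN n s) \<longlonglongrightarrow> l s" unfolding lN_def by (rule isCont_tendsto_compose[OF elim(2)])
   have "lN n s \<le> l s" for n unfolding lN_def by (rule monoD[OF m fl(2)[OF s]])
   then have up: "x + s *\<^sub>R p - lN n s \<in> {x + s *\<^sub>R p - l s..}" for n by simp
   have "continuous (at (x + s *\<^sub>R p - l s) within {x + s *\<^sub>R p - l s..}) q"
    using q pay_path_surplus(2)[OF l s] by (auto simp: tame_def)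
   moreover note up
   moreover have "(\<lambda>n. x + s *\<^sub>R p - lN n s) \<longlonglongrightarrow> x + s *\<^sub>R p - l s" by (intro tendsto_intros ll)
   ultimately have "(\<lambda>n. q (x + s *\<^sub>R p - lN n s)) \<longlonglongrightarrow> q (x + s *\<^sub>R p - l s)"
    by (rule continuous_within_seqD)
   then show ?case unfolding flow_def by (intro tendsto_intros ll)
  qed
 qed
 then show ?thesis
  by (intro LIMSEQ_le_const2[OF tendsto_add[OF tendsto_const]]) (use step in auto)
qed

text \<open>For finite \<open>T\<close>, stopping uses \<open>f \<le> W\<close> at time
  \<open>T\<close>. For \<open>T = \<infinity>\<close> the inequality is taken at integer times,
  where the lower bound on \<open>W\<close> makes the discounted remainder vanish in the
  limit.\<close>

lemma path_bound:
 assumes S: "supersol W q" and x: "0 \<le> x" and l: "pay_path x l" and m: "mono l"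
 shows "(LINT s|elaw beta. a \<bullet> l (stop T s)) +
  (if T < \<infinity> then exp (- beta * enn2real T) * f0 (x + enn2real T *\<^sub>R p - l (enn2real T)) else 0) +
  lam / beta * (LINT s|elaw beta. (if ennreal s \<le> T then q (x + s *\<^sub>R p - l s) else 0)) \<le> W x"
proof -
 note S' = S[unfolded supersol_def]
 have q: "tame q" using S' by blast
 have fi: "integrable (elaw beta) (flow q x l)" by (rule flow_integrable[OF l x q])
 have ai: "integrable (elaw beta) (\<lambda>s. a \<bullet> l s)" by (rule pay_path_inner_integrable[OF l x])
 have qi: "integrable (elaw beta) (\<lambda>s. q (x + s *\<^sub>R p - l s))" by (rule pay_path_q_integrable[OF l q])
 show ?thesis
 proof (cases T)
  case (real t)
  have f: "f0 (x + t *\<^sub>R p - l t) \<le> W (x + t *\<^sub>R p - l t)"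
   using S' pay_path_surplus(2)[OF l real(1)] by (auto simp: f0_def)
  have pt: "pay_path x (\<lambda>s. l (min s t))"
   unfolding pay_path_def
  proof (intro conjI allI impI)
   show "(\<lambda>s. l (min s t)) \<in> borel_measurable borel" by (rule measurable_compose[OF _ pay_pathD(1)[OF l]]) measurable
   fix s :: real assume s: "0 \<le> s"
   then show "0 \<le> l (min s t)" using real by (intro pay_pathD(2)[OF l]) auto
   have "l (min s t) \<le> l s" by (rule monoD[OF m]) simp
   also have "\<dots> \<le> x + s *\<^sub>R p" by (rule pay_pathD(3)[OF l s])
   finally show "l (min s t) \<le> x + s *\<^sub>R p" .
  qed
  have ti: "integrable (elaw beta) (\<lambda>s. a \<bullet> l (min s t))" by (rule pay_path_inner_integrable[OF pt x])
  have "(LINT s|elaw beta. a \<bullet> l (stop T s)) = (LINT s|elaw beta. a \<bullet> l (min s t))"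
  proof (rule integral_cong_AE)
   show "AE s in elaw beta. a \<bullet> l (stop T s) = a \<bullet> l (min s t)"
    using AE_elaw_pos by eventually_elim (use real in \<open>simp add: stop_simps\<close>)
   have "(\<lambda>s. l (stop T s)) \<in> borel_measurable borel" by (rule measurable_compose[OF stop_measurable pay_pathD(1)[OF l]])
   then show "(\<lambda>s. a \<bullet> l (stop T s)) \<in> borel_measurable (elaw beta)"
    unfolding measurable_elaw by (intro borel_measurable_inner borel_measurable_const)
  qed (use borel_measurable_integrable[OF ti] in simp)
  also have "\<dots> = (LINT s|elaw beta. indicator {..<t} s * (a \<bullet> l (min s t))) + exp (- beta * t) * (LINT s|elaw beta. a \<bullet> l (min (t + s) t))"
   by (rule elaw_shift(2)[OF beta_pos(1) real(1) ti])
  also have "(LINT s|elaw beta. a \<bullet> l (min (t + s) t)) = (LINT s|elaw beta. a \<bullet> l t)"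
   by (rule integral_cong_AE) (use AE_elaw_pos[of beta] borel_measurable_integrable[OF elaw_shift(1)[OF beta_pos(1) real(1) ti]] in \<open>auto elim!: eventually_mono simp: min_def\<close>)
  also have "\<dots> = a \<bullet> l t" using B.prob_space by simp
  also have "(\<lambda>s. indicator {..<t} s * (a \<bullet> l (min s t))) = (\<lambda>s. indicator {..<t} s * (a \<bullet> l s))"
   by (auto simp: indicator_def)
  finally have 1: "(LINT s|elaw beta. a \<bullet> l (stop T s)) = (LINT s|elaw beta. indicator {..<t} s * (a \<bullet> l s)) + exp (- beta * t) * (a \<bullet> l t)" .
  have 2: "(LINT s|elaw beta. (if ennreal s \<le> T then q (x + s *\<^sub>R p - l s) else 0)) = (LINT s|elaw beta. indicator {..<t} s * q (x + s *\<^sub>R p - l s))"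
  proof (rule integral_cong_AE)
   show "AE s in elaw beta. (if ennreal s \<le> T then q (x + s *\<^sub>R p - l s) else 0) = indicator {..<t} s * q (x + s *\<^sub>R p - l s)"
    using AE_elaw_pos AE_elaw[OF AE_lborel_singleton[of t]]
    by eventually_elim (use real in \<open>auto simp: ennreal_le_iff\<close>)
   show "(\<lambda>s. if ennreal s \<le> T then q (x + s *\<^sub>R p - l s) else 0) \<in> borel_measurable (elaw beta)"
    using borel_measurable_integrable[OF qi] by measurable
  qed (use borel_measurable_integrable[OF qi] in simp)
  have "(LINT s|elaw beta. indicator {..<t} s * flow q x l s) =
   (LINT s|elaw beta. indicator {..<t} s * (a \<bullet> l s) + lam / beta * (indicator {..<t} s * q (x + s *\<^sub>R p - l s)))"
   by (simp add: flow_def distrib_left mult_ac)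
  also have "\<dots> = (LINT s|elaw beta. indicator {..<t} s * (a \<bullet> l s)) + (LINT s|elaw beta. lam / beta * (indicator {..<t} s * q (x + s *\<^sub>R p - l s)))"
   by (intro Bochner_Integration.integral_add indicator_integrable ai qi Bochner_Integration.integrable_mult_right) auto
  finally have 3: "(LINT s|elaw beta. indicator {..<t} s * flow q x l s) =
   (LINT s|elaw beta. indicator {..<t} s * (a \<bullet> l s)) + lam / beta * (LINT s|elaw beta. indicator {..<t} s * q (x + s *\<^sub>R p - l s))"
   by simp
  have "exp (- beta * t) * f0 (x + t *\<^sub>R p - l t) \<le> exp (- beta * t) * W (x + t *\<^sub>R p - l t)"
   using f by (intro mult_left_mono) auto
  moreover have "T < \<infinity>" "enn2real T = t" using real by auto
  ultimately show ?thesis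
   unfolding 1 2 using path_inequality[OF S x l m real(1), unfolded 3 distrib_left] by (simp only: if_True)
 next
  case top
  obtain C where C: "\<And>x. 0 \<le> x ==> - C \<le> W x" using S' by blast
  have lim: "(\<lambda>n. LINT s|elaw beta. indicator {..<real n} s * flow q x l s) \<longlonglongrightarrow> (LINT s|elaw beta. flow q x l s)"
  proof (rule integral_dominated_convergence[where w="\<lambda>s. \<bar>flow q x l s\<bar>"])
   show "AE s in elaw beta. (\<lambda>n. indicator {..<real n} s * flow q x l s) \<longlonglongrightarrow> flow q x l s"
   proof (rule AE_I2)
    fix s
    obtain N :: nat where "s < real N" using reals_Archimedean2 by blast
    then have "eventually (\<lambda>n. flow q x l s = indicator {..<real n} s * flow q x l s) sequentially"
     unfolding eventually_sequentially by (intro exI[of _ N]) auto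
    then show "(\<lambda>n. indicator {..<real n} s * flow q x l s) \<longlonglongrightarrow> flow q x l s"
     by (rule Lim_transform_eventually[OF tendsto_const])
   qed
  qed (use fi borel_measurable_integrable[OF fi] in \<open>auto simp: indicator_def\<close>)
  have "(\<lambda>n. exp (- beta * real n) * (- C)) \<longlonglongrightarrow> 0 * (- C)"
  proof (intro tendsto_mult tendsto_const)
   have "((\<lambda>x. exp (- beta * x)) \<longlongrightarrow> 0) at_top" using beta_pos(1) by real_asymp
   then show "(\<lambda>n. exp (- beta * real n)) \<longlonglongrightarrow> 0" by (rule filterlim_compose[OF _ filterlim_real_sequentially])
  qed
  from tendsto_add[OF this lim]
  have lim2: "(\<lambda>n. exp (- beta * real n) * (- C) + (LINT s|elaw beta. indicator {..<real n} s * flow q x l s)) \<longlonglongrightarrow> (LINT s|elaw beta. flow q x l s)" by simp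
  have "(LINT s|elaw beta. flow q x l s) \<le> W x"
  proof (rule LIMSEQ_le_const2[OF lim2], intro exI allI impI)
   fix n :: nat
   have "- C \<le> a \<bullet> l (real n) + W (x + real n *\<^sub>R p - l (real n))"
    using C[OF pay_path_surplus(2)[OF l, of "real n"]] a_inner_nonneg[OF pay_pathD(2)[OF l, of "real n"]] by simp
   then have "exp (- beta * real n) * (- C) \<le> exp (- beta * real n) * (a \<bullet> l (real n) + W (x + real n *\<^sub>R p - l (real n)))"
    by (intro mult_left_mono) auto
   then show "exp (- beta * real n) * (- C) + (LINT s|elaw beta. indicator {..<real n} s * flow q x l s) \<le> W x"
    using path_inequality[OF S x l m, of "real n"] by simp
  qed
  also have "(LINT s|elaw beta. flow q x l s) = (LINT s|elaw beta. a \<bullet> l s) + lam / beta * (LINT s|elaw beta. q (x + s *\<^sub>R p - l s))"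
   unfolding flow_def using ai qi by simp
  also have "(LINT s|elaw beta. a \<bullet> l s) = (LINT s|elaw beta. a \<bullet> l (stop T s))"
  proof (rule integral_cong_AE)
   show "AE s in elaw beta. a \<bullet> l s = a \<bullet> l (stop T s)"
    using AE_elaw_pos by eventually_elim (use top in \<open>simp add: stop_simps(1)[simplified]\<close>)
   have "(\<lambda>s. l (stop T s)) \<in> borel_measurable borel" by (rule measurable_compose[OF stop_measurable pay_pathD(1)[OF l]])
   then show "(\<lambda>s. a \<bullet> l (stop T s)) \<in> borel_measurable (elaw beta)"
    unfolding measurable_elaw by (intro borel_measurable_inner borel_measurable_const)
  qed (use borel_measurable_integrable[OF ai] in simp)
  finally show ?thesis using top by simp
 qed
qed

end

subsection \<open>The first claim\<close>

text \<open>A reference scenario without claims up to time \<open>t\<close>. Anything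
  non-anticipating that happens before the first claim can be read off from it.\<close>

definition late :: "real \<Rightarrow> 'n::finite claims" where
 "late t k = (t + 1 + real k, 0)"

lemma late_paths: "0 \<le> t ==> late t \<in> claim_paths"
 unfolding claim_paths_iff
proof (intro conjI allI)
 assume t: "0 \<le> t"
 fix N :: nat
 show "\<exists>k. real N \<le> fst (late t k)" using t by (intro exI[of _ N]) (simp add: late_def)
qed (auto simp: late_def)

lemma same_until_no_claims:
 "w \<in> claim_paths ==> w' \<in> claim_paths ==> t < fst (w 0) ==> t < fst (w' 0) ==> same_claims_until t w w'"
proof -
 assume *: "w \<in> claim_paths" "w' \<in> claim_paths" "t < fst (w 0)" "t < fst (w' 0)"
 have a: "t < fst (w k)" for k
  by (rule order_less_le_trans[OF *(3)]) (rule iffD1[OF claim_pathsD(3)[OF *(1)] le0])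
 have b: "t < fst (w' k)" for k
  by (rule order_less_le_trans[OF *(4)]) (rule iffD1[OF claim_pathsD(3)[OF *(2)] le0])
 show ?thesis unfolding same_claims_until_def using not_le[THEN iffD2, OF a] not_le[THEN iffD2, OF b] by blast
qed

lemma same_until_cons:
 "same_claims_until t w w' ==> same_claims_until (s + t) (cons_claim s u w) (cons_claim s u w')"
 unfolding same_claims_until_def
proof (intro allI impI)
 assume *: "\<forall>k. fst (w k) \<le> t \<or> fst (w' k) \<le> t \<longrightarrow> w k = w' k"
 fix k assume k: "fst (cons_claim s u w k) \<le> s + t \<or> fst (cons_claim s u w' k) \<le> s + t"
 show "cons_claim s u w k = cons_claim s u w' k"
 proof (cases k)
  case (Suc j)
  then have "w j = w' j" using k by (intro *[rule_format]) simp
  then show ?thesis by (simp add: Suc)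
 qed simp
qed

lemma same_until_delay:
 "same_claims_until t w w' \<longleftrightarrow> same_claims_until (r + t) (delay r w) (delay r w')"
 unfolding same_claims_until_def by (auto simp: delay_def prod_eq_iff)

lemma nn_integral_ge_integral:
 assumes "integrable N (g :: 'a \<Rightarrow> real)" shows "ennreal (LINT x|N. g x) \<le> (\<integral>\<^sup>+x. ennreal (g x) \<partial>N)"
proof -
 have i: "integrable N (\<lambda>x. max (g x) 0)" using assms by (intro integrable_max) auto
 have "(LINT x|N. g x) \<le> (LINT x|N. max (g x) 0)" by (intro integral_mono assms i) auto
 then have "ennreal (LINT x|N. g x) \<le> ennreal (LINT x|N. max (g x) 0)" by (rule ennreal_leI)
 also have "\<dots> = (\<integral>\<^sup>+x. ennreal (max (g x) 0) \<partial>N)" by (rule nn_integral_eq_integral[OF i, symmetric]) auto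
 also have "\<dots> = (\<integral>\<^sup>+x. ennreal (g x) \<partial>N)" by (intro nn_integral_cong) (auto simp: max_def ennreal_neg)
 finally show ?thesis .
qed

lemma elaw_indicator:
 assumes "0 < b" "0 \<le> h" shows "(LINT s|elaw b. indicator {..<h} s * k) = (1 - exp (- b * h)) * k"
proof -
 interpret E: prob_space "elaw b" using assms by (intro prob_space_exponential_density)
 show ?thesis using elaw_shift(2)[OF assms, of "\<lambda>_. k"] E.prob_space by (simp add: algebra_simps)
qed

lemma stop_min: "0 \<le> q ==> 0 \<le> s ==> T < ennreal s ==> stop T (min q s) = stop T q"
proof -
 assume *: "0 \<le> q" "0 \<le> s" "T < ennreal s"
 have "min (ennreal (min q s)) T = min (ennreal q) T"
 proof (cases "q \<le> s")
  case False
  then have "ennreal s \<le> ennreal q" by (intro ennreal_leI) simp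
  then have "T \<le> ennreal s" "T \<le> ennreal q" using *(3) by auto
  then show ?thesis using False by (simp add: min_absorb2)
 qed (simp add: min_absorb1)
 then show ?thesis by (simp add: stop_def)
qed

context dividend_model
begin

lemma ext_const: "ext_expectation M (\<lambda>_. k) = ereal k"
 by (subst M.ext_expectation_upper[of _ k]) (auto simp: zero_ennreal.rep_eq)

text \<open>A conditional expectation written as a substitution: \<open>E\<close> fixes the first
  claim, or its absence for some time, and \<open>M\<close> governs the remainder of the
  scenario.\<close>

abbreviation "fibre x L T E \<equiv> ext_expectation M (\<lambda>w. payoff x (\<lambda>t. L t (E w)) (T (E w)) (E w))"

text \<open>The hypothesis \<open>inv\<close> transports information: what is known of the remaining
  scenario up to \<open>t\<close> is what is known of the whole one up to \<open>r + t\<close>. The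
  truncated subtraction in \<open>T'\<close> loses nothing since the switch does not precede
  \<open>r\<close>.\<close>

lemma tail_admissible:
 assumes A: "(L, T) \<in> admissible p x" and E: "E \<in> measurable path_space path_space"
  and S: "\<And>w. w \<in> claim_paths ==> shift_rel d r (E w) w"
  and inv: "\<And>t w w'. 0 \<le> t ==> same_claims_until t w w' ==> same_claims_until (r + t) (E w) (E w')"
  and y: "\<And>w. w \<in> claim_paths ==> y = x + r *\<^sub>R p - (\<Sum>k<d. snd (E w k)) - b"
  and b: "\<And>w. w \<in> claim_paths ==> b \<le> L r (E w)"
  and n: "\<And>w j. w \<in> claim_paths ==> j < d ==> \<not> ruin_at p x (\<lambda>t. L t (E w)) (E w) j"
  and T: "\<And>w. w \<in> claim_paths ==> ennreal r \<le> T (E w)"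
 defines "L' \<equiv> \<lambda>t w. if t < 0 then 0 else L (r + t) (E w) - b" and "T' \<equiv> \<lambda>w. T (E w) - ennreal r"
 shows "(L', T') \<in> admissible p y"
 unfolding admissible_iff
proof (intro conjI allI impI ballI)
 have r: "0 \<le> r" using shift_relD(3)[OF S[OF late_paths[of 0]]] by simp
 have Ep: "E w \<in> claim_paths" if "w \<in> claim_paths" for w using shift_relD(1)[OF S[OF that]] .
 note A' = A[unfolded admissible_iff]
 have T': "T (E w) = ennreal r + T' w" if "w \<in> claim_paths" for w
  unfolding T'_def using diff_add_cancel_ennreal[OF T[OF that]] by (simp only: add.commute)
 show "L' t \<in> borel_measurable path_space" if t: "0 \<le> t" for t
 proof -
  have "(\<lambda>w. L (r + t) (E w)) \<in> borel_measurable path_space"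
   using A' r t by (intro measurable_compose[OF E]) auto
  then have "(\<lambda>w. L (r + t) (E w) - b) \<in> borel_measurable path_space" by measurable
  then show ?thesis using t by (simp add: L'_def)
 qed
 show "adapted_at t (L' t)" if t: "0 \<le> t" for t
  unfolding adapted_at_def
 proof (intro ballI impI)
  fix w w' :: "'n claims" assume *: "w \<in> claim_paths" "w' \<in> claim_paths" "same_claims_until t w w'"
  have "adapted_at (r + t) (L (r + t))" using A' r t by auto
  from adapted_atD[OF this Ep[OF *(1)] Ep[OF *(2)] inv[OF t *(3)]] show "L' t w = L' t w'" by (simp add: L'_def)
 qed
 show "good_path p y w (\<lambda>t. L' t w)" if w: "w \<in> claim_paths" for w
  unfolding y[OF w]
  by (rule good_path_tail[OF admissible_good_path[OF A Ep[OF w]] S[OF w] n[OF w] b[OF w]]) (simp_all add: L'_def)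
 show "stopping_time history T'"
  unfolding stopping_time_history_iff
 proof (intro conjI allI impI)
  have "(\<lambda>w. T (E w)) \<in> borel_measurable path_space"
   by (rule measurable_compose[OF E admissible_T_measurable[OF A]])
  then show "T' \<in> borel_measurable path_space" unfolding T'_def by measurable
  fix t :: real assume t: "0 \<le> t"
  show "adapted_at t (\<lambda>w. T' w \<le> ennreal t)"
   unfolding adapted_at_def
  proof (intro ballI impI)
   fix w w' :: "'n claims" assume *: "w \<in> claim_paths" "w' \<in> claim_paths" "same_claims_until t w w'"
   have e: "T' w \<le> ennreal t \<longleftrightarrow> T (E w) \<le> ennreal (r + t)" if "w \<in> claim_paths" for w
    unfolding T'[OF that] using r t by (simp add: ennreal_add_left_cancel_le)
   have "adapted_at (r + t) (\<lambda>w. T w \<le> ennreal (r + t))"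
    using A' r t unfolding stopping_time_history_iff by (simp del: ennreal_plus)
   from adapted_atD[OF this Ep[OF *(1)] Ep[OF *(2)] inv[OF t *(3)]]
   show "(T' w \<le> ennreal t) = (T' w' \<le> ennreal t)" unfolding e[OF *(1)] e[OF *(2)] .
  qed
 qed
qed

text \<open>\<open>P\<close> is the killed value of the dividends up to \<open>r\<close>, with
  \<open>b\<close> kept afterwards. As it does not vary with the scenario, the payoff is an affine
  image of the payoff of the tail.\<close>

lemma tail_value:
 assumes A: "(L, T) \<in> admissible p x" and E: "E \<in> measurable path_space path_space"
  and S: "\<And>w. w \<in> claim_paths ==> shift_rel d r (E w) w"
  and y: "\<And>w. w \<in> claim_paths ==> y = x + r *\<^sub>R p - (\<Sum>k<d. snd (E w k)) - b"
  and n: "\<And>w j. w \<in> claim_paths ==> j < d ==> \<not> ruin_at p x (\<lambda>t. L t (E w)) (E w) j"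
  and A': "(L', T') \<in> admissible p y" and x: "0 \<le> x" "0 \<le> y"
  and L': "\<And>t w. w \<in> claim_paths ==> 0 \<le> t ==> L (r + t) (E w) = b + L' t w"
  and T': "\<And>w. w \<in> claim_paths ==> T (E w) = ennreal r + T' w"
  and pre: "\<And>w. w \<in> claim_paths ==> (LINT q|elaw c. a \<bullet> (if q < r then L q (E w) else b)) = P"
 shows "fibre x L T E = ereal P + ereal (exp (- c * r)) * val y (L', T')"
proof -
 have "fibre x L T E =
  ext_expectation M (\<lambda>w. P + exp (- c * r) * payoff y (\<lambda>t. L' t w) (T' w) w)"
 proof (rule ext_expectation_cong)
  fix w assume "w \<in> space M"
  then have w: "w \<in> claim_paths" by simp
  note D = shift_relD[OF S[OF w]]
  show "payoff x (\<lambda>t. L t (E w)) (T (E w)) (E w) = P + exp (- c * r) * payoff y (\<lambda>t. L' t w) (T' w) w"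
   unfolding pre[OF w, symmetric]
   by (rule payoff_tail[OF S[OF w] admissible_good_path[OF A D(1)] x(1) y[OF w] x(2) admissible_good_path[OF A' w] L'[OF w] n[OF w] T'[OF w]])
 qed
 also have "\<dots> = ereal P + ereal (exp (- c * r)) * ext_expectation M (\<lambda>w. payoff y (\<lambda>t. L' t w) (T' w) w)"
  by (rule M.ext_expectation_affine[of _ "4 * K * h0 y"])
   (auto simp: measurable_M intro: payoff_measurable[OF A'] payoff_bound[OF A' x(2)])
 finally show ?thesis by (simp add: strategy_value_eq[OF A' x(2)])
qed

text \<open>Tower property for upper bounds. The conditional values, possibly
  \<open>-\<infinity>\<close>, enter only through the integrable majorant \<open>\<Psi>\<close>; the
  estimate is made inside the iterated integral of the gap \<open>C - Z\<close>.\<close>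

lemma ext_expectation_le_iterated:
 assumes Z: "Z \<in> borel_measurable path_space" "\<And>w. w \<in> claim_paths ==> Z w \<le> C"
  and ae: "AE s in wait_law. integrable F (\<Psi> s) \<and> (AE u in F. ext_expectation M (\<lambda>w. Z (cons_claim s u w)) \<le> ereal (\<Psi> s u))"
  and I: "integrable wait_law (\<lambda>s. LINT u|F. \<Psi> s u)"
 shows "ext_expectation M Z \<le> ereal (LINT s|wait_law. LINT u|F. \<Psi> s u)"
proof (subst M.ext_expectation_le_iff[of _ C])
 have g: "(\<lambda>w. ennreal (C - Z w)) \<in> borel_measurable path_space" using Z(1) by measurable
 have "ennreal (C - (LINT s|wait_law. LINT u|F. \<Psi> s u)) = ennreal (LINT s|wait_law. C - (LINT u|F. \<Psi> s u))"
  using I E.prob_space by simp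
 also have "\<dots> \<le> (\<integral>\<^sup>+s. ennreal (C - (LINT u|F. \<Psi> s u)) \<partial>wait_law)"
  using I by (intro nn_integral_ge_integral) auto
 also have "\<dots> \<le> (\<integral>\<^sup>+s. \<integral>\<^sup>+u. \<integral>\<^sup>+w. ennreal (C - Z (cons_claim s u w)) \<partial>M \<partial>F \<partial>wait_law)"
 proof (rule nn_integral_mono_AE, use ae wait_pos in eventually_elim)
  fix s :: real
  assume i: "integrable F (\<Psi> s) \<and> (AE u in F. ext_expectation M (\<lambda>w. Z (cons_claim s u w)) \<le> ereal (\<Psi> s u))" and s: "0 < s"
  have "ennreal (C - (LINT u|F. \<Psi> s u)) = ennreal (LINT u|F. C - \<Psi> s u)"
   using i F.prob_space by simp
  also have "\<dots> \<le> (\<integral>\<^sup>+u. ennreal (C - \<Psi> s u) \<partial>F)"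
   using i by (intro nn_integral_ge_integral) auto
  also have "\<dots> \<le> (\<integral>\<^sup>+u. \<integral>\<^sup>+w. ennreal (C - Z (cons_claim s u w)) \<partial>M \<partial>F)"
  proof (rule nn_integral_mono_AE, use conjunct2[OF i] F_nonneg in eventually_elim)
   fix u :: "real^'n"
   assume le: "ext_expectation M (\<lambda>w. Z (cons_claim s u w)) \<le> ereal (\<Psi> s u)" and u: "0 \<le> u"
   show "ennreal (C - \<Psi> s u) \<le> (\<integral>\<^sup>+w. ennreal (C - Z (cons_claim s u w)) \<partial>M)"
   proof (subst M.ext_expectation_le_iff[of _ C, symmetric])
    show "(\<lambda>w. Z (cons_claim s u w)) \<in> borel_measurable M"
     unfolding measurable_M by (rule measurable_comp_cons[OF Z(1) s u])
    show "w \<in> space M ==> Z (cons_claim s u w) \<le> C" for w using Z(2) cons_paths[OF _ s u] by simp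
   qed (rule le)
  qed
  finally show "ennreal (C - (LINT u|F. \<Psi> s u)) \<le> (\<integral>\<^sup>+u. \<integral>\<^sup>+w. ennreal (C - Z (cons_claim s u w)) \<partial>M \<partial>F)" .
 qed
 also have "\<dots> = (\<integral>\<^sup>+w. ennreal (C - Z w) \<partial>M)" by (rule nn_integral_M_cons[OF g, symmetric])
 finally show "ennreal (C - (LINT s|wait_law. LINT u|F. \<Psi> s u)) \<le> (\<integral>\<^sup>+w. ennreal (C - Z w) \<partial>M)" .
qed (use Z in \<open>auto simp: measurable_M\<close>)

text \<open>Dividends run until the earlier of the killing time and the claim, which
  \<open>elaw_min\<close> turns into one clock of rate \<open>beta\<close>; tilting does the same
  for the discounted claim term. The outcome is the left-hand side of
  \<open>path_bound\<close>.\<close>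

lemma first_claim_integral:
 fixes T :: ennreal
 assumes l: "pay_path x l" and m: "mono l" and x: "0 \<le> x" and q: "tame q"
 defines "D \<equiv> \<lambda>s. LINT r|elaw c. a \<bullet> l (stop T (min r s))"
  and "A \<equiv> exp (- c * enn2real T) * f0 (x + enn2real T *\<^sub>R p - l (enn2real T))"
 shows "integrable wait_law (\<lambda>s. D s + (if T < ennreal s then A else exp (- c * s) * q (x + s *\<^sub>R p - l s)))" (is ?I)
  "(LINT s|wait_law. D s + (if T < ennreal s then A else exp (- c * s) * q (x + s *\<^sub>R p - l s))) =
   (LINT s|elaw beta. a \<bullet> l (stop T s)) +
   (if T < \<infinity> then exp (- beta * enn2real T) * f0 (x + enn2real T *\<^sub>R p - l (enn2real T)) else 0) +
   lam / beta * (LINT s|elaw beta. (if ennreal s \<le> T then q (x + s *\<^sub>R p - l s) else 0))" (is ?E)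
proof -
 define G where "G r = a \<bullet> l (stop T r)" for r
 have lsm: "(\<lambda>r. l (stop T r)) \<in> borel_measurable borel" by (rule measurable_compose[OF stop_measurable pay_pathD(1)[OF l]])
 then have Gm [measurable]: "G \<in> borel_measurable borel" unfolding G_def[abs_def] by measurable
 have lp: "pay_path x (\<lambda>r. l (stop T r))"
  unfolding pay_path_def
 proof (intro conjI allI impI lsm)
  fix s :: real assume s: "0 \<le> s"
  show "0 \<le> l (stop T s)" by (intro pay_pathD(2)[OF l]) simp
  have "l (stop T s) \<le> l s" by (rule monoD[OF m stop_le[OF s]])
  also have "\<dots> \<le> x + s *\<^sub>R p" by (rule pay_pathD(3)[OF l s])
  finally show "l (stop T s) \<le> x + s *\<^sub>R p" .
 qed
 have G0: "0 \<le> G r" for r unfolding G_def by (intro a_inner_nonneg pay_pathD(2)[OF l]) simp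
 have Gi: "integrable (elaw beta) G" unfolding G_def[abs_def] by (rule pay_path_inner_integrable[OF lp x])
 have Gle: "AE r in elaw c. G (min r s) \<le> K * h0 x * exp (c / 2 * r)" if s: "0 < s" for s
  using AE_elaw_pos
 proof eventually_elim
  case (elim r)
  have "G (min r s) \<le> K * h0 x * exp (c / 2 * min r s)"
   using inner_growth[of "l (stop T (min r s))" x "min r s"] pay_pathD(2,3)[OF lp, of "min r s"] elim s x by (simp add: G_def)
  also have "\<dots> \<le> K * h0 x * exp (c / 2 * r)"
   using K(1) h0_pos[of x] c_pos by (intro mult_left_mono) auto
  finally show ?case .
 qed
 have Di: "integrable (elaw c) (\<lambda>r. G (min r s))" if s: "0 < s" for s
 proof (rule Bochner_Integration.integrable_bound)
  show "integrable (elaw c) (\<lambda>r. K * h0 x * exp (c / 2 * r))"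
   using elaw_exp(1)[of c "c/2"] c_pos by simp
  show "AE r in elaw c. norm (G (min r s)) \<le> norm (K * h0 x * exp (c / 2 * r))"
   using Gle[OF s] by eventually_elim (use G0 in simp)
 qed measurable
 have Dn: "ennreal (D s) = (\<integral>\<^sup>+r. ennreal (G (min r s)) \<partial>elaw c)" if "0 < s" for s
  unfolding D_def G_def[symmetric] by (rule nn_integral_eq_integral[OF Di[OF that], symmetric]) (simp add: G0)
 have Dm: "D \<in> borel_measurable borel"
  unfolding D_def[abs_def] G_def[symmetric]
  by (intro C.borel_measurable_lebesgue_integral) (simp add: split_beta')
 have hb: "has_bochner_integral wait_law D (LINT s|elaw beta. G s)"
 proof (rule has_bochner_integral_nn_integral)
  show "(\<integral>\<^sup>+s. ennreal (D s) \<partial>wait_law) = ennreal (LINT s|elaw beta. G s)"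
  proof -
   have "(\<integral>\<^sup>+s. ennreal (D s) \<partial>wait_law) = (\<integral>\<^sup>+s. \<integral>\<^sup>+r. ennreal (G (min r s)) \<partial>elaw c \<partial>wait_law)"
    by (rule nn_integral_cong_AE, use wait_pos in eventually_elim) (rule Dn)
   also have "\<dots> = (\<integral>\<^sup>+s. ennreal (G s) \<partial>elaw (c + lam))"
    by (rule elaw_min[OF c_pos lam_pos]) simp
   also have "\<dots> = ennreal (LINT s|elaw beta. G s)"
    unfolding beta_def add.commute[of c] using Gi unfolding beta_def by (intro nn_integral_eq_integral) (auto simp: G0)
   finally show ?thesis .
  qed
  show "0 \<le> (LINT s|elaw beta. G s)" by (intro integral_nonneg_AE AE_I2 G0)
  show "AE s in wait_law. 0 \<le> D s" unfolding D_def G_def[symmetric] by (intro AE_I2 integral_nonneg_AE G0)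
 qed (simp add: Dm)
 let ?A = "\<lambda>s. if T < ennreal s then A else 0"
 let ?B = "\<lambda>s. exp (- c * s) * (if ennreal s \<le> T then q (x + s *\<^sub>R p - l s) else 0)"
 let ?q = "\<lambda>s. if ennreal s \<le> T then q (x + s *\<^sub>R p - l s) else 0"
 have qm: "(\<lambda>s. q (x + s *\<^sub>R p - l s)) \<in> borel_measurable borel"
  by (rule measurable_compose[OF pay_path_surplus(1)[OF l] tame_measurable[OF q]])
 have qm': "?q \<in> borel_measurable borel" using qm by measurable
 have qi: "integrable (elaw beta) ?q"
  by (rule Bochner_Integration.integrable_bound[OF pay_path_q_integrable[OF l q]]) (use qm' in auto)
 have Ai: "integrable wait_law ?A" by (rule E.integrable_const_bound[of _ "\<bar>A\<bar>"]) auto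
 have e: "- (beta - lam) = - c" by (simp add: beta_def)
 have Bi: "integrable wait_law ?B" "(LINT s|wait_law. ?B s) = lam / beta * (LINT s|elaw beta. ?q s)"
  using elaw_tilt[OF lam_pos beta_pos(1) qm'] qi unfolding e by auto
 have AI: "(LINT s|wait_law. ?A s) = (if T < \<infinity> then exp (- beta * enn2real T) * f0 (x + enn2real T *\<^sub>R p - l (enn2real T)) else 0)"
 proof (cases T)
  case (real t)
  have "(LINT s|wait_law. ?A s) = (LINT s|wait_law. A - indicator {..<t} s * A)"
  proof (rule integral_cong_AE)
   show "AE s in wait_law. ?A s = A - indicator {..<t} s * A"
    using AE_elaw_pos AE_elaw[OF AE_lborel_singleton[of t]]
    by eventually_elim (use real in \<open>auto simp: ennreal_less_iff indicator_def\<close>)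
  qed auto
  also have "\<dots> = (LINT s|wait_law. A) - (LINT s|wait_law. indicator {..<t} s * A)"
   by (intro Bochner_Integration.integral_diff indicator_integrable E.integrable_const) simp
  also have "\<dots> = A - (1 - exp (- lam * t)) * A"
   unfolding elaw_indicator[OF lam_pos real(1), of A] using E.prob_space by simp
  also have "\<dots> = exp (- lam * t) * A" by (simp add: algebra_simps)
  also have "\<dots> = (exp (- lam * t) * exp (- c * t)) * f0 (x + t *\<^sub>R p - l t)" using real by (simp add: A_def)
  also have "exp (- lam * t) * exp (- c * t) = exp (- beta * t)" by (simp add: beta_def mult_exp_exp algebra_simps)
  finally show ?thesis using real by simp
 next
  case top then show ?thesis by simp
 qed
 have eq: "(\<lambda>s. D s + (if T < ennreal s then A else exp (- c * s) * q (x + s *\<^sub>R p - l s))) = (\<lambda>s. D s + (?A s + ?B s))"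
 proof
  fix s
  show "D s + (if T < ennreal s then A else exp (- c * s) * q (x + s *\<^sub>R p - l s)) = D s + (?A s + ?B s)"
   by (cases "T < ennreal s") (auto simp: not_less)
 qed
 show ?I unfolding eq using hb Ai Bi(1) by (intro Bochner_Integration.integrable_add) (auto simp: has_bochner_integral_iff)
 have "(LINT s|wait_law. D s + (?A s + ?B s)) = (LINT s|wait_law. D s) + ((LINT s|wait_law. ?A s) + (LINT s|wait_law. ?B s))"
  using hb Ai Bi(1) by (subst Bochner_Integration.integral_add) (auto simp: has_bochner_integral_iff intro!: Bochner_Integration.integral_add)
 then show ?E unfolding eq AI Bi(2) using hb by (simp add: has_bochner_integral_iff G_def)
qed

end

definition first_path :: "'n::finite dividends \<Rightarrow> real \<Rightarrow> real^'n" where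
 "first_path L t = (if t < 0 then 0 else L t (late t))"

text \<open>A switch before the first claim cannot depend on the scenario, so the set has at most
  one element. Its infimum is that common time, or \<open>\<infinity>\<close> if no scenario
  switches before its first claim.\<close>

definition first_time :: "('n::finite claims \<Rightarrow> ennreal) \<Rightarrow> ennreal" where
 "first_time T = Inf {T w | w. w \<in> claim_paths \<and> T w < ennreal (fst (w 0))}"

lemma late_0 [simp]: "fst (late t 0) = t + 1" by (simp add: late_def)

lemma first_timeD:
 assumes T: "stopping_time history T" and w: "w \<in> claim_paths"
 shows "T w < ennreal (fst (w 0)) ==> T w = first_time T"
  "first_time T < ennreal (fst (w 0)) ==> T w = first_time T"
proof -
 have eq: "T w2 = T w1" if "w1 \<in> claim_paths" "w2 \<in> claim_paths" "T w1 < ennreal (fst (w1 0))" "T w1 < ennreal (fst (w2 0))" for w1 w2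
 proof -
  note h = that
  obtain t where t: "T w1 = ennreal t" "0 \<le> t" using h(3) by (cases "T w1") auto
  then have "same_claims_until t w1 w2"
   using that claim_pathsD(1) by (intro same_until_no_claims) (auto simp: ennreal_less_iff)
  then show ?thesis using t by (intro stopping_time_eq[OF T that(1,2)]) auto
 qed
 have eq': "T w2 = T w1" if "w1 \<in> claim_paths" "w2 \<in> claim_paths" "T w1 < ennreal (fst (w1 0))" "T w2 < ennreal (fst (w2 0))" for w1 w2
 proof (cases "T w1 \<le> T w2")
  case True
  then show ?thesis using that by (intro eq) (auto intro: le_less_trans)
 next
  case False
  then show ?thesis using that by (intro eq[symmetric]) (auto intro: less_trans)
 qed
 let ?S = "{T w | w. w \<in> claim_paths \<and> T w < ennreal (fst (w 0))}"
 have S: "first_time T = T w1" if "w1 \<in> claim_paths" "T w1 < ennreal (fst (w1 0))" for w1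
 proof -
  have "?S = {T w1}" using that eq'[OF that(1) _ that(2)] by blast
  then show ?thesis by (simp add: first_time_def)
 qed
 show "T w < ennreal (fst (w 0)) ==> T w = first_time T" using S[OF w] by simp
 assume lt: "first_time T < ennreal (fst (w 0))"
 have "?S \<noteq> {}"
 proof
  assume "?S = {}"
  then have "first_time T = \<infinity>" unfolding first_time_def by (simp only: Inf_empty) simp
  then show False using lt by simp
 qed
 then obtain w1 where "w1 \<in> claim_paths" "T w1 < ennreal (fst (w1 0))" by blast
 then show "T w = first_time T" using eq[OF _ w] S lt by simp
qed

context dividend_model
begin

lemma before_first_claim:
 assumes A: "(L, T) \<in> admissible p x" and w: "w \<in> claim_paths" and t: "t < fst (w 0)"
 shows "L t w = first_path L t"
proof (cases "t < 0")
 case True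
 then show ?thesis using good_pathD(1)[OF admissible_good_path[OF A w]] by (simp add: first_path_def)
next
 case False
 then have t0: "0 \<le> t" by simp
 have "adapted_at t (L t)" using A t0 unfolding admissible_iff by blast
 from adapted_atD[OF this w late_paths[OF t0] same_until_no_claims[OF w late_paths[OF t0] t]]
 show ?thesis using False by (simp add: first_path_def)
qed

lemma first_path:
 assumes A: "(L, T) \<in> admissible p x"
 shows "pay_path x (first_path L)" "mono (first_path L)"
proof -
 have eq: "first_path L t = L t (late s)" if "0 \<le> s" "t < s + 1" for t s
  using before_first_claim[OF A late_paths[OF that(1)], of t] that by simp
 note g = admissible_good_path[OF A late_paths]
 show mo: "mono (first_path L)"
 proof
  fix s t :: real assume "s \<le> t"
  then show "first_path L s \<le> first_path L t"
   using eq[of "max t 0" s] eq[of "max t 0" t] monoD[OF good_pathD(4)[OF g[of "max t 0"]], of s t] by simp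
 qed
 show "pay_path x (first_path L)"
  unfolding pay_path_def
 proof (intro conjI allI impI mono_vec_measurable mo)
  fix s :: real assume s: "0 \<le> s"
  show "0 \<le> first_path L s" using good_pathD(5)[OF g[OF s], of s] eq[OF s] by simp
  show "first_path L s \<le> x + s *\<^sub>R p" using good_path_le[OF late_paths[OF s] g[OF s] p_nonneg s] eq[OF s] by simp
 qed
qed

text \<open>The dividend at the claim time may react to the claim, its left limit cannot. At
  continuity points of the claim-free path the left limit is the value of that path; the exceptional
  times are countable and the claim time has a density.\<close>

lemma first_left_limit:
 assumes A: "(L, T) \<in> admissible p x" and w: "w \<in> claim_paths" and c: "isCont (first_path L) (fst (w 0))"
 shows "left_limit (\<lambda>t. L t w) (fst (w 0)) = first_path L (fst (w 0))"
  "first_path L (fst (w 0)) \<le> L (fst (w 0)) w"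
proof -
 let ?s = "fst (w 0)"
 have "(first_path L \<longlongrightarrow> first_path L ?s) (at_left ?s)"
  using c unfolding isCont_def by (rule filterlim_mono[OF _ order_refl at_le]) simp
 moreover have "eventually (\<lambda>t. first_path L t = L t w) (at_left ?s)"
  by (rule eventually_at_leftI[of "?s - 1"]) (use before_first_claim[OF A w] in auto)
 ultimately have lim: "((\<lambda>t. L t w) \<longlongrightarrow> first_path L ?s) (at_left ?s)"
  by (rule Lim_transform_eventually)
 then show "left_limit (\<lambda>t. L t w) ?s = first_path L ?s" by (rule left_limitI)
 have "eventually (\<lambda>t. L t w \<le> L ?s w) (at_left ?s)"
  by (rule eventually_at_leftI[of "?s - 1"]) (use monoD[OF good_pathD(4)[OF admissible_good_path[OF A w]]] in auto)
 then show "first_path L ?s \<le> L ?s w" by (rule tendsto_upperbound_vec[OF lim]) simp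
qed

lemma first_pre_claim:
 assumes w: "w \<in> claim_paths" and l: "left_limit l (fst (w 0)) = m"
 shows "pre_claim p x l w 0 = x + fst (w 0) *\<^sub>R p - m"
proof -
 have "claim_count w (fst (w 0)) = 1"
  by (rule claim_count_eqI[OF w]) (use claim_pathsD(3)[OF w, of _ 0] in auto)
 then show ?thesis by (simp add: pre_claim_def surplus_def l)
qed

text \<open>Either the switch precedes the claim, or the claim ruins, or the remainder is an
  admissible strategy from \<open>x + s *\<^sub>R p - l s - u\<close>, to which the bound
  \<open>V\<close> applies. In the last case only \<open>l s\<close> counts as paid; a payment at
  the claim time belongs to the remainder.\<close>

lemma first_claim_value:
 assumes A: "(L, T) \<in> admissible p x" and x: "0 \<le> x" and s: "0 < s" and u: "0 \<le> u" and cont: "isCont (first_path L) s"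
  and V: "\<And>y \<pi>. 0 \<le> y ==> \<pi> \<in> admissible p y ==> val y \<pi> \<le> ereal (vf y)"
 defines "l \<equiv> first_path L" and "T1 \<equiv> first_time T"
 shows "fibre x L T (cons_claim s u) \<le>
  ereal ((LINT r|elaw c. a \<bullet> l (stop T1 (min r s))) +
   (if T1 < ennreal s then exp (- c * enn2real T1) * f0 (x + enn2real T1 *\<^sub>R p - l (enn2real T1))
   else exp (- c * s) * psi vf (x + s *\<^sub>R p - l s) u))"
proof -
 let ?E = "cons_claim s u"
 define D where "D = (LINT r|elaw c. a \<bullet> l (stop T1 (min r s)))"
 define y where "y = x + s *\<^sub>R p - l s"
 have y0: "0 \<le> y" unfolding y_def l_def by (rule pay_path_surplus(2)[OF first_path(1)[OF A]]) (use s in simp)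
 have st: "stopping_time history T" using A unfolding admissible_iff by blast
 have Ep: "?E w \<in> claim_paths" if "w \<in> claim_paths" for w using that s u by (rule cons_paths)
 have g: "good_path p x (?E w) (\<lambda>t. L t (?E w))" if "w \<in> claim_paths" for w
  by (rule admissible_good_path[OF A Ep[OF that]])
 have ll: "left_limit (\<lambda>t. L t (?E w)) s = l s" "l s \<le> L s (?E w)" if "w \<in> claim_paths" for w
  using first_left_limit[OF A Ep[OF that]] cont by (auto simp: l_def)
 have bf: "L t (?E w) = l t" if "w \<in> claim_paths" "t < s" for w t
  using before_first_claim[OF A Ep[OF that(1)], of t] that by (simp add: l_def)
 have pc: "pre_claim p x (\<lambda>t. L t (?E w)) (?E w) 0 = y" if "w \<in> claim_paths" for w
  using first_pre_claim[OF Ep[OF that], of "\<lambda>t. L t (?E w)" "l s"] ll(1)[OF that] by (simp add: y_def)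
 have ru: "ruin_at p x (\<lambda>t. L t (?E w)) (?E w) 0 \<longleftrightarrow> \<not> u \<le> y" if "w \<in> claim_paths" for w
  using pc[OF that] by (simp add: ruin_at_def)
 have m1: "(\<lambda>r. a \<bullet> l (stop T1 (min r s))) \<in> borel_measurable (elaw c)"
 proof -
  have "(\<lambda>r. l (stop T1 (min r s))) \<in> borel_measurable borel" unfolding l_def
   by (rule measurable_compose[OF measurable_compose[OF _ stop_measurable] mono_vec_measurable[OF first_path(2)[OF A]]]) measurable
  then show ?thesis
   unfolding measurable_elaw by (rule borel_measurable_inner[OF borel_measurable_const])
 qed
 show ?thesis
 proof (cases "T1 < ennreal s")
  case True
  define t where "t = enn2real T1"
  have t: "T1 = ennreal t" "0 \<le> t" "t < s"
  proof -
   obtain r where r: "T1 = ennreal r" "0 \<le> r" using True by (cases T1) auto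
   then have "t = r" by (simp add: t_def)
   then show "T1 = ennreal t" "0 \<le> t" "t < s" using r True by (simp_all add: ennreal_less_iff)
  qed
  have "payoff x (\<lambda>t. L t (?E w)) (T (?E w)) (?E w) = D + exp (- c * t) * f0 (x + t *\<^sub>R p - l t)" if w: "w \<in> claim_paths" for w
  proof -
   have T: "T (?E w) = T1" using first_timeD(2)[OF st Ep[OF w]] True by (simp add: T1_def)
   have R: "T1 < path_ruin p x (\<lambda>t. L t (?E w)) (?E w)"
    using path_ruin_pos[OF Ep[OF w], of p x "\<lambda>t. L t (?E w)"] True by (auto intro: less_le_trans)
   have "div_value (\<lambda>t. L t (?E w)) T1 = D"
    unfolding div_value_def D_def
   proof (rule integral_cong_AE)
    show "AE r in elaw c. a \<bullet> L (stop T1 r) (?E w) = a \<bullet> l (stop T1 (min r s))"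
     using AE_elaw_pos
    proof eventually_elim
     case (elim r)
     have "stop T1 (min r s) = stop T1 r" using elim s True by (intro stop_min) auto
     moreover have "stop T1 r \<le> t" using elim t by (simp add: stop_simps)
     ultimately show ?case using bf[OF w, of "stop T1 r"] t by simp
    qed
    show "(\<lambda>r. a \<bullet> L (stop T1 r) (?E w)) \<in> borel_measurable (elaw c)"
     by (rule borel_measurable_integrable[OF dividend_integrable[OF Ep[OF w] g[OF w] x]])
   qed (rule m1)
   moreover have "surplus p x (?E w) t = x + t *\<^sub>R p" using surplus_before[OF Ep[OF w]] t by simp
   moreover have "\<not> path_ruin p x (\<lambda>t. L t (?E w)) (?E w) \<le> T1" using R by simp
   ultimately show ?thesis using R bf[OF w t(3)] by (simp add: payoff_def gain_def loss_def T t_def[symmetric])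
  qed
  then have "fibre x L T ?E =
   ereal (D + exp (- c * t) * f0 (x + t *\<^sub>R p - l t))"
   using ext_const by (subst ext_expectation_cong[where Y="\<lambda>_. D + exp (- c * t) * f0 (x + t *\<^sub>R p - l t)"]) auto
  then show ?thesis using True by (simp add: D_def t_def)
 next
  case False
  then have T1s: "ennreal s \<le> T1" by simp
  have Ts: "ennreal s \<le> T (?E w)" if w: "w \<in> claim_paths" for w
   using first_timeD(1)[OF st Ep[OF w]] False by (cases "T (?E w) < ennreal s") (auto simp: T1_def)
  have Ps: "a \<bullet> l (stop T1 (min q s)) = a \<bullet> (if q < s then l q else l s)" if "0 < q" for q
  proof -
   have "ennreal (min q s) \<le> T1" using order_trans[OF ennreal_leI[of "min q s" s] T1s] by simp
   then have "stop T1 (min q s) = min q s" using that s by (intro stop_before) auto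
   then show ?thesis by (auto simp: min_def)
  qed
  have m2: "(\<lambda>q. a \<bullet> (if q < s then l q else l s)) \<in> borel_measurable (elaw c)"
   unfolding measurable_elaw l_def
   by (intro borel_measurable_inner[OF borel_measurable_const] measurable_If mono_vec_measurable[OF first_path(2)[OF A]]) auto
  have pre: "(LINT q|elaw c. a \<bullet> (if q < s then L q (?E w) else l s)) = D" if w: "w \<in> claim_paths" for w
  proof -
   have "(\<lambda>q. a \<bullet> (if q < s then L q (?E w) else l s)) = (\<lambda>q. a \<bullet> (if q < s then l q else l s))"
    using bf[OF w] by auto
   then show ?thesis
    unfolding D_def by (simp only:) (rule integral_cong_AE[OF m2 m1], use AE_elaw_pos[of c] in eventually_elim, simp add: Ps)
  qed
  show ?thesis
  proof (cases "u \<le> y")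
   case ruin: False
   have "payoff x (\<lambda>t. L t (?E w)) (T (?E w)) (?E w) = D - exp (- c * s) * pen0 y u" if w: "w \<in> claim_paths" for w
   proof -
    let ?l = "\<lambda>t. L t (?E w)"
    have r0: "ruin_at p x ?l (?E w) 0" using ru[OF w] ruin by simp
    then have R: "path_ruin p x ?l (?E w) = ennreal s" using path_ruin_eq[OF Ep[OF w] r0] by simp
    have i: "ruin_index x ?l (?E w) = 0" unfolding ruin_index_def using r0 by (intro Least_eq_0)
    have "div_value ?l (T (?E w)) = (LINT q|elaw c. a \<bullet> (if q < s then L q (?E w) else l s))"
     unfolding div_value_def
    proof (rule integral_cong_AE)
     show "AE q in elaw c. a \<bullet> L (stop (T (?E w)) q) (?E w) = a \<bullet> (if q < s then L q (?E w) else l s)"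
      using AE_elaw_pos
     proof eventually_elim
      case (elim q)
      show ?case
      proof (cases "q < s")
       case True
       have "ennreal q \<le> T (?E w)" using order_trans[OF ennreal_leI[of q s] Ts[OF w]] True by simp
       then show ?thesis using True elim by (simp add: stop_before)
      next
       case False
       \<comment> \<open>A killing time after the ruinous claim finds the dividends frozen at their
         left limit \<open>l s\<close>, whatever the switch time is.\<close>
       then have "ennreal s \<le> min (ennreal q) (T (?E w))" using Ts[OF w] by (simp add: ennreal_leI)
       then have "path_ruin p x ?l (?E w) \<le> ennreal (stop (T (?E w)) q)" unfolding R ennreal_stop .
       then have "?l (stop (T (?E w)) q) = left_limit ?l s"
        using good_pathD(7)[OF g[OF w], of "stop (T (?E w)) q"] R s by simp
       then show ?thesis using ll(1)[OF w] False by simp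
      qed
     qed
     show "(\<lambda>q. a \<bullet> (if q < s then L q (?E w) else l s)) \<in> borel_measurable (elaw c)"
     proof -
      have "(\<lambda>q. a \<bullet> (if q < s then L q (?E w) else l s)) = (\<lambda>q. a \<bullet> (if q < s then l q else l s))"
       using bf[OF w] by auto
      then show ?thesis using m2 by simp
     qed
    qed (rule borel_measurable_integrable[OF dividend_integrable[OF Ep[OF w] g[OF w] x]])
    then show ?thesis
     using Ts[OF w] s by (simp add: payoff_def gain_def loss_def R i pc[OF w] pre[OF w])
   qed
   then have "fibre x L T ?E = ereal (D - exp (- c * s) * pen0 y u)"
    using ext_const by (subst ext_expectation_cong[where Y="\<lambda>_. D - exp (- c * s) * pen0 y u"]) auto
   then show ?thesis using False ruin by (simp add: D_def y_def psi_def)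
  next
   case surv: True
   define L' where "L' = (\<lambda>t w. if t < 0 then 0 else L (s + t) (?E w) - l s)"
   define T' where "T' = (\<lambda>w. T (?E w) - ennreal s)"
   have Em: "?E \<in> measurable path_space path_space" by (rule measurable_cons[OF s u])
   have S: "shift_rel 1 s (?E w) w" if "w \<in> claim_paths" for w by (rule shift_rel_cons[OF that s u])
   have yy: "y - u = x + s *\<^sub>R p - (\<Sum>k<1. snd (?E w k)) - l s" for w by (simp add: y_def)
   have nr: "\<not> ruin_at p x (\<lambda>t. L t (?E w)) (?E w) j" if "w \<in> claim_paths" "j < 1" for w j
    using ru[OF that(1)] that(2) surv by simp
   have A': "(L', T') \<in> admissible p (y - u)"
    unfolding L'_def T'_def
    by (rule tail_admissible[OF A Em S same_until_cons yy ll(2) nr Ts])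
   have "fibre x L T ?E = ereal D + ereal (exp (- c * s)) * val (y - u) (L', T')"
   proof (rule tail_value[OF A Em S yy nr A' x _ _ _ pre])
    show "0 \<le> y - u" using surv by simp
    show "L (s + t) (?E w) = l s + L' t w" if "0 \<le> t" for t w using that by (simp add: L'_def)
    show "T (?E w) = ennreal s + T' w" if "w \<in> claim_paths" for w
     unfolding T'_def using diff_add_cancel_ennreal[OF Ts[OF that]] by (simp only: add.commute)
   qed
   also have "\<dots> \<le> ereal D + ereal (exp (- c * s)) * ereal (vf (y - u))"
    using surv by (intro add_left_mono ereal_mult_left_mono V A') auto
   finally show ?thesis using False surv by (simp add: D_def y_def psi_def)
  qed
 qed
qed

text \<open>One step of the iteration over claims: a bound \<open>vf\<close> valid for all
  strategies may be replaced by any supersolution relative to \<open>Q vf\<close>, since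
  \<open>vf\<close> is only used after the first claim.\<close>

lemma first_claim_bound:
 assumes A: "(L, T) \<in> admissible p x" and x: "0 \<le> x" and w: "tame vf"
  and V: "\<And>y \<pi>. 0 \<le> y ==> \<pi> \<in> admissible p y ==> val y \<pi> \<le> ereal (vf y)"
  and S: "supersol W (Q vf)"
 shows "val x (L, T) \<le> ereal (W x)"
proof -
 let ?l = "first_path L" and ?T = "first_time T"
 note l = first_path[OF A]
 define D where "D s = (LINT r|elaw c. a \<bullet> ?l (stop ?T (min r s)))" for s
 define A' where "A' = exp (- c * enn2real ?T) * f0 (x + enn2real ?T *\<^sub>R p - ?l (enn2real ?T))"
 define \<Psi> where "\<Psi> s u = D s + (if ?T < ennreal s then A' else exp (- c * s) * psi vf (x + s *\<^sub>R p - ?l s) u)" for s u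
 have \<Psi>: "integrable F (\<Psi> s)" "(LINT u|F. \<Psi> s u) = D s + (if ?T < ennreal s then A' else exp (- c * s) * Q vf (x + s *\<^sub>R p - ?l s))"
  if "0 < s" for s
 proof -
  have i: "integrable F (psi vf (x + s *\<^sub>R p - ?l s))"
   using that by (intro psi_integrable[OF w] pay_path_surplus(2)[OF l(1)]) simp
  show "integrable F (\<Psi> s)" unfolding \<Psi>_def[abs_def] using i by (cases "?T < ennreal s") auto
  show "(LINT u|F. \<Psi> s u) = D s + (if ?T < ennreal s then A' else exp (- c * s) * Q vf (x + s *\<^sub>R p - ?l s))"
   unfolding \<Psi>_def Q_def using i F.prob_space by (cases "?T < ennreal s") auto
 qed
 note I = first_claim_integral[OF l x Q_tame[OF w], of ?T, folded D_def A'_def]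
 have m1: "(\<lambda>s. LINT u|F. \<Psi> s u) \<in> borel_measurable wait_law"
 proof -
  have "D \<in> borel_measurable borel"
   unfolding D_def[abs_def]
   using measurable_compose[OF stop_measurable mono_vec_measurable[OF l(2)]]
   by (intro C.borel_measurable_lebesgue_integral) (simp add: split_beta')
  moreover have "(\<lambda>x. \<Psi> (fst x) (snd x)) \<in> borel_measurable (borel \<Otimes>\<^sub>M F)"
  proof -
   have 1: "(\<lambda>x. D (fst x)) \<in> borel_measurable (borel \<Otimes>\<^sub>M F)" using calculation by measurable
   have "(\<lambda>z::real \<times> (real^'n). x + fst z *\<^sub>R p - ?l (fst z)) \<in> borel_measurable (borel \<Otimes>\<^sub>M F)"
    by (rule measurable_compose[OF measurable_fst pay_path_surplus(1)[OF l(1)]])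
   then have 2: "(\<lambda>z. psi vf (x + fst z *\<^sub>R p - ?l (fst z)) (snd z)) \<in> borel_measurable (borel \<Otimes>\<^sub>M F)"
    by (rule psi_measurable_pair(2)[OF w]) (simp add: measurable_F[symmetric])
   show ?thesis unfolding \<Psi>_def using 1 2 by measurable
  qed
  then show ?thesis
   unfolding measurable_elaw by (intro F.borel_measurable_lebesgue_integral) (simp add: split_beta')
 qed
 have ae: "AE s in wait_law. (LINT u|F. \<Psi> s u) = D s + (if ?T < ennreal s then A' else exp (- c * s) * Q vf (x + s *\<^sub>R p - ?l s))"
  using wait_pos by eventually_elim (rule \<Psi>(2))
 have "val x (L, T) = ext_expectation M (\<lambda>w. payoff x (\<lambda>t. L t w) (T w) w)" by (rule strategy_value_eq[OF A x])
 also have "\<dots> \<le> ereal (LINT s|wait_law. LINT u|F. \<Psi> s u)"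
 proof (rule ext_expectation_le_iterated[OF payoff_measurable[OF A] payoff_bound[OF A x]])
  show "AE s in wait_law. integrable F (\<Psi> s) \<and>
   (AE u in F. fibre x L T (cons_claim s u) \<le> ereal (\<Psi> s u))"
   using wait_pos AE_elaw[OF mono_vec_isCont_AE[OF l(2)], of lam]
  proof eventually_elim
   case (elim s)
   have "AE u in F. fibre x L T (cons_claim s u) \<le> ereal (\<Psi> s u)"
    using F_nonneg
    by eventually_elim (unfold \<Psi>_def D_def A'_def, rule first_claim_value[OF A x elim(1) _ elim(2) V])
   then show ?case using \<Psi>(1)[OF elim(1)] by simp
  qed
  show "integrable wait_law (\<lambda>s. LINT u|F. \<Psi> s u)"
   using I(1) ae m1 by (subst integrable_cong_AE[OF m1 borel_measurable_integrable[OF I(1)] ae])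
 qed
 also have "(LINT s|wait_law. LINT u|F. \<Psi> s u) =
   (LINT s|wait_law. D s + (if ?T < ennreal s then A' else exp (- c * s) * Q vf (x + s *\<^sub>R p - ?l s)))"
  by (rule integral_cong_AE[OF m1 borel_measurable_integrable[OF I(1)] ae])
 also have "\<dots> \<le> W x" unfolding I(2) by (rule path_bound[OF S x l])
 finally show ?thesis by simp
qed

section \<open>The contraction in the weight and the verification theorem\<close>

definition theta where "theta = lam / (lam + c / 2)"

lemma theta: "0 < theta" "theta < 1" using lam_pos c_pos by (auto simp: theta_def)

text \<open>\<open>theta * h0 x\<close> is the value of waiting for the first claim and then
  receiving the weight of the surplus: \<open>lam / beta\<close> times the mean
  \<open>beta / (beta - c / 2)\<close> of \<open>exp (c / 2 * s)\<close>, times \<open>h0 x\<close>.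
  The identity is the dynamic programming equation of this value, an equality for every
  \<open>h\<close>.\<close>

lemma wait_h0:
 assumes h: "0 \<le> h"
 shows "exp (- beta * h) * (theta * h0 (x + h *\<^sub>R p)) + lam / beta * (LINT s|elaw beta. indicator {..<h} s * h0 (x + s *\<^sub>R p)) = theta * h0 x"
proof -
 have g: "beta - c / 2 = lam + c / 2" "0 < lam + c / 2" using lam_pos c_pos by (auto simp: beta_def)
 define e where "e = exp (- beta * h)"
 define k where "k = exp (c / 2 * h)"
 have "(LINT s|elaw beta. exp (c / 2 * s)) = (LINT s|elaw beta. indicator {..<h} s * exp (c / 2 * s)) + e * (LINT s|elaw beta. exp (c / 2 * (h + s)))"
  unfolding e_def by (rule elaw_shift(2)[OF beta_pos(1) h elaw_beta_growth(1)])
 also have "(LINT s|elaw beta. exp (c / 2 * (h + s))) = k * (LINT s|elaw beta. exp (c / 2 * s))"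
  by (simp add: k_def distrib_left exp_add)
 finally have "beta / (lam + c / 2) = (LINT s|elaw beta. indicator {..<h} s * exp (c / 2 * s)) + e * (k * (beta / (lam + c / 2)))"
  unfolding elaw_beta_growth(2) g .
 then have 0: "beta / (lam + c / 2) = (LINT s|elaw beta. indicator {..<h} s * exp (c / 2 * s)) + e * (k * (beta / (lam + c / 2)))" .
 have *: "X = J + e * (k * X) ==> J = X * (1 - e * k)" for X J :: real by (simp add: algebra_simps)
 have 1: "(LINT s|elaw beta. indicator {..<h} s * exp (c / 2 * s)) = beta / (lam + c / 2) * (1 - e * k)" by (rule *[OF 0])
 have "(LINT s|elaw beta. indicator {..<h} s * h0 (x + s *\<^sub>R p)) = (LINT s|elaw beta. h0 x * (indicator {..<h} s * exp (c / 2 * s)))"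
  by (simp add: h0_shift mult_ac)
 also have "\<dots> = h0 x * (beta / (lam + c / 2) * (1 - e * k))" by (subst 1[symmetric]) simp
 finally have 2: "lam / beta * (LINT s|elaw beta. indicator {..<h} s * h0 (x + s *\<^sub>R p)) = theta * (h0 x * (1 - e * k))"
  using beta_pos(1) by (simp add: theta_def)
 show ?thesis unfolding 2 unfolding h0_shift e_def[symmetric] k_def[symmetric] by (simp add: algebra_simps)
qed

lemma Q_add_h0:
 assumes w: "tame vf" and y: "0 \<le> y" and D: "0 \<le> D"
 shows "Q (\<lambda>z. vf z + D * h0 z) y \<le> Q vf y + D * h0 y"
proof -
 have i: "integrable F (\<lambda>u. if u \<le> y then h0 (y - u) else 0)" by (rule shifted_integrable[OF tame_h0])
 have "Q (\<lambda>z. vf z + D * h0 z) y = (LINT u|F. psi vf y u + D * (if u \<le> y then h0 (y - u) else 0))"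
  unfolding Q_def by (rule Bochner_Integration.integral_cong) (auto simp: psi_def)
 also have "\<dots> = Q vf y + D * (LINT u|F. (if u \<le> y then h0 (y - u) else 0))"
  unfolding Q_def using psi_integrable[OF w y] i by simp
 also have "(LINT u|F. (if u \<le> y then h0 (y - u) else 0)) \<le> (LINT u|F. h0 y)"
 proof (rule integral_mono_AE[OF i])
  show "AE u in F. (if u \<le> y then h0 (y - u) else 0) \<le> h0 y"
   using F_nonneg by eventually_elim (use h0_pos[of y] in \<open>auto intro!: h0_mono simp: less_imp_le\<close>)
 qed simp
 also have "(LINT u|F. h0 y) = h0 y" using F.prob_space by simp
 finally show ?thesis using D by (simp add: mult_left_mono)
qed

lemma wait_integrable:
 assumes "tame q" "0 \<le> x" shows "integrable (elaw beta) (\<lambda>s. indicator {..<h} s * q (x + s *\<^sub>R p))"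
 using indicator_integrable[OF pay_path_q_integrable[of x "\<lambda>_. 0", OF _ assms(1)], of "{..<h}"] assms(2)
 by (auto simp: pay_path_def orthant_path)

text \<open>\<open>theta * D * h0\<close> solves the waiting equation with claim term
  \<open>D * h0\<close>, and it increases with the surplus. Hence an error \<open>D * h0\<close>
  after the claim costs only \<open>theta * D * h0\<close> before it.\<close>

lemma supersol_add_h0:
 assumes S: "supersol W (Q W)" and D: "0 \<le> D"
 shows "supersol (\<lambda>x. W x + theta * D * h0 x) (Q (\<lambda>x. W x + D * h0 x))"
proof -
 note S' = S[unfolded supersol_def]
 have tW: "tame W" using S' by blast
 have tD: "tame (\<lambda>x. W x + D * h0 x)" by (rule tame_add[OF tW tame_h0])
 have nn: "0 \<le> theta * D" using theta(1) D by simp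
 show ?thesis
  unfolding supersol_def
 proof (intro conjI allI impI)
  show "tame (\<lambda>x. W x + theta * D * h0 x)" by (rule tame_add[OF tW tame_h0])
  show "tame (Q (\<lambda>x. W x + D * h0 x))" by (rule Q_tame[OF tD])
  obtain C where C: "\<And>x. 0 \<le> x ==> - C \<le> W x" using S' by blast
  have "- C \<le> W x + theta * D * h0 x" if "0 \<le> x" for x
   using C[OF that] nn h0_pos[of x] by (smt (verit) mult_nonneg_nonneg)
  then show "\<exists>C. \<forall>x\<ge>0. - C \<le> W x + theta * D * h0 x" by blast
  fix x :: "real^'n" assume x: "0 \<le> x"
  show "f x \<le> W x + theta * D * h0 x" using S' x nn h0_pos[of x] by (smt (verit) mult_nonneg_nonneg)
  { fix z :: "real^'n" assume z: "0 \<le> z"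
   have "a \<bullet> z + W x \<le> W (x + z)" using S' x z by blast
   moreover have "theta * D * h0 x \<le> theta * D * h0 (x + z)" using z nn by (intro mult_left_mono h0_mono) auto
   ultimately show "a \<bullet> z + (W x + theta * D * h0 x) \<le> W (x + z) + theta * D * h0 (x + z)" by simp }
  { fix h :: real assume h: "0 \<le> h"
   let ?I = "\<lambda>q. LINT s|elaw beta. indicator {..<h} s * q (x + s *\<^sub>R p)"
   have iW: "integrable (elaw beta) (\<lambda>s. indicator {..<h} s * Q W (x + s *\<^sub>R p))" by (rule wait_integrable[OF Q_tame[OF tW] x])
   have ih: "integrable (elaw beta) (\<lambda>s. indicator {..<h} s * h0 (x + s *\<^sub>R p))" by (rule wait_integrable[OF tame_h0 x])
   have "?I (Q (\<lambda>x. W x + D * h0 x)) \<le> (LINT s|elaw beta. indicator {..<h} s * Q W (x + s *\<^sub>R p) + D * (indicator {..<h} s * h0 (x + s *\<^sub>R p)))"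
   proof (rule integral_mono_AE)
    show "AE s in elaw beta. indicator {..<h} s * Q (\<lambda>x. W x + D * h0 x) (x + s *\<^sub>R p) \<le> indicator {..<h} s * Q W (x + s *\<^sub>R p) + D * (indicator {..<h} s * h0 (x + s *\<^sub>R p))"
     using AE_elaw_pos
    proof eventually_elim
     case (elim s)
     then show ?case using Q_add_h0[OF tW orthant_path[OF x, of s] D] by (simp add: indicator_def)
    qed
   qed (use iW ih wait_integrable[OF Q_tame[OF tD] x] in auto)
   also have "\<dots> = ?I (Q W) + D * ?I h0" using iW ih by simp
   finally have "lam / beta * ?I (Q (\<lambda>x. W x + D * h0 x)) \<le> lam / beta * (?I (Q W) + D * ?I h0)"
    using lam_pos beta_pos(1) by (intro mult_left_mono) auto
   moreover have "exp (- beta * h) * W (x + h *\<^sub>R p) + lam / beta * ?I (Q W) \<le> W x" using S' x h unfolding wait_value_def by blast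
   moreover have "D * (exp (- beta * h) * (theta * h0 (x + h *\<^sub>R p)) + lam / beta * ?I h0) = D * (theta * h0 x)"
    unfolding wait_h0[OF h] ..
   ultimately show "wait_value (\<lambda>x. W x + theta * D * h0 x) (Q (\<lambda>x. W x + D * h0 x)) h x \<le> W x + theta * D * h0 x"
    unfolding wait_value_def by (simp add: algebra_simps) }
 qed
qed

theorem verification:
 assumes S: "supersol W (Q W)" and x: "0 \<le> x" and \<pi>: "\<pi> \<in> admissible p x"
 shows "val x \<pi> \<le> ereal (W x)"
proof -
 note S' = S[unfolded supersol_def]
 obtain C where C: "\<And>x. 0 \<le> x ==> - C \<le> W x" using S' by blast
 \<comment> \<open>\<open>4 * K * h0\<close> bounds every value, and the summand
   \<open>\<bar>C\<bar>\<close> makes up for \<open>W\<close> being possibly as low as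
   \<open>- C\<close>; since \<open>h0\<close> is at least 1, \<open>W + D * h0\<close> is an
   initial bound.\<close>
 define D where "D = 4 * K + \<bar>C\<bar>"
 have D0: "0 \<le> D" using K(1) by (simp add: D_def)
 have *: "\<forall>y \<pi>. 0 \<le> y \<longrightarrow> \<pi> \<in> admissible p y \<longrightarrow> val y \<pi> \<le> ereal (W y + theta ^ n * D * h0 y)" for n
 proof (induction n)
  case 0
  show ?case
  proof (intro allI impI)
   fix y :: "real^'n" and \<pi> assume y: "0 \<le> y" and \<pi>: "\<pi> \<in> admissible p y"
   obtain L T where LT: "\<pi> = (L, T)" by (cases \<pi>)
   have A: "(L, T) \<in> admissible p y" using \<pi> LT by simp
   have "val y \<pi> \<le> ereal (4 * K * h0 y)"
    unfolding LT strategy_value_eq[OF A y]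
    by (subst M.ext_expectation_le_iff[of _ "4 * K * h0 y"])
     (auto simp: measurable_M intro: payoff_measurable[OF A] payoff_bound[OF A y])
   also have "4 * K * h0 y \<le> W y + D * h0 y"
   proof -
    have "\<bar>C\<bar> * 1 \<le> \<bar>C\<bar> * h0 y" using h0_ge_1[OF y] by (intro mult_left_mono) auto
    then show ?thesis using C[OF y] by (simp add: D_def distrib_right)
   qed
   finally show "val y \<pi> \<le> ereal (W y + theta ^ 0 * D * h0 y)" by simp
  qed
 next
  case (Suc n)
  define D' where "D' = theta ^ n * D"
  have D': "0 \<le> D'" using D0 theta(1) by (simp add: D'_def)
  have tD: "tame (\<lambda>x. W x + D' * h0 x)" using S' by (intro tame_add tame_h0) blast
  show ?case
  proof (intro allI impI)
   fix y :: "real^'n" and \<pi> assume y: "0 \<le> y" and \<pi>: "\<pi> \<in> admissible p y"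
   obtain L T where LT: "\<pi> = (L, T)" by (cases \<pi>)
   have A: "(L, T) \<in> admissible p y" using \<pi> LT by simp
   have "val y (L, T) \<le> ereal (W y + theta * D' * h0 y)"
    by (rule first_claim_bound[OF A y tD _ supersol_add_h0[OF S D']]) (use Suc in \<open>auto simp: D'_def\<close>)
   then show "val y \<pi> \<le> ereal (W y + theta ^ Suc n * D * h0 y)" by (simp add: LT D'_def mult.assoc)
  qed
 qed
 have "(\<lambda>n. ereal (W x + theta ^ n * D * h0 x)) \<longlonglongrightarrow> ereal (W x + 0 * D * h0 x)"
  using theta by (intro tendsto_intros LIMSEQ_realpow_zero) auto
 then have "val x \<pi> \<le> ereal (W x + 0 * D * h0 x)"
  by (rule LIMSEQ_le_const) (use * x \<pi> in blast)
 then show ?thesis by simp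
qed

end

subsection \<open>Grid strategies\<close>

lemma next_claim_count: "w \<in> claim_paths ==> next_claim w t = claim_count w t"
 by (simp add: next_claim_def claim_count_Least)

lemma next_claim_gt: "w \<in> claim_paths ==> t < fst (w (next_claim w t))"
 using claim_count_iff[of w "claim_count w t" t] by (simp add: next_claim_count)

lemma next_claim_first: "w \<in> claim_paths ==> t < fst (w 0) ==> next_claim w t = 0"
 unfolding next_claim_def by (rule Least_eq_0)

definition shift_state :: "real \<Rightarrow> (real \<times> 'b) option \<Rightarrow> (real \<times> 'b) option" where
 "shift_state r = map_option (\<lambda>(t, m). (r + t, m))"

lemma shift_state_simps [simp]: "shift_state r None = None" "shift_state r (Some (t, m)) = Some (r + t, m)"
 by (auto simp: shift_state_def)

lemma shift_state_eq_Some: "shift_state r z = Some (t, m) \<longleftrightarrow> (\<exists>t'. z = Some (t', m) \<and> t = r + t')"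
 by (cases z) (auto simp: shift_state_def)

context
 fixes p :: "real^'n::finite" and \<delta> :: real
begin

lemma next_claim_shift:
 assumes S: "shift_rel d r w w'" and t: "0 \<le> t"
 shows "fst (w (next_claim w (r + t))) = r + fst (w' (next_claim w' t))"
  "snd (w (next_claim w (r + t))) = snd (w' (next_claim w' t))"
  "post_claim p \<delta> w (r + t) m = post_claim p \<delta> w' t m"
proof -
 note D = shift_relD[OF S]
 have n: "next_claim w (r + t) = next_claim w' t + d"
  by (simp add: next_claim_count[OF D(1)] next_claim_count[OF D(2)] claim_count_shift[OF S t])
 show "fst (w (next_claim w (r + t))) = r + fst (w' (next_claim w' t))"
  "snd (w (next_claim w (r + t))) = snd (w' (next_claim w' t))" unfolding n D(4,5) by simp_all
 then show "post_claim p \<delta> w (r + t) m = post_claim p \<delta> w' t m" by (simp add: post_claim_def)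
qed

lemma action_shift:
 assumes S: "shift_rel d r w w'" and t: "0 \<le> t"
 shows "action_end p \<delta> w act (r + t, m) = shift_state r (action_end p \<delta> w' act (t, m))"
  "action_dividend p \<delta> w act (r + t, m) = action_dividend p \<delta> w' act (t, m)"
 by (cases act; simp add: next_claim_shift[OF S t])+

lemma action_end_time:
 assumes "w \<in> claim_paths" "0 < \<delta>" "action_end p \<delta> w act (t, m) = Some (t', m')"
 shows "t \<le> t'"
 using assms next_claim_gt[OF assms(1), of t] by (cases act) (auto split: if_splits)

lemma grid_state_time:
 assumes w: "w \<in> claim_paths" and d: "0 < \<delta>"
 shows "grid_state p \<delta> m w \<sigma> k = Some (t, m') ==> 0 \<le> t"
proof (induction k arbitrary: t m')
 case (Suc k)
 then obtain t0 m0 where 0: "grid_state p \<delta> m w \<sigma> k = Some (t0, m0)" "action_end p \<delta> w (\<sigma> k) (t0, m0) = Some (t, m')"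
  by (cases "grid_state p \<delta> m w \<sigma> k") auto
 show ?case using Suc.IH[OF 0(1)] action_end_time[OF w d 0(2)] by simp
qed simp

text \<open>An action depends on the past only through the elapsed time and the grid index. After
  the first action the remaining sequence therefore runs as a fresh one in the restarted scenario,
  with its clock set back by \<open>r\<close>.\<close>

lemma grid_state_tail:
 assumes S: "shift_rel d r w w'" and d: "0 < \<delta>" and e: "action_end p \<delta> w (\<sigma> 0) (0, m) = Some (r, m1)"
 shows "grid_state p \<delta> m w \<sigma> (Suc k) = shift_state r (grid_state p \<delta> m1 w' (\<lambda>k. \<sigma> (Suc k)) k)"
proof (induction k)
 case 0
 then show ?case using e by simp
next
 case (Suc k)
 show ?case
 proof (cases "grid_state p \<delta> m1 w' (\<lambda>k. \<sigma> (Suc k)) k")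
  case None
  then show ?thesis using Suc by simp
 next
  case (Some z)
  obtain t m' where z: "z = (t, m')" by (cases z)
  have t: "0 \<le> t" using grid_state_time[OF shift_relD(2)[OF S] d] Some z by simp
  have "grid_state p \<delta> m w \<sigma> (Suc (Suc k)) = action_end p \<delta> w (\<sigma> (Suc k)) (r + t, m')"
   using Suc Some z by simp
  also have "\<dots> = shift_state r (action_end p \<delta> w' (\<sigma> (Suc k)) (t, m'))" by (rule action_shift(1)[OF S t])
  finally show ?thesis using Some z by simp
 qed
qed

lemma grid_state_stop:
 "action_end p \<delta> w (\<sigma> 0) (0, m) = None ==> grid_state p \<delta> m w \<sigma> (Suc k) = None"
 by (induction k) auto

definition allowed_along where
 "allowed_along m w \<sigma> \<longleftrightarrow> (\<forall>k t m' i. grid_state p \<delta> m w \<sigma> k = Some (t, m') \<and> \<sigma> k = Pay i \<longrightarrow> 0 < m' $ i)"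

lemma allowed_actions_along: "allowed_actions p \<delta> m s \<longleftrightarrow> (\<forall>w\<in>claim_paths. allowed_along m w (s w))"
 by (auto simp: allowed_actions_def allowed_along_def)

lemma allowed_along_tail:
 assumes S: "shift_rel d r w w'" and d: "0 < \<delta>" and e: "action_end p \<delta> w (\<sigma> 0) (0, m) = Some (r, m1)"
 shows "allowed_along m w \<sigma> \<longleftrightarrow> (\<forall>i. \<sigma> 0 = Pay i \<longrightarrow> 0 < m $ i) \<and> allowed_along m1 w' (\<lambda>k. \<sigma> (Suc k))"
proof -
 have "allowed_along m w \<sigma> \<longleftrightarrow> (\<forall>i. \<sigma> 0 = Pay i \<longrightarrow> 0 < m $ i) \<and>
  (\<forall>k t m' i. grid_state p \<delta> m w \<sigma> (Suc k) = Some (t, m') \<and> \<sigma> (Suc k) = Pay i \<longrightarrow> 0 < m' $ i)"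
  unfolding allowed_along_def
 proof (intro iffI conjI allI impI)
  fix i assume *: "\<forall>k t m' i. grid_state p \<delta> m w \<sigma> k = Some (t, m') \<and> \<sigma> k = Pay i \<longrightarrow> 0 < m' $ i" and "\<sigma> 0 = Pay i"
  then show "0 < m $ i" using *[rule_format, of 0 0 m i] by simp
 next
  fix k t m' i assume *: "(\<forall>i. \<sigma> 0 = Pay i \<longrightarrow> 0 < m $ i) \<and>
   (\<forall>k t m' i. grid_state p \<delta> m w \<sigma> (Suc k) = Some (t, m') \<and> \<sigma> (Suc k) = Pay i \<longrightarrow> 0 < m' $ i)"
   and k: "grid_state p \<delta> m w \<sigma> k = Some (t, m') \<and> \<sigma> k = Pay i"
  then show "0 < m' $ i" by (cases k) (auto simp del: grid_state.simps(2))
 qed blast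
 also have "(\<forall>k t m' i. grid_state p \<delta> m w \<sigma> (Suc k) = Some (t, m') \<and> \<sigma> (Suc k) = Pay i \<longrightarrow> 0 < m' $ i) \<longleftrightarrow>
  allowed_along m1 w' (\<lambda>k. \<sigma> (Suc k))"
  unfolding grid_state_tail[where \<sigma>=\<sigma>, OF assms] shift_state_eq_Some allowed_along_def by blast
 finally show ?thesis .
qed

lemma allowed_along_stop:
 assumes "action_end p \<delta> w (\<sigma> 0) (0, m) = None"
 shows "allowed_along m w \<sigma>"
 unfolding allowed_along_def
proof (intro allI impI)
 fix k t m' i assume "grid_state p \<delta> m w \<sigma> k = Some (t, m') \<and> \<sigma> k = Pay i"
 then show "0 < m' $ i" using assms grid_state_stop[where \<sigma>=\<sigma>, OF assms, of "k - 1"] by (cases k) (auto simp del: grid_state.simps(2))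
qed

definition indices where
 "indices m w \<sigma> t = {k. \<exists>t' m'. grid_state p \<delta> m w \<sigma> (Suc k) = Some (t', m') \<and> t' \<le> t}"

text \<open>A \<open>Wait\<close> advances the clock by \<open>\<delta>\<close> or passes a claim, and consecutive payments decrease the
 grid index.\<close>

lemma finite_indices:
 assumes w: "w \<in> claim_paths" and d: "0 < \<delta>" and al: "allowed_along m w \<sigma>"
 shows "finite (indices m w \<sigma> t)"
proof (rule ccontr)
 assume inf: "infinite (indices m w \<sigma> t)"
 have stp: "\<exists>t0 m0. grid_state p \<delta> m w \<sigma> k = Some (t0, m0) \<and> t0 \<le> t1" if st1: "grid_state p \<delta> m w \<sigma> (Suc k) = Some (t1, m1)" for k t1 m1
 proof -
  obtain t0 m0 where 0: "grid_state p \<delta> m w \<sigma> k = Some (t0, m0)" "action_end p \<delta> w (\<sigma> k) (t0, m0) = Some (t1, m1)"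
   using st1 by (cases "grid_state p \<delta> m w \<sigma> k") auto
  then show ?thesis using action_end_time[OF w d 0(2)] by blast
 qed
 have down: "\<exists>t0 m0. grid_state p \<delta> m w \<sigma> j = Some (t0, m0) \<and> t0 \<le> t" if "j \<le> k" "\<exists>t1 m1. grid_state p \<delta> m w \<sigma> k = Some (t1, m1) \<and> t1 \<le> t" for j k
  using that
 proof (induction rule: inc_induct)
  case (step n)
  then obtain t1 m1 where 1: "grid_state p \<delta> m w \<sigma> (Suc n) = Some (t1, m1)" "t1 \<le> t" by blast
  from stp[OF 1(1)] obtain t0 m0 where "grid_state p \<delta> m w \<sigma> n = Some (t0, m0)" "t0 \<le> t1" by blast
  with 1(2) show ?case by (intro exI[of _ t0] exI[of _ m0]) simp
 qed
 have ex: "\<exists>t0 m0. grid_state p \<delta> m w \<sigma> j = Some (t0, m0) \<and> t0 \<le> t" for j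
 proof -
  obtain k where "j \<le> k" "k \<in> indices m w \<sigma> t" using inf unfolding infinite_nat_iff_unbounded_le by blast
  then show ?thesis by (intro down[of j "Suc k"]) (auto simp: indices_def)
 qed
 define \<tau> where "\<tau> j = fst (the (grid_state p \<delta> m w \<sigma> j))" for j
 define \<mu> where "\<mu> j = snd (the (grid_state p \<delta> m w \<sigma> j))" for j
 have st: "grid_state p \<delta> m w \<sigma> j = Some (\<tau> j, \<mu> j)" "\<tau> j \<le> t" for j
  using ex[of j] by (auto simp: \<tau>_def \<mu>_def)
 have \<tau>0: "0 \<le> \<tau> j" for j using grid_state_time[OF w d st(1)] .
 have act: "action_end p \<delta> w (\<sigma> j) (\<tau> j, \<mu> j) = Some (\<tau> (Suc j), \<mu> (Suc j))" for j
  using st(1)[of "Suc j"] st(1)[of j] by simp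
 \<comment> \<open>A potential counting full periods of length \<open>\<delta>\<close> and claims.
   It never decreases, grows at every \<open>Wait\<close> and is bounded up to time
   \<open>t\<close>, so from some action on only payments remain.\<close>
 define \<phi> where "\<phi> j = nat \<lfloor>\<tau> j / \<delta>\<rfloor> + claim_count w (\<tau> j)" for j
 have cc: "claim_count w u \<le> claim_count w v" if "u \<le> v" for u v
 proof (rule ccontr)
  assume "\<not> claim_count w u \<le> claim_count w v"
  then have "fst (w (claim_count w v)) \<le> u" using claim_count_iff[OF w] by simp
  then have "fst (w (claim_count w v)) \<le> v" using that by simp
  then show False using claim_count_iff[OF w] by simp
 qed
 have le: "\<tau> j \<le> \<tau> (Suc j)" for j by (rule action_end_time[OF w d act])
 have fl: "nat \<lfloor>u / \<delta>\<rfloor> \<le> nat \<lfloor>v / \<delta>\<rfloor>" if "u \<le> v" for u v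
  using that d by (intro nat_mono floor_mono divide_right_mono) auto
 have \<phi>_mono: "\<phi> j \<le> \<phi> (Suc j)" for j unfolding \<phi>_def using le cc fl by (intro add_mono) auto
 have \<phi>_wait: "\<phi> j < \<phi> (Suc j)" if "\<sigma> j = Wait" for j
 proof (cases "\<tau> (Suc j) = \<tau> j + \<delta>")
  case True
  have "\<lfloor>\<tau> (Suc j) / \<delta>\<rfloor> = \<lfloor>\<tau> j / \<delta>\<rfloor> + 1" using d by (simp add: True add_divide_distrib)
  moreover have "0 \<le> \<lfloor>\<tau> j / \<delta>\<rfloor>" using \<tau>0 d by simp
  ultimately have "nat \<lfloor>\<tau> j / \<delta>\<rfloor> < nat \<lfloor>\<tau> (Suc j) / \<delta>\<rfloor>" by simp
  then show ?thesis unfolding \<phi>_def by (rule add_less_le_mono[OF _ cc[OF le]])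
 next
  case False
  then have "\<tau> (Suc j) = fst (w (next_claim w (\<tau> j)))"
   using act[of j] that by (auto split: if_splits)
  then have "next_claim w (\<tau> j) < claim_count w (\<tau> (Suc j))" using claim_count_iff[OF w, of "next_claim w (\<tau> j)" "\<tau> (Suc j)"] by simp
  then show ?thesis unfolding \<phi>_def using fl[OF le[of j]] by (simp add: next_claim_count[OF w])
 qed
 have \<phi>_bd: "\<phi> j \<le> nat \<lfloor>t / \<delta>\<rfloor> + claim_count w t" for j unfolding \<phi>_def using st(2) cc fl by (intro add_mono) auto
 have "range \<phi> \<subseteq> {..nat \<lfloor>t / \<delta>\<rfloor> + claim_count w t}" using \<phi>_bd by auto
 then have fin: "finite (range \<phi>)" by (rule finite_subset) simp
 then have "Max (range \<phi>) \<in> range \<phi>" by (intro Max_in) auto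
 then obtain J where "Max (range \<phi>) = \<phi> J" by auto
 then have J: "\<And>j. \<phi> j \<le> \<phi> J" using Max_ge[OF fin] by (metis rangeI)
 have "\<phi> J \<le> \<phi> j" if "J \<le> j" for j using that by (induction rule: dec_induct) (auto intro: order_trans[OF _ \<phi>_mono])
 then have nw: "\<sigma> j \<noteq> Wait" if "J \<le> j" for j using \<phi>_wait[of j] J[of "Suc j"] that by (meson leD order_trans)
 have dec: "(\<Sum>i\<in>UNIV. \<mu> (Suc j) $ i) < (\<Sum>i\<in>UNIV. \<mu> j $ i)" if jJ: "J \<le> j" for j
 proof -
  obtain i where i: "\<sigma> j = Pay i" using nw[OF jJ] act[of j] by (cases "\<sigma> j") auto
  have "0 < \<mu> j $ i" using al st(1)[of j] i unfolding allowed_along_def by blast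
  moreover have "\<mu> (Suc j) = \<mu> j - axis i 1" using act[of j] i by simp
  ultimately show ?thesis by (intro sum_strict_mono_ex1) (auto simp: axis_def)
 qed
 have "(\<Sum>i\<in>UNIV. \<mu> (J + n) $ i) + n \<le> (\<Sum>i\<in>UNIV. \<mu> J $ i)" for n
 proof (induction n)
  case (Suc n)
  then show ?case using dec[of "J + n"] by simp
 qed simp
 from this[of "Suc (\<Sum>i\<in>UNIV. \<mu> J $ i)"] show False by simp
qed

lemma grid_dividends_path: "grid_dividends p \<delta> m s t w = grid_dividends p \<delta> m (\<lambda>_. s w) t w"
 by (simp add: grid_dividends_def)

lemma grid_switch_time_path: "grid_switch_time p \<delta> m s w = grid_switch_time p \<delta> m (\<lambda>_. s w) w"
 by (simp add: grid_switch_time_def)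

lemma grid_dividends_indices:
 "grid_dividends p \<delta> m (\<lambda>_. \<sigma>) t w = (\<Sum>k\<in>indices m w \<sigma> t. action_dividend p \<delta> w (\<sigma> k) (the (grid_state p \<delta> m w \<sigma> k)))"
 by (simp add: grid_dividends_def indices_def)

lemma grid_dividends_tail:
 assumes S: "shift_rel d r w w'" and d: "0 < \<delta>" and e: "action_end p \<delta> w (\<sigma> 0) (0, m) = Some (r, m1)"
  and al: "allowed_along m w \<sigma>"
 shows "0 \<le> t ==> grid_dividends p \<delta> m (\<lambda>_. \<sigma>) (r + t) w =
   action_dividend p \<delta> w (\<sigma> 0) (0, m) + grid_dividends p \<delta> m1 (\<lambda>_ k. \<sigma> (Suc k)) t w'"
  "t < r ==> grid_dividends p \<delta> m (\<lambda>_. \<sigma>) t w = 0"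
proof -
 note D = shift_relD[OF S]
 let ?\<sigma> = "\<lambda>k. \<sigma> (Suc k)"
 have al': "allowed_along m1 w' ?\<sigma>" using allowed_along_tail[where \<sigma>=\<sigma>, OF S d e] al by blast
 note tail = grid_state_tail[where \<sigma>=\<sigma>, OF S d e]
 {
  assume t: "0 \<le> t"
  have I: "indices m w \<sigma> (r + t) = insert 0 (Suc ` indices m1 w' ?\<sigma> t)"
  proof -
   have "k \<in> indices m w \<sigma> (r + t) \<longleftrightarrow> k = 0 \<or> (\<exists>j. k = Suc j \<and> j \<in> indices m1 w' ?\<sigma> t)" for k
   proof (cases k)
    case 0
    then show ?thesis using tail[of 0] t by (simp add: indices_def)
   next
    case (Suc j)
    then show ?thesis unfolding indices_def mem_Collect_eq Suc tail shift_state_eq_Some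
     by (auto simp del: grid_state.simps(2))
   qed
   then show ?thesis by auto
  qed
  have "(\<Sum>k\<in>Suc ` indices m1 w' ?\<sigma> t. action_dividend p \<delta> w (\<sigma> k) (the (grid_state p \<delta> m w \<sigma> k))) =
   (\<Sum>k\<in>indices m1 w' ?\<sigma> t. action_dividend p \<delta> w (\<sigma> (Suc k)) (the (grid_state p \<delta> m w \<sigma> (Suc k))))"
   by (rule sum.reindex_cong[of Suc]) (auto simp del: grid_state.simps(2))
  also have "\<dots> = (\<Sum>k\<in>indices m1 w' ?\<sigma> t. action_dividend p \<delta> w' (?\<sigma> k) (the (grid_state p \<delta> m1 w' ?\<sigma> k)))"
  proof (rule sum.cong[OF refl])
   fix k assume "k \<in> indices m1 w' ?\<sigma> t"
   then obtain t' m' where z: "grid_state p \<delta> m1 w' ?\<sigma> k = Some (t', m')"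
    unfolding indices_def by (cases "grid_state p \<delta> m1 w' ?\<sigma> k") auto
   show "action_dividend p \<delta> w (\<sigma> (Suc k)) (the (grid_state p \<delta> m w \<sigma> (Suc k))) = action_dividend p \<delta> w' (?\<sigma> k) (the (grid_state p \<delta> m1 w' ?\<sigma> k))"
    unfolding tail z using action_shift(2)[OF S grid_state_time[OF D(2) d z]] by simp
  qed
  finally show "grid_dividends p \<delta> m (\<lambda>_. \<sigma>) (r + t) w =
   action_dividend p \<delta> w (\<sigma> 0) (0, m) + grid_dividends p \<delta> m1 (\<lambda>_ k. \<sigma> (Suc k)) t w'"
   \<comment> \<open>A sum over an infinite index set would be 0 by convention; finiteness is what
     allows the first term to be split off.\<close>
   unfolding grid_dividends_indices I using finite_indices[OF D(2) d al', of t]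
   by (subst sum.insert) auto
 }
 assume t: "t < r"
 have "indices m w \<sigma> t = {}"
  unfolding indices_def tail shift_state_eq_Some using grid_state_time[OF D(2) d] t by fastforce
 then show "grid_dividends p \<delta> m (\<lambda>_. \<sigma>) t w = 0" by (simp add: grid_dividends_indices)
qed

lemma grid_dividends_stop:
 assumes "action_end p \<delta> w (\<sigma> 0) (0, m) = None"
 shows "grid_dividends p \<delta> m (\<lambda>_. \<sigma>) t w = 0"
 unfolding grid_dividends_indices indices_def grid_state_stop[where \<sigma>=\<sigma>, OF assms] by simp

lemma grid_switch_time_tail:
 assumes S: "shift_rel d r w w'" and d: "0 < \<delta>" and e: "action_end p \<delta> w (\<sigma> 0) (0, m) = Some (r, m1)"
 shows "grid_switch_time p \<delta> m (\<lambda>_. \<sigma>) w = ennreal r + grid_switch_time p \<delta> m1 (\<lambda>_ k. \<sigma> (Suc k)) w'"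
proof -
 note D = shift_relD[OF S]
 let ?\<sigma> = "\<lambda>k. \<sigma> (Suc k)"
 note tail = grid_state_tail[where \<sigma>=\<sigma>, OF S d e]
 let ?A = "{ennreal t | t k m'. grid_state p \<delta> m w \<sigma> k = Some (t, m') \<and> \<sigma> k = Switch}"
 let ?B = "{ennreal t | t k m'. grid_state p \<delta> m1 w' ?\<sigma> k = Some (t, m') \<and> ?\<sigma> k = Switch}"
 have s0: "\<sigma> 0 \<noteq> Switch" using e by auto
 have "?A = (\<lambda>z. ennreal r + z) ` ?B"
 proof safe
  fix t k m' assume k: "grid_state p \<delta> m w \<sigma> k = Some (t, m')" "\<sigma> k = Switch"
  then obtain j where j: "k = Suc j" using s0 by (cases k) auto
  then obtain t' where t': "grid_state p \<delta> m1 w' ?\<sigma> j = Some (t', m')" "t = r + t'"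
   using k(1) unfolding j tail shift_state_eq_Some by blast
  then have "ennreal t = ennreal r + ennreal t'" using grid_state_time[OF D(2) d t'(1)] D(3) by simp
  moreover have "ennreal t' \<in> ?B" using t' k j by blast
  ultimately show "ennreal t \<in> (\<lambda>z. ennreal r + z) ` ?B" by blast
 next
  fix t k m' assume k: "grid_state p \<delta> m1 w' ?\<sigma> k = Some (t, m')" "\<sigma> (Suc k) = Switch"
  have "ennreal r + ennreal t = ennreal (r + t)" using grid_state_time[OF D(2) d k(1)] D(3) by simp
  moreover have "grid_state p \<delta> m w \<sigma> (Suc k) = Some (r + t, m')" unfolding tail k by simp
  ultimately show "\<exists>ta k m'. ennreal r + ennreal t = ennreal ta \<and> grid_state p \<delta> m w \<sigma> k = Some (ta, m') \<and> \<sigma> k = Switch"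
   using k(2) by blast
 qed
 then have "grid_switch_time p \<delta> m (\<lambda>_. \<sigma>) w = Inf ((\<lambda>z. ennreal r + z) ` ?B)"
  by (simp add: grid_switch_time_def)
 also have "\<dots> = ennreal r + Inf ?B"
 proof (cases "?B = {}")
  case True
  then show ?thesis by (simp only: image_empty Inf_empty) simp
 next
  case False
  then show ?thesis
   by (intro continuous_at_Inf_mono[symmetric]) (auto intro!: monoI add_left_mono continuous_intros)
 qed
 finally show ?thesis by (simp add: grid_switch_time_def)
qed

lemma grid_switch_time_stop:
 assumes "action_end p \<delta> w (\<sigma> 0) (0, m) = None"
 shows "grid_switch_time p \<delta> m (\<lambda>_. \<sigma>) w = (if \<sigma> 0 = Switch then 0 else \<infinity>)"
proof -
 have "{ennreal t | t k m'. grid_state p \<delta> m w \<sigma> k = Some (t, m') \<and> \<sigma> k = Switch} = (if \<sigma> 0 = Switch then {0} else {})"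
 proof (intro set_eqI iffI)
  fix z assume "z \<in> {ennreal t | t k m'. grid_state p \<delta> m w \<sigma> k = Some (t, m') \<and> \<sigma> k = Switch}"
  then obtain t k m' where k: "z = ennreal t" "grid_state p \<delta> m w \<sigma> k = Some (t, m')" "\<sigma> k = Switch" by blast
  then have "k = 0" using grid_state_stop[where \<sigma>=\<sigma>, OF assms, of "k - 1"] by (cases k) (auto simp del: grid_state.simps(2))
  then show "z \<in> (if \<sigma> 0 = Switch then {0} else {})" using k by auto
 next
  fix z assume "z \<in> (if \<sigma> 0 = Switch then {0::ennreal} else {})"
  then have "z = ennreal 0" "grid_state p \<delta> m w \<sigma> 0 = Some (0, m)" "\<sigma> 0 = Switch" by (auto split: if_splits)
  then show "z \<in> {ennreal t | t k m'. grid_state p \<delta> m w \<sigma> k = Some (t, m') \<and> \<sigma> k = Switch}" by blast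
 qed
 then show ?thesis by (simp add: grid_switch_time_def)
qed

end

section \<open>Values of grid strategies, decomposed by the first action\<close>

locale grid_model = dividend_model lam F p a c \<upsilon> f for lam and F :: "(real^'n::finite) measure" and p a c \<upsilon> f +
 fixes \<delta> :: real
 assumes \<delta>_pos: "0 < \<delta>"
begin

abbreviation "G \<equiv> grid_point p \<delta>"
abbreviation "\<rho> \<equiv> grid_index p \<delta>"
abbreviation "fl \<equiv> grid_floor p \<delta>"
abbreviation "strat \<equiv> grid_strategies p \<delta>"

lemma G_nth: "G m $ i = p $ i * \<delta> * real (m $ i)" by (simp add: grid_point_def)

lemma G_nonneg: "0 \<le> G m"
 using p_pos \<delta>_pos by (auto simp: less_eq_vec_def G_nth less_imp_le)

lemma G_add1: "G (m + 1) = G m + \<delta> *\<^sub>R p"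
 by (simp add: vec_eq_iff G_nth algebra_simps)

lemma G_pay: "0 < m $ i ==> G (m - axis i 1) = G m - axis i (p $ i * \<delta>)"
 by (auto simp: vec_eq_iff G_nth axis_def of_nat_diff algebra_simps)

lemma rho_G: "\<rho> (G m) = m"
 using p_pos \<delta>_pos by (auto simp: grid_index_def vec_eq_iff G_nth less_imp_neq[symmetric])

lemma rho_nth: "real (\<rho> x $ i) \<le> x $ i / (\<delta> * p $ i)" "x $ i / (\<delta> * p $ i) < real (\<rho> x $ i) + 1" if "0 \<le> x"
proof -
 have "0 \<le> x $ i / (\<delta> * p $ i)" using that p_pos[of i] \<delta>_pos by (auto simp: less_eq_vec_def)
 then show "real (\<rho> x $ i) \<le> x $ i / (\<delta> * p $ i)" "x $ i / (\<delta> * p $ i) < real (\<rho> x $ i) + 1"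
  by (auto simp: grid_index_def)
qed

lemma fl_nth: "fl x $ i \<le> x $ i" "x $ i < fl x $ i + p $ i * \<delta>" if "0 \<le> x"
 using rho_nth[OF that, of i] p_pos[of i] \<delta>_pos
 by (auto simp: grid_floor_def G_nth pos_le_divide_eq pos_divide_less_eq algebra_simps)

lemma fl_le: "0 \<le> x ==> fl x \<le> x" using fl_nth by (auto simp: less_eq_vec_def)

lemma fl_nonneg: "0 \<le> fl x" unfolding grid_floor_def by (rule G_nonneg)

text \<open>Extends a grid function as \<open>grid_value\<close> does: the surplus exceeding the
  grid point below is paid at once. The value 0 off the orthant yields a Borel function on the whole
  space.\<close>

definition lift :: "(nat^'n \<Rightarrow> real) \<Rightarrow> real^'n \<Rightarrow> real" where
 "lift vf x = (if 0 \<le> x then vf (\<rho> x) + a \<bullet> (x - fl x) else 0)"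

lemma lift_G [simp]: "lift vf (G m) = vf m"
 by (simp add: lift_def grid_floor_def rho_G G_nonneg)

definition tail_L :: "('n claims \<Rightarrow> 'n claims) \<Rightarrow> real \<Rightarrow> real^'n \<Rightarrow> 'n dividends \<Rightarrow> 'n dividends" where
 "tail_L E r b L = (\<lambda>t w. if t < 0 then 0 else L (r + t) (E w) - b)"

definition tail_T :: "('n claims \<Rightarrow> 'n claims) \<Rightarrow> real \<Rightarrow> ('n claims \<Rightarrow> ennreal) \<Rightarrow> 'n claims \<Rightarrow> ennreal" where
 "tail_T E r T = (\<lambda>w. T (E w) - ennreal r)"

text \<open>Membership in \<open>grid_strategies\<close> with its action rule \<open>s\<close> made
  explicit, because the first action and the remaining rule have to be accessed.\<close>

definition follows :: "nat^'n \<Rightarrow> ('n claims \<Rightarrow> nat \<Rightarrow> 'n action) \<Rightarrow> 'n dividends \<Rightarrow> ('n claims \<Rightarrow> ennreal) \<Rightarrow> bool" where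
 "follows m s L T \<longleftrightarrow> (L, T) \<in> admissible p (G m) \<and> (\<forall>w\<in>claim_paths. allowed_along p \<delta> m w (s w)) \<and>
  non_anticipative p \<delta> m s \<and>
  (\<forall>w\<in>claim_paths. (\<forall>t. L t w = grid_dividends p \<delta> m (\<lambda>_. s w) t w) \<and> T w = grid_switch_time p \<delta> m (\<lambda>_. s w) w)"

lemma strat_iff: "(L, T) \<in> strat m \<longleftrightarrow> (\<exists>s. follows m s L T)"
proof -
 have 1: "grid_dividends p \<delta> m s t w = grid_dividends p \<delta> m (\<lambda>_. s w) t w" for s t w by (rule grid_dividends_path)
 have 2: "grid_switch_time p \<delta> m s w = grid_switch_time p \<delta> m (\<lambda>_. s w) w" for s w by (rule grid_switch_time_path)
 show ?thesis
  unfolding grid_strategies_def follows_def allowed_actions_along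
  by (subst 1, subst 2) blast
qed

lemma action_dividend_nonneg: "0 \<le> action_dividend p \<delta> w act (t, m)"
proof (cases act)
 case (Pay i)
 then show ?thesis using p_pos[of i] \<delta>_pos by (auto simp: less_eq_vec_def axis_def)
qed (use fl_le in auto)

lemma grid_dividends_nonneg: "0 \<le> grid_dividends p \<delta> m s t w"
 unfolding grid_dividends_def
proof (rule sum_nonneg)
 fix k show "0 \<le> action_dividend p \<delta> w (s w k) (the (grid_state p \<delta> m w (s w) k))"
  by (cases "the (grid_state p \<delta> m w (s w) k)") (simp only: action_dividend_nonneg)
qed

text \<open>All scenarios carry the same information at time 0, as no claim has arrived by then;
  non-anticipation makes the first action deterministic.\<close>

lemma follows_first_constant:
 assumes fo: "follows m s L T" and w: "w \<in> claim_paths" "w' \<in> claim_paths"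
 shows "s w 0 = s w' 0"
proof -
 have "same_claims_until 0 w w'"
  using claim_pathsD(1)[OF w(1)] claim_pathsD(1)[OF w(2)] by (intro same_until_no_claims w)
 then show ?thesis using fo w unfolding follows_def non_anticipative_def
  by (metis grid_state.simps(1) order_refl)
qed

text \<open>The common part of the cases below. On the scenarios in the range of \<open>E\<close>
  the first action has one end time, one end index and one dividend; what follows is again a grid
  strategy, and the value splits accordingly.\<close>

lemma grid_tail:
 assumes fo: "follows m s L T" and E: "E \<in> measurable path_space path_space"
  and S: "\<And>w. w \<in> claim_paths ==> shift_rel d r (E w) w"
  and inv: "\<And>t w w'. 0 \<le> t ==> same_claims_until t w w' ==> same_claims_until (r + t) (E w) (E w')"
  and act: "\<And>w. w \<in> claim_paths ==> s (E w) 0 = act"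
  and e: "\<And>w. w \<in> claim_paths ==> action_end p \<delta> (E w) act (0, m) = Some (r, m1)"
  and dv: "\<And>w. w \<in> claim_paths ==> action_dividend p \<delta> (E w) act (0, m) = b"
  and geo: "\<And>w. w \<in> claim_paths ==> G m1 = G m + r *\<^sub>R p - (\<Sum>k<d. snd (E w k)) - b"
  and nr: "\<And>w j. w \<in> claim_paths ==> j < d ==> \<not> ruin_at p (G m) (\<lambda>t. L t (E w)) (E w) j"
  and pre: "\<And>w. w \<in> claim_paths ==> (LINT q|elaw c. a \<bullet> (if q < r then L q (E w) else b)) = P"
 shows "follows m1 (\<lambda>w k. s (E w) (Suc k)) (tail_L E r b L) (tail_T E r T)"
  "fibre (G m) L T E =
   ereal P + ereal (exp (- c * r)) * val (G m1) (tail_L E r b L, tail_T E r T)"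
proof -
 have A: "(L, T) \<in> admissible p (G m)" using fo by (simp add: follows_def)
 have Ep: "E w \<in> claim_paths" if "w \<in> claim_paths" for w using shift_relD(1)[OF S[OF that]] .
 have e': "action_end p \<delta> (E w) (s (E w) 0) (0, m) = Some (r, m1)" if "w \<in> claim_paths" for w
  using e[OF that] act[OF that] by simp
 have al: "allowed_along p \<delta> m (E w) (s (E w))" if "w \<in> claim_paths" for w
  using fo Ep[OF that] by (simp add: follows_def)
 have Ld: "L t (E w) = grid_dividends p \<delta> m (\<lambda>_. s (E w)) t (E w)" "T (E w) = grid_switch_time p \<delta> m (\<lambda>_. s (E w)) (E w)"
  if "w \<in> claim_paths" for t w using fo Ep[OF that] by (simp_all add: follows_def)
 have L1: "L (r + t) (E w) = b + grid_dividends p \<delta> m1 (\<lambda>_ k. s (E w) (Suc k)) t w" if "w \<in> claim_paths" "0 \<le> t" for t w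
  unfolding Ld(1)[OF that(1)]
   grid_dividends_tail(1)[where \<sigma>="s (E w)", OF S[OF that(1)] \<delta>_pos e'[OF that(1)] al[OF that(1)] that(2)]
   act[OF that(1)] dv[OF that(1)] ..
 have T1: "T (E w) = ennreal r + grid_switch_time p \<delta> m1 (\<lambda>_ k. s (E w) (Suc k)) w" if "w \<in> claim_paths" for w
  unfolding Ld(2)[OF that]
  by (rule grid_switch_time_tail[where \<sigma>="s (E w)", OF S[OF that] \<delta>_pos e'[OF that]])
 have Tr: "ennreal r \<le> T (E w)" if "w \<in> claim_paths" for w unfolding T1[OF that] by simp
 have A': "(tail_L E r b L, tail_T E r T) \<in> admissible p (G m1)"
  unfolding tail_L_def tail_T_def
 proof (rule tail_admissible[OF A E S inv geo _ nr Tr])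
  fix w :: "'n claims" assume w: "w \<in> claim_paths"
  show "b \<le> L r (E w)" using L1[OF w, of 0] grid_dividends_nonneg[of m1 "\<lambda>_ k. s (E w) (Suc k)" 0 w] by simp
 qed
 have TT: "tail_T E r T w = grid_switch_time p \<delta> m1 (\<lambda>_ k. s (E w) (Suc k)) w" if "w \<in> claim_paths" for w
  unfolding tail_T_def T1[OF that] by simp
 have LL: "tail_L E r b L t w = grid_dividends p \<delta> m1 (\<lambda>_ k. s (E w) (Suc k)) t w" if "w \<in> claim_paths" for t w
 proof (cases "t < 0")
  case True
  have "indices p \<delta> m1 w (\<lambda>k. s (E w) (Suc k)) t = {}"
   unfolding indices_def using grid_state_time[OF that \<delta>_pos] True by fastforce
  then show ?thesis using True by (simp add: tail_L_def grid_dividends_indices)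
 next
  case False
  then show ?thesis using L1[OF that, of t] by (simp add: tail_L_def)
 qed
 show "follows m1 (\<lambda>w k. s (E w) (Suc k)) (tail_L E r b L) (tail_T E r T)"
  unfolding follows_def
 proof (intro conjI ballI allI A' TT LL)
  show "allowed_along p \<delta> m1 w (\<lambda>k. s (E w) (Suc k))" if "w \<in> claim_paths" for w
   using allowed_along_tail[where \<sigma>="s (E w)", OF S[OF that] \<delta>_pos e'[OF that]] al[OF that] by blast
  show "non_anticipative p \<delta> m1 (\<lambda>w k. s (E w) (Suc k))"
   unfolding non_anticipative_def
  proof (intro ballI allI impI)
   fix w w' :: "'n claims" and t k t' m'
   assume w: "w \<in> claim_paths" "w' \<in> claim_paths" and sm: "same_claims_until t w w'"
    and st: "grid_state p \<delta> m1 w (\<lambda>k. s (E w) (Suc k)) k = Some (t', m') \<and> t' \<le> t"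
   have "0 \<le> t'" using grid_state_time[OF w(1) \<delta>_pos] st by blast
   then have t: "0 \<le> t" using st by simp
   have "grid_state p \<delta> m (E w) (s (E w)) (Suc k) = Some (r + t', m')"
    unfolding grid_state_tail[where \<sigma>="s (E w)", OF S[OF w(1)] \<delta>_pos e'[OF w(1)]] using st by simp
   moreover have "r + t' \<le> r + t" using st by simp
   moreover have "non_anticipative p \<delta> m s" using fo by (simp add: follows_def)
   ultimately show "s (E w) (Suc k) = s (E w') (Suc k)"
    using Ep[OF w(1)] Ep[OF w(2)] inv[OF t sm] unfolding non_anticipative_def by blast
  qed
 qed
 show "fibre (G m) L T E =
   ereal P + ereal (exp (- c * r)) * val (G m1) (tail_L E r b L, tail_T E r T)"
  by (rule tail_value[OF A E S geo nr A' G_nonneg G_nonneg _ _ pre])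
   (simp_all add: L1 LL T1 TT)
qed

lemma exp_tail: "0 \<le> s ==> (LINT q|elaw c. (if q < s then 0 else k)) = exp (- c * s) * k"
proof -
 assume s: "0 \<le> s"
 have "(LINT q|elaw c. (if q < s then 0 else k)) = (LINT q|elaw c. k - indicator {..<s} q * k)"
  by (intro Bochner_Integration.integral_cong) (auto simp: indicator_def)
 also have "\<dots> = (LINT q|elaw c. k) - (LINT q|elaw c. indicator {..<s} q * k)"
  by (intro Bochner_Integration.integral_diff indicator_integrable C.integrable_const) simp
 also have "\<dots> = exp (- c * s) * k"
  unfolding elaw_indicator[OF c_pos s] using C.prob_space by (simp add: algebra_simps)
 finally show ?thesis .
qed

lemma wait_delay:
 assumes fo: "follows m s L T" and act: "\<And>w. w \<in> claim_paths ==> s w 0 = Wait"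
 shows "follows (m + 1) (\<lambda>w k. s (delay \<delta> w) (Suc k)) (tail_L (delay \<delta>) \<delta> 0 L) (tail_T (delay \<delta>) \<delta> T)"
  "fibre (G m) L T (delay \<delta>) =
   ereal (exp (- c * \<delta>)) * val (G (m + 1)) (tail_L (delay \<delta>) \<delta> 0 L, tail_T (delay \<delta>) \<delta> T)"
proof -
 have Ep: "delay \<delta> w \<in> claim_paths" if "w \<in> claim_paths" for w using delay_paths[OF that] \<delta>_pos by simp
 have S: "shift_rel 0 \<delta> (delay \<delta> w) w" if "w \<in> claim_paths" for w using shift_rel_delay[OF that] \<delta>_pos by simp
 have n0: "next_claim (delay \<delta> w) 0 = 0" if "w \<in> claim_paths" for w
  using next_claim_first[OF Ep[OF that]] claim_pathsD(1)[OF Ep[OF that], of 0] by simp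
 have e: "action_end p \<delta> (delay \<delta> w) Wait (0, m) = Some (\<delta>, m + 1)"
  "action_dividend p \<delta> (delay \<delta> w) Wait (0, m) = 0" if "w \<in> claim_paths" for w
  using claim_pathsD(1)[OF that, of 0] by (simp_all add: n0[OF that])
 have L0: "L t (delay \<delta> w) = 0" if "w \<in> claim_paths" "t < \<delta>" for t w
 proof -
  have "action_end p \<delta> (delay \<delta> w) (s (delay \<delta> w) 0) (0, m) = Some (\<delta>, m + 1)"
   using e(1)[OF that(1)] act[OF Ep[OF that(1)]] by simp
  moreover have "allowed_along p \<delta> m (delay \<delta> w) (s (delay \<delta> w))" "L t (delay \<delta> w) = grid_dividends p \<delta> m (\<lambda>_. s (delay \<delta> w)) t (delay \<delta> w)"
   using fo Ep[OF that(1)] by (simp_all add: follows_def)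
  ultimately show ?thesis
   using grid_dividends_tail(2)[where \<sigma>="s (delay \<delta> w)", OF S[OF that(1)] \<delta>_pos _ _ that(2)] by simp
 qed
 have pre: "(LINT q|elaw c. a \<bullet> (if q < \<delta> then L q (delay \<delta> w) else 0)) = 0" if "w \<in> claim_paths" for w
 proof -
  have "(\<lambda>q. a \<bullet> (if q < \<delta> then L q (delay \<delta> w) else 0)) = (\<lambda>q. 0)" using L0[OF that] by auto
  then show ?thesis by simp
 qed
 have geo: "G (m + 1) = G m + \<delta> *\<^sub>R p - (\<Sum>k<0. snd (delay \<delta> w k)) - 0" for w by (simp add: G_add1)
 have md: "delay \<delta> \<in> measurable path_space path_space" by (rule measurable_delay) (use \<delta>_pos in simp)
 have inv: "same_claims_until (\<delta> + t) (delay \<delta> w) (delay \<delta> w')" if "0 \<le> t" "same_claims_until t w w'" for t and w w' :: "'n claims"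
  using same_until_delay that(2) by blast
 have nr: "\<not> ruin_at p (G m) (\<lambda>t. L t (delay \<delta> w)) (delay \<delta> w) j" if "w \<in> claim_paths" "j < 0" for w j
  using that(2) by simp
 note R = grid_tail[OF fo md S inv act[OF Ep] e geo nr pre]
 show "follows (m + 1) (\<lambda>w k. s (delay \<delta> w) (Suc k)) (tail_L (delay \<delta>) \<delta> 0 L) (tail_T (delay \<delta>) \<delta> T)"
  by (rule R(1))
 show "fibre (G m) L T (delay \<delta>) =
   ereal (exp (- c * \<delta>)) * val (G (m + 1)) (tail_L (delay \<delta>) \<delta> 0 L, tail_T (delay \<delta>) \<delta> T)"
 proof -
  have "fibre (G m) L T (delay \<delta>) =
    ereal 0 + ereal (exp (- c * \<delta>)) * val (G (m + 1)) (tail_L (delay \<delta>) \<delta> 0 L, tail_T (delay \<delta>) \<delta> T)"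
   by (rule R(2))
  then show ?thesis unfolding zero_ereal_def[symmetric] add_0 .
 qed
qed

lemma cons_facts:
 assumes w: "w \<in> claim_paths" and t: "0 < t" "t \<le> \<delta>" and u: "0 \<le> u"
 shows "cons_claim t u w \<in> claim_paths" "next_claim (cons_claim t u w) 0 = 0"
  "post_claim p \<delta> (cons_claim t u w) 0 m = G m + t *\<^sub>R p - u"
  "u \<le> G m + t *\<^sub>R p ==> action_end p \<delta> (cons_claim t u w) Wait (0, m) = Some (t, \<rho> (G m + t *\<^sub>R p - u))"
  "u \<le> G m + t *\<^sub>R p ==> action_dividend p \<delta> (cons_claim t u w) Wait (0, m) = (G m + t *\<^sub>R p - u) - fl (G m + t *\<^sub>R p - u)"
  "\<not> u \<le> G m + t *\<^sub>R p ==> action_end p \<delta> (cons_claim t u w) Wait (0, m) = None"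
proof -
 show p: "cons_claim t u w \<in> claim_paths" by (rule cons_paths[OF w t(1) u])
 show n: "next_claim (cons_claim t u w) 0 = 0" using next_claim_first[OF p] t by simp
 show pc: "post_claim p \<delta> (cons_claim t u w) 0 m = G m + t *\<^sub>R p - u" by (simp add: post_claim_def n)
 show "u \<le> G m + t *\<^sub>R p ==> action_end p \<delta> (cons_claim t u w) Wait (0, m) = Some (t, \<rho> (G m + t *\<^sub>R p - u))"
  "u \<le> G m + t *\<^sub>R p ==> action_dividend p \<delta> (cons_claim t u w) Wait (0, m) = (G m + t *\<^sub>R p - u) - fl (G m + t *\<^sub>R p - u)"
  "\<not> u \<le> G m + t *\<^sub>R p ==> action_end p \<delta> (cons_claim t u w) Wait (0, m) = None"
  using t by (simp_all add: n pc)
qed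

text \<open>Nothing is paid before the claim, so the left limit of the dividends is 0 and survival
  is decided by \<open>u \<le> G m + t *\<^sub>R p\<close> alone. The rounding dividend
  \<open>y - fl y\<close> is discounted from the claim time.\<close>

lemma wait_claim:
 assumes fo: "follows m s L T" and act: "\<And>w. w \<in> claim_paths ==> s w 0 = Wait"
  and t: "0 < t" "t \<le> \<delta>" and u: "0 \<le> u" "u \<le> G m + t *\<^sub>R p"
 defines "y \<equiv> G m + t *\<^sub>R p - u"
 shows "follows (\<rho> y) (\<lambda>w k. s (cons_claim t u w) (Suc k)) (tail_L (cons_claim t u) t (y - fl y) L) (tail_T (cons_claim t u) t T)"
  "fibre (G m) L T (cons_claim t u) =
   ereal (exp (- c * t) * (a \<bullet> (y - fl y))) + ereal (exp (- c * t)) * val (G (\<rho> y)) (tail_L (cons_claim t u) t (y - fl y) L, tail_T (cons_claim t u) t T)"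
proof -
 let ?E = "cons_claim t u"
 note cf = cons_facts[OF _ t u(1)]
 have e: "action_end p \<delta> (?E w) Wait (0, m) = Some (t, \<rho> y)" "action_dividend p \<delta> (?E w) Wait (0, m) = y - fl y"
  if "w \<in> claim_paths" for w using cf(4,5)[OF that u(2)] by (simp_all only: y_def)
 have S: "shift_rel 1 t (?E w) w" if "w \<in> claim_paths" for w by (rule shift_rel_cons[OF that t(1) u(1)])
 have L0: "L r (?E w) = 0" if "w \<in> claim_paths" "r < t" for r w
 proof -
  have "action_end p \<delta> (?E w) (s (?E w) 0) (0, m) = Some (t, \<rho> y)"
   using e(1)[OF that(1)] act[OF cf(1)[OF that(1)]] by simp
  moreover have "allowed_along p \<delta> m (?E w) (s (?E w))" "L r (?E w) = grid_dividends p \<delta> m (\<lambda>_. s (?E w)) r (?E w)"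
   using fo cf(1)[OF that(1)] by (simp_all add: follows_def)
  ultimately show ?thesis
   using grid_dividends_tail(2)[where \<sigma>="s (?E w)", OF S[OF that(1)] \<delta>_pos _ _ that(2)] by simp
 qed
 have pre: "(LINT q|elaw c. a \<bullet> (if q < t then L q (?E w) else (y - fl y))) = exp (- c * t) * (a \<bullet> (y - fl y))" if "w \<in> claim_paths" for w
 proof -
  have "(\<lambda>q. a \<bullet> (if q < t then L q (?E w) else (y - fl y))) = (\<lambda>q. if q < t then 0 else a \<bullet> (y - fl y))"
   using L0[OF that] by auto
  then show ?thesis using exp_tail[of t] t by simp
 qed
 have geo: "G (\<rho> y) = G m + t *\<^sub>R p - (\<Sum>k<1. snd (?E w k)) - (y - fl y)" for w
  by (simp add: y_def grid_floor_def)
 have nr: "\<not> ruin_at p (G m) (\<lambda>r. L r (?E w)) (?E w) j" if "w \<in> claim_paths" "j < 1" for w j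
 proof -
  have "((\<lambda>r. L r (?E w)) \<longlongrightarrow> 0) (at_left t)"
   by (rule Lim_transform_eventually[OF tendsto_const], rule eventually_at_leftI[OF _ t(1)]) (use L0[OF that(1)] in auto)
  then have "left_limit (\<lambda>r. L r (?E w)) (fst (?E w 0)) = 0" by (simp add: left_limitI)
  from first_pre_claim[OF cf(1)[OF that(1)] this] show ?thesis using that(2) u(2) by (simp add: ruin_at_def)
 qed
 note R = grid_tail[OF fo measurable_cons[OF t(1) u(1)] S same_until_cons act[OF cf(1)] e geo nr pre]
 show "follows (\<rho> y) (\<lambda>w k. s (?E w) (Suc k)) (tail_L ?E t (y - fl y) L) (tail_T ?E t T)"
  by (rule R(1))
 show "fibre (G m) L T ?E =
   ereal (exp (- c * t) * (a \<bullet> (y - fl y))) + ereal (exp (- c * t)) * val (G (\<rho> y)) (tail_L ?E t (y - fl y) L, tail_T ?E t T)"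
  by (rule R(2))
qed

lemma wait_ruin:
 assumes fo: "follows m s L T" and act: "\<And>w. w \<in> claim_paths ==> s w 0 = Wait"
  and t: "0 < t" "t \<le> \<delta>" and u: "0 \<le> u" "\<not> u \<le> G m + t *\<^sub>R p"
 shows "fibre (G m) L T (cons_claim t u) =
   ereal (- (exp (- c * t) * pen0 (G m + t *\<^sub>R p) u))"
proof -
 let ?E = "cons_claim t u"
 note cf = cons_facts[OF _ t u(1)]
 have "payoff (G m) (\<lambda>r. L r (?E w)) (T (?E w)) (?E w) = - (exp (- c * t) * pen0 (G m + t *\<^sub>R p) u)" if w: "w \<in> claim_paths" for w
 proof -
  have e: "action_end p \<delta> (?E w) (s (?E w) 0) (0, m) = None"
   using cf(6)[OF w u(2)] act[OF cf(1)[OF w]] by simp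
  have L0: "L r (?E w) = 0" for r
   using fo cf(1)[OF w] grid_dividends_stop[where \<sigma>="s (?E w)", OF e] by (simp add: follows_def)
  have T: "T (?E w) = \<infinity>"
   using fo cf(1)[OF w] grid_switch_time_stop[where \<sigma>="s (?E w)", OF e] act[OF cf(1)[OF w]] by (simp add: follows_def)
  have "left_limit (\<lambda>r. 0::real^'n) (fst (?E w 0)) = 0" by (rule left_limitI) simp
  from first_pre_claim[OF cf(1)[OF w] this, of "G m"]
  have pc: "pre_claim p (G m) (\<lambda>_. 0) (?E w) 0 = G m + t *\<^sub>R p" by simp
  then have r0: "ruin_at p (G m) (\<lambda>_. 0) (?E w) 0" using u(2) by (simp add: ruin_at_def)
  then have R: "path_ruin p (G m) (\<lambda>_. 0) (?E w) = ennreal t" using path_ruin_eq[OF cf(1)[OF w] r0] by simp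
  have i: "ruin_index (G m) (\<lambda>_. 0) (?E w) = 0" unfolding ruin_index_def using r0 by (intro Least_eq_0)
  show ?thesis using t by (simp add: L0 T payoff_def gain_def loss_def R i pc div_value_def)
 qed
 then show ?thesis
  using ext_const by (subst ext_expectation_cong[where Y="\<lambda>_. - (exp (- c * t) * pen0 (G m + t *\<^sub>R p) u)"]) auto
qed

lemma pay_value:
 assumes fo: "follows m s L T" and act: "\<And>w. w \<in> claim_paths ==> s w 0 = Pay i"
 shows "0 < m $ i"
  "follows (m - axis i 1) (\<lambda>w k. s w (Suc k)) (tail_L (\<lambda>w. w) 0 (axis i (p $ i * \<delta>)) L) (tail_T (\<lambda>w. w) 0 T)"
  "val (G m) (L, T) = ereal (a $ i * (p $ i * \<delta>)) + val (G (m - axis i 1)) (tail_L (\<lambda>w. w) 0 (axis i (p $ i * \<delta>)) L, tail_T (\<lambda>w. w) 0 T)"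
proof -
 have A: "(L, T) \<in> admissible p (G m)" using fo by (simp add: follows_def)
 have lp: "late 0 \<in> (claim_paths :: 'n claims set)" by (rule late_paths) simp
 have "allowed_along p \<delta> m (late 0) (s (late 0))" using fo lp by (simp add: follows_def)
 then show mi: "0 < m $ i" using act[OF late_paths[of 0]] unfolding allowed_along_def
  by (metis grid_state.simps(1) order_refl)
 let ?b = "axis i (p $ i * \<delta>)"
 have geo: "G (m - axis i 1) = G m + 0 *\<^sub>R p - (\<Sum>k<0. snd (w k)) - ?b" for w :: "'n claims"
  using G_pay[OF mi] by simp
 have pre: "(LINT q|elaw c. a \<bullet> (if q < 0 then L q w else ?b)) = a $ i * (p $ i * \<delta>)" if "w \<in> claim_paths" for w
 proof -
  have "(\<lambda>q. a \<bullet> (if q < 0 then L q w else ?b)) = (\<lambda>q. if q < 0 then 0 else a $ i * (p $ i * \<delta>))"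
   using good_pathD(1)[OF admissible_good_path[OF A that]] by (auto simp: inner_axis)
  then show ?thesis using exp_tail[of 0 "a $ i * (p $ i * \<delta>)"] by simp
 qed
 have inv: "same_claims_until (0 + t) w w'" if "0 \<le> t" "same_claims_until t w w'" for t and w w' :: "'n claims" using that by simp
 have e: "action_end p \<delta> w (Pay i) (0, m) = Some (0, m - axis i 1)" "action_dividend p \<delta> w (Pay i) (0, m) = ?b" for w by auto
 have nr: "\<not> ruin_at p (G m) (\<lambda>t. L t w) w j" if "w \<in> claim_paths" "j < 0" for w j
  using that(2) by simp
 note R = grid_tail[OF fo measurable_ident_sets[OF refl] shift_rel_refl inv act e geo nr pre]
 show "follows (m - axis i 1) (\<lambda>w k. s w (Suc k)) (tail_L (\<lambda>w. w) 0 ?b L) (tail_T (\<lambda>w. w) 0 T)"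
  by (rule R(1))
 show "val (G m) (L, T) = ereal (a $ i * (p $ i * \<delta>)) + val (G (m - axis i 1)) (tail_L (\<lambda>w. w) 0 ?b L, tail_T (\<lambda>w. w) 0 T)"
 proof -
  have "ext_expectation M (\<lambda>w. payoff (G m) (\<lambda>t. L t w) (T w) w) = ereal (a $ i * (p $ i * \<delta>)) +
    ereal (exp (- c * 0)) * val (G (m - axis i 1)) (tail_L (\<lambda>w. w) 0 ?b L, tail_T (\<lambda>w. w) 0 T)"
   by (rule R(2))
  then show ?thesis
   unfolding strategy_value_eq[OF A G_nonneg] mult_zero_right exp_zero one_ereal_def[symmetric] mult_1_left .
 qed
qed

lemma switch_value:
 assumes fo: "follows m s L T" and act: "\<And>w. w \<in> claim_paths ==> s w 0 = Switch"
 shows "val (G m) (L, T) = ereal (f (G m))"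
proof -
 have A: "(L, T) \<in> admissible p (G m)" using fo by (simp add: follows_def)
 have "payoff (G m) (\<lambda>t. L t w) (T w) w = f (G m)" if w: "w \<in> claim_paths" for w
 proof -
  have e: "action_end p \<delta> w (s w 0) (0, m) = None" using act[OF w] by simp
  have L0: "L r w = 0" for r
   using fo w grid_dividends_stop[where \<sigma>="s w", OF e] by (simp add: follows_def)
  have T: "T w = 0"
   using fo w grid_switch_time_stop[where \<sigma>="s w", OF e] act[OF w] by (simp add: follows_def)
  have "0 < path_ruin p (G m) (\<lambda>_. 0) w"
   by (rule order_less_le_trans[OF _ path_ruin_pos[OF w]]) (simp add: claim_pathsD(1)[OF w])
  moreover from this have "path_ruin p (G m) (\<lambda>_. 0) w \<noteq> 0" by simp
  ultimately show ?thesis using surplus_before[OF w claim_pathsD(1)[OF w], of p "G m"] G_nonneg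
   by (simp add: L0 T payoff_def gain_def loss_def div_value_def f0_def)
 qed
 then show ?thesis
  unfolding strategy_value_eq[OF A G_nonneg]
  using ext_const by (subst ext_expectation_cong[where Y="\<lambda>_. f (G m)"]) auto
qed

end

subsection \<open>Dynamic programming on the grid\<close>

lemma ennreal_plus_le: "ennreal (x + y) \<le> ennreal x + ennreal y"
proof (cases "0 \<le> x \<and> 0 \<le> y")
 case False
 then have "ennreal (x + y) \<le> ennreal x \<or> ennreal (x + y) \<le> ennreal y"
  using ennreal_leI[of "x + y" x] ennreal_leI[of "x + y" y] by linarith
 then show ?thesis by (metis add.commute add_increasing zero_le)
qed simp

context dividend_model
begin

text \<open>Tilting from \<open>lam\<close> to \<open>beta\<close> absorbs the discount factor. A
  claim at the very end of the wait counts as a claim, hence \<open>{..r}\<close>, while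
  \<open>wait_value\<close> integrates over \<open>{..<r}\<close>; the two differ by a null
  set.\<close>

lemma claim_split:
 assumes w: "tame vf" and x: "0 \<le> x" and r: "0 \<le> r"
 shows "integrable wait_law (\<lambda>s. indicator {..r} s * (exp (- c * s) * Q vf (x + s *\<^sub>R p)))"
  "(LINT s|wait_law. indicator {..r} s * (exp (- c * s) * Q vf (x + s *\<^sub>R p))) + exp (- lam * r) * (exp (- c * r) * vf (x + r *\<^sub>R p)) =
   wait_value vf (Q vf) r x"
proof -
 define g where "g s = indicator {..<r} s * Q vf (x + s *\<^sub>R p)" for s
 have gi: "integrable (elaw beta) g" unfolding g_def by (rule wait_integrable[OF Q_tame[OF w] x])
 then have gm: "g \<in> borel_measurable borel" using borel_measurable_integrable[OF gi] by (simp add: measurable_elaw)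
 have b: "beta - lam = c" by (simp add: beta_def)
 note t = elaw_tilt[OF lam_pos beta_pos(1) gm, unfolded b]
 have ti: "integrable wait_law (\<lambda>s. exp (- c * s) * g s)" using t(1) gi by simp
 have Qm: "(\<lambda>s. Q vf (x + s *\<^sub>R p)) \<in> borel_measurable borel"
  by (rule measurable_compose[OF _ Q_measurable[OF w]]) measurable
 have m: "(\<lambda>s. indicator {..r} s * (exp (- c * s) * Q vf (x + s *\<^sub>R p))) \<in> borel_measurable wait_law"
  using Qm by measurable
 have ae: "AE s in wait_law. indicator {..r} s * (exp (- c * s) * Q vf (x + s *\<^sub>R p)) = exp (- c * s) * g s"
  using AE_elaw[OF AE_lborel_singleton[of r], of lam] by eventually_elim (auto simp: g_def indicator_def)
 show "integrable wait_law (\<lambda>s. indicator {..r} s * (exp (- c * s) * Q vf (x + s *\<^sub>R p)))"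
  using ti by (subst integrable_cong_AE[OF m borel_measurable_integrable[OF ti] ae])
 have "(LINT s|wait_law. indicator {..r} s * (exp (- c * s) * Q vf (x + s *\<^sub>R p))) = lam / beta * (LINT s|elaw beta. g s)"
  unfolding integral_cong_AE[OF m borel_measurable_integrable[OF ti] ae] by (rule t(2))
 moreover have "exp (- lam * r) * exp (- c * r) = exp (- beta * r)"
  by (simp add: mult_exp_exp beta_def algebra_simps)
 ultimately show "(LINT s|wait_law. indicator {..r} s * (exp (- c * s) * Q vf (x + s *\<^sub>R p))) + exp (- lam * r) * (exp (- c * r) * vf (x + r *\<^sub>R p)) =
   wait_value vf (Q vf) r x"
  by (simp only: wait_value_def g_def[symmetric] mult.assoc[symmetric])
qed

text \<open>The previous identity for the gaps to an upper bound, the form in which extended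
  expectations are compared. The weights of \<open>C\<close> in the two terms add up to one.\<close>

lemma claim_split_gap:
 assumes w: "tame vf" and x: "0 \<le> x" and r: "0 \<le> r"
 shows "integrable wait_law (\<lambda>s. indicator {..r} s * (C - exp (- c * s) * Q vf (x + s *\<^sub>R p)))"
  "(LINT s|wait_law. indicator {..r} s * (C - exp (- c * s) * Q vf (x + s *\<^sub>R p))) + exp (- lam * r) * (C - exp (- c * r) * vf (x + r *\<^sub>R p)) =
   C - wait_value vf (Q vf) r x"
proof -
 note s = claim_split[OF assms]
 have i: "integrable wait_law (\<lambda>s. indicator {..r} s * C)" by (intro indicator_integrable) auto
 have "(LINT s|wait_law. indicator {..r} s * C) = (LINT s|wait_law. indicator {..<r} s * C)"
 proof (rule integral_cong_AE)
  show "AE s in wait_law. indicator {..r} s * C = indicator {..<r} s * C"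
   using AE_elaw[OF AE_lborel_singleton[of r], of lam] by eventually_elim (auto simp: indicator_def)
 qed auto
 also have "\<dots> = (1 - exp (- lam * r)) * C" by (rule elaw_indicator[OF lam_pos r])
 finally have C: "(LINT s|wait_law. indicator {..r} s * C) = (1 - exp (- lam * r)) * C" .
 have e: "indicator {..r} s * (C - exp (- c * s) * Q vf (x + s *\<^sub>R p)) =
  indicator {..r} s * C - indicator {..r} s * (exp (- c * s) * Q vf (x + s *\<^sub>R p))" for s by (simp add: right_diff_distrib)
 show "integrable wait_law (\<lambda>s. indicator {..r} s * (C - exp (- c * s) * Q vf (x + s *\<^sub>R p)))"
  unfolding e by (intro Bochner_Integration.integrable_diff i s(1))
 show "(LINT s|wait_law. indicator {..r} s * (C - exp (- c * s) * Q vf (x + s *\<^sub>R p))) + exp (- lam * r) * (C - exp (- c * r) * vf (x + r *\<^sub>R p)) =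
   C - wait_value vf (Q vf) r x"
  unfolding e Bochner_Integration.integral_diff[OF i s(1)] C s(2)[symmetric] by (simp only: left_diff_distrib right_diff_distrib mult_1_left)
qed

lemma cons_fibre:
 assumes Z: "Z \<in> borel_measurable path_space" "\<And>w. w \<in> claim_paths ==> Z w \<le> C"
  and s: "0 < s" and u: "0 \<le> u"
 shows "(\<lambda>w. Z (cons_claim s u w)) \<in> borel_measurable M" "\<And>w. w \<in> space M ==> Z (cons_claim s u w) \<le> C"
 using Z(2) cons_paths[OF _ s u] measurable_comp_cons[OF Z(1) s u] by (auto simp: measurable_M)

lemma delay_fibre:
 assumes Z: "Z \<in> borel_measurable path_space" "\<And>w. w \<in> claim_paths ==> Z w \<le> C" and r: "0 \<le> r"
 shows "(\<lambda>w. Z (delay r w)) \<in> borel_measurable M" "\<And>w. w \<in> space M ==> Z (delay r w) \<le> C"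
 using Z(2) delay_paths[OF _ r] measurable_compose[OF measurable_delay[OF r] Z(1)] by (auto simp: measurable_M)

text \<open>A wait of length \<open>r\<close> is conditioned on its first claim or on the absence of
  claims. Gaps of either sign are harmless here, since truncation at zero only enlarges an
  integral.\<close>

lemma ext_expectation_le_wait:
 assumes Z: "Z \<in> borel_measurable path_space" "\<And>w. w \<in> claim_paths ==> Z w \<le> C"
  and w: "tame vf" and x: "0 \<le> x" and r: "0 \<le> r"
  and 1: "\<And>s u. 0 < s ==> s \<le> r ==> 0 \<le> u ==>
   ext_expectation M (\<lambda>w. Z (cons_claim s u w)) \<le> ereal (exp (- c * s) * psi vf (x + s *\<^sub>R p) u)"
  and 2: "ext_expectation M (\<lambda>w. Z (delay r w)) \<le> ereal (exp (- c * r) * vf (x + r *\<^sub>R p))"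
 shows "ext_expectation M Z \<le> ereal (wait_value vf (Q vf) r x)"
proof (subst M.ext_expectation_le_iff[of _ C])
 note g = claim_split_gap[OF w x r, of C]
 have m: "(\<lambda>w. ennreal (C - Z w)) \<in> borel_measurable path_space" using Z(1) by measurable
 let ?I = "\<lambda>s. indicator {..r} s * (C - exp (- c * s) * Q vf (x + s *\<^sub>R p))"
 have "ennreal (C - wait_value vf (Q vf) r x) \<le> ennreal (LINT s|wait_law. ?I s) + ennreal (exp (- lam * r) * (C - exp (- c * r) * vf (x + r *\<^sub>R p)))"
  unfolding g(2)[symmetric] by (rule ennreal_plus_le)
 also have "\<dots> \<le> (\<integral>\<^sup>+s. (\<integral>\<^sup>+u. \<integral>\<^sup>+w. ennreal (C - Z (cons_claim s u w)) \<partial>M \<partial>F) * indicator {..r} s \<partial>wait_law) +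
  ennreal (exp (- lam * r)) * (\<integral>\<^sup>+w. ennreal (C - Z (delay r w)) \<partial>M)"
 proof (rule add_mono)
  have "ennreal (LINT s|wait_law. ?I s) \<le> (\<integral>\<^sup>+s. ennreal (?I s) \<partial>wait_law)" by (rule nn_integral_ge_integral[OF g(1)])
  also have "\<dots> \<le> (\<integral>\<^sup>+s. (\<integral>\<^sup>+u. \<integral>\<^sup>+w. ennreal (C - Z (cons_claim s u w)) \<partial>M \<partial>F) * indicator {..r} s \<partial>wait_law)"
  proof (rule nn_integral_mono_AE, use wait_pos in eventually_elim)
   fix s :: real assume s: "0 < s"
   show "ennreal (?I s) \<le> (\<integral>\<^sup>+u. \<integral>\<^sup>+w. ennreal (C - Z (cons_claim s u w)) \<partial>M \<partial>F) * indicator {..r} s"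
   proof (cases "s \<le> r")
    case True
    have i: "integrable F (\<lambda>u. C - exp (- c * s) * psi vf (x + s *\<^sub>R p) u)"
     using psi_integrable[OF w orthant_path[OF x]] s by (intro Bochner_Integration.integrable_diff Bochner_Integration.integrable_mult_right) auto
    have "C - exp (- c * s) * Q vf (x + s *\<^sub>R p) = (LINT u|F. C - exp (- c * s) * psi vf (x + s *\<^sub>R p) u)"
     unfolding Q_def using psi_integrable[OF w orthant_path[OF x], of s] s F.prob_space by simp
    then have "ennreal (C - exp (- c * s) * Q vf (x + s *\<^sub>R p)) \<le> (\<integral>\<^sup>+u. ennreal (C - exp (- c * s) * psi vf (x + s *\<^sub>R p) u) \<partial>F)"
     using nn_integral_ge_integral[OF i] by simp
    also have "\<dots> \<le> (\<integral>\<^sup>+u. \<integral>\<^sup>+w. ennreal (C - Z (cons_claim s u w)) \<partial>M \<partial>F)"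
    proof (rule nn_integral_mono_AE, use F_nonneg in eventually_elim)
     fix u :: "real^'n" assume u: "0 \<le> u"
     show "ennreal (C - exp (- c * s) * psi vf (x + s *\<^sub>R p) u) \<le> (\<integral>\<^sup>+w. ennreal (C - Z (cons_claim s u w)) \<partial>M)"
      using 1[OF s True u] by (subst M.ext_expectation_le_iff[of _ C, symmetric]) (use cons_fibre[OF Z s u] in auto)
    qed
    finally show ?thesis using True by simp
   qed simp
  qed
  finally show "ennreal (LINT s|wait_law. ?I s) \<le> \<dots>" .
  have "ennreal (C - exp (- c * r) * vf (x + r *\<^sub>R p)) \<le> (\<integral>\<^sup>+w. ennreal (C - Z (delay r w)) \<partial>M)"
   using 2 by (subst M.ext_expectation_le_iff[of _ C, symmetric]) (use delay_fibre[OF Z r] in auto)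
  then show "ennreal (exp (- lam * r) * (C - exp (- c * r) * vf (x + r *\<^sub>R p))) \<le> ennreal (exp (- lam * r)) * (\<integral>\<^sup>+w. ennreal (C - Z (delay r w)) \<partial>M)"
   unfolding ennreal_mult'[OF exp_ge_zero] by (rule mult_left_mono) simp
 qed
 also have "\<dots> = (\<integral>\<^sup>+w. ennreal (C - Z w) \<partial>M)" by (rule nn_integral_M_split[OF m r, symmetric])
 finally show "ennreal (C - wait_value vf (Q vf) r x) \<le> (\<integral>\<^sup>+w. ennreal (C - Z w) \<partial>M)" .
qed (use Z in \<open>auto simp: measurable_M\<close>)

text \<open>In this direction the gaps must be known to be nonnegative before their integrals can be
  replaced by real ones. This comes from the hypotheses themselves: a conditional value is at most
  \<open>C\<close>, hence so is any lower bound for it.\<close>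

lemma ext_expectation_ge_wait:
 assumes Z: "Z \<in> borel_measurable path_space" "\<And>w. w \<in> claim_paths ==> Z w \<le> C"
  and w: "tame vf" and x: "0 \<le> x" and r: "0 \<le> r"
  and 1: "\<And>s u. 0 < s ==> s \<le> r ==> 0 \<le> u ==>
   ereal (exp (- c * s) * psi vf (x + s *\<^sub>R p) u) \<le> ext_expectation M (\<lambda>w. Z (cons_claim s u w))"
  and 2: "ereal (exp (- c * r) * vf (x + r *\<^sub>R p)) \<le> ext_expectation M (\<lambda>w. Z (delay r w))"
 shows "ereal (wait_value vf (Q vf) r x) \<le> ext_expectation M Z"
proof (subst M.ext_expectation_ge_iff[of _ C], safe)
 note g = claim_split_gap[OF w x r, of C]
 have m: "(\<lambda>w. ennreal (C - Z w)) \<in> borel_measurable path_space" using Z(1) by measurable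
 let ?I = "\<lambda>s. indicator {..r} s * (C - exp (- c * s) * Q vf (x + s *\<^sub>R p))"
 have f1: "exp (- c * s) * psi vf (x + s *\<^sub>R p) u \<le> C"
  "(\<integral>\<^sup>+w. ennreal (C - Z (cons_claim s u w)) \<partial>M) \<le> ennreal (C - exp (- c * s) * psi vf (x + s *\<^sub>R p) u)"
  if "0 < s" "s \<le> r" "0 \<le> u" for s u
  using 1[OF that] M.ext_expectation_ge_iff[OF cons_fibre[OF Z that(1,3)]] by blast+
 have f2: "exp (- c * r) * vf (x + r *\<^sub>R p) \<le> C"
  "(\<integral>\<^sup>+w. ennreal (C - Z (delay r w)) \<partial>M) \<le> ennreal (C - exp (- c * r) * vf (x + r *\<^sub>R p))"
  using 2 M.ext_expectation_ge_iff[OF delay_fibre[OF Z r]] by blast+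
 have fib: "0 \<le> C - exp (- c * s) * Q vf (x + s *\<^sub>R p) \<and>
  (\<integral>\<^sup>+u. \<integral>\<^sup>+w. ennreal (C - Z (cons_claim s u w)) \<partial>M \<partial>F) \<le> ennreal (C - exp (- c * s) * Q vf (x + s *\<^sub>R p))"
  if s: "0 < s" "s \<le> r" for s
 proof -
  have i: "integrable F (\<lambda>u. C - exp (- c * s) * psi vf (x + s *\<^sub>R p) u)"
   using psi_integrable[OF w orthant_path[OF x]] s by (intro Bochner_Integration.integrable_diff Bochner_Integration.integrable_mult_right) auto
  have e: "C - exp (- c * s) * Q vf (x + s *\<^sub>R p) = (LINT u|F. C - exp (- c * s) * psi vf (x + s *\<^sub>R p) u)"
   unfolding Q_def using psi_integrable[OF w orthant_path[OF x], of s] s F.prob_space by simp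
  have pos: "AE u in F. 0 \<le> C - exp (- c * s) * psi vf (x + s *\<^sub>R p) u"
   using F_nonneg by eventually_elim (use f1(1)[OF s] in simp)
  have "(\<integral>\<^sup>+u. \<integral>\<^sup>+w. ennreal (C - Z (cons_claim s u w)) \<partial>M \<partial>F) \<le> (\<integral>\<^sup>+u. ennreal (C - exp (- c * s) * psi vf (x + s *\<^sub>R p) u) \<partial>F)"
   by (rule nn_integral_mono_AE, use F_nonneg in eventually_elim) (rule f1(2)[OF s])
  also have "\<dots> = ennreal (LINT u|F. C - exp (- c * s) * psi vf (x + s *\<^sub>R p) u)" by (rule nn_integral_eq_integral[OF i pos])
  finally show ?thesis unfolding e using integral_nonneg_AE[OF pos] by simp
 qed
 have posI: "AE s in wait_law. 0 \<le> ?I s"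
  using wait_pos by eventually_elim (use fib in \<open>auto simp: indicator_def\<close>)
 have n1: "0 \<le> (LINT s|wait_law. ?I s)" by (rule integral_nonneg_AE[OF posI])
 have n2: "0 \<le> exp (- lam * r) * (C - exp (- c * r) * vf (x + r *\<^sub>R p))" using f2(1) by simp
 show "wait_value vf (Q vf) r x \<le> C" using n1 n2 g(2) by simp
 have "(\<integral>\<^sup>+w. ennreal (C - Z w) \<partial>M) = (\<integral>\<^sup>+s. (\<integral>\<^sup>+u. \<integral>\<^sup>+w. ennreal (C - Z (cons_claim s u w)) \<partial>M \<partial>F) * indicator {..r} s \<partial>wait_law) +
  ennreal (exp (- lam * r)) * (\<integral>\<^sup>+w. ennreal (C - Z (delay r w)) \<partial>M)" by (rule nn_integral_M_split[OF m r])
 also have "\<dots> \<le> ennreal (LINT s|wait_law. ?I s) + ennreal (exp (- lam * r) * (C - exp (- c * r) * vf (x + r *\<^sub>R p)))"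
 proof (rule add_mono)
  have "(\<integral>\<^sup>+s. (\<integral>\<^sup>+u. \<integral>\<^sup>+w. ennreal (C - Z (cons_claim s u w)) \<partial>M \<partial>F) * indicator {..r} s \<partial>wait_law) \<le> (\<integral>\<^sup>+s. ennreal (?I s) \<partial>wait_law)"
   by (rule nn_integral_mono_AE, use wait_pos in eventually_elim) (use fib in \<open>auto simp: indicator_def\<close>)
  also have "\<dots> = ennreal (LINT s|wait_law. ?I s)" by (rule nn_integral_eq_integral[OF g(1) posI])
  finally show "(\<integral>\<^sup>+s. (\<integral>\<^sup>+u. \<integral>\<^sup>+w. ennreal (C - Z (cons_claim s u w)) \<partial>M \<partial>F) * indicator {..r} s \<partial>wait_law) \<le> ennreal (LINT s|wait_law. ?I s)" .
  show "ennreal (exp (- lam * r)) * (\<integral>\<^sup>+w. ennreal (C - Z (delay r w)) \<partial>M) \<le> ennreal (exp (- lam * r) * (C - exp (- c * r) * vf (x + r *\<^sub>R p)))"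
   unfolding ennreal_mult'[OF exp_ge_zero] by (rule mult_left_mono[OF f2(2)]) simp
 qed
 also have "\<dots> = ennreal (C - wait_value vf (Q vf) r x)" unfolding g(2)[symmetric] by (rule ennreal_plus[OF n1 n2, symmetric])
 finally show "(\<integral>\<^sup>+w. ennreal (C - Z w) \<partial>M) \<le> ennreal (C - wait_value vf (Q vf) r x)" .
qed (use Z in \<open>auto simp: measurable_M\<close>)

lemma value_upper: "\<pi> \<in> admissible p x ==> 0 \<le> x ==> val x \<pi> \<le> ereal (4 * K * h0 x)"
proof -
 assume A: "\<pi> \<in> admissible p x" and x: "0 \<le> x"
 obtain L T where \<pi>: "\<pi> = (L, T)" by (cases \<pi>)
 show ?thesis unfolding \<pi> strategy_value_eq[OF A[unfolded \<pi>] x]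
  by (subst M.ext_expectation_le_iff[of _ "4 * K * h0 x"])
   (auto simp: measurable_M intro: payoff_measurable[OF A[unfolded \<pi>]] payoff_bound[OF A[unfolded \<pi>] x])
qed

lemma wait_value_mono:
 assumes "tame q" "tame q'" "0 \<le> x" "0 \<le> h" "vf (x + h *\<^sub>R p) \<le> vf' (x + h *\<^sub>R p)" "\<And>y. 0 \<le> y ==> q y \<le> q' y"
 shows "wait_value vf q h x \<le> wait_value vf' q' h x"
proof -
 have "(LINT s|elaw beta. indicator {..<h} s * q (x + s *\<^sub>R p)) \<le> (LINT s|elaw beta. indicator {..<h} s * q' (x + s *\<^sub>R p))"
 proof (rule integral_mono_AE[OF wait_integrable[OF assms(1,3)] wait_integrable[OF assms(2,3)]])
  show "AE s in elaw beta. indicator {..<h} s * q (x + s *\<^sub>R p) \<le> indicator {..<h} s * q' (x + s *\<^sub>R p)"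
   using AE_elaw_pos by eventually_elim (use assms(6) orthant_path[OF assms(3)] in \<open>auto intro!: mult_left_mono\<close>)
 qed
 then show ?thesis unfolding wait_value_def
  using assms(5) lam_pos beta_pos by (intro add_mono mult_left_mono) auto
qed

lemma Q_mono:
 assumes "tame vf" "tame vf'" "0 \<le> y" "\<And>z. 0 \<le> z ==> vf z \<le> vf' z"
 shows "Q vf y \<le> Q vf' y"
 unfolding Q_def
 by (intro integral_mono psi_integrable assms) (auto simp: psi_def intro!: assms(4))

text \<open>The end term \<open>exp (- beta * h) * h0 (x + h *\<^sub>R p)\<close> is split in the
  proportion \<open>theta : 1 - theta\<close>. The first share and the claim term give
  \<open>theta * h0 x\<close> by \<open>wait_h0\<close>; the other decays at rate
  \<open>beta - c / 2\<close>. For \<open>h > 0\<close> the resulting factor is below one.\<close>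

lemma wait_add_h0:
 assumes w: "tame vf" and x: "0 \<le> x" and h: "0 \<le> h" and D: "0 \<le> D"
 shows "wait_value (\<lambda>z. vf z + D * h0 z) (Q (\<lambda>z. vf z + D * h0 z)) h x \<le>
  wait_value vf (Q vf) h x + D * ((theta + (1 - theta) * exp (- (beta - c / 2) * h)) * h0 x)"
proof -
 note tq = Q_tame[OF w]
 have "wait_value (\<lambda>z. vf z + D * h0 z) (Q (\<lambda>z. vf z + D * h0 z)) h x \<le> wait_value (\<lambda>z. vf z + D * h0 z) (\<lambda>y. Q vf y + D * h0 y) h x"
  by (rule wait_value_mono[OF Q_tame[OF tame_add[OF w tame_h0]] tame_add[OF tq tame_h0] x h]) (use Q_add_h0[OF w _ D] in auto)
 also have "\<dots> = wait_value vf (Q vf) h x + D * (exp (- beta * h) * h0 (x + h *\<^sub>R p) + lam / beta * (LINT s|elaw beta. indicator {..<h} s * h0 (x + s *\<^sub>R p)))"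
 proof -
  have "(LINT s|elaw beta. indicator {..<h} s * (Q vf (x + s *\<^sub>R p) + D * h0 (x + s *\<^sub>R p))) =
   (LINT s|elaw beta. indicator {..<h} s * Q vf (x + s *\<^sub>R p) + D * (indicator {..<h} s * h0 (x + s *\<^sub>R p)))"
   by (simp add: algebra_simps)
  also have "\<dots> = (LINT s|elaw beta. indicator {..<h} s * Q vf (x + s *\<^sub>R p)) + D * (LINT s|elaw beta. indicator {..<h} s * h0 (x + s *\<^sub>R p))"
   using wait_integrable[OF tq x] wait_integrable[OF tame_h0 x] by simp
  finally show ?thesis by (simp add: wait_value_def algebra_simps)
 qed
 also have "exp (- beta * h) * h0 (x + h *\<^sub>R p) + lam / beta * (LINT s|elaw beta. indicator {..<h} s * h0 (x + s *\<^sub>R p)) =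
  theta * h0 x + (1 - theta) * (exp (- beta * h) * h0 (x + h *\<^sub>R p))"
  using wait_h0[OF h, of x] by (simp add: algebra_simps)
 also have "exp (- beta * h) * h0 (x + h *\<^sub>R p) = exp (- (beta - c / 2) * h) * h0 x"
  by (simp add: h0_shift mult_exp_exp algebra_simps)
 finally show ?thesis by (simp add: algebra_simps)
qed

end

section \<open>Supersolutions of the discretised inequalities\<close>

context grid_model
begin

text \<open>The part of a cell lying above \<open>y\<close> contains all points above
  \<open>y\<close> that are close to it. So the grid index is locally constant from above, the
  source of upper continuity of lifted functions.\<close>

lemma rho_eqI: "0 \<le> y ==> y \<le> z ==> (\<And>i. z $ i < fl y $ i + p $ i * \<delta>) ==> \<rho> z = \<rho> y"
proof -
 assume y: "0 \<le> y" "y \<le> z" and lt: "\<And>i. z $ i < fl y $ i + p $ i * \<delta>"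
 have "nat \<lfloor>z $ i / (\<delta> * p $ i)\<rfloor> = \<rho> y $ i" for i
 proof -
  have pd: "0 < \<delta> * p $ i" using p_pos \<delta>_pos by simp
  have "y $ i / (\<delta> * p $ i) \<le> z $ i / (\<delta> * p $ i)" using y(2) pd by (intro divide_right_mono) (auto simp: less_eq_vec_def)
  then have "real (\<rho> y $ i) \<le> z $ i / (\<delta> * p $ i)" using rho_nth(1)[OF y(1), of i] by simp
  moreover have "z $ i / (\<delta> * p $ i) < real (\<rho> y $ i) + 1"
   using lt[of i] pd by (simp add: pos_divide_less_eq grid_floor_def G_nth algebra_simps)
  ultimately have "\<lfloor>z $ i / (\<delta> * p $ i)\<rfloor> = int (\<rho> y $ i)" by (intro floor_unique) auto
  then show ?thesis by simp
 qed
 then show ?thesis by (simp add: vec_eq_iff) (simp add: grid_index_def)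
qed

text \<open>The inequalities that do not involve waiting. They already make \<open>lift vf\<close>
  tame, so that the integrals in the waiting inequality of \<open>grid_super\<close> are
  meaningful.\<close>

definition grid_base :: "(nat^'n \<Rightarrow> real) \<Rightarrow> bool" where
 "grid_base vf \<longleftrightarrow> (\<forall>m. f (G m) \<le> vf m) \<and> (\<forall>m i. 0 < m $ i \<longrightarrow> a $ i * (p $ i * \<delta>) + vf (m - axis i 1) \<le> vf m) \<and>
  (\<exists>C. \<forall>m. vf m \<le> C * h0 (G m))"

definition grid_super :: "(nat^'n \<Rightarrow> real) \<Rightarrow> bool" where
 "grid_super vf \<longleftrightarrow> grid_base vf \<and> (\<forall>m. wait_value (lift vf) (Q (lift vf)) \<delta> (G m) \<le> vf m)"

text \<open>The difference of the two indices is paid out in single units, by induction on the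
  number of units.\<close>

lemma pay_mono:
 assumes pay: "\<And>m i. 0 < m $ i ==> a $ i * (p $ i * \<delta>) + vf (m - axis i 1) \<le> vf m" and le: "m \<le> m'"
 shows "vf m + a \<bullet> (G m' - G m) \<le> vf m'"
 using le
proof (induction "\<Sum>i\<in>UNIV. m' $ i - m $ i" arbitrary: m')
 case 0
 have "m' $ i = m $ i" for i
 proof -
  have "m' $ i - m $ i = 0" using 0(1)[symmetric] by simp
  moreover have "m $ i \<le> m' $ i" using 0(2) by (simp add: less_eq_vec_def)
  ultimately show ?thesis by linarith
 qed
 then have "m' = m" by (simp add: vec_eq_iff)
 then show ?case by simp
next
 case (Suc n)
 have "\<exists>i. m $ i < m' $ i"
 proof (rule ccontr)
  assume "\<not> ?thesis"
  then have "(\<Sum>i\<in>UNIV. m' $ i - m $ i) = 0" by (simp add: not_less)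
  then show False using Suc(2) by simp
 qed
 then obtain i where i: "m $ i < m' $ i" by blast
 have le': "m \<le> m' - axis i 1" using Suc(3) i by (auto simp: less_eq_vec_def axis_def)
 have "(\<Sum>j\<in>UNIV. m' $ j - m $ j) = (\<Sum>j\<in>UNIV. (m' - axis i 1) $ j - m $ j + (if j = i then 1 else 0))"
  using i by (intro sum.cong) (auto simp: axis_def)
 also have "\<dots> = (\<Sum>j\<in>UNIV. (m' - axis i 1) $ j - m $ j) + 1" by (simp add: sum.distrib)
 finally have "n = (\<Sum>j\<in>UNIV. (m' - axis i 1) $ j - m $ j)" using Suc(2) by simp
 from Suc(1)[OF this le'] have "vf m + a \<bullet> (G (m' - axis i 1) - G m) \<le> vf (m' - axis i 1)" .
 moreover have "0 < m' $ i" using i by simp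
 ultimately show ?case using pay[of m' i] G_pay[of m' i] by (simp add: inner_diff_right inner_axis)
qed

lemma rho_mono: "x \<le> y ==> \<rho> x \<le> \<rho> y"
 using p_pos \<delta>_pos by (auto simp: grid_index_def less_eq_vec_def intro!: nat_mono floor_mono divide_right_mono less_imp_le[OF mult_pos_pos])

lemma lift_mono:
 assumes pay: "\<And>m i. 0 < m $ i ==> a $ i * (p $ i * \<delta>) + vf (m - axis i 1) \<le> vf m" and x: "0 \<le> x" "x \<le> y"
 shows "lift vf x + a \<bullet> (y - x) \<le> lift vf y"
proof -
 have "0 \<le> y" using x by (rule order_trans)
 then show ?thesis using pay_mono[where vf=vf, OF pay rho_mono[OF x(2)]] x
  by (simp add: lift_def grid_floor_def inner_diff_right)
qed

lemma super_lower:
 assumes S: "grid_base vf" and x: "0 \<le> x" shows "f 0 \<le> lift vf x"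
proof -
 note S' = S[unfolded grid_base_def]
 have G0: "G 0 = 0" by (simp add: vec_eq_iff G_nth)
 have "f 0 \<le> lift vf 0" using S' G0 lift_G[of vf 0] by (metis)
 also have "\<dots> \<le> lift vf 0 + a \<bullet> (x - 0)" using a_inner_nonneg[OF x] by simp
 also have "\<dots> \<le> lift vf x" by (rule lift_mono[OF _ order_refl x]) (use S' in blast)
 finally show ?thesis .
qed

lemma super_tame: assumes S: "grid_base vf" shows "tame (lift vf)"
 unfolding tame_def
proof (intro conjI allI impI)
 have up: "continuous (at y within {y..}) (lift vf)" if y: "0 \<le> y" for y
 proof -
  have "eventually (\<lambda>z. z \<in> {y..} \<and> (\<forall>i\<in>UNIV. z $ i < fl y $ i + p $ i * \<delta>)) (at y within {y..})"
  proof (intro eventually_conj eventually_ball_finite ballI)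
   show "eventually (\<lambda>z. z \<in> {y..}) (at y within {y..})" by (simp add: eventually_at_filter)
   fix i
   have "((\<lambda>z. z $ i) \<longlongrightarrow> y $ i) (at y within {y..})" by (intro tendsto_intros)
   then show "eventually (\<lambda>z. z $ i < fl y $ i + p $ i * \<delta>) (at y within {y..})"
    by (rule order_tendstoD(2)) (rule fl_nth(2)[OF y])
  qed simp
  then have "eventually (\<lambda>z. vf (\<rho> y) + a \<bullet> (z - fl y) = lift vf z) (at y within {y..})"
  proof eventually_elim
   case (elim z)
   then have "\<rho> z = \<rho> y" using rho_eqI[OF y, of z] by simp
   moreover have "0 \<le> z" using y elim order_trans by (metis atLeast_iff)
   ultimately show ?case by (simp add: lift_def grid_floor_def)
  qed
  moreover have "((\<lambda>z. vf (\<rho> y) + a \<bullet> (z - fl y)) \<longlongrightarrow> vf (\<rho> y) + a \<bullet> (y - fl y)) (at y within {y..})"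
   by (intro tendsto_intros)
  ultimately have "(lift vf \<longlongrightarrow> vf (\<rho> y) + a \<bullet> (y - fl y)) (at y within {y..})"
   by (rule Lim_transform_eventually[rotated])
  then show ?thesis using y by (simp add: continuous_within lift_def)
 qed
 then show "continuous (at y within {y..}) (lift vf)" if "0 \<le> y" for y using that .
 have "(\<lambda>x. if 0 \<le> x then lift vf x else 0) = lift vf" by (auto simp: lift_def)
 then show "lift vf \<in> borel_measurable borel" using borel_measurable_upper_continuous[OF up] by simp
 obtain C where C: "\<And>m. vf m \<le> C * h0 (G m)" using S unfolding grid_base_def by blast
 show "\<exists>C. \<forall>y\<ge>0. \<bar>lift vf y\<bar> \<le> C * h0 y"
 \<comment> \<open>\<open>\<bar>C\<bar>\<close> bounds the grid value, \<open>K\<close> the dividend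
   paid to reach the grid, and \<open>\<bar>f 0\<bar>\<close> the function from below, by
   \<open>super_lower\<close>.\<close>
 proof (intro exI[of _ "\<bar>C\<bar> + K + \<bar>f 0\<bar>"] allI impI)
  fix y :: "real^'n" assume y: "0 \<le> y"
  have "vf (\<rho> y) \<le> \<bar>C\<bar> * h0 (G (\<rho> y))" using C[of "\<rho> y"] h0_pos[of "G (\<rho> y)"] by (smt (verit) mult_right_mono)
  also have "\<dots> \<le> \<bar>C\<bar> * h0 y" using h0_mono[OF fl_le[OF y]] by (intro mult_left_mono) (auto simp: grid_floor_def)
  finally have 1: "vf (\<rho> y) \<le> \<bar>C\<bar> * h0 y" .
  have "a \<bullet> (y - fl y) \<le> a \<bullet> y" using fl_nonneg by (intro a_inner_mono) simp
  also have "\<dots> \<le> K * h0 y" by (rule K(3)[OF y])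
  finally have 2: "lift vf y \<le> (\<bar>C\<bar> + K) * h0 y" using 1 y by (simp add: lift_def algebra_simps)
  have 3: "\<bar>f 0\<bar> \<le> \<bar>f 0\<bar> * h0 y" using h0_ge_1[OF y] by (simp add: mult_le_cancel_left1)
  have "0 \<le> (\<bar>C\<bar> + K) * h0 y" using K(1) h0_pos[of y] by simp
  then show "\<bar>lift vf y\<bar> \<le> (\<bar>C\<bar> + K + \<bar>f 0\<bar>) * h0 y"
   using super_lower[OF S y] 2 3 by (simp add: algebra_simps)
 qed
qed

text \<open>The factor of \<open>wait_add_h0\<close> for one wait of length \<open>\<delta>\<close>.
  It tends to 1 as the mesh shrinks and is only used for a fixed \<open>\<delta>\<close>.\<close>

definition contraction where "contraction = theta + (1 - theta) * exp (- (beta - c / 2) * \<delta>)"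

lemma contraction: "0 \<le> contraction" "contraction < 1"
proof -
 have "0 < (beta - c / 2) * \<delta>" using beta_pos c_pos \<delta>_pos by (intro mult_pos_pos) auto
 then have "exp (- (beta - c / 2) * \<delta>) < 1" by (simp add: algebra_simps)
 then have "(1 - theta) * exp (- (beta - c / 2) * \<delta>) < (1 - theta) * 1" using theta by (intro mult_strict_left_mono) auto
 then show "contraction < 1" by (simp add: contraction_def)
 show "0 \<le> contraction" using theta by (simp add: contraction_def)
qed

text \<open>Payments take no time and contract nothing, so they are treated by an inner induction on
  the sum of the grid index, which keeps the improved bound. At a \<open>Wait\<close> the weaker
  bound \<open>IH\<close> is applied to the continuation, and the wait supplies the factor.\<close>

lemma grid_improve:
 assumes S: "grid_super vf" and D: "0 \<le> D" and IH: "\<And>m s L T. follows m s L T ==> val (G m) (L, T) \<le> ereal (vf m + D * h0 (G m))"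
 shows "follows m s L T ==> val (G m) (L, T) \<le> ereal (vf m + contraction * D * h0 (G m))"
proof (induction "\<Sum>i\<in>UNIV. m $ i" arbitrary: m s L T rule: less_induct)
 case less
 note B = S[unfolded grid_super_def, THEN conjunct1]
 note S' = B[unfolded grid_base_def]
 note A = less(2)[unfolded follows_def, THEN conjunct1]
 note tw = super_tame[OF B]
 let ?v = "\<lambda>z. lift vf z + D * h0 z"
 have CD: "0 \<le> contraction * D * h0 x" for x using contraction D h0_pos[of x] by simp
 have first: "s w 0 = s (late 0) 0" if "w \<in> claim_paths" for w
  by (rule follows_first_constant[OF less(2) that late_paths]) simp
 show ?case
 proof (cases "s (late 0) 0")
  case Switch
  then show ?thesis using switch_value[OF less(2)] first S'[THEN conjunct1, THEN spec, of m] CD[of "G m"] by simp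
 next
  case (Pay i)
  then have act: "\<And>w. w \<in> claim_paths ==> s w 0 = Pay i" using first by simp
  have P: "0 < m $ i"
   "follows (m - axis i 1) (\<lambda>w k. s w (Suc k)) (tail_L (\<lambda>w. w) 0 (axis i (p $ i * \<delta>)) L) (tail_T (\<lambda>w. w) 0 T)"
   "val (G m) (L, T) = ereal (a $ i * (p $ i * \<delta>)) + val (G (m - axis i 1)) (tail_L (\<lambda>w. w) 0 (axis i (p $ i * \<delta>)) L, tail_T (\<lambda>w. w) 0 T)"
   by (rule pay_value[OF less(2) act]; assumption)+
  have "(\<Sum>j\<in>UNIV. (m - axis i 1) $ j) < (\<Sum>j\<in>UNIV. m $ j)"
   using P(1) by (intro sum_strict_mono_ex1) (auto simp: axis_def)
  from less(1)[OF this P(2)]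
  have "val (G m) (L, T) \<le> ereal (a $ i * (p $ i * \<delta>)) + ereal (vf (m - axis i 1) + contraction * D * h0 (G (m - axis i 1)))"
   unfolding P(3) by (rule add_left_mono)
  also have "\<dots> \<le> ereal (vf m + contraction * D * h0 (G m))"
  proof -
   have "G (m - axis i 1) \<le> G m" unfolding G_pay[OF P(1)] using p_pos[of i] \<delta>_pos by (auto simp: less_eq_vec_def axis_def)
   then have "contraction * D * h0 (G (m - axis i 1)) \<le> contraction * D * h0 (G m)"
    using contraction D by (intro mult_left_mono h0_mono) auto
   moreover have "a $ i * (p $ i * \<delta>) + vf (m - axis i 1) \<le> vf m" using S' P(1) by blast
   ultimately show ?thesis by simp
  qed
  finally show ?thesis .
 next
  case Wait
  then have act: "\<And>w. w \<in> claim_paths ==> s w 0 = Wait" using first by simp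
  have "val (G m) (L, T) \<le> ereal (wait_value ?v (Q ?v) \<delta> (G m))"
   unfolding strategy_value_eq[OF A G_nonneg]
  proof (rule ext_expectation_le_wait[OF payoff_measurable[OF A] payoff_bound[OF A G_nonneg] tame_add[OF tw tame_h0] G_nonneg])
   show "0 \<le> \<delta>" using \<delta>_pos by simp
   fix t :: real and u :: "real^'n" assume tu: "0 < t" "t \<le> \<delta>" "0 \<le> u"
   let ?E = "cons_claim t u"
   show "fibre (G m) L T ?E \<le> ereal (exp (- c * t) * psi ?v (G m + t *\<^sub>R p) u)"
   proof (cases "u \<le> G m + t *\<^sub>R p")
    case True
    define y where "y = G m + t *\<^sub>R p - u"
    have W: "follows (\<rho> y) (\<lambda>w k. s (?E w) (Suc k)) (tail_L ?E t (y - fl y) L) (tail_T ?E t T)"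
     "fibre (G m) L T ?E =
      ereal (exp (- c * t) * (a \<bullet> (y - fl y))) + ereal (exp (- c * t)) * val (G (\<rho> y)) (tail_L ?E t (y - fl y) L, tail_T ?E t T)"
     unfolding y_def by (rule wait_claim[OF less(2) act tu True]; assumption)+
    have y: "0 \<le> y" using True by (simp add: y_def)
    have "fibre (G m) L T ?E \<le>
     ereal (exp (- c * t) * (a \<bullet> (y - fl y))) + ereal (exp (- c * t)) * ereal (vf (\<rho> y) + D * h0 (G (\<rho> y)))"
     unfolding W(2) by (intro add_left_mono ereal_mult_left_mono IH[OF W(1)]) simp
    also have "\<dots> = ereal (exp (- c * t) * (a \<bullet> (y - fl y) + vf (\<rho> y) + D * h0 (G (\<rho> y))))" by (simp add: algebra_simps)
    also have "\<dots> \<le> ereal (exp (- c * t) * psi ?v (G m + t *\<^sub>R p) u)"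
     using True y h0_mono[OF fl_le[OF y]] D
     by (auto simp: psi_def y_def[symmetric] lift_def grid_floor_def[symmetric] intro!: mult_left_mono)
    finally show ?thesis .
   next
    case False
    have "fibre (G m) L T ?E = ereal (- (exp (- c * t) * pen0 (G m + t *\<^sub>R p) u))"
     by (rule wait_ruin[OF less(2) act tu False])
    then show ?thesis using False by (simp add: psi_def)
   qed
  next
   have W: "follows (m + 1) (\<lambda>w k. s (delay \<delta> w) (Suc k)) (tail_L (delay \<delta>) \<delta> 0 L) (tail_T (delay \<delta>) \<delta> T)"
    "fibre (G m) L T (delay \<delta>) =
     ereal (exp (- c * \<delta>)) * val (G (m + 1)) (tail_L (delay \<delta>) \<delta> 0 L, tail_T (delay \<delta>) \<delta> T)"
    by (rule wait_delay[OF less(2) act]; assumption)+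
   have "fibre (G m) L T (delay \<delta>) \<le>
    ereal (exp (- c * \<delta>)) * ereal (vf (m + 1) + D * h0 (G (m + 1)))"
    unfolding W(2) by (intro ereal_mult_left_mono IH[OF W(1)]) simp
   also have "\<dots> = ereal (exp (- c * \<delta>) * ?v (G m + \<delta> *\<^sub>R p))" by (simp add: G_add1[symmetric])
   finally show "fibre (G m) L T (delay \<delta>) \<le> \<dots>" .
  qed
  also have "\<dots> \<le> ereal (vf m + contraction * D * h0 (G m))"
   using wait_add_h0[OF tw G_nonneg, of \<delta> D m] \<delta>_pos D S[unfolded grid_super_def, THEN conjunct2, THEN spec, of m]
   by (simp add: contraction_def mult_ac)
  finally show ?thesis .
 qed
qed

lemma grid_least:
 assumes S: "grid_super vf" and \<pi>: "\<pi> \<in> strat m"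
 shows "val (G m) \<pi> \<le> ereal (vf m)"
proof -
 define D where "D = 4 * K + \<bar>f 0\<bar>"
 have D: "0 \<le> D" using K(1) by (simp add: D_def)
 have it: "follows m s L T ==> val (G m) (L, T) \<le> ereal (vf m + contraction ^ n * D * h0 (G m))" for n m s L T
 proof (induction n arbitrary: m s L T)
  case 0
  have A: "(L, T) \<in> admissible p (G m)" using 0 by (simp add: follows_def)
  have "f 0 \<le> vf m" using super_lower[OF S[unfolded grid_super_def, THEN conjunct1] G_nonneg, of m] by simp
  moreover have "\<bar>f 0\<bar> \<le> \<bar>f 0\<bar> * h0 (G m)" using h0_ge_1[OF G_nonneg, of m] by (simp add: mult_le_cancel_left1)
  ultimately have "4 * K * h0 (G m) \<le> vf m + D * h0 (G m)" by (simp add: D_def algebra_simps)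
  then show ?case using value_upper[OF A G_nonneg] by (simp add: order_trans)
 next
  case (Suc n)
  show ?case
   using grid_improve[OF S _ Suc(1) Suc(2)] contraction D by (simp add: mult.assoc)
 qed
 obtain L T s where "\<pi> = (L, T)" "follows m s L T" using \<pi> strat_iff by (cases \<pi>) auto
 note it = it[OF this(2)] this(1)
 have "(\<lambda>n. contraction ^ n) \<longlonglongrightarrow> 0" using contraction by (intro LIMSEQ_realpow_zero)
 then have "(\<lambda>n. vf m + contraction ^ n * D * h0 (G m)) \<longlonglongrightarrow> vf m + 0 * D * h0 (G m)"
  by (intro tendsto_add tendsto_mult tendsto_const)
 then have "(\<lambda>n. ereal (vf m + contraction ^ n * D * h0 (G m))) \<longlonglongrightarrow> ereal (vf m)" by simp
 then show ?thesis unfolding it(2) by (rule LIMSEQ_le_const) (use it(1) in blast)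
qed

end

section \<open>Construction of strategies with a prescribed first action\<close>

lemma zero_good_path:
 fixes w :: "'n::finite claims"
 assumes w: "w \<in> claim_paths" and p: "0 \<le> p" and x: "0 \<le> x"
 shows "good_path p x w (\<lambda>_. 0)"
proof -
 have ll: "left_limit (\<lambda>_. 0 :: real^'n) t = 0" for t by (rule left_limitI) simp
 have sp: "0 \<le> surplus p x w t" if t: "0 \<le> t" "ennreal t < path_ruin p x (\<lambda>_. 0) w" for t
 proof (cases "claim_count w t")
  case 0
  have "0 \<le> t *\<^sub>R p" using vec_scale_mono[OF t(1) p] by simp
  then show ?thesis using x by (simp add: surplus_def 0)
 next
  case (Suc k)
  have kt: "fst (w k) \<le> t" using claim_count_iff[OF w, of k t] Suc by simp
  \<comment> \<open>The last claim before \<open>t\<close> did not cause ruin, so the surplus was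
    nonnegative at its arrival and has only grown since.\<close>
  have "\<not> ruin_at p x (\<lambda>_. 0) w k"
  proof
   assume "ruin_at p x (\<lambda>_. 0) w k"
   then have "path_ruin p x (\<lambda>_. 0) w \<le> ennreal (fst (w k))" unfolding path_ruin_INF by (intro INF_lower) simp
   also have "\<dots> \<le> ennreal t" by (rule ennreal_leI[OF kt])
   finally show False using t(2) by simp
  qed
  then have 1: "0 \<le> surplus p x w (fst (w k))" by (simp add: ruin_at_def pre_claim_def ll)
  have cc: "claim_count w (fst (w k)) = Suc k"
   by (rule claim_count_eqI[OF w]) (simp add: claim_pathsD(3)[OF w, symmetric] less_Suc_eq_le)
  have "surplus p x w t = surplus p x w (fst (w k)) + (t - fst (w k)) *\<^sub>R p"
   by (simp add: surplus_def Suc cc scaleR_diff_left)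
  moreover have "0 \<le> (t - fst (w k)) *\<^sub>R p" using vec_scale_mono[of 0 "t - fst (w k)" p] kt p by simp
  ultimately show ?thesis using 1 by simp
 qed
 then show ?thesis unfolding good_path_def by (auto simp: ll cadlag_def mono_on_def intro!: exI[of _ 0])
qed

text \<open>Inverse of \<open>cons_claim\<close>. Together with \<open>delay (- r)\<close>, the
  inverse of \<open>delay r\<close>, it recovers the scenario that a continuation is to be fed
  with.\<close>

definition tail_claims :: "'n::finite claims \<Rightarrow> 'n claims" where
 "tail_claims w = (\<lambda>k. (fst (w (Suc k)) - fst (w 0), snd (w (Suc k))))"

lemma tail_claims_simps [simp]:
 "fst (tail_claims w k) = fst (w (Suc k)) - fst (w 0)" "snd (tail_claims w k) = snd (w (Suc k))"
 by (auto simp: tail_claims_def)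

lemma tail_claims_cons [simp]: "tail_claims (cons_claim s u w) = w"
 by (rule ext) (simp add: prod_eq_iff)

lemma delay_minus [simp]: "delay (- r) (delay r w) = w"
 by (rule ext) (simp add: prod_eq_iff)

lemma delay_plus [simp]: "delay r (delay (- r) w) = w"
 by (rule ext) (simp add: prod_eq_iff)

lemma same_until_advance:
 assumes "same_claims_until t w w'" shows "same_claims_until (t - r) (delay (- r) w) (delay (- r) w')"
 by (subst same_until_delay[of _ _ _ r]) (simp add: assms)

lemma same_until_tail:
 assumes s: "same_claims_until t w w'" and 0: "w' 0 = w 0"
 shows "same_claims_until (t - fst (w 0)) (tail_claims w) (tail_claims w')"
 unfolding same_claims_until_def
proof (intro allI impI)
 fix k assume k: "fst (tail_claims w k) \<le> t - fst (w 0) \<or> fst (tail_claims w' k) \<le> t - fst (w 0)"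
 have "w (Suc k) = w' (Suc k)"
  by (rule s[unfolded same_claims_until_def, rule_format]) (use k in \<open>simp add: 0\<close>)
 then show "tail_claims w k = tail_claims w' k" by (simp add: tail_claims_def 0)
qed

lemma claims_unbounded: "w \<in> claim_paths ==> \<exists>k. r \<le> fst (w k)"
proof -
 assume w: "w \<in> claim_paths"
 obtain N :: nat where "r < real N" using reals_Archimedean2 by blast
 moreover obtain k where "real N \<le> fst (w k)" using w unfolding claim_paths_iff by blast
 ultimately show ?thesis by (intro exI[of _ k]) simp
qed

lemma shift_rel_tail:
 assumes w: "w \<in> claim_paths" shows "shift_rel 1 (fst (w 0)) w (tail_claims w)"
proof -
 note D = claim_pathsD[OF w]
 have "tail_claims w \<in> claim_paths"
  unfolding claim_paths_iff
 proof (intro conjI allI)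
  show "0 < fst (tail_claims w 0)" using D(2)[of 0 1] by simp
  show "fst (tail_claims w k) < fst (tail_claims w (Suc k))" for k using D(2)[of "Suc k" "Suc (Suc k)"] by simp
  show "0 \<le> snd (tail_claims w k)" for k using D(4) by simp
  fix N :: nat
  obtain k where k: "real N + fst (w 0) \<le> fst (w k)" using claims_unbounded[OF w] by blast
  then show "\<exists>k. real N \<le> fst (tail_claims w k)" using D(2)[of k "Suc k"] by (intro exI[of _ k]) simp
 qed
 then show ?thesis using w less_imp_le[OF D(1)] by (simp add: shift_rel_def)
qed

lemma shift_rel_advance:
 assumes w: "w \<in> claim_paths" and r: "0 \<le> r" "r < fst (w 0)" shows "shift_rel 0 r w (delay (- r) w)"
proof -
 note D = claim_pathsD[OF w]
 have "delay (- r) w \<in> claim_paths"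
  unfolding claim_paths_iff
 proof (intro conjI allI)
  show "0 < fst (delay (- r) w 0)" using r by simp
  show "fst (delay (- r) w k) < fst (delay (- r) w (Suc k))" for k using D(2)[of k "Suc k"] by simp
  show "0 \<le> snd (delay (- r) w k)" for k using D(4) by simp
  fix N :: nat
  obtain k where k: "real N + r \<le> fst (w k)" using claims_unbounded[OF w] by blast
  then show "\<exists>k. real N \<le> fst (delay (- r) w k)" by (intro exI[of _ k]) simp
 qed
 then show ?thesis using w r by (simp add: shift_rel_def)
qed

context grid_model
begin

lemma val_cong:
 assumes "(L, T) \<in> admissible p x" "(L', T') \<in> admissible p x" "0 \<le> x"
  and "\<And>w t. w \<in> claim_paths ==> L t w = L' t w" "\<And>w. w \<in> claim_paths ==> T w = T' w"
 shows "val x (L, T) = val x (L', T')"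
 unfolding strategy_value_eq[OF assms(1,3)] strategy_value_eq[OF assms(2,3)]
 by (rule ext_expectation_cong) (simp add: assms(4,5))

lemma idle_admissible: "0 \<le> x ==> (\<lambda>_ _. 0, \<lambda>_. 0) \<in> admissible p x"
 unfolding admissible_iff stopping_time_history_iff
 by (auto simp: adapted_at_def intro: zero_good_path p_nonneg)

lemma lump_admissible:
 assumes A: "(L, T) \<in> admissible p x" and b: "0 \<le> b"
 shows "(\<lambda>t w. if t < 0 then 0 else b + L t w, T) \<in> admissible p (x + b)"
 unfolding admissible_iff
proof (intro conjI allI impI ballI)
 note A' = A[unfolded admissible_iff]
 show "stopping_time history T" using A' by blast
 fix t :: real assume t: "0 \<le> t"
 have "L t \<in> borel_measurable path_space" "adapted_at t (L t)" using A' t by auto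
 then show "(\<lambda>w. if t < 0 then 0 else b + L t w) \<in> borel_measurable path_space" "adapted_at t (\<lambda>w. if t < 0 then 0 else b + L t w)"
  using t by (auto simp: adapted_at_def)
next
 fix w :: "'n claims" assume w: "w \<in> claim_paths"
 show "good_path p (x + b) w (\<lambda>t. if t < 0 then 0 else b + L t w)"
 proof (rule good_path_glue[OF _ shift_rel_refl[OF w] _ b])
  show "good_path p (x + b + 0 *\<^sub>R p - (\<Sum>k<0. snd (w k)) - b) w (\<lambda>t. L t w)"
   using admissible_good_path[OF A w] by simp
 qed auto
qed

lemma lump_value:
 assumes A: "(L, T) \<in> admissible p x" and b: "0 \<le> b" and x: "0 \<le> x"
 shows "val (x + b) (\<lambda>t w. if t < 0 then 0 else b + L t w, T) = ereal (a \<bullet> b) + val x (L, T)"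
proof -
 note B = lump_admissible[OF A b]
 let ?L = "\<lambda>t w. if t < 0 then 0 else b + L t w"
 have xb: "0 \<le> x + b" using x b by simp
 have pre: "(LINT q|elaw c. a \<bullet> (if q < 0 then ?L q w else b)) = a \<bullet> b" if "w \<in> claim_paths" for w
 proof -
  have "(\<lambda>q. a \<bullet> (if q < 0 then ?L q w else b)) = (\<lambda>q. if q < 0 then 0 else a \<bullet> b)" by auto
  then show ?thesis using exp_tail[of 0 "a \<bullet> b"] by simp
 qed
 have "ext_expectation M (\<lambda>w. payoff (x + b) (\<lambda>t. ?L t w) (T w) w) = ereal (a \<bullet> b) + ereal (exp (- c * 0)) * val x (L, T)"
  by (rule tail_value[OF B measurable_ident_sets[OF refl] shift_rel_refl _ _ A xb x _ _ pre]) auto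
 then show ?thesis unfolding strategy_value_eq[OF B xb] by (simp add: one_ereal_def[symmetric])
qed

lemma switch_follows: "follows m (\<lambda>_ _. Switch) (\<lambda>_ _. 0) (\<lambda>_. 0)"
proof -
 have e: "action_end p \<delta> w Switch (0, m) = None" for w by simp
 show ?thesis
  unfolding follows_def non_anticipative_def
  using idle_admissible[OF G_nonneg] allowed_along_stop[where \<sigma>="\<lambda>_. Switch", OF e]
   grid_dividends_stop[where \<sigma>="\<lambda>_. Switch", OF e] grid_switch_time_stop[where \<sigma>="\<lambda>_. Switch", OF e]
  by auto
qed

lemma pay_follows:
 assumes fo: "follows (m - axis i 1) s L T" and i: "0 < m $ i"
 shows "follows m (\<lambda>w. case_nat (Pay i) (s w)) (\<lambda>t w. if t < 0 then 0 else axis i (p $ i * \<delta>) + L t w) T"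
proof -
 let ?b = "axis i (p $ i * \<delta>)" and ?\<sigma> = "\<lambda>w. case_nat (Pay i) (s w)"
 have Gm: "G (m - axis i 1) + ?b = G m" using G_pay[OF i] by simp
 have b: "0 \<le> ?b" using p_pos[of i] \<delta>_pos by (auto simp: less_eq_vec_def axis_def)
 have A: "(L, T) \<in> admissible p (G (m - axis i 1))" using fo by (simp add: follows_def)
 have e: "action_end p \<delta> w (?\<sigma> w 0) (0, m) = Some (0, m - axis i 1)" for w by simp
 have al: "allowed_along p \<delta> m w (?\<sigma> w)" if "w \<in> claim_paths" for w
  unfolding allowed_along_tail[where \<sigma>="?\<sigma> w", OF shift_rel_refl[OF that] \<delta>_pos e] using fo that i by (simp add: follows_def)
 show ?thesis
  unfolding follows_def
 proof (intro conjI ballI allI al)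
  show "(\<lambda>t w. if t < 0 then 0 else ?b + L t w, T) \<in> admissible p (G m)"
   using lump_admissible[OF A b] unfolding Gm .
  show "non_anticipative p \<delta> m ?\<sigma>"
   unfolding non_anticipative_def
  proof (intro ballI allI impI)
   fix w w' :: "'n claims" and t k t' m'
   assume w: "w \<in> claim_paths" "w' \<in> claim_paths" and sm: "same_claims_until t w w'"
    and st: "grid_state p \<delta> m w (?\<sigma> w) k = Some (t', m') \<and> t' \<le> t"
   show "?\<sigma> w k = ?\<sigma> w' k"
   proof (cases k)
    case (Suc j)
    have "shift_state 0 (grid_state p \<delta> (m - axis i 1) w (s w) j) = Some (t', m')"
     using st grid_state_tail[where \<sigma>="?\<sigma> w", OF shift_rel_refl[OF w(1)] \<delta>_pos e, of j] unfolding Suc by simp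
    then have "grid_state p \<delta> (m - axis i 1) w (s w) j = Some (t', m')" unfolding shift_state_eq_Some by simp
    moreover have "non_anticipative p \<delta> (m - axis i 1) s" using fo by (simp add: follows_def)
    ultimately show ?thesis using w sm st unfolding non_anticipative_def Suc by fastforce
   qed simp
  qed
  fix w :: "'n claims" assume w: "w \<in> claim_paths"
  note S = shift_rel_refl[OF w]
  show "(if t < 0 then 0 else ?b + L t w) = grid_dividends p \<delta> m (\<lambda>_. ?\<sigma> w) t w" for t
   using grid_dividends_tail[where \<sigma>="?\<sigma> w", OF S \<delta>_pos e al[OF w], of t] fo w by (simp add: follows_def)
  show "T w = grid_switch_time p \<delta> m (\<lambda>_. ?\<sigma> w) w"
   using grid_switch_time_tail[where \<sigma>="?\<sigma> w", OF S \<delta>_pos e] fo w by (simp add: follows_def)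
 qed
qed

context
 fixes m :: "nat^'n" and sf :: "nat^'n \<Rightarrow> 'n claims \<Rightarrow> nat \<Rightarrow> 'n action" and Lf :: "nat^'n \<Rightarrow> 'n dividends"
  and Tf :: "nat^'n \<Rightarrow> 'n claims \<Rightarrow> ennreal"
begin

text \<open>A wait is put in front of a family of continuations, one for each grid index. At time
  \<open>clock w\<close> the continuation for the index \<open>idx w\<close> takes over and sees the
  scenario \<open>after w\<close>, once \<open>lump w\<close> has been paid. After ruin during the
  wait (\<open>\<not> alive w\<close>) nothing is paid and no switch occurs.\<close>

definition "post w = G m + fst (w 0) *\<^sub>R p - snd (w (0::nat))"
definition "alive w \<longleftrightarrow> \<delta> < fst (w 0) \<or> 0 \<le> post w"
definition "clock w = min \<delta> (fst (w (0::nat)))"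
definition "after w = (if \<delta> < fst (w 0) then delay (- \<delta>) w else tail_claims w)"
definition "idx w = (if \<delta> < fst (w 0) then m + 1 else \<rho> (post w))"
definition "lump w = (if \<delta> < fst (w 0) then 0 else post w - fl (post w))"
definition "claims_used w = (if \<delta> < fst (w 0) then 0 else 1 :: nat)"
definition "wait_L t w = (if alive w \<and> clock w \<le> t then lump w + Lf (idx w) (t - clock w) (after w) else 0)"
definition "wait_T w = (if alive w then ennreal (clock w) + Tf (idx w) (after w) else \<infinity>)"
definition "wait_s w = case_nat Wait (sf (idx w) (after w))"

lemma wait_shift: "w \<in> claim_paths ==> shift_rel (claims_used w) (clock w) w (after w)"
 using shift_rel_tail[of w] shift_rel_advance[of w \<delta>] \<delta>_pos
 by (auto simp: claims_used_def clock_def after_def min_def)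

lemma wait_end:
 assumes w: "w \<in> claim_paths"
 shows "alive w ==> action_end p \<delta> w Wait (0, m) = Some (clock w, idx w)"
  "alive w ==> action_dividend p \<delta> w Wait (0, m) = lump w"
  "\<not> alive w ==> action_end p \<delta> w Wait (0, m) = None"
proof -
 have n: "next_claim w 0 = 0" using next_claim_first[OF w] claim_pathsD(1)[OF w, of 0] by simp
 have "post_claim p \<delta> w 0 m = post w" by (simp add: post_claim_def n post_def)
 then show "alive w ==> action_end p \<delta> w Wait (0, m) = Some (clock w, idx w)"
  "alive w ==> action_dividend p \<delta> w Wait (0, m) = lump w"
  "\<not> alive w ==> action_end p \<delta> w Wait (0, m) = None"
  by (auto simp: n alive_def clock_def idx_def lump_def)
qed

lemma wait_geo: "G (idx w) = G m + clock w *\<^sub>R p - (\<Sum>k<claims_used w. snd (w k)) - lump w"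
 by (simp add: idx_def clock_def claims_used_def lump_def G_add1 post_def grid_floor_def)

lemma lump_nonneg: "alive w ==> 0 \<le> lump w"
 using fl_le[of "post w"] by (auto simp: alive_def lump_def)

text \<open>When the wait is over by time \<open>t\<close>, everything that selects the continuation
  is known at \<open>t\<close>. Scenarios with the same claims up to \<open>t\<close> then use the
  same continuation, and the scenarios fed to it agree for the remaining time.\<close>

lemma wait_sync:
 assumes w: "w \<in> claim_paths" "w' \<in> claim_paths" and s: "same_claims_until t w w'" and t: "clock w \<le> t"
 shows "clock w' = clock w" "alive w' = alive w" "idx w' = idx w" "lump w' = lump w"
  "same_claims_until (t - clock w) (after w) (after w')"
proof -
 have eq: "w 0 = w' 0" if "fst (w 0) \<le> t \<or> fst (w' 0) \<le> t" using s that unfolding same_claims_until_def by blast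
 have "clock w' = clock w \<and> alive w' = alive w \<and> idx w' = idx w \<and> lump w' = lump w \<and>
  same_claims_until (t - clock w) (after w) (after w')"
 proof (cases "\<delta> < fst (w 0)")
  case True
  then have "\<delta> \<le> t" using t by (simp add: clock_def)
  then have *: "\<delta> < fst (w' 0)" using eq True by force
  have "same_claims_until (t - \<delta>) (delay (- \<delta>) w) (delay (- \<delta>) w')"
   by (rule same_until_advance[OF s])
  then show ?thesis using True * by (simp add: clock_def alive_def idx_def lump_def after_def)
 next
  case False
  then have "fst (w 0) \<le> t" using t by (simp add: clock_def)
  then have *: "w' 0 = w 0" using eq by simp
  have "same_claims_until (t - fst (w 0)) (tail_claims w) (tail_claims w')"
   by (rule same_until_tail[OF s *])
  then show ?thesis using False * by (simp add: clock_def alive_def idx_def lump_def after_def post_def)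
 qed
 then show "clock w' = clock w" "alive w' = alive w" "idx w' = idx w" "lump w' = lump w"
  "same_claims_until (t - clock w) (after w) (after w')" by auto
qed

lemma wait_measurable:
 "clock \<in> borel_measurable path_space" "Measurable.pred path_space alive" "lump \<in> borel_measurable path_space"
 "idx \<in> measurable path_space (count_space UNIV)" "after \<in> measurable path_space path_space"
proof -
 have d: "{w \<in> space path_space. \<delta> < fst (w (0::nat))} \<in> sets path_space"
  by (rule borel_measurable_less[OF borel_measurable_const measurable_claim(1)])
 have po: "post \<in> borel_measurable path_space"
  unfolding post_def[abs_def] by (intro borel_measurable_diff borel_measurable_add borel_measurable_const borel_measurable_scaleR measurable_claim)
 show "clock \<in> borel_measurable path_space"
  unfolding clock_def[abs_def] by (intro borel_measurable_min borel_measurable_const measurable_claim)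
 show "Measurable.pred path_space alive"
  unfolding alive_def[abs_def] using d by (intro pred_intros_logic pred_le_vec po borel_measurable_const) (simp add: pred_def)
 have "(\<lambda>w. nat \<lfloor>post w $ i / (\<delta> * p $ i)\<rfloor>) \<in> measurable path_space (count_space UNIV)" for i
  using measurable_compose[OF po borel_measurable_vec_nth'[of i]] by measurable
 then have rp: "(\<lambda>w. \<rho> (post w)) \<in> measurable path_space (count_space UNIV)"
  unfolding grid_index_def by (rule measurable_vec_count_space)
 then show "idx \<in> measurable path_space (count_space UNIV)"
  unfolding idx_def[abs_def] by (intro measurable_If d) auto
 have "(\<lambda>w. fl (post w)) \<in> borel_measurable path_space"
  unfolding grid_floor_def by (rule measurable_compose[OF rp]) simp
 then show "lump \<in> borel_measurable path_space"
  unfolding lump_def[abs_def] by (intro measurable_If d borel_measurable_diff po) auto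
 show "after \<in> measurable path_space path_space"
 proof (rule measurable_path_spaceI)
  show "after w \<in> claim_paths" if "w \<in> space path_space" for w using shift_relD(2)[OF wait_shift] that by simp
  fix k
  have "(\<lambda>w. if \<delta> < fst (w 0) then - \<delta> + fst (w k) else fst (w (Suc k)) - fst (w 0)) \<in> borel_measurable path_space"
   "(\<lambda>w. if \<delta> < fst (w 0) then snd (w k) else snd (w (Suc k))) \<in> borel_measurable path_space"
   by (intro measurable_If d borel_measurable_add borel_measurable_diff borel_measurable_const measurable_claim)+
  then show "(\<lambda>w. fst (after w k)) \<in> borel_measurable path_space" "(\<lambda>w. snd (after w k)) \<in> borel_measurable path_space"
   by (simp_all add: after_def if_distrib[where f="\<lambda>w. fst (w k)"] if_distrib[where f="\<lambda>w. snd (w k)"] cong: if_cong)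
 qed
qed

context
 assumes fo: "\<And>m'. follows m' (sf m') (Lf m') (Tf m')"
begin

lemma Af: "(Lf i, Tf i) \<in> admissible p (G i)" using fo[of i] by (simp add: follows_def)

lemma wait_good:
 assumes w: "w \<in> claim_paths" shows "good_path p (G m) w (\<lambda>t. wait_L t w)"
proof (cases "alive w")
 case False
 then show ?thesis using zero_good_path[OF w p_nonneg G_nonneg] by (simp add: wait_L_def)
next
 case True
 note S = wait_shift[OF w]
 have L: "wait_L t w = (if t < clock w then 0 else lump w + Lf (idx w) (t - clock w) (after w))" for t
  using True by (simp add: wait_L_def)
 show ?thesis
 proof (rule good_path_glue[OF _ S _ lump_nonneg[OF True] L])
  show "good_path p (G m + clock w *\<^sub>R p - (\<Sum>k<claims_used w. snd (w k)) - lump w) (after w) (\<lambda>t. Lf (idx w) t (after w))"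
   unfolding wait_geo[symmetric] by (rule admissible_good_path[OF Af shift_relD(2)[OF S]])
  show "0 \<le> surplus p (G m) w t" if "0 \<le> t" "t < clock w" for t
   using surplus_before[OF w, of t p "G m"] orthant_path[OF G_nonneg that(1)] that(2) by (simp add: clock_def)
  fix j assume j: "j < claims_used w"
  then have *: "j = 0" "clock w = fst (w 0)" "0 \<le> post w" using True by (auto simp: claims_used_def clock_def alive_def split: if_splits)
  have "((\<lambda>t. wait_L t w) \<longlongrightarrow> 0) (at_left (fst (w 0)))"
   by (rule Lim_transform_eventually[OF tendsto_const], rule eventually_at_leftI[of "fst (w 0) - 1"]) (auto simp: L *(2))
  then have "left_limit (\<lambda>t. wait_L t w) (fst (w 0)) = 0" by (rule left_limitI)
  from first_pre_claim[OF w this] show "\<not> ruin_at p (G m) (\<lambda>t. wait_L t w) w j"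
   using *(3) by (simp add: ruin_at_def *(1) post_def)
 qed
qed

lemma wait_T_le: "0 \<le> t ==> w \<in> claim_paths ==>
 wait_T w \<le> ennreal t \<longleftrightarrow> alive w \<and> clock w \<le> t \<and> Tf (idx w) (after w) \<le> ennreal (t - clock w)"
proof -
 assume t: "0 \<le> t" and w: "w \<in> claim_paths"
 have c0: "0 \<le> clock w" using shift_relD(3)[OF wait_shift[OF w]] .
 show ?thesis
 proof (cases "alive w")
  case True
  show ?thesis
  proof (cases "Tf (idx w) (after w)")
   case (real r)
   then have "wait_T w = ennreal (clock w + r)" using True c0 by (simp add: wait_T_def)
   then show ?thesis using True t c0 real by (cases "clock w \<le> t") (auto simp: ennreal_le_iff simp del: ennreal_plus)
  qed (simp_all add: wait_T_def True top_unique)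
 qed (simp add: wait_T_def top_unique)
qed

text \<open>Choosing the continuation by the index reached is measurable because there are only
  countably many indices. Adaptedness rests on \<open>wait_sync\<close> once the wait is over;
  earlier, nothing has been paid and no switch has occurred in either scenario.\<close>

lemma wait_admissible: "(wait_L, wait_T) \<in> admissible p (G m)"
 unfolding admissible_iff stopping_time_history_iff
proof (intro conjI allI impI ballI wait_good)
 note [measurable] = wait_measurable
 note f = Af[unfolded admissible_iff stopping_time_history_iff]
 show "wait_T \<in> borel_measurable path_space"
 proof -
  have [measurable]: "Tf i \<in> borel_measurable path_space" for i using f by blast
  have "(\<lambda>w. if alive w then ennreal (clock w) + Tf i (after w) else \<infinity>) \<in> borel_measurable path_space" for i by measurable
  then show ?thesis unfolding wait_T_def[abs_def] by (rule measurable_compose_countable) (rule wait_measurable)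
 qed
 fix t :: real assume t: "0 \<le> t"
 show "wait_L t \<in> borel_measurable path_space"
 proof -
  have [measurable]: "(\<lambda>w. Lf i (t - clock w) (after w)) \<in> borel_measurable path_space" for i
   by (rule process_measurable[OF Af]) measurable
  have "(\<lambda>w. if alive w \<and> clock w \<le> t then lump w + Lf i (t - clock w) (after w) else 0) \<in> borel_measurable path_space" for i by measurable
  then show ?thesis unfolding wait_L_def[abs_def] by (rule measurable_compose_countable) (rule wait_measurable)
 qed
 have notyet: "\<not> clock w' \<le> t" if "w \<in> claim_paths" "w' \<in> claim_paths" "same_claims_until t w w'" "\<not> clock w \<le> t" for w w' :: "'n claims"
  using wait_sync(1)[OF that(2,1) same_claims_until_sym[OF that(3)]] that(4) by auto
 show "adapted_at t (wait_L t)"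
  unfolding adapted_at_def
 proof (intro ballI impI)
  fix w w' :: "'n claims" assume *: "w \<in> claim_paths" "w' \<in> claim_paths" "same_claims_until t w w'"
  show "wait_L t w = wait_L t w'"
  proof (cases "clock w \<le> t")
   case True
   note s = wait_sync[OF * True]
   have "adapted_at (t - clock w) (Lf (idx w) (t - clock w))" using f True by auto
   from adapted_atD[OF this shift_relD(2)[OF wait_shift[OF *(1)]] shift_relD(2)[OF wait_shift[OF *(2)]] s(5)]
   show ?thesis by (simp add: wait_L_def s)
  qed (use notyet[OF *] in \<open>simp add: wait_L_def\<close>)
 qed
 show "adapted_at t (\<lambda>w. wait_T w \<le> ennreal t)"
  unfolding adapted_at_def
 proof (intro ballI impI)
  fix w w' :: "'n claims" assume *: "w \<in> claim_paths" "w' \<in> claim_paths" "same_claims_until t w w'"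
  show "(wait_T w \<le> ennreal t) = (wait_T w' \<le> ennreal t)"
  proof (cases "clock w \<le> t")
   case True
   note s = wait_sync[OF * True]
   have "adapted_at (t - clock w) (\<lambda>w'. Tf (idx w) w' \<le> ennreal (t - clock w))" using f True by auto
   from adapted_atD[OF this shift_relD(2)[OF wait_shift[OF *(1)]] shift_relD(2)[OF wait_shift[OF *(2)]] s(5)]
   show ?thesis by (simp add: wait_T_le[OF t *(1)] wait_T_le[OF t *(2)] s)
  qed (use notyet[OF *] in \<open>simp add: wait_T_le[OF t *(1)] wait_T_le[OF t *(2)]\<close>)
 qed
qed

lemma wait_follows: "follows m wait_s wait_L wait_T"
 unfolding follows_def
proof (intro conjI ballI allI wait_admissible)
 have ws: "wait_s w 0 = Wait" "(\<lambda>k. wait_s w (Suc k)) = sf (idx w) (after w)" for w by (simp_all add: wait_s_def)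
 have e: "action_end p \<delta> w (wait_s w 0) (0, m) = Some (clock w, idx w)" if "w \<in> claim_paths" "alive w" for w
  using wait_end(1)[OF that] by (simp only: ws)
 have e': "action_end p \<delta> w (wait_s w 0) (0, m) = None" if "w \<in> claim_paths" "\<not> alive w" for w
  using wait_end(3)[OF that] by (simp only: ws)
 have fo': "allowed_along p \<delta> (idx w) (after w) (sf (idx w) (after w))"
  "Lf (idx w) t (after w) = grid_dividends p \<delta> (idx w) (\<lambda>_. sf (idx w) (after w)) t (after w)"
  "Tf (idx w) (after w) = grid_switch_time p \<delta> (idx w) (\<lambda>_. sf (idx w) (after w)) (after w)" if "w \<in> claim_paths" for w t
  using fo[of "idx w"] shift_relD(2)[OF wait_shift[OF that]] by (simp_all add: follows_def)
 show al: "allowed_along p \<delta> m w (wait_s w)" if w: "w \<in> claim_paths" for w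
 proof (cases "alive w")
  case True
  show ?thesis
   unfolding allowed_along_tail[where \<sigma>="wait_s w", OF wait_shift[OF w] \<delta>_pos e[OF w True]] ws using fo'(1)[OF w] by simp
 qed (rule allowed_along_stop[where \<sigma>="wait_s w", OF e'[OF w]])
 show "non_anticipative p \<delta> m wait_s"
  unfolding non_anticipative_def
 proof (intro ballI allI impI)
  fix w w' :: "'n claims" and t k t' m'
  assume w: "w \<in> claim_paths" "w' \<in> claim_paths" and sm: "same_claims_until t w w'"
   and st: "grid_state p \<delta> m w (wait_s w) k = Some (t', m') \<and> t' \<le> t"
  show "wait_s w k = wait_s w' k"
  proof (cases k)
   case (Suc j)
   note S = wait_shift[OF w(1)]
   have av: "alive w"
   proof (rule ccontr)
    assume "\<not> alive w"
    from grid_state_stop[where \<sigma>="wait_s w", OF e'[OF w(1) this], of j] st show False unfolding Suc by simp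
   qed
   obtain t1 where t1: "grid_state p \<delta> (idx w) (after w) (sf (idx w) (after w)) j = Some (t1, m')" "t' = clock w + t1"
    using st grid_state_tail[where \<sigma>="wait_s w", OF S \<delta>_pos e[OF w(1) av], of j] unfolding Suc ws shift_state_eq_Some[symmetric]
    by (metis shift_state_eq_Some)
   have t10: "0 \<le> t1" by (rule grid_state_time[OF shift_relD(2)[OF S] \<delta>_pos t1(1)])
   then have ct: "clock w \<le> t" using st t1(2) by simp
   note s = wait_sync[OF w sm ct]
   have "non_anticipative p \<delta> (idx w) (sf (idx w))" using fo[of "idx w"] by (simp add: follows_def)
   moreover have "t1 \<le> t - clock w" using st t1(2) by simp
   ultimately have "sf (idx w) (after w) j = sf (idx w) (after w') j"
    using shift_relD(2)[OF S] shift_relD(2)[OF wait_shift[OF w(2)]] s(5) t1(1) unfolding non_anticipative_def by blast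
   then show ?thesis by (simp add: Suc wait_s_def s)
  qed (simp add: ws)
 qed
 fix w :: "'n claims" assume w: "w \<in> claim_paths"
 note S = wait_shift[OF w]
 show "wait_L t w = grid_dividends p \<delta> m (\<lambda>_. wait_s w) t w" for t
 proof (cases "alive w")
  case True
  note g = grid_dividends_tail[where \<sigma>="wait_s w", OF S \<delta>_pos e[OF w True] al[OF w], unfolded ws]
  show ?thesis
  proof (cases "clock w \<le> t")
   case ct: True
   then show ?thesis using g(1)[of "t - clock w"] True wait_end(2)[OF w True] fo'(2)[OF w] by (simp add: wait_L_def)
  qed (use g(2) in \<open>simp add: wait_L_def\<close>)
 next
  case False
  then show ?thesis using grid_dividends_stop[where \<sigma>="wait_s w", OF e'[OF w False]] by (simp add: wait_L_def)
 qed
 show "wait_T w = grid_switch_time p \<delta> m (\<lambda>_. wait_s w) w"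
 proof (cases "alive w")
  case True
  then show ?thesis
   using grid_switch_time_tail[where \<sigma>="wait_s w", OF S \<delta>_pos e[OF w True], unfolded ws] fo'(3)[OF w] by (simp add: wait_T_def)
 next
  case False
  then show ?thesis using grid_switch_time_stop[where \<sigma>="wait_s w", OF e'[OF w False]] by (simp add: wait_T_def ws)
 qed
qed

text \<open>\<open>u0\<close> is a minorant of the values of the continuations, with the rounding
  dividend included. Given the first claim, or no claim within \<open>\<delta>\<close>, the
  remainder of the glued strategy is exactly the selected continuation, so its value enters the
  conditional bounds.\<close>

lemma wait_value_le:
 assumes u0: "tame u0" and le: "\<And>y. 0 \<le> y ==> ereal (u0 y) \<le> ereal (a \<bullet> (y - fl y)) + val (G (\<rho> y)) (Lf (\<rho> y), Tf (\<rho> y))"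
 shows "ereal (wait_value u0 (Q u0) \<delta> (G m)) \<le> val (G m) (wait_L, wait_T)"
 unfolding strategy_value_eq[OF wait_admissible G_nonneg]
proof (rule ext_expectation_ge_wait[OF payoff_measurable[OF wait_admissible] payoff_bound[OF wait_admissible G_nonneg] u0 G_nonneg])
 have act: "wait_s w 0 = Wait" for w by (simp add: wait_s_def)
 show "0 \<le> \<delta>" using \<delta>_pos by simp
 fix t :: real and u :: "real^'n" assume tu: "0 < t" "t \<le> \<delta>" "0 \<le> u"
 let ?E = "cons_claim t u"
 show "ereal (exp (- c * t) * psi u0 (G m + t *\<^sub>R p) u) \<le> fibre (G m) wait_L wait_T ?E"
 proof (cases "u \<le> G m + t *\<^sub>R p")
  case True
  define y where "y = G m + t *\<^sub>R p - u"
  have y: "0 \<le> y" using True by (simp add: y_def)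
  have W: "follows (\<rho> y) (\<lambda>w k. wait_s (?E w) (Suc k)) (tail_L ?E t (y - fl y) wait_L) (tail_T ?E t wait_T)"
   "fibre (G m) wait_L wait_T ?E =
    ereal (exp (- c * t) * (a \<bullet> (y - fl y))) + ereal (exp (- c * t)) * val (G (\<rho> y)) (tail_L ?E t (y - fl y) wait_L, tail_T ?E t wait_T)"
   unfolding y_def by (rule wait_claim[OF wait_follows act tu True])+
  have E: "post (?E w) = y" "alive (?E w)" "clock (?E w) = t" "after (?E w) = w" "idx (?E w) = \<rho> y" "lump (?E w) = y - fl y" for w
  proof -
   show p: "post (?E w) = y" by (simp add: post_def y_def)
   show "alive (?E w)" "clock (?E w) = t" "after (?E w) = w" "idx (?E w) = \<rho> y" "lump (?E w) = y - fl y"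
    using tu y by (simp_all add: alive_def clock_def after_def idx_def lump_def p)
  qed
  have "val (G (\<rho> y)) (tail_L ?E t (y - fl y) wait_L, tail_T ?E t wait_T) = val (G (\<rho> y)) (Lf (\<rho> y), Tf (\<rho> y))"
  proof (rule val_cong[OF _ Af G_nonneg])
   show "(tail_L ?E t (y - fl y) wait_L, tail_T ?E t wait_T) \<in> admissible p (G (\<rho> y))" using W(1) by (simp add: follows_def)
   fix w :: "'n claims" assume w: "w \<in> claim_paths"
   show "tail_L ?E t (y - fl y) wait_L r w = Lf (\<rho> y) r w" for r
    using good_pathD(1)[OF admissible_good_path[OF Af w], of r] by (simp add: tail_L_def wait_L_def E)
   show "tail_T ?E t wait_T w = Tf (\<rho> y) w" by (simp add: tail_T_def wait_T_def E)
  qed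
  note W' = W(2)[unfolded this]
  have "ereal (exp (- c * t) * psi u0 (G m + t *\<^sub>R p) u) = ereal (exp (- c * t)) * ereal (u0 y)"
   using True by (simp add: psi_def y_def)
  also have "\<dots> \<le> ereal (exp (- c * t)) * (ereal (a \<bullet> (y - fl y)) + val (G (\<rho> y)) (Lf (\<rho> y), Tf (\<rho> y)))"
   by (intro ereal_mult_left_mono le y) simp
  also have "\<dots> = ereal (exp (- c * t) * (a \<bullet> (y - fl y))) + ereal (exp (- c * t)) * val (G (\<rho> y)) (Lf (\<rho> y), Tf (\<rho> y))"
   by (cases "val (G (\<rho> y)) (Lf (\<rho> y), Tf (\<rho> y))") (simp_all add: algebra_simps)
  finally show ?thesis unfolding W' .
 next
  case False
  have "fibre (G m) wait_L wait_T ?E = ereal (- (exp (- c * t) * pen0 (G m + t *\<^sub>R p) u))"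
   by (rule wait_ruin[OF wait_follows act tu False])
  then show ?thesis using False by (simp add: psi_def)
 qed
next
 have act: "wait_s w 0 = Wait" for w by (simp add: wait_s_def)
 have W: "follows (m + 1) (\<lambda>w k. wait_s (delay \<delta> w) (Suc k)) (tail_L (delay \<delta>) \<delta> 0 wait_L) (tail_T (delay \<delta>) \<delta> wait_T)"
  "fibre (G m) wait_L wait_T (delay \<delta>) =
   ereal (exp (- c * \<delta>)) * val (G (m + 1)) (tail_L (delay \<delta>) \<delta> 0 wait_L, tail_T (delay \<delta>) \<delta> wait_T)"
  by (rule wait_delay[OF wait_follows act])+
 have E: "alive (delay \<delta> w)" "clock (delay \<delta> w) = \<delta>" "after (delay \<delta> w) = w" "idx (delay \<delta> w) = m + 1" "lump (delay \<delta> w) = 0"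
  if "w \<in> claim_paths" for w
  using claim_pathsD(1)[OF that, of 0] by (simp_all add: alive_def clock_def after_def idx_def lump_def)
 have "val (G (m + 1)) (tail_L (delay \<delta>) \<delta> 0 wait_L, tail_T (delay \<delta>) \<delta> wait_T) = val (G (m + 1)) (Lf (m + 1), Tf (m + 1))"
 proof (rule val_cong[OF _ Af G_nonneg])
  show "(tail_L (delay \<delta>) \<delta> 0 wait_L, tail_T (delay \<delta>) \<delta> wait_T) \<in> admissible p (G (m + 1))" using W(1) by (simp add: follows_def)
  fix w :: "'n claims" assume w: "w \<in> claim_paths"
  show "tail_L (delay \<delta>) \<delta> 0 wait_L r w = Lf (m + 1) r w" for r
   using good_pathD(1)[OF admissible_good_path[OF Af w], of r] by (simp add: tail_L_def wait_L_def E[OF w])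
  show "tail_T (delay \<delta>) \<delta> wait_T w = Tf (m + 1) w" by (simp add: tail_T_def wait_T_def E[OF w])
 qed
 note W' = W(2)[unfolded this]
 have "ereal (u0 (G (m + 1))) \<le> val (G (m + 1)) (Lf (m + 1), Tf (m + 1))"
  using le[OF G_nonneg, of "m + 1"] by (simp add: rho_G grid_floor_def zero_ereal_def[symmetric])
 then have "ereal (exp (- c * \<delta>)) * ereal (u0 (G (m + 1))) \<le> ereal (exp (- c * \<delta>)) * val (G (m + 1)) (Lf (m + 1), Tf (m + 1))"
  by (intro ereal_mult_left_mono) simp_all
 then show "ereal (exp (- c * \<delta>) * u0 (G m + \<delta> *\<^sub>R p)) \<le> fibre (G m) wait_L wait_T (delay \<delta>)"
  unfolding W' by (simp add: G_add1)
qed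

end

end

section \<open>The grid value function\<close>

abbreviation "grid_opt \<equiv> grid_optimal p a c lam F \<upsilon> f \<delta>"

definition "v m = real_of_ereal (grid_opt m)"

lemma strat_value_le: "\<pi> \<in> strat m ==> val (G m) \<pi> \<le> grid_opt m"
 unfolding grid_optimal_def by (rule SUP_upper)

lemma grid_opt_bounds: "ereal (f (G m)) \<le> grid_opt m" "grid_opt m \<le> ereal (4 * K * h0 (G m))"
proof -
 have "val (G m) (\<lambda>_ _. 0, \<lambda>_. 0) = ereal (f (G m))" by (rule switch_value[OF switch_follows]) simp
 then show "ereal (f (G m)) \<le> grid_opt m"
  using strat_value_le[of "(\<lambda>_ _. 0, \<lambda>_. 0)" m] switch_follows[of m] strat_iff by metis
 show "grid_opt m \<le> ereal (4 * K * h0 (G m))"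
  unfolding grid_optimal_def
 proof (rule SUP_least)
  fix \<pi> assume "\<pi> \<in> strat m"
  then have "\<pi> \<in> admissible p (G m)" by (auto simp: grid_strategies_def)
  then show "val (G m) \<pi> \<le> ereal (4 * K * h0 (G m))" using G_nonneg by (rule value_upper)
 qed
qed

lemma v: "grid_opt m = ereal (v m)" "f (G m) \<le> v m" "v m \<le> 4 * K * h0 (G m)"
proof -
 show "grid_opt m = ereal (v m)" using grid_opt_bounds[of m] by (cases "grid_opt m") (auto simp: v_def)
 then show "f (G m) \<le> v m" "v m \<le> 4 * K * h0 (G m)" using grid_opt_bounds[of m] by simp_all
qed

lemma v_base: "grid_base v"
 unfolding grid_base_def
proof (intro conjI allI impI v(2))
 show "\<exists>C. \<forall>m. v m \<le> C * h0 (G m)" using v(3) by (intro exI[of _ "4 * K"]) simp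
 fix m i assume i: "0 < (m :: nat^'n) $ i"
 let ?b = "axis i (p $ i * \<delta>)"
 have "grid_opt (m - axis i 1) \<le> ereal (v m - a $ i * (p $ i * \<delta>))"
  unfolding grid_optimal_def
 proof (rule SUP_least)
  fix \<pi> assume "\<pi> \<in> strat (m - axis i 1)"
  then obtain L T s where \<pi>: "\<pi> = (L, T)" and fo: "follows (m - axis i 1) s L T" using strat_iff by (cases \<pi>) auto
  have A: "(L, T) \<in> admissible p (G (m - axis i 1))" using fo by (simp add: follows_def)
  have b: "0 \<le> ?b" using p_pos[of i] \<delta>_pos by (auto simp: less_eq_vec_def axis_def)
  have Gm: "G (m - axis i 1) + ?b = G m" using G_pay[OF i] by simp
  have "(\<lambda>t w. if t < 0 then 0 else ?b + L t w, T) \<in> strat m" using pay_follows[OF fo i] strat_iff by blast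
  from strat_value_le[OF this] have "ereal (a \<bullet> ?b) + val (G (m - axis i 1)) (L, T) \<le> ereal (v m)"
   using lump_value[OF A b G_nonneg] unfolding Gm v(1) by simp
  then show "val (G (m - axis i 1)) \<pi> \<le> ereal (v m - a $ i * (p $ i * \<delta>))"
   unfolding \<pi> by (cases "val (G (m - axis i 1)) (L, T)") (auto simp: inner_axis)
 qed
 then show "a $ i * (p $ i * \<delta>) + v (m - axis i 1) \<le> v m" by (simp add: v(1))
qed

lemma v_super: "grid_super v"
 unfolding grid_super_def
proof (intro conjI v_base allI)
 fix m
 note tv = super_tame[OF v_base]
 show "wait_value (lift v) (Q (lift v)) \<delta> (G m) \<le> v m"
 proof (rule field_le_epsilon)
  fix e :: real assume e: "0 < e"
  \<comment> \<open>Scaled so that the final error \<open>\<epsilon> * h0 (G m)\<close> is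
    \<open>e\<close>.\<close>
  define \<epsilon> where "\<epsilon> = e / h0 (G m)"
  have \<epsilon>: "0 < \<epsilon>" using e h0_pos by (simp add: \<epsilon>_def)
  have "\<exists>L T s. follows i s L T \<and> ereal (v i - \<epsilon>) < val (G i) (L, T)" for i
  proof -
   have "ereal (v i - \<epsilon>) < grid_opt i" using \<epsilon> by (simp add: v(1))
   then obtain \<pi> where "\<pi> \<in> strat i" "ereal (v i - \<epsilon>) < val (G i) \<pi>" unfolding grid_optimal_def less_SUP_iff by blast
   then show ?thesis using strat_iff by (cases \<pi>) blast
  qed
  then obtain Lf Tf sf where fo: "\<And>i. follows i (sf i) (Lf i) (Tf i)" and near: "\<And>i. ereal (v i - \<epsilon>) < val (G i) (Lf i, Tf i)"
   by metis
  \<comment> \<open>The uniform defect \<open>\<epsilon>\<close> is enlarged to the multiple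
    \<open>\<epsilon> * h0\<close> of the weight, as \<open>h0\<close> is at least 1; how such a
    multiple propagates through a wait is known from \<open>wait_add_h0\<close>.\<close>
  define u0 where "u0 z = lift v z + - \<epsilon> * h0 z" for z
  have t0: "tame u0" unfolding u0_def[abs_def] by (rule tame_add[OF tv tame_h0])
  have le: "ereal (u0 y) \<le> ereal (a \<bullet> (y - fl y)) + val (G (\<rho> y)) (Lf (\<rho> y), Tf (\<rho> y))" if y: "0 \<le> y" for y
  proof -
   have "ereal (u0 y) \<le> ereal (a \<bullet> (y - fl y)) + ereal (v (\<rho> y) - \<epsilon>)"
    using y h0_ge_1[OF y] \<epsilon> by (simp add: u0_def lift_def mult_le_cancel_left1)
   also have "\<dots> \<le> ereal (a \<bullet> (y - fl y)) + val (G (\<rho> y)) (Lf (\<rho> y), Tf (\<rho> y))"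
    by (rule add_left_mono[OF less_imp_le[OF near]])
   finally show ?thesis .
  qed
  have "(wait_L m Lf, wait_T m Tf) \<in> strat m" using wait_follows[OF fo] strat_iff by blast
  from order_trans[OF wait_value_le[OF fo t0 le] strat_value_le[OF this]]
  have 1: "wait_value u0 (Q u0) \<delta> (G m) \<le> v m" by (simp add: v(1))
  have "(\<lambda>z. u0 z + \<epsilon> * h0 z) = lift v" by (simp add: u0_def)
  then have "wait_value (lift v) (Q (lift v)) \<delta> (G m) \<le> wait_value u0 (Q u0) \<delta> (G m) + \<epsilon> * (contraction * h0 (G m))"
   using wait_add_h0[OF t0 G_nonneg, of \<delta> \<epsilon> m] \<delta>_pos \<epsilon> by (simp add: contraction_def)
  also have "\<epsilon> * (contraction * h0 (G m)) = contraction * e" using h0_pos[of "G m"] by (simp add: \<epsilon>_def)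
  also have "\<dots> \<le> e" using contraction e by (simp add: mult_le_cancel_right1)
  finally show "wait_value (lift v) (Q (lift v)) \<delta> (G m) \<le> v m + e" using 1 by simp
 qed
qed

lemma v_least: "grid_super vf ==> v m \<le> vf m"
proof -
 assume S: "grid_super vf"
 have "grid_opt m \<le> ereal (vf m)" unfolding grid_optimal_def by (rule SUP_least[OF grid_least[OF S]])
 then show ?thesis by (simp add: v(1))
qed

lemma grid_value_lift: "0 \<le> x ==> grid_value p a c lam F \<upsilon> f \<delta> x = ereal (lift v x)"
 by (simp add: grid_value_def v(1) lift_def)

text \<open>A grid strategy from the grid point below \<open>x\<close>, preceded by the immediate
  payment of \<open>x - fl x\<close>, is an admissible strategy from \<open>x\<close>.\<close>

lemma grid_value_le_optimal:
 assumes x: "0 \<le> x" shows "ereal (lift v x) \<le> optimal_value p a c lam F \<upsilon> f x"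
proof -
 let ?b = "x - fl x"
 have b: "0 \<le> ?b" using fl_le[OF x] by simp
 have G: "G (\<rho> x) + ?b = x" by (simp add: grid_floor_def)
 have "ereal (a \<bullet> ?b) + val (G (\<rho> x)) \<pi> \<le> optimal_value p a c lam F \<upsilon> f x" if "\<pi> \<in> strat (\<rho> x)" for \<pi>
 proof -
  obtain L T where \<pi>: "\<pi> = (L, T)" by (cases \<pi>)
  have A: "(L, T) \<in> admissible p (G (\<rho> x))" using that unfolding \<pi> by (auto simp: grid_strategies_def)
  have "val x (\<lambda>t w. if t < 0 then 0 else ?b + L t w, T) \<le> optimal_value p a c lam F \<upsilon> f x"
   unfolding optimal_value_def using lump_admissible[OF A b] unfolding G by (rule SUP_upper)
  then show ?thesis using lump_value[OF A b G_nonneg] unfolding G \<pi> by simp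
 qed
 then have "val (G (\<rho> x)) \<pi> \<le> optimal_value p a c lam F \<upsilon> f x - ereal (a \<bullet> ?b)" if "\<pi> \<in> strat (\<rho> x)" for \<pi>
  using that by (simp add: ereal_le_minus add.commute)
 then have "grid_opt (\<rho> x) \<le> optimal_value p a c lam F \<upsilon> f x - ereal (a \<bullet> ?b)"
  unfolding grid_optimal_def by (rule SUP_least)
 then have "grid_opt (\<rho> x) + ereal (a \<bullet> ?b) \<le> optimal_value p a c lam F \<upsilon> f x" by (simp add: ereal_le_minus)
 then show ?thesis using x by (simp add: v(1) lift_def)
qed

end

subsection \<open>Dyadic refinement\<close>

lemma finite_vec_atMost: "finite {m :: nat^'n::finite. m \<le> M}"
proof (rule finite_subset)
 show "{m. m \<le> M} \<subseteq> (\<lambda>g. \<chi> i. g i) ` PiE UNIV (\<lambda>i. {..M $ i})"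
 proof
  fix m assume "m \<in> {m. m \<le> M}"
  then show "m \<in> (\<lambda>g. \<chi> i. g i) ` PiE UNIV (\<lambda>i. {..M $ i})"
   by (intro image_eqI[of _ _ "\<lambda>i. m $ i"]) (auto simp: less_eq_vec_def)
 qed
qed (intro finite_imageI finite_PiE; simp)

context dividend_model
begin

lemma wait_value_0: "wait_value vf q 0 x = vf x"
proof -
 have "(LINT s|elaw beta. indicator {..<0} s * q (x + s *\<^sub>R p)) = (LINT s|elaw beta. 0)"
 \<comment> \<open>No regularity of \<open>q\<close> is at hand: a non-measurable integrand is not
   integrable, and its integral is 0 by convention.\<close>
 proof (cases "(\<lambda>s. indicator {..<0} s * q (x + s *\<^sub>R p)) \<in> borel_measurable (elaw beta)")
  case True
  show ?thesis
  proof (rule integral_cong_AE[OF True])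
   show "AE s in elaw beta. indicator {..<0} s * q (x + s *\<^sub>R p) = 0" using AE_elaw_pos by eventually_elim simp
  qed simp
 next
  case False
  then have "\<not> integrable (elaw beta) (\<lambda>s. indicator {..<0} s * q (x + s *\<^sub>R p))"
   using borel_measurable_integrable by blast
  then show ?thesis by (simp add: not_integrable_integral_eq)
 qed
 then show ?thesis by (simp add: wait_value_def)
qed

text \<open>Semigroup property of waiting: the clock of rate \<open>beta\<close> is memoryless, and
  the surplus moves linearly.\<close>

lemma wait_value_add:
 assumes q: "tame q" and x: "0 \<le> x" and s: "0 \<le> s" and t: "0 \<le> t"
 shows "wait_value vf q (s + t) x = wait_value (wait_value vf q t) q s x"
proof -
 have e1: "indicator {..<s} r * (indicator {..<s + t} r * q (x + r *\<^sub>R p)) = indicator {..<s} r * q (x + r *\<^sub>R p)" for r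
  using t by (simp add: indicator_def)
 have e2: "indicator {..<s + t} (s + r) * q (x + (s + r) *\<^sub>R p) = indicator {..<t} r * q (x + s *\<^sub>R p + r *\<^sub>R p)" for r
  by (simp add: indicator_def scaleR_add_left add.assoc)
 have "(LINT r|elaw beta. indicator {..<s + t} r * q (x + r *\<^sub>R p)) =
  (LINT r|elaw beta. indicator {..<s} r * q (x + r *\<^sub>R p)) + exp (- beta * s) * (LINT r|elaw beta. indicator {..<t} r * q (x + s *\<^sub>R p + r *\<^sub>R p))"
  using elaw_shift(2)[OF beta_pos(1) s wait_integrable[OF q x, of "s + t"]] by (simp only: e1 e2)
 moreover have "exp (- beta * (s + t)) = exp (- beta * s) * exp (- beta * t)" by (simp add: mult_exp_exp algebra_simps)
 ultimately show ?thesis by (simp add: wait_value_def scaleR_add_left algebra_simps)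
qed

text \<open>Joint continuity in the starting point and the length of the wait, both approached from
  above. This is the limit needed when points and times are rounded up to a grid.\<close>

lemma wait_value_continuous:
 assumes w: "tame vf" and q: "tame q" and x: "0 \<le> x" and h: "0 \<le> h"
  and g: "\<And>k. x \<le> g k" "\<And>k. g k \<le> x + r *\<^sub>R p" "g \<longlonglongrightarrow> x" and t: "\<And>k. h \<le> t k" "t \<longlonglongrightarrow> h"
 shows "(\<lambda>k. wait_value vf q (t k) (g k)) \<longlonglongrightarrow> wait_value vf q h x"
 unfolding wait_value_def
proof (rule tendsto_add[OF tendsto_mult tendsto_mult[OF tendsto_const]])
 have g0: "0 \<le> g k" for k using x g(1) by (rule order_trans)
 show "(\<lambda>k. exp (- beta * t k)) \<longlonglongrightarrow> exp (- beta * h)" by (intro tendsto_exp tendsto_mult tendsto_const t)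
 show "(\<lambda>k. vf (g k + t k *\<^sub>R p)) \<longlonglongrightarrow> vf (x + h *\<^sub>R p)"
 proof (rule continuous_within_seqD[where g=vf and z="\<lambda>k. g k + t k *\<^sub>R p" and x="x + h *\<^sub>R p" and S="{x + h *\<^sub>R p..}"])
  show "continuous (at (x + h *\<^sub>R p) within {x + h *\<^sub>R p..}) vf" using w orthant_path[OF x h] by (simp add: tame_def)
  show "g k + t k *\<^sub>R p \<in> {x + h *\<^sub>R p..}" for k using g(1) vec_scale_mono[OF t(1) p_nonneg] by (simp add: add_mono)
  show "(\<lambda>k. g k + t k *\<^sub>R p) \<longlonglongrightarrow> x + h *\<^sub>R p" by (intro tendsto_add tendsto_scaleR tendsto_const g t)
 qed
 obtain C where C: "0 \<le> C" "\<And>y. 0 \<le> y ==> \<bar>q y\<bar> \<le> C * h0 y" using tame_growth[OF q] by blast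
 show "(\<lambda>k. LINT s|elaw beta. indicator {..<t k} s * q (g k + s *\<^sub>R p)) \<longlonglongrightarrow> (LINT s|elaw beta. indicator {..<h} s * q (x + s *\<^sub>R p))"
 proof (rule integral_dominated_convergence[where w="\<lambda>s. C * (h0 (x + r *\<^sub>R p) * exp (c / 2 * s))"])
  show "(\<lambda>s. indicator {..<h} s * q (x + s *\<^sub>R p)) \<in> borel_measurable (elaw beta)"
   by (rule borel_measurable_integrable[OF wait_integrable[OF q x]])
  show "(\<lambda>s. indicator {..<t k} s * q (g k + s *\<^sub>R p)) \<in> borel_measurable (elaw beta)" for k
   by (rule borel_measurable_integrable[OF wait_integrable[OF q g0]])
  show "integrable (elaw beta) (\<lambda>s. C * (h0 (x + r *\<^sub>R p) * exp (c / 2 * s)))" using elaw_beta_growth(1) by simp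
  show "AE s in elaw beta. norm (indicator {..<t k} s * q (g k + s *\<^sub>R p)) \<le> C * (h0 (x + r *\<^sub>R p) * exp (c / 2 * s))" for k
   using AE_elaw_pos
  proof eventually_elim
   case (elim s)
   have "norm (indicator {..<t k} s * q (g k + s *\<^sub>R p)) \<le> \<bar>q (g k + s *\<^sub>R p)\<bar>" by (simp add: indicator_def)
   also have "\<dots> \<le> C * h0 (g k + s *\<^sub>R p)" using elim by (intro C orthant_path g0) simp
   also have "\<dots> \<le> C * h0 (x + r *\<^sub>R p + s *\<^sub>R p)" using g(2)[of k] C(1) by (intro mult_left_mono h0_mono add_right_mono) auto
   finally show ?case by (simp only: h0_shift)
  qed
  show "AE s in elaw beta. (\<lambda>k. indicator {..<t k} s * q (g k + s *\<^sub>R p)) \<longlonglongrightarrow> indicator {..<h} s * q (x + s *\<^sub>R p)"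
   using AE_elaw_pos AE_elaw[OF AE_lborel_singleton[of h]]
  proof eventually_elim
   case (elim s)
   have "continuous (at (x + s *\<^sub>R p) within {x + s *\<^sub>R p..}) q" using q orthant_path[OF x, of s] elim by (simp add: tame_def)
   then have "(\<lambda>k. q (g k + s *\<^sub>R p)) \<longlonglongrightarrow> q (x + s *\<^sub>R p)"
    by (rule continuous_within_seqD) (use g in \<open>auto intro!: tendsto_intros\<close>)
   moreover have "(\<lambda>k. indicator {..<t k} s) \<longlonglongrightarrow> (indicator {..<h} s :: real)"
   proof (cases "s < h")
    case True
    then have "s < t k" for k using t(1)[of k] by simp
    then show ?thesis using True by simp
   next
    case False
    then have "h < s" using elim by simp
    from order_tendstoD(2)[OF t(2) this]
    have "eventually (\<lambda>k. indicator {..<h} s = (indicator {..<t k} s :: real)) sequentially"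
     by eventually_elim (use False in simp)
    then show ?thesis by (rule Lim_transform_eventually[OF tendsto_const])
   qed
   ultimately show ?case by (intro tendsto_mult)
  qed
 qed
qed

text \<open>All terms lie between the first one and the limit, and these two supply the integrable
  majorant.\<close>

lemma dominated_between:
 fixes g :: "nat \<Rightarrow> 'b \<Rightarrow> real"
 assumes "\<And>k. integrable N (g k)" "integrable N l"
  and "AE x in N. (\<lambda>k. g k x) \<longlonglongrightarrow> l x" "\<And>k. AE x in N. g 0 x \<le> g k x \<and> g k x \<le> l x"
 shows "(\<lambda>k. LINT x|N. g k x) \<longlonglongrightarrow> (LINT x|N. l x)"
proof (rule integral_dominated_convergence[where w="\<lambda>x. \<bar>g 0 x\<bar> + \<bar>l x\<bar>"])
 show "integrable N (\<lambda>x. \<bar>g 0 x\<bar> + \<bar>l x\<bar>)" using assms(1)[of 0] assms(2) by auto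
 show "AE x in N. norm (g k x) \<le> \<bar>g 0 x\<bar> + \<bar>l x\<bar>" for k using assms(4)[of k] by eventually_elim auto
qed (use assms in auto)

lemma Q_limit:
 assumes w: "\<And>k. tame (vf k)" "tame W" and y: "0 \<le> y"
  and l: "\<And>z. 0 \<le> z ==> (\<lambda>k. vf k z) \<longlonglongrightarrow> W z" "\<And>k z. 0 \<le> z ==> vf 0 z \<le> vf k z \<and> vf k z \<le> W z"
 shows "(\<lambda>k. Q (vf k) y) \<longlonglongrightarrow> Q W y"
 unfolding Q_def
proof (rule dominated_between[OF psi_integrable[OF w(1) y] psi_integrable[OF w(2) y]])
 show "AE u in F. (\<lambda>k. psi (vf k) y u) \<longlonglongrightarrow> psi W y u" by (rule AE_I2) (auto simp: psi_def intro: l)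
 show "AE u in F. psi (vf 0) y u \<le> psi (vf k) y u \<and> psi (vf k) y u \<le> psi W y u" for k
  by (rule AE_I2) (use l(2) in \<open>auto simp: psi_def\<close>)
qed

lemma wait_value_limit:
 assumes w: "\<And>k. tame (vf k)" "tame W" and x: "0 \<le> x" and h: "0 \<le> h"
  and l: "\<And>z. 0 \<le> z ==> (\<lambda>k. vf k z) \<longlonglongrightarrow> W z" "\<And>k z. 0 \<le> z ==> vf 0 z \<le> vf k z \<and> vf k z \<le> W z"
 shows "(\<lambda>k. wait_value (vf k) (Q (vf k)) h x) \<longlonglongrightarrow> wait_value W (Q W) h x"
 unfolding wait_value_def
proof (intro tendsto_add tendsto_mult tendsto_const l orthant_path x h)
 show "(\<lambda>k. LINT s|elaw beta. indicator {..<h} s * Q (vf k) (x + s *\<^sub>R p)) \<longlonglongrightarrow> (LINT s|elaw beta. indicator {..<h} s * Q W (x + s *\<^sub>R p))"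
 proof (rule dominated_between[OF wait_integrable[OF Q_tame[OF w(1)] x] wait_integrable[OF Q_tame[OF w(2)] x]])
  show "AE s in elaw beta. (\<lambda>k. indicator {..<h} s * Q (vf k) (x + s *\<^sub>R p)) \<longlonglongrightarrow> indicator {..<h} s * Q W (x + s *\<^sub>R p)"
   using AE_elaw_pos
   by eventually_elim (intro tendsto_mult tendsto_const Q_limit[OF w _ l] orthant_path x; simp)
  show "AE s in elaw beta. indicator {..<h} s * Q (vf 0) (x + s *\<^sub>R p) \<le> indicator {..<h} s * Q (vf k) (x + s *\<^sub>R p) \<and>
    indicator {..<h} s * Q (vf k) (x + s *\<^sub>R p) \<le> indicator {..<h} s * Q W (x + s *\<^sub>R p)" for k
   using AE_elaw_pos
  proof eventually_elim
   case (elim s)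
   have y: "0 \<le> x + s *\<^sub>R p" using elim by (intro orthant_path x) simp
   have "Q (vf 0) (x + s *\<^sub>R p) \<le> Q (vf k) (x + s *\<^sub>R p)" "Q (vf k) (x + s *\<^sub>R p) \<le> Q W (x + s *\<^sub>R p)"
    using l(2) by (auto intro!: Q_mono w y)
   then show ?case by (simp add: indicator_def)
  qed
 qed
qed

end

context grid_model
begin

lemma super_steps:
 assumes S: "grid_super vf" shows "wait_value (lift vf) (Q (lift vf)) (real n * \<delta>) (G m) \<le> vf m"
proof (induction n arbitrary: m)
 case 0
 then show ?case by (simp add: wait_value_0)
next
 case (Suc n)
 have t: "tame (Q (lift vf))" by (rule Q_tame[OF super_tame]) (use S in \<open>simp add: grid_super_def\<close>)
 have "wait_value (lift vf) (Q (lift vf)) (\<delta> + real n * \<delta>) (G m) = wait_value (wait_value (lift vf) (Q (lift vf)) (real n * \<delta>)) (Q (lift vf)) \<delta> (G m)"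
  by (rule wait_value_add[OF t G_nonneg]) (use \<delta>_pos in auto)
 also have "\<dots> \<le> wait_value (lift vf) (Q (lift vf)) \<delta> (G m)"
  by (rule wait_value_mono[OF t t G_nonneg]) (use \<delta>_pos Suc[of "m + 1"] in \<open>simp_all add: G_add1[symmetric]\<close>)
 also have "\<dots> \<le> vf m" using S by (simp add: grid_super_def)
 finally show ?case by (simp add: algebra_simps)
qed

end

context dividend_model
begin

lemma grid_value_refine:
 assumes d: "0 < \<delta>" and x: "0 \<le> x"
 shows "grid_value p a c lam F \<upsilon> f \<delta> x \<le> grid_value p a c lam F \<upsilon> f (\<delta> / 2) x"
proof -
 interpret A: grid_model lam F p a c \<upsilon> f \<delta> by unfold_locales (rule d)
 interpret H: grid_model lam F p a c \<upsilon> f "\<delta> / 2" by unfold_locales (use d in simp)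
 \<comment> \<open>Indices double under refinement, and every coarse grid point belongs to the fine
   grid.\<close>
 have GG: "H.G (m + m) = A.G m" for m by (simp add: vec_eq_iff A.G_nth H.G_nth)
 have vp: "\<And>m i. 0 < m $ i ==> a $ i * (p $ i * (\<delta> / 2)) + H.v (m - axis i 1) \<le> H.v m"
  using H.v_base unfolding H.grid_base_def by blast
 define vf where "vf m = H.v (m + m)" for m
 \<comment> \<open>Both functions agree at the coarse grid point below \<open>y\<close>. From there
   to \<open>y\<close> the coarse lift grows by just the dividend, the fine one by at least
   that.\<close>
 have le: "A.lift vf y \<le> H.lift H.v y" if y: "0 \<le> y" for y
 proof -
  have "H.lift H.v (A.fl y) = vf (A.\<rho> y)" using H.lift_G[of H.v "A.\<rho> y + A.\<rho> y"] by (simp add: GG vf_def grid_floor_def)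
  then show ?thesis using H.lift_mono[where vf=H.v, OF vp A.fl_nonneg A.fl_le[OF y]] y by (simp add: A.lift_def)
 qed
 have base: "A.grid_base vf"
  unfolding A.grid_base_def
 proof (intro conjI allI impI exI)
  show "f (A.G m) \<le> vf m" for m using H.v(2)[of "m + m"] by (simp add: GG vf_def)
  show "vf m \<le> 4 * K * h0 (A.G m)" for m using H.v(3)[of "m + m"] by (simp add: GG vf_def)
  fix m :: "nat^'n" and i assume i: "0 < m $ i"
  have "m - axis i 1 + (m - axis i 1) \<le> m + m" by (auto simp: less_eq_vec_def axis_def)
  from H.pay_mono[where vf=H.v, OF vp this]
  show "a $ i * (p $ i * \<delta>) + vf (m - axis i 1) \<le> vf m"
   unfolding GG A.G_pay[OF i] by (simp add: vf_def inner_axis)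
 qed
 have "A.grid_super vf"
  unfolding A.grid_super_def
 proof (intro conjI base allI)
  fix m
  note t = A.super_tame[OF base] H.super_tame[OF H.v_base]
  have "wait_value (A.lift vf) (Q (A.lift vf)) \<delta> (A.G m) \<le> wait_value (H.lift H.v) (Q (H.lift H.v)) \<delta> (A.G m)"
   using d by (intro wait_value_mono Q_tame t A.G_nonneg le Q_mono orthant_path) auto
  also have "\<dots> \<le> vf m" using H.super_steps[OF H.v_super, of 2 "m + m"] by (simp add: GG vf_def)
  finally show "wait_value (A.lift vf) (Q (A.lift vf)) \<delta> (A.G m) \<le> vf m" .
 qed
 then have "A.lift A.v x \<le> A.lift vf x" using A.v_least[of vf "A.\<rho> x"] x by (simp add: A.lift_def)
 then show ?thesis using le[OF x] by (simp add: A.grid_value_lift[OF x] H.grid_value_lift[OF x])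
qed

end

section \<open>The limit of the grid value functions\<close>

context grid_model
begin

definition V :: "nat \<Rightarrow> real^'n \<Rightarrow> real" where
 "V k x = (if 0 \<le> x then real_of_ereal (grid_value p a c lam F \<upsilon> f (\<delta> / 2 ^ k) x) else 0)"

abbreviation "opt \<equiv> optimal_value p a c lam F \<upsilon> f"

text \<open>Collects what is used of the grid of mesh \<open>\<delta> / 2 ^ k\<close>, so that the
  interpretations of the locale for the individual meshes stay inside this proof.\<close>

lemma V:
 shows "0 \<le> x ==> grid_value p a c lam F \<upsilon> f (\<delta> / 2 ^ k) x = ereal (V k x)"
  "tame (V k)" "0 \<le> x ==> ereal (V k x) \<le> opt x" "0 \<le> x ==> x \<le> y ==> V k x + a \<bullet> (y - x) \<le> V k y"
  "wait_value (V k) (Q (V k)) (real n * (\<delta> / 2 ^ k)) (grid_point p (\<delta> / 2 ^ k) m) \<le> V k (grid_point p (\<delta> / 2 ^ k) m)"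
  "f (grid_point p (\<delta> / 2 ^ k) m) \<le> V k (grid_point p (\<delta> / 2 ^ k) m)" "0 \<le> x ==> f 0 \<le> V k x"
  "0 \<le> grid_floor p (\<delta> / 2 ^ k) x" "0 \<le> x ==> grid_floor p (\<delta> / 2 ^ k) x \<le> x"
  "0 \<le> x ==> x \<le> grid_floor p (\<delta> / 2 ^ k) x + (\<delta> / 2 ^ k) *\<^sub>R p"
  "grid_point p (\<delta> / 2 ^ k) (m + 1) = grid_point p (\<delta> / 2 ^ k) m + (\<delta> / 2 ^ k) *\<^sub>R p"
  "x \<le> y ==> grid_index p (\<delta> / 2 ^ k) x \<le> grid_index p (\<delta> / 2 ^ k) y"
  "0 \<le> x ==> V k x \<le> V (Suc k) x"
proof -
 interpret L: grid_model lam F p a c \<upsilon> f "\<delta> / 2 ^ k" by unfold_locales (use \<delta>_pos in simp)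
 interpret L': grid_model lam F p a c \<upsilon> f "\<delta> / 2 ^ Suc k" by unfold_locales (use \<delta>_pos in simp)
 have V: "V k = L.lift L.v" by (rule ext) (simp add: V_def L.grid_value_lift L.lift_def)
 have V': "V (Suc k) = L'.lift L'.v"
 proof
  fix x show "V (Suc k) x = L'.lift L'.v x"
  proof (cases "0 \<le> x")
   case True
   then show ?thesis by (simp only: V_def if_True L'.grid_value_lift[OF True] real_of_ereal.simps)
  qed (simp only: V_def L'.lift_def if_False)
 qed
 show "0 \<le> x ==> grid_value p a c lam F \<upsilon> f (\<delta> / 2 ^ k) x = ereal (V k x)" unfolding V by (rule L.grid_value_lift)
 show "tame (V k)" unfolding V by (rule L.super_tame[OF L.v_base])
 show "0 \<le> x ==> ereal (V k x) \<le> opt x" unfolding V by (rule L.grid_value_le_optimal)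
 show "V k x + a \<bullet> (y - x) \<le> V k y" if "0 \<le> x" "x \<le> y"
  unfolding V by (rule L.lift_mono[where vf=L.v, OF _ that]) (use L.v_base[unfolded L.grid_base_def] in blast)
 show "wait_value (V k) (Q (V k)) (real n * (\<delta> / 2 ^ k)) (L.G m) \<le> V k (L.G m)"
  unfolding V L.lift_G by (rule L.super_steps[OF L.v_super])
 show "f (L.G m) \<le> V k (L.G m)" unfolding V L.lift_G by (rule L.v)
 show "0 \<le> x ==> f 0 \<le> V k x" unfolding V by (rule L.super_lower[OF L.v_base])
 show "0 \<le> L.fl x" "0 \<le> x ==> L.fl x \<le> x" "L.G (m + 1) = L.G m + (\<delta> / 2 ^ k) *\<^sub>R p" "x \<le> y ==> L.\<rho> x \<le> L.\<rho> y"
  by (rule L.fl_nonneg L.fl_le L.G_add1 L.rho_mono; assumption?)+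
 show "0 \<le> x ==> x \<le> L.fl x + (\<delta> / 2 ^ k) *\<^sub>R p"
  using L.fl_nth(2)[of x] by (auto simp: less_eq_vec_def mult.commute intro: less_imp_le)
 show "V k x \<le> V (Suc k) x" if x: "0 \<le> x"
 proof -
  have "grid_value p a c lam F \<upsilon> f (\<delta> / 2 ^ k) x \<le> grid_value p a c lam F \<upsilon> f (\<delta> / 2 ^ Suc k) x"
   using grid_value_refine[OF L.\<delta>_pos x] by (simp add: mult.commute)
  then show ?thesis unfolding V V' L.grid_value_lift[OF x] L'.grid_value_lift[OF x] by simp
 qed
qed

lemma opt_upper: "0 \<le> x ==> opt x \<le> ereal (4 * K * h0 x)"
 unfolding optimal_value_def by (intro SUP_least value_upper)

definition W :: "real^'n \<Rightarrow> real" where "W x = (SUP k. V k x)"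

lemma V_upper: "0 \<le> x ==> V k x \<le> 4 * K * h0 x"
 using order_trans[OF V(3) opt_upper, of x k] by simp

lemma W_off: "\<not> 0 \<le> x ==> W x = 0"
 by (simp add: W_def V_def)

lemma W:
 assumes x: "0 \<le> x"
 shows "incseq (\<lambda>k. V k x)" "(\<lambda>k. V k x) \<longlonglongrightarrow> W x" "V k x \<le> W x" "f 0 \<le> W x" "W x \<le> 4 * K * h0 x"
proof -
 have b: "bdd_above (range (\<lambda>k. V k x))" using V_upper[OF x] by (auto simp: bdd_above_def)
 show i: "incseq (\<lambda>k. V k x)" by (rule incseq_SucI) (rule V(13)[OF x])
 show "(\<lambda>k. V k x) \<longlonglongrightarrow> W x" unfolding W_def by (rule LIMSEQ_incseq_SUP[OF b i])
 show le: "V k x \<le> W x" for k unfolding W_def by (rule cSUP_upper[OF _ b]) simp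
 show "f 0 \<le> W x" by (rule order_trans[OF V(7)[OF x] le])
 show "W x \<le> 4 * K * h0 x" unfolding W_def by (rule cSUP_least) (auto simp: V_upper[OF x])
qed

lemma W_pay: "0 \<le> x ==> x \<le> y ==> W x + a \<bullet> (y - x) \<le> W y"
proof -
 assume x: "0 \<le> x" "x \<le> y"
 have y: "0 \<le> y" using x by (rule order_trans)
 show ?thesis
  by (rule LIMSEQ_le[OF tendsto_add[OF W(2)[OF x(1)] tendsto_const] W(2)[OF y]]) (use V(4)[OF x] in blast)
qed

lemma W_mono: "0 \<le> x ==> x \<le> y ==> W x \<le> W y"
 using W_pay[of x y] a_inner_nonneg[of "y - x"] by simp

lemma mesh: "(\<lambda>k. \<delta> / 2 ^ k) \<longlonglongrightarrow> 0" "0 < \<delta> / 2 ^ k" "\<delta> / 2 ^ k \<le> \<delta>"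
proof -
 have "(\<lambda>k. \<delta> * (1 / 2) ^ k) \<longlonglongrightarrow> \<delta> * 0" by (intro tendsto_mult tendsto_const LIMSEQ_realpow_zero) auto
 then show "(\<lambda>k. \<delta> / 2 ^ k) \<longlonglongrightarrow> 0" by (simp add: power_divide)
 show "0 < \<delta> / 2 ^ k" using \<delta>_pos by simp
 have "\<delta> / 2 ^ k \<le> \<delta> / 1" using \<delta>_pos by (intro divide_left_mono) auto
 then show "\<delta> / 2 ^ k \<le> \<delta>" by simp
qed

text \<open>Rounding upwards keeps the approximating times above \<open>h\<close>, as
  \<open>wait_value_continuous\<close> demands.\<close>

lemma mesh_steps:
 assumes "0 \<le> h"
 defines "t \<equiv> \<lambda>k. real (nat \<lceil>h / (\<delta> / 2 ^ k)\<rceil>) * (\<delta> / 2 ^ k)"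
 shows "h \<le> t k" "t k \<le> h + \<delta> / 2 ^ k" "t \<longlonglongrightarrow> h"
proof -
 have *: "h \<le> t k" "t k \<le> h + \<delta> / 2 ^ k" for k
 proof -
  let ?d = "\<delta> / 2 ^ k"
  have "0 \<le> h / ?d" by (intro divide_nonneg_nonneg assms(1) less_imp_le[OF mesh(2)])
  then have "h / ?d \<le> real (nat \<lceil>h / ?d\<rceil>)" "real (nat \<lceil>h / ?d\<rceil>) \<le> h / ?d + 1" by linarith+
  then have "h / ?d * ?d \<le> t k" "t k \<le> (h / ?d + 1) * ?d"
   unfolding t_def using mesh(2)[of k] by (simp_all only: mult_right_mono less_imp_le)
  moreover have "h / ?d * ?d = h" using \<delta>_pos by simp
  ultimately show "h \<le> t k" "t k \<le> h + ?d" unfolding distrib_right mult_1_left by simp_all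
 qed
 then show "h \<le> t k" "t k \<le> h + \<delta> / 2 ^ k" by auto
 have "(\<lambda>k. h + \<delta> / 2 ^ k) \<longlonglongrightarrow> h + 0" by (intro tendsto_add tendsto_const mesh)
 then show "t \<longlonglongrightarrow> h" by (intro tendsto_sandwich[of "\<lambda>_. h" t _ "\<lambda>k. h + \<delta> / 2 ^ k"]) (auto simp: *)
qed

text \<open>A constant for \<open>k = 0\<close> which serves for all \<open>k\<close>:
  \<open>V k\<close> and hence \<open>Q (V k)\<close> increase with \<open>k\<close>. It makes the
  growth estimate uniform in the mesh.\<close>

definition lower_rate where "lower_rate = (SOME C. 0 \<le> C \<and> (\<forall>y\<ge>0. \<bar>Q (V 0) y\<bar> \<le> C * h0 y))"

lemma lower_rate: "0 \<le> lower_rate" "0 \<le> y ==> - (lower_rate * h0 y) \<le> Q (V k) y"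
proof -
 have "\<exists>C. 0 \<le> C \<and> (\<forall>y\<ge>0. \<bar>Q (V 0) y\<bar> \<le> C * h0 y)" using Q_bound[OF V(2)] by blast
 from someI_ex[OF this] have *: "0 \<le> lower_rate" "\<And>y. 0 \<le> y ==> \<bar>Q (V 0) y\<bar> \<le> lower_rate * h0 y"
  unfolding lower_rate_def[symmetric] by auto
 then show "0 \<le> lower_rate" by simp
 assume y: "0 \<le> y"
 have "Q (V 0) y \<le> Q (V k) y" using W(1) by (intro Q_mono V(2) y) (auto simp: incseq_def)
 then show "- (lower_rate * h0 y) \<le> Q (V k) y" using *(2)[OF y] by linarith
qed

text \<open>Waiting for a time \<open>t\<close> loses at most a factor \<open>exp (- beta * t)\<close>, hence the value function
 cannot increase quickly along the diagonal direction \<open>p\<close>.\<close>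

lemma V_growth:
 fixes m n k defines "g \<equiv> grid_point p (\<delta> / 2 ^ k) m" and "t \<equiv> real n * (\<delta> / 2 ^ k)"
 assumes g: "0 \<le> g"
 shows "V k (g + t *\<^sub>R p) \<le> exp (beta * t) * V k g + (exp (beta * t) - 1) * (lower_rate * h0 (g + t *\<^sub>R p))"
proof -
 let ?C = "lower_rate * h0 (g + t *\<^sub>R p)"
 have t: "0 \<le> t" unfolding t_def by (intro mult_nonneg_nonneg less_imp_le[OF mesh(2)]) simp
 have C: "0 \<le> ?C" using lower_rate(1) h0_pos[of "g + t *\<^sub>R p"] by simp
 have "- ((1 - exp (- beta * t)) * ?C) = (LINT s|elaw beta. indicator {..<t} s * - ?C)"
  unfolding elaw_indicator[OF beta_pos(1) t] by simp
 also have "\<dots> \<le> (LINT s|elaw beta. indicator {..<t} s * Q (V k) (g + s *\<^sub>R p))"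
 proof (rule integral_mono_AE)
  show "integrable (elaw beta) (\<lambda>s. indicator {..<t} s * - ?C)" by (intro indicator_integrable) auto
  show "integrable (elaw beta) (\<lambda>s. indicator {..<t} s * Q (V k) (g + s *\<^sub>R p))" by (rule wait_integrable[OF Q_tame[OF V(2)] g])
  show "AE s in elaw beta. indicator {..<t} s * - ?C \<le> indicator {..<t} s * Q (V k) (g + s *\<^sub>R p)"
   using AE_elaw_pos
  proof eventually_elim
   case (elim s)
   show ?case
   proof (cases "s < t")
    case True
    have "- ?C \<le> - (lower_rate * h0 (g + s *\<^sub>R p))"
     using True vec_scale_mono[OF _ p_nonneg, of s t] lower_rate(1) by (simp add: mult_left_mono h0_mono)
    also have "\<dots> \<le> Q (V k) (g + s *\<^sub>R p)" using elim by (intro lower_rate orthant_path g) simp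
    finally show ?thesis using True by simp
   qed simp
  qed
 qed
 finally have "lam / beta * - ((1 - exp (- beta * t)) * ?C) \<le> lam / beta * (LINT s|elaw beta. indicator {..<t} s * Q (V k) (g + s *\<^sub>R p))"
  using lam_pos beta_pos by (intro mult_left_mono) auto
 moreover have "- ((1 - exp (- beta * t)) * ?C) \<le> lam / beta * - ((1 - exp (- beta * t)) * ?C)"
 proof -
  have "0 \<le> (1 - exp (- beta * t)) * ?C" using mult_nonneg_nonneg[OF _ C, of "1 - exp (- beta * t)"] mult_nonneg_nonneg[OF less_imp_le[OF beta_pos(1)] t] by simp
  moreover have "lam / beta \<le> 1" using beta_pos by simp
  ultimately have "lam / beta * ((1 - exp (- beta * t)) * ?C) \<le> 1 * ((1 - exp (- beta * t)) * ?C)" by (intro mult_right_mono)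
  then show ?thesis by (simp only: mult_minus_right neg_le_iff_le mult_1_left)
 qed
 ultimately have 1: "exp (- beta * t) * V k (g + t *\<^sub>R p) - (1 - exp (- beta * t)) * ?C \<le> V k g"
  using V(5)[of k n m] by (simp add: wait_value_def g_def t_def)
 have e: "exp (beta * t) * exp (- beta * t) = 1" by (simp add: mult_exp_exp)
 have "exp (beta * t) * (exp (- beta * t) * V k (g + t *\<^sub>R p) - (1 - exp (- beta * t)) * ?C) \<le> exp (beta * t) * V k g"
  using 1 by (intro mult_left_mono) auto
 moreover have "exp (beta * t) * (exp (- beta * t) * V k (g + t *\<^sub>R p) - (1 - exp (- beta * t)) * ?C) =
  (exp (beta * t) * exp (- beta * t)) * V k (g + t *\<^sub>R p) - (exp (beta * t) - exp (beta * t) * exp (- beta * t)) * ?C"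
  by (simp only: right_diff_distrib left_diff_distrib mult_1_right mult_1_left mult.assoc)
 ultimately show ?thesis unfolding e mult_1_left by linarith
qed

text \<open>\<open>V_growth\<close> is applied at the grid point below \<open>x\<close>, with a time
  long enough to pass \<open>y\<close>; monotonicity removes the grid point, and the rounded times
  tend to \<open>e\<close>.\<close>

lemma W_growth:
 assumes x: "0 \<le> x" and e: "0 \<le> e" and y: "x \<le> y" "y \<le> x + e *\<^sub>R p"
 shows "W y \<le> exp (beta * e) * W x + (exp (beta * e) - 1) * (lower_rate * h0 (x + e *\<^sub>R p))"
proof -
 \<comment> \<open>The additional step makes up for the distance between \<open>x\<close> and the
   grid point below it, which is at most one mesh along \<open>p\<close>.\<close>
 define t where "t k = real (nat \<lceil>e / (\<delta> / 2 ^ k)\<rceil> + 1) * (\<delta> / 2 ^ k)" for k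
 have t: "e + \<delta> / 2 ^ k \<le> t k" "t \<longlonglongrightarrow> e" for k
 proof -
  have tt: "t = (\<lambda>k. real (nat \<lceil>e / (\<delta> / 2 ^ k)\<rceil>) * (\<delta> / 2 ^ k) + \<delta> / 2 ^ k)"
   by (rule ext) (simp add: t_def distrib_right add_divide_distrib)
  show "e + \<delta> / 2 ^ k \<le> t k" unfolding tt using mesh_steps(1)[OF e, of k] by simp
  have "t \<longlonglongrightarrow> e + 0" unfolding tt by (intro tendsto_add mesh_steps(3)[OF e] mesh)
  then show "t \<longlonglongrightarrow> e" by simp
 qed
 have t0: "0 \<le> t k" for k using t(1)[of k] e mesh(2)[of k] by linarith
 have y0: "0 \<le> y" using x y(1) by (rule order_trans)
 have "V k y \<le> exp (beta * t k) * W x + (exp (beta * t k) - 1) * (lower_rate * (h0 x * exp (c / 2 * t k)))" for k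
 proof -
  let ?g = "grid_floor p (\<delta> / 2 ^ k) x"
  have g: "0 \<le> ?g" "?g \<le> x" using V(8) V(9)[OF x] by auto
  have "y \<le> ?g + (\<delta> / 2 ^ k) *\<^sub>R p + e *\<^sub>R p" using y(2) V(10)[OF x, of k] by (meson add_right_mono order_trans)
  also have "\<dots> = ?g + (e + \<delta> / 2 ^ k) *\<^sub>R p" by (simp add: scaleR_add_left algebra_simps)
  also have "\<dots> \<le> ?g + t k *\<^sub>R p" by (intro add_left_mono vec_scale_mono t p_nonneg)
  finally have yg: "y \<le> ?g + t k *\<^sub>R p" .
  have vm: "V k z \<le> V k z'" if "0 \<le> z" "z \<le> z'" for z z' using V(4)[OF that, of k] a_inner_nonneg[of "z' - z"] that by simp
  have "V k y \<le> V k (?g + t k *\<^sub>R p)" by (rule vm[OF y0 yg])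
  also have "\<dots> \<le> exp (beta * t k) * V k ?g + (exp (beta * t k) - 1) * (lower_rate * h0 (?g + t k *\<^sub>R p))"
   unfolding t_def grid_floor_def by (rule V_growth) (use g in \<open>simp add: grid_floor_def\<close>)
  also have "\<dots> \<le> exp (beta * t k) * W x + (exp (beta * t k) - 1) * (lower_rate * (h0 x * exp (c / 2 * t k)))"
  proof (intro add_mono mult_left_mono lower_rate)
   show "V k ?g \<le> W x" using vm[OF g] W(3)[OF x, of k] by simp
   show "h0 (?g + t k *\<^sub>R p) \<le> h0 x * exp (c / 2 * t k)"
    unfolding h0_shift[symmetric] by (intro h0_mono add_right_mono g)
   show "0 \<le> exp (beta * t k) - 1" using t0[of k] beta_pos(1) by simp
  qed simp
  finally show ?thesis .
 qed
 moreover have "(\<lambda>k. exp (beta * t k) * W x + (exp (beta * t k) - 1) * (lower_rate * (h0 x * exp (c / 2 * t k)))) \<longlonglongrightarrow>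
  exp (beta * e) * W x + (exp (beta * e) - 1) * (lower_rate * (h0 x * exp (c / 2 * e)))"
  by (intro tendsto_add tendsto_mult tendsto_diff tendsto_const tendsto_exp t)
 ultimately show ?thesis unfolding h0_shift using W(2)[OF y0] by (intro LIMSEQ_le[OF W(2)[OF y0]]) auto
qed

lemma W_upper_continuous:
 assumes x: "0 \<le> x" shows "continuous (at x within {x..}) W"
 unfolding continuous_within
proof (rule order_tendstoI)
 have ev: "eventually (\<lambda>z. z \<in> {x..}) (at x within {x..})" by (simp add: eventually_at_filter)
 fix r
 show "eventually (\<lambda>z. r < W z) (at x within {x..})" if "r < W x"
  using ev by eventually_elim (use W_mono[OF x] that in force)
 assume r: "W x < r"
 \<comment> \<open>The bound of \<open>W_growth\<close> equals \<open>W x\<close> at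
   \<open>e = 0\<close> and depends continuously on \<open>e\<close>, so a small positive
   \<open>e\<close> keeps it below \<open>r\<close>.\<close>
 let ?\<phi> = "\<lambda>e. exp (beta * e) * W x + (exp (beta * e) - 1) * (lower_rate * h0 (x + e *\<^sub>R p))"
 have "isCont (\<lambda>e. h0 (x + e *\<^sub>R p)) 0" unfolding h0_shift by (intro continuous_intros)
 then have "((\<lambda>e. h0 (x + e *\<^sub>R p)) \<longlongrightarrow> h0 (x + 0 *\<^sub>R p)) (at_right 0)" by (simp add: isCont_def filterlim_at_split)
 then have "(?\<phi> \<longlongrightarrow> exp (beta * 0) * W x + (exp (beta * 0) - 1) * (lower_rate * h0 (x + 0 *\<^sub>R p))) (at_right 0)"
  by (intro tendsto_add tendsto_mult tendsto_diff tendsto_const tendsto_exp tendsto_ident_at)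
 then have "eventually (\<lambda>e. ?\<phi> e < r) (at_right 0)" using r by (intro order_tendstoD(2)) auto
 then have "eventually (\<lambda>e. ?\<phi> e < r \<and> 0 < e) (at_right 0)" using eventually_at_right_less by (rule eventually_conj)
 then obtain e where e: "?\<phi> e < r" "0 < e" using eventually_happens'[OF trivial_limit_at_right_real] by blast
 have "eventually (\<lambda>z. \<forall>i\<in>UNIV. z $ i < x $ i + e * p $ i) (at x within {x..})"
 proof (intro eventually_ball_finite ballI)
  fix i
  have "((\<lambda>z. z $ i) \<longlongrightarrow> x $ i) (at x within {x..})" by (intro tendsto_intros)
  then show "eventually (\<lambda>z. z $ i < x $ i + e * p $ i) (at x within {x..})"
   by (rule order_tendstoD(2)) (use e p_pos in simp)
 qed simp
 with ev show "eventually (\<lambda>z. W z < r) (at x within {x..})"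
 proof eventually_elim
  case (elim z)
  then have "x \<le> z" "z \<le> x + e *\<^sub>R p" by (auto simp: less_eq_vec_def less_imp_le)
  from W_growth[OF x less_imp_le[OF e(2)] this] show ?case using e(1) by simp
 qed
qed

lemma W_tame: "tame W"
 unfolding tame_def
proof (intro conjI allI impI W_upper_continuous)
 have "(\<lambda>x. if 0 \<le> x then W x else 0) = W" using W_off by auto
 then show "W \<in> borel_measurable borel" using borel_measurable_upper_continuous[OF W_upper_continuous] by simp
 show "\<exists>C. \<forall>y\<ge>0. \<bar>W y\<bar> \<le> C * h0 y"
 proof (intro exI[of _ "4 * K + \<bar>f 0\<bar>"] allI impI)
  fix y :: "real^'n" assume y: "0 \<le> y"
  have "\<bar>f 0\<bar> \<le> \<bar>f 0\<bar> * h0 y" using h0_ge_1[OF y] by (simp add: mult_le_cancel_left1)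
  moreover have "0 \<le> 4 * K * h0 y" using K(1) h0_pos[of y] by simp
  ultimately have "W y \<le> 4 * K * h0 y + \<bar>f 0\<bar> * h0 y" "- W y \<le> 4 * K * h0 y + \<bar>f 0\<bar> * h0 y"
   using W(4,5)[OF y] by linarith+
  then show "\<bar>W y\<bar> \<le> (4 * K + \<bar>f 0\<bar>) * h0 y" by (simp add: distrib_right abs_le_iff)
 qed
qed

text \<open>The upper corner of the cell of \<open>x\<close>. Being a grid point it satisfies the
  discretised inequalities, and it tends to \<open>x\<close> from above, the side on which
  \<open>f\<close>, \<open>V\<close> and \<open>W\<close> are continuous.\<close>

definition "corner k x = grid_point p (\<delta> / 2 ^ k) (grid_index p (\<delta> / 2 ^ k) x + 1)"

lemma corner:
 assumes x: "0 \<le> x"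
 shows "x \<le> corner k x" "corner k x \<le> x + \<delta> *\<^sub>R p" "(\<lambda>k. corner k x) \<longlonglongrightarrow> x"
proof -
 have c: "corner k x = grid_floor p (\<delta> / 2 ^ k) x + (\<delta> / 2 ^ k) *\<^sub>R p" for k
  unfolding corner_def grid_floor_def by (rule V(11))
 have up: "corner k x \<le> x + (\<delta> / 2 ^ k) *\<^sub>R p" for k unfolding c by (intro add_right_mono V(9) x)
 show lo: "x \<le> corner k x" for k unfolding c by (rule V(10)[OF x])
 have "x + (\<delta> / 2 ^ k) *\<^sub>R p \<le> x + \<delta> *\<^sub>R p" by (intro add_left_mono vec_scale_mono mesh p_nonneg)
 then show "corner k x \<le> x + \<delta> *\<^sub>R p" by (rule order_trans[OF up])
 show "(\<lambda>k. corner k x) \<longlonglongrightarrow> x"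
 proof (rule vec_tendstoI)
  fix i
  have "(\<lambda>k. x $ i + \<delta> / 2 ^ k * p $ i) \<longlonglongrightarrow> x $ i + 0 * p $ i" by (intro tendsto_add tendsto_mult tendsto_const mesh)
  then have "(\<lambda>k. x $ i + \<delta> / 2 ^ k * p $ i) \<longlonglongrightarrow> x $ i" by simp
  note lim = this
  have "x $ i \<le> corner k x $ i" "corner k x $ i \<le> x $ i + \<delta> / 2 ^ k * p $ i" for k
   using lo[of k] up[of k] by (auto simp: less_eq_vec_def)
  note b = this
  show "(\<lambda>k. corner k x $ i) \<longlonglongrightarrow> x $ i"
   by (rule tendsto_sandwich[OF always_eventually[OF allI[OF b(1)]] always_eventually[OF allI[OF b(2)]] tendsto_const lim])
 qed
qed

lemma W_corner: "0 \<le> x ==> (\<lambda>k. W (corner k x)) \<longlonglongrightarrow> W x"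
 by (rule continuous_within_seqD[OF W_upper_continuous]) (auto simp: corner)

text \<open>Two successive limits. For fixed \<open>i\<close>, the waiting inequality of
  \<open>V k\<close> at the corners, with \<open>k \<ge> i\<close>, bounds the waiting value of
  \<open>V i\<close> there, and \<open>k\<close> tending to infinity needs the regularity of
  \<open>V i\<close> and \<open>W\<close> only. Then \<open>i\<close> tends to infinity by dominated
  convergence.\<close>

lemma W_wait:
 assumes x: "0 \<le> x" and h: "0 \<le> h" shows "wait_value W (Q W) h x \<le> W x"
proof -
 have "wait_value (V i) (Q (V i)) h x \<le> W x" for i
 proof -
  define t where "t k = real (nat \<lceil>h / (\<delta> / 2 ^ k)\<rceil>) * (\<delta> / 2 ^ k)" for k
  note t = mesh_steps[OF h, folded t_def]
  have g0: "0 \<le> corner k x" for k using x corner(1)[OF x] by (rule order_trans)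
  have "(\<lambda>k. wait_value (V i) (Q (V i)) (t k) (corner k x)) \<longlonglongrightarrow> wait_value (V i) (Q (V i)) h x"
   by (rule wait_value_continuous[OF V(2) Q_tame[OF V(2)] x h corner[OF x] t(1,3)])
  then show ?thesis
  proof (rule LIMSEQ_le[OF _ W_corner[OF x]], intro exI[of _ i] allI impI)
   fix k assume k: "i \<le> k"
   have Vm: "V i z \<le> V k z" if "0 \<le> z" for z using W(1)[OF that] k by (auto simp: incseq_def)
   have t0: "0 \<le> t k" using h t(1)[of k] by simp
   have "wait_value (V i) (Q (V i)) (t k) (corner k x) \<le> wait_value (V k) (Q (V k)) (t k) (corner k x)"
    by (intro wait_value_mono Q_tame V(2) g0 t0 Vm Q_mono orthant_path)
   also have "\<dots> \<le> V k (corner k x)" unfolding corner_def t_def by (rule V(5))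
   also have "\<dots> \<le> W (corner k x)" by (rule W(3)[OF g0])
   finally show "wait_value (V i) (Q (V i)) (t k) (corner k x) \<le> W (corner k x)" .
  qed
 qed
 moreover have "(\<lambda>i. wait_value (V i) (Q (V i)) h x) \<longlonglongrightarrow> wait_value W (Q W) h x"
  by (rule wait_value_limit[OF V(2) W_tame x h W(2)]) (use W(1,3) in \<open>auto simp: incseq_def\<close>)
 ultimately show ?thesis by (intro LIMSEQ_le_const2) auto
qed

lemma W_ge_f: assumes x: "0 \<le> x" shows "f x \<le> W x"
proof (rule LIMSEQ_le[OF continuous_within_seqD[OF f_upper_continuous[OF x]] W_corner[OF x]])
 show "corner k x \<in> {x..}" for k using corner(1)[OF x] by simp
 show "(\<lambda>k. corner k x) \<longlonglongrightarrow> x" by (rule corner(3)[OF x])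
 have "f (corner k x) \<le> W (corner k x)" for k
  using V(6)[of k "grid_index p (\<delta> / 2 ^ k) x + 1"] W(3)[OF order_trans[OF x corner(1)[OF x]], of k k] by (simp add: corner_def)
 then show "\<exists>N. \<forall>k\<ge>N. f (corner k x) \<le> W (corner k x)" by blast
qed

lemma W_supersol: "supersol W (Q W)"
 unfolding supersol_def
proof (intro conjI allI impI exI W_tame Q_tame W_ge_f W_wait)
 show "a \<bullet> z + W x \<le> W (x + z)" if "0 \<le> x" "0 \<le> z" for x z using W_pay[of x "x + z"] that by simp
 show "- (- f 0) \<le> W x" if "0 \<le> x" for x using W(4)[OF that] by simp
qed

lemma opt_eq: assumes x: "0 \<le> x" shows "opt x = ereal (W x)"
proof (rule antisym)
 show "opt x \<le> ereal (W x)" unfolding optimal_value_def by (intro SUP_least verification[OF W_supersol x])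
 have "(\<lambda>k. ereal (V k x)) \<longlonglongrightarrow> ereal (W x)" using W(2)[OF x] by simp
 then show "ereal (W x) \<le> opt x" by (rule LIMSEQ_le_const2) (use V(3)[OF x] in blast)
qed

lemma local_uniform:
 assumes x: "0 \<le> x" shows "uniform_limit (cball x 1 \<inter> {0..}) V W sequentially"
proof (rule uniform_limitI)
 fix e :: real assume e: "0 < e"
 define b where "b = (\<chi> i. x $ i + 1)"
 have yb: "0 \<le> y" "y \<le> b" if "y \<in> cball x 1 \<inter> {0..}" for y
 proof -
  show "0 \<le> y" using that by simp
  have "\<bar>(x - y) $ i\<bar> \<le> 1" for i using component_le_norm_cart[of "x - y" i] that by (simp add: dist_norm)
  note c = this
  show "y \<le> b"
   unfolding less_eq_vec_def
  proof
   fix i show "y $ i \<le> b $ i" using c[of i] by (simp add: b_def abs_le_iff)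
  qed
 qed
 \<comment> \<open>Below \<open>b\<close>, \<open>W\<close> is at most \<open>4 * K\<close> times
   the weight, and the correction in \<open>W_growth\<close> is \<open>lower_rate\<close> times the
   weight. Thus \<open>E\<close> times \<open>exp (beta * (\<delta> / 2 ^ j)) - 1\<close> bounds the
   increase of \<open>W\<close> within one cell of mesh \<open>\<delta> / 2 ^ j\<close>.\<close>
 define E where "E = (4 * K + lower_rate) * h0 (b + \<delta> *\<^sub>R p)"
 have "(\<lambda>j. (exp (beta * (\<delta> / 2 ^ j)) - 1) * E) \<longlonglongrightarrow> (exp (beta * 0) - 1) * E"
  by (intro tendsto_mult tendsto_diff tendsto_exp tendsto_const mesh)
 then have "(\<lambda>j. (exp (beta * (\<delta> / 2 ^ j)) - 1) * E) \<longlonglongrightarrow> 0" by simp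
 from order_tendstoD(2)[OF this, of "e / 2"] obtain j where j: "(exp (beta * (\<delta> / 2 ^ j)) - 1) * E < e / 2"
  using e by (auto simp: eventually_sequentially)
 let ?d = "\<delta> / 2 ^ j"
 \<comment> \<open>From here on \<open>j\<close> is fixed. Only the finitely many points of this one
   grid are tested for convergence, while \<open>k\<close> runs.\<close>
 define Z where "Z = grid_point p ?d ` {m. m \<le> grid_index p ?d b}"
 have Z: "finite Z" unfolding Z_def by (intro finite_imageI finite_vec_atMost)
 have fZ: "grid_floor p ?d y \<in> Z" if "y \<le> b" for y unfolding Z_def grid_floor_def using V(12)[OF that] by blast
 have "eventually (\<lambda>k. \<forall>z\<in>Z. 0 \<le> z \<longrightarrow> W z - e / 2 < V k z) sequentially"
 proof (intro eventually_ball_finite Z ballI)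
  fix z
  show "eventually (\<lambda>k. 0 \<le> z \<longrightarrow> W z - e / 2 < V k z) sequentially"
  proof (cases "0 \<le> z")
   case True
   have "eventually (\<lambda>k. W z - e / 2 < V k z) sequentially" using e by (intro order_tendstoD(1)[OF W(2)[OF True]]) simp
   then show ?thesis by eventually_elim simp
  qed simp
 qed
 then show "eventually (\<lambda>k. \<forall>y\<in>cball x 1 \<inter> {0..}. dist (V k y) (W y) < e) sequentially"
 proof eventually_elim
  case (elim k)
  show ?case
  proof
   fix y assume "y \<in> cball x 1 \<inter> {0..}"
   note y = yb[OF this]
   let ?z = "grid_floor p ?d y"
   have z: "0 \<le> ?z" "?z \<le> y" "y \<le> ?z + ?d *\<^sub>R p" using V(8) V(9,10)[OF y(1)] by auto
   have "h0 ?z \<le> h0 (b + \<delta> *\<^sub>R p)" "h0 (?z + ?d *\<^sub>R p) \<le> h0 (b + \<delta> *\<^sub>R p)"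
   proof -
    have zb: "?z \<le> b" using z(2) y(2) by (rule order_trans)
    show "h0 (?z + ?d *\<^sub>R p) \<le> h0 (b + \<delta> *\<^sub>R p)" by (intro h0_mono add_mono zb vec_scale_mono mesh p_nonneg)
    have "?z + 0 *\<^sub>R p \<le> b + \<delta> *\<^sub>R p" using \<delta>_pos by (intro add_mono zb vec_scale_mono p_nonneg) simp
    then show "h0 ?z \<le> h0 (b + \<delta> *\<^sub>R p)" by (intro h0_mono) simp
   qed
   then have "4 * K * h0 ?z \<le> 4 * K * h0 (b + \<delta> *\<^sub>R p)" "lower_rate * h0 (?z + ?d *\<^sub>R p) \<le> lower_rate * h0 (b + \<delta> *\<^sub>R p)"
    using K(1) lower_rate(1) by (auto intro!: mult_left_mono)
   then have "W ?z + lower_rate * h0 (?z + ?d *\<^sub>R p) \<le> E" using W(5)[OF z(1)] by (simp add: E_def distrib_right)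
   then have "(exp (beta * ?d) - 1) * (W ?z + lower_rate * h0 (?z + ?d *\<^sub>R p)) \<le> (exp (beta * ?d) - 1) * E"
    using mult_nonneg_nonneg[OF less_imp_le[OF beta_pos(1)] less_imp_le[OF mesh(2)], of j] by (intro mult_left_mono) simp_all
   moreover have "W y - W ?z \<le> (exp (beta * ?d) - 1) * (W ?z + lower_rate * h0 (?z + ?d *\<^sub>R p))"
    using W_growth[OF z(1) less_imp_le[OF mesh(2)] z(2,3)] by (simp add: algebra_simps)
   ultimately have "W y - W ?z < e / 2" using j by linarith
   moreover have "W ?z - e / 2 < V k ?z" using elim fZ[OF y(2)] z(1) by blast
   moreover have "V k ?z \<le> V k y" using V(4)[OF z(1,2), of k] a_inner_nonneg[of "y - ?z"] z(2) by simp
   ultimately show "dist (V k y) (W y) < e" using W(3)[OF y(1), of k] by (simp add: dist_real_def)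
  qed
 qed
qed

end

theorem theorem5p6:
  fixes p a :: "real^'n::finite" and c lam \<delta> :: real
    and F :: "(real^'n) measure"
    and \<upsilon> :: "real^'n \<Rightarrow> real^'n \<Rightarrow> real"
    and f :: "real^'n \<Rightarrow> real"
  assumes "\<forall>i. 0 < p $ i" and "\<forall>i. 0 < a $ i" and "0 < c" and "0 < lam"
    and "prob_space F" and "sets F = sets borel" and "AE u in F. u \<in> {0..}"
    and "integrable F norm" and "measure F {..0} = 0"
    and "(\<lambda>(x, \<alpha>). \<upsilon> x \<alpha>) \<in> borel_measurable (restrict_space borel ruin_pairs)"
    and "\<forall>x y \<alpha>. (x, \<alpha>) \<in> ruin_pairs \<and> (y, \<alpha>) \<in> ruin_pairs \<and> x \<le> y \<longrightarrow> \<upsilon> y \<alpha> \<le> \<upsilon> x \<alpha>"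
    and "\<forall>x \<alpha> \<beta>. (x, \<alpha>) \<in> ruin_pairs \<and> (x, \<beta>) \<in> ruin_pairs \<and> \<alpha> \<le> \<beta> \<longrightarrow> \<upsilon> x \<alpha> \<le> \<upsilon> x \<beta>"
    and "set_integrable F {u. (0, u) \<in> ruin_pairs} (\<upsilon> 0)"
    and "(mono_on {0..} f \<and> (\<forall>x\<in>{0..}. continuous (at x within {x..}) f))
         \<or> continuous_on {0..} f"
    and "growth_condition c p f"
    and "\<forall>x\<in>{0..}. bdd_above ((\<lambda>\<alpha>. - \<upsilon> x \<alpha>) ` {\<alpha>. (x, \<alpha>) \<in> ruin_pairs})"
    and "growth_condition c p (\<lambda>x. SUP \<alpha>\<in>{\<alpha>. (x, \<alpha>) \<in> ruin_pairs}. - \<upsilon> x \<alpha>)"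
    and "continuous_on {0..} (\<lambda>x. lam * (LINT \<alpha> : {\<alpha>. (x, \<alpha>) \<in> ruin_pairs} | F. \<upsilon> x \<alpha>))"
    and "0 < \<delta>"
  shows "(\<forall>x\<in>{0..}. \<bar>optimal_value p a c lam F \<upsilon> f x\<bar> \<noteq> \<infinity> \<and>
            (\<forall>k. \<bar>grid_value p a c lam F \<upsilon> f (\<delta> / 2 ^ k) x\<bar> \<noteq> \<infinity>))
       \<and> (\<forall>x\<in>{0..}. incseq (\<lambda>k. grid_value p a c lam F \<upsilon> f (\<delta> / 2 ^ k) x))
       \<and> (\<forall>x\<in>{0..}. (\<lambda>k. grid_value p a c lam F \<upsilon> f (\<delta> / 2 ^ k) x)
            \<longlonglongrightarrow> optimal_value p a c lam F \<upsilon> f x)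
       \<and> (\<forall>x\<in>{0..}. \<exists>\<epsilon>>0. uniform_limit (cball x \<epsilon> \<inter> {0..})
            (\<lambda>k y. real_of_ereal (grid_value p a c lam F \<upsilon> f (\<delta> / 2 ^ k) y))
            (\<lambda>y. real_of_ereal (optimal_value p a c lam F \<upsilon> f y)) sequentially)"
proof -
 \<comment> \<open>Either alternative for the switch value gives continuity along the points above
   \<open>x\<close>, the only regularity of \<open>f\<close> that enters the locale.\<close>
 have f: "continuous (at x within {x..}) f" if "0 \<le> x" for x
  using assms(14)
 proof
  assume "continuous_on {0..} f"
  then have "continuous (at x within {0..}) f" using that by (simp add: continuous_on_eq_continuous_within)
  then show ?thesis by (rule continuous_within_subset) (use that in auto)
 qed (use that in simp)
 interpret grid_model lam F p a c \<upsilon> f \<delta>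
 proof (intro grid_model.intro dividend_model.intro claim_model.intro dividend_model_axioms.intro grid_model_axioms.intro)
  show "AE u in F. 0 \<le> u" using assms(7) by simp
  show "\<upsilon> y \<alpha> \<le> \<upsilon> x \<alpha>" if "(x, \<alpha>) \<in> ruin_pairs" "(y, \<alpha>) \<in> ruin_pairs" "x \<le> y" for x y \<alpha>
   using assms(11) that by blast
  show "bdd_above ((\<lambda>\<alpha>. - \<upsilon> x \<alpha>) ` {\<alpha>. (x, \<alpha>) \<in> ruin_pairs})" if "0 \<le> x" for x
   using assms(16) that by simp
 qed (use assms f in \<open>simp_all del: atLeast_iff\<close>)
 show ?thesis
 proof (intro conjI ballI allI)
  fix x :: "real^'n" assume "x \<in> {0..}"
  then have x: "0 \<le> x" by simp
  show "\<bar>optimal_value p a c lam F \<upsilon> f x\<bar> \<noteq> \<infinity>" "\<bar>grid_value p a c lam F \<upsilon> f (\<delta> / 2 ^ k) x\<bar> \<noteq> \<infinity>" for k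
   unfolding opt_eq[OF x] V(1)[OF x] by simp_all
  show "incseq (\<lambda>k. grid_value p a c lam F \<upsilon> f (\<delta> / 2 ^ k) x)"
   unfolding V(1)[OF x] using W(1)[OF x] by (simp add: incseq_def)
  show "(\<lambda>k. grid_value p a c lam F \<upsilon> f (\<delta> / 2 ^ k) x) \<longlonglongrightarrow> optimal_value p a c lam F \<upsilon> f x"
   unfolding opt_eq[OF x] V(1)[OF x] using W(2)[OF x] by simp
  have "uniform_limit (cball x 1 \<inter> {0..}) (\<lambda>k y. real_of_ereal (grid_value p a c lam F \<upsilon> f (\<delta> / 2 ^ k) y))
      (\<lambda>y. real_of_ereal (optimal_value p a c lam F \<upsilon> f y)) sequentially"
   by (rule uniform_limit_cong'[THEN iffD1, OF _ _ local_uniform[OF x]]) (simp_all add: opt_eq V(1))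
  then show "\<exists>\<epsilon>>0. uniform_limit (cball x \<epsilon> \<inter> {0..})
      (\<lambda>k y. real_of_ereal (grid_value p a c lam F \<upsilon> f (\<delta> / 2 ^ k) y))
      (\<lambda>y. real_of_ereal (optimal_value p a c lam F \<upsilon> f y)) sequentially"
   by (intro exI[of _ 1]) simp
 qed
qed

end
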